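(* Let $H$ be the Hopf algebra associated to a group datum $(G,\chi,g,1)$ of non-nilpotent type, $\overline H\cong H/H(1-e)$, $r(\overline H)\subseteq r(H)$ the Green rings, and $\mathcal P$ the ideal of $r(H)$ spanned over $\mathbb Z$ by the isomorphism classes of indecomposable projective $H$-modules (see context). Equip $r(\overline H)\oplus\mathcal P$ with the commutative ring structure whose multiplication is $(b_1,c_1)(b_2,c_2)=(b_1b_2,\ b_1c_2+c_1b_2+c_1c_2)$ for $b_1,b_2\in r(\overline H)$, $c_1,c_2\in\mathcal P$. Let $\mathcal I$ be the $\mathbb Z$-submodule of $r(\overline H)\oplus\mathcal P$ generated by the elements $(-M[n,i],M[n,i])$ for $i\in\Omega_0$. Then $\mathcal I$ is an ideal of $r(\overline H)\oplus\mathcal P$, and the quotient ring $(r(\overline H)\oplus\mathcal P)/\mathcal I$ is isomorphic to $r(H)$.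
   Context: $\Bbbk$ is an algebraically closed field of characteristic zero; modules are finite-dimensional left modules. Fix a finite group $G$, a $\Bbbk$-linear character $\chi$ of $G$ and a central element $g\in G$; let $n\ge 2$ be the order of $q=\chi(g)$, and assume $\chi^n=1$ and $g^n\neq 1$. $H$ is the Hopf algebra generated as an algebra by $y$ and $G$, with $\Bbbk G$ as a subalgebra and relations $y^n=g^n-1$, $yh=\chi(h)hy$ for $h\in G$; $\Delta(y)=y\otimes g+1\otimes y$, $\varepsilon(y)=0$, $S(y)=-yg^{-1}$, and the elements of $G$ are group-like. It has $\Bbbk$-basis $\{y^ih\mid h\in G,\ 0\le i\le n-1\}$. The order of $g$ is $nr$ with $r>1$; $e=\frac1r\sum_{s=0}^{r-1}g^{sn}$ is a central idempotent, $H(1-e)$ is a Hopf ideal, and $\overline H= H/H(1-e)$ (equivalently, the Hopf algebra generated by $z$ and $\overline G=G/\langle g^n\rangle$ with $z^n=0$, $z\overline h=\chi(h)\overline hz$, $\Delta(z)=z\otimes\overline g+1\otimes z$). Let $\{V_i\mid i\in\Omega\}$ be a complete set of simple $\Bbbk G$-modules up to isomorphism; $g^n$ acts on $V_i$ by a scalar $\lambda_i$; $\Omega_0=\{i\mid\lambda_i=1\}$, $\Omega_1=\{i\mid\lambda_i\ne1\}$. For $k\ge0$, $x^kV_i$ is a copy of the vector space $V_i$ with $G$-action $h(x^kv)=\chi^{-k}(h)x^k(hv)$. For $i\in\Omega_0$, $1\le k\le n$, $M(k,i)=V_i\oplus xV_i\oplus\cdots\oplus x^{k-1}V_i$ is the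 $H$-module with $y(x^sv)=x^{s+1}v$ for $s\le k-2$, $y(x^{k-1}v)=0$. For $j\in\Omega_1$, $P_j=V_j\oplus xV_j\oplus\cdots\oplus x^{n-1}V_j$ is the $H$-module with $y(x^sv)=x^{s+1}v$ for $s\le n-2$, $y(x^{n-1}v)=(\lambda_j-1)v$. The Green ring $r(A)$ of a Hopf algebra $A$ is the abelian group generated by the isomorphism classes $[M]$ of finite-dimensional $A$-modules modulo $[M\oplus N]=[M]+[N]$, with product $[M][N]=[M\otimes N]$. The ring $r(H)$ is commutative. $M[k,i]$ and $P_{[j]}$ denote the classes of $M(k,i)$ and $P_j$. Viewing $\overline H$-modules as $H$-modules through $H\to\overline H$ makes $r(\overline H)$ a subring of $r(H)$. The $M(k,i)$ ($i\in\Omega_0$, $1\le k\le n$) are the indecomposable $\overline H$-modules up to isomorphism, and the indecomposable projective $H$-modules are the $M(n,i)$ and the $P_j$, so $\mathcal P=\mathbb Z\{M[n,i],P_{[j]}\mid i\in\Omega_0,j\in\Omega_1\}$. *)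

theory Defs
  imports
    "HOL-Algebra.QuotRing"
    "HOL-Algebra.Generated_Groups"
    "HOL-Algebra.Multiplicative_Group"
    "HOL-Algebra.Free_Abelian_Groups"
    "HOL-Computational_Algebra.Polynomial"
    "Jordan_Normal_Form.Matrix"
begin

section \<open>Finite-dimensional Hopf algebras with a chosen basis\<close>

text \<open>
  An algebra over \<open>'k\<close> with a finite basis \<open>bas A\<close> consists of the coefficient functions
  \<open>'b \<Rightarrow> 'k\<close>. The function \<open>prd A b c\<close> is the product of the basis elements \<open>b\<close> and \<open>c\<close>, and
  \<open>unt A\<close> is the unit. An element of the tensor product of two such algebras is a
  coefficient function on pairs of basis elements.
\<close>

record ('b, 'k) falg =
  bas :: "'b set"
  prd :: "'b \<Rightarrow> 'b \<Rightarrow> 'b \<Rightarrow> 'k"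
  unt :: "'b \<Rightarrow> 'k"

record ('b, 'k) hopf = "('b, 'k) falg" +
  comul :: "'b \<Rightarrow> 'b \<times> 'b \<Rightarrow> 'k"
  counit :: "'b \<Rightarrow> 'k"
  antip :: "'b \<Rightarrow> 'b \<Rightarrow> 'k"

definition bvec :: "'b \<Rightarrow> 'b \<Rightarrow> 'k::field"
  where "bvec b = (\<lambda>c. if c = b then 1 else 0)"

definition vectors :: "('b, 'k::field, 'm) falg_scheme \<Rightarrow> ('b \<Rightarrow> 'k) set"
  where "vectors A = {u. \<forall>b. b \<notin> bas A \<longrightarrow> u b = 0}"

definition amult :: "('b, 'k::field, 'm) falg_scheme \<Rightarrow> ('b \<Rightarrow> 'k) \<Rightarrow> ('b \<Rightarrow> 'k) \<Rightarrow> 'b \<Rightarrow> 'k"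
  where "amult A u v = (\<lambda>d. \<Sum>b\<in>bas A. \<Sum>c\<in>bas A. u b * v c * prd A b c d)"

definition apow :: "('b, 'k::field, 'm) falg_scheme \<Rightarrow> ('b \<Rightarrow> 'k) \<Rightarrow> nat \<Rightarrow> 'b \<Rightarrow> 'k"
  where "apow A u m = ((\<lambda>v. amult A v u) ^^ m) (unt A)"

definition vtensor :: "('b \<Rightarrow> 'k::field) \<Rightarrow> ('c \<Rightarrow> 'k) \<Rightarrow> 'b \<times> 'c \<Rightarrow> 'k"
  where "vtensor u v = (\<lambda>(b, c). u b * v c)"

definition alg_tensor ::
    "('b, 'k::field) falg \<Rightarrow> ('c, 'k) falg \<Rightarrow> ('b \<times> 'c, 'k) falg"
  where "alg_tensor A B =
    \<lparr> bas = bas A \<times> bas B,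
      prd = (\<lambda>(b, c) (b', c'). vtensor (prd A b b') (prd B c c')),
      unt = vtensor (unt A) (unt B) \<rparr>"


section \<open>The group algebra and the Hopf algebra of a group datum\<close>

definition group_alg :: "('a, 'm) monoid_scheme \<Rightarrow> ('a, 'k::field) falg"
  where "group_alg G =
    \<lparr> bas = carrier G, prd = (\<lambda>h h'. bvec (h \<otimes>\<^bsub>G\<^esub> h')), unt = bvec \<one>\<^bsub>G\<^esub> \<rparr>"

text \<open>
  The pair \<open>(i, h)\<close> stands for the basis element \<open>y\<^sup>i h\<close>, where \<open>0 \<le> i \<le> n - 1\<close>.
  The relation \<open>y h = \<chi>(h) h y\<close> gives \<open>(y\<^sup>i h) (y\<^sup>j h') = \<chi>(h)\<^sup>-\<^sup>j y\<^sup>i\<^sup>+\<^sup>j h h'\<close>, and when \<open>i + j \<ge> n\<close>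
  the relation \<open>y\<^sup>n = g\<^sup>n - 1\<close> (with \<open>g\<close> central in \<open>G\<close>) reduces this to
  \<open>\<chi>(h)\<^sup>-\<^sup>j y\<^sup>i\<^sup>+\<^sup>j\<^sup>-\<^sup>n (g\<^sup>n - 1) h h'\<close>.
\<close>

definition H_alg ::
    "('a, 'm) monoid_scheme \<Rightarrow> ('a \<Rightarrow> 'k::field) \<Rightarrow> 'a \<Rightarrow> nat \<Rightarrow> (nat \<times> 'a, 'k) falg"
  where "H_alg G \<chi> g n =
    \<lparr> bas = {0..<n} \<times> carrier G,
      prd = (\<lambda>(i, h) (j, h') d. inverse (\<chi> h) ^ j *
        (if i + j < n then bvec (i + j, h \<otimes>\<^bsub>G\<^esub> h') d
         else bvec (i + j - n, (g [^]\<^bsub>G\<^esub> n) \<otimes>\<^bsub>G\<^esub> (h \<otimes>\<^bsub>G\<^esub> h')) d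
              - bvec (i + j - n, h \<otimes>\<^bsub>G\<^esub> h') d)),
      unt = bvec (0, \<one>\<^bsub>G\<^esub>) \<rparr>"

lemma amult_bvec:
  assumes "finite (bas A)" "b \<in> bas A" "c \<in> bas A"
  shows "amult A (bvec b) (bvec c) = prd A b c"
proof
  fix d
  have "amult A (bvec b) (bvec c) d = (\<Sum>b'\<in>bas A. if b' = b then \<Sum>c'\<in>bas A. if c' = c then prd A b c d else 0 else 0)"
    unfolding amult_def bvec_def by (intro sum.cong refl) (auto intro!: sum.cong sum.neutral)
  also have "\<dots> = prd A b c d" using assms by simp
  finally show "amult A (bvec b) (bvec c) d = prd A b c d" .
qed

text \<open>The generators \<open>y\<close> and \<open>h \<in> G\<close> satisfy the defining relations, and \<open>(i, h)\<close> is indeed \<open>y\<^sup>i h\<close>.\<close>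

lemma H_relations:
  fixes G (structure) and \<chi> :: "'a \<Rightarrow> 'k::field"
  assumes G: "group G" "finite (carrier G)" and "\<And>h. h \<in> carrier G \<Longrightarrow> \<chi> h \<noteq> 0"
    and mult: "\<And>h h'. h \<in> carrier G \<Longrightarrow> h' \<in> carrier G \<Longrightarrow> \<chi> (h \<otimes> h') = \<chi> h * \<chi> h'"
    and g: "g \<in> carrier G" and n: "n \<ge> 2"
  defines "H \<equiv> H_alg G \<chi> g n" and "y \<equiv> bvec (1, \<one>) :: nat \<times> 'a \<Rightarrow> 'k" and "gr \<equiv> \<lambda>h. bvec (0, h)"
  shows "apow H y n = (\<lambda>d. gr (g [^] n) d - unt H d)"
    and "h \<in> carrier G \<Longrightarrow> amult H y (gr h) = (\<lambda>d. \<chi> h * amult H (gr h) y d)"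
    and "h \<in> carrier G \<Longrightarrow> h' \<in> carrier G \<Longrightarrow> amult H (gr h) (gr h') = gr (h \<otimes> h')"
    and "i < n \<Longrightarrow> h \<in> carrier G \<Longrightarrow> amult H (apow H y i) (gr h) = bvec (i, h)"
proof -
  interpret group G by fact
  have fin: "finite (bas H)" using G by (simp add: H_def H_alg_def)
  have mem: "(i, h) \<in> bas H \<longleftrightarrow> i < n \<and> h \<in> carrier G" for i h by (simp add: H_def H_alg_def)
  have chi1: "\<chi> \<one> = 1" using mult[of \<one> \<one>] assms(3)[of \<one>] by simp
  have yb: "(1, \<one>) \<in> bas H" using n by (simp add: mem)
  have pw: "apow H y i = bvec (i, \<one>)" if "i < n" for i
    using that
  proof (induction i)
    case 0 show ?case by (simp add: apow_def H_def H_alg_def)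
  next
    case (Suc i)
    have "apow H y (Suc i) = amult H (bvec (i, \<one>)) y" using Suc by (simp add: apow_def)
    also have "\<dots> = prd H (i, \<one>) (1, \<one>)" unfolding y_def by (rule amult_bvec) (use fin yb Suc mem in auto)
    also have "\<dots> = bvec (Suc i, \<one>)" using Suc by (simp add: H_def H_alg_def chi1)
    finally show ?case .
  qed
  have "apow H y n = amult H (apow H y (n - 1)) y" using n by (cases n) (auto simp: apow_def)
  also have "\<dots> = prd H (n - 1, \<one>) (1, \<one>)"
    using pw[of "n - 1"] n unfolding y_def by (subst amult_bvec[symmetric]) (use fin yb mem in auto)
  also have "\<dots> = (\<lambda>d. gr (g [^] n) d - unt H d)" using n g by (simp add: H_def H_alg_def chi1 gr_def)
  finally show "apow H y n = (\<lambda>d. gr (g [^] n) d - unt H d)" .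
  show "amult H y (gr h) = (\<lambda>d. \<chi> h * amult H (gr h) y d)" if h: "h \<in> carrier G"
    using h n assms(3)[OF h] fin yb mem unfolding y_def gr_def
    by (subst (1 2) amult_bvec) (auto simp: H_def H_alg_def)
  show "amult H (gr h) (gr h') = gr (h \<otimes> h')" if "h \<in> carrier G" "h' \<in> carrier G"
    using that n fin mem unfolding gr_def by (subst amult_bvec) (auto simp: H_def H_alg_def)
  show "amult H (apow H y i) (gr h) = bvec (i, h)" if "i < n" "h \<in> carrier G"
    using that n fin mem pw[of i] unfolding gr_def by (simp add: amult_bvec) (simp add: H_def H_alg_def)
qed

text \<open>
  \<open>\<Delta>\<close> is the algebra map with \<open>\<Delta>(y) = y \<otimes> g + 1 \<otimes> y\<close> and \<open>\<Delta>(h) = h \<otimes> h\<close>, \<open>\<epsilon>\<close> is the algebra map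
  with \<open>\<epsilon>(y) = 0\<close> and \<open>\<epsilon>(h) = 1\<close>, and \<open>S\<close> is the algebra antimorphism with
  \<open>S(y) = - y g\<^sup>-\<^sup>1\<close> and \<open>S(h) = h\<^sup>-\<^sup>1\<close>.
\<close>

definition H_hopf ::
    "('a, 'm) monoid_scheme \<Rightarrow> ('a \<Rightarrow> 'k::field) \<Rightarrow> 'a \<Rightarrow> nat \<Rightarrow> (nat \<times> 'a, 'k) hopf"
  where "H_hopf G \<chi> g n =
    falg.extend (H_alg G \<chi> g n)
      (let H = H_alg G \<chi> g n; HH = alg_tensor H H;
           y = bvec (1, \<one>\<^bsub>G\<^esub>); gr = (\<lambda>h. bvec (0, h));
           Dy = (\<lambda>d. vtensor y (gr g) d + vtensor (unt H) y d);
           Sy = (\<lambda>d. - amult H y (gr (inv\<^bsub>G\<^esub> g)) d)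
       in \<lparr> comul = (\<lambda>(i, h). amult HH (apow HH Dy i) (vtensor (gr h) (gr h))),
            counit = (\<lambda>(i, h). if i = 0 then 1 else 0),
            antip = (\<lambda>(i, h). amult H (gr (inv\<^bsub>G\<^esub> h)) (apow H Sy i)) \<rparr>)"


section \<open>Finite-dimensional modules\<close>

text \<open>
  A \<open>d\<close>-dimensional left module is given in coordinates: it is the space of column vectors of
  length \<open>d\<close>, and the basis element \<open>b\<close> acts by the matrix \<open>snd M b\<close>. Every finite-dimensional
  module is isomorphic to one of this form.
\<close>

type_synonym ('b, 'k) rep = "nat \<times> ('b \<Rightarrow> 'k mat)"

definition act :: "('b, 'k::field, 'm) falg_scheme \<Rightarrow> ('b, 'k) rep \<Rightarrow> ('b \<Rightarrow> 'k) \<Rightarrow> 'k mat"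
  where "act A M u =
    mat (fst M) (fst M) (\<lambda>(r, s). \<Sum>b\<in>bas A. u b * (snd M b $$ (r, s)))"

definition is_module :: "('b, 'k::field, 'm) falg_scheme \<Rightarrow> ('b, 'k) rep \<Rightarrow> bool"
  where "is_module A M \<longleftrightarrow>
    (\<forall>b\<in>bas A. snd M b \<in> carrier_mat (fst M) (fst M)) \<and>
    act A M (unt A) = 1\<^sub>m (fst M) \<and>
    (\<forall>b\<in>bas A. \<forall>c\<in>bas A. snd M b * snd M c = act A M (prd A b c))"

text \<open>
  For an ideal \<open>I\<close>, the modules over the quotient \<open>A / I\<close> are the \<open>A\<close>-modules annihilated by \<open>I\<close>.
  The algebra \<open>A\<close> itself is the case of the zero ideal \<open>{\<lambda>_. 0}\<close>.
\<close>

definition modules ::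
    "('b, 'k::field, 'm) falg_scheme \<Rightarrow> ('b \<Rightarrow> 'k) set \<Rightarrow> ('b, 'k) rep set"
  where "modules A I = {M. is_module A M \<and> (\<forall>u\<in>I. act A M u = 0\<^sub>m (fst M) (fst M))}"

definition mod_hom ::
    "('b, 'k::field, 'm) falg_scheme \<Rightarrow> ('b, 'k) rep \<Rightarrow> ('b, 'k) rep \<Rightarrow> 'k mat set"
  where "mod_hom A M N =
    {T \<in> carrier_mat (fst N) (fst M). \<forall>b\<in>bas A. T * snd M b = snd N b * T}"

definition mod_iso ::
    "('b, 'k::field, 'm) falg_scheme \<Rightarrow> ('b, 'k) rep \<Rightarrow> ('b, 'k) rep \<Rightarrow> bool"
  where "mod_iso A M N \<longleftrightarrow>
    (\<exists>T\<in>mod_hom A M N. \<exists>S\<in>mod_hom A N M. T * S = 1\<^sub>m (fst N) \<and> S * T = 1\<^sub>m (fst M))"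

definition dsum :: "('b, 'k::field) rep \<Rightarrow> ('b, 'k) rep \<Rightarrow> ('b, 'k) rep"
  where "dsum M N = (fst M + fst N, \<lambda>b.
    four_block_mat (snd M b) (0\<^sub>m (fst M) (fst N)) (0\<^sub>m (fst N) (fst M)) (snd N b))"

text \<open>The basis vector \<open>v\<^sub>i \<otimes> w\<^sub>j\<close> of the tensor product has index \<open>i * dim N + j\<close>.\<close>

definition tensor ::
    "('b, 'k::field) hopf \<Rightarrow> ('b, 'k) rep \<Rightarrow> ('b, 'k) rep \<Rightarrow> ('b, 'k) rep"
  where "tensor A M N = (fst M * fst N, \<lambda>b.
    mat (fst M * fst N) (fst M * fst N) (\<lambda>(r, s). \<Sum>(c, c')\<in>bas A \<times> bas A.
      comul A b (c, c') * (snd M c $$ (r div fst N, s div fst N))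
                        * (snd N c' $$ (r mod fst N, s mod fst N))))"

definition triv :: "('b, 'k::field) hopf \<Rightarrow> ('b, 'k) rep"
  where "triv A = (1, \<lambda>b. mat 1 1 (\<lambda>_. counit A b))"

definition simple_module :: "('b, 'k::field, 'm) falg_scheme \<Rightarrow> ('b, 'k) rep \<Rightarrow> bool"
  where "simple_module A M \<longleftrightarrow> is_module A M \<and> fst M \<noteq> 0 \<and>
    (\<forall>W \<subseteq> carrier_vec (fst M).
      0\<^sub>v (fst M) \<in> W \<and> (\<forall>v\<in>W. \<forall>w\<in>W. v + w \<in> W) \<and> (\<forall>c. \<forall>v\<in>W. c \<cdot>\<^sub>v v \<in> W) \<and>
      (\<forall>b\<in>bas A. \<forall>v\<in>W. snd M b *\<^sub>v v \<in> W)
      \<longrightarrow> W = {0\<^sub>v (fst M)} \<or> W = carrier_vec (fst M))"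

definition complete_simples ::
    "('b, 'k::field, 'm) falg_scheme \<Rightarrow> 'i set \<Rightarrow> ('i \<Rightarrow> ('b, 'k) rep) \<Rightarrow> bool"
  where "complete_simples A \<Omega> V \<longleftrightarrow>
    (\<forall>i\<in>\<Omega>. simple_module A (V i)) \<and>
    (\<forall>i\<in>\<Omega>. \<forall>j\<in>\<Omega>. mod_iso A (V i) (V j) \<longrightarrow> i = j) \<and>
    (\<forall>M. simple_module A M \<longrightarrow> (\<exists>i\<in>\<Omega>. mod_iso A M (V i)))"

definition indecomposable :: "('b, 'k::field, 'm) falg_scheme \<Rightarrow> ('b, 'k) rep \<Rightarrow> bool"
  where "indecomposable A M \<longleftrightarrow> is_module A M \<and> fst M \<noteq> 0 \<and>
    (\<forall>M1 M2. is_module A M1 \<and> is_module A M2 \<and> mod_iso A M (dsum M1 M2)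
      \<longrightarrow> fst M1 = 0 \<or> fst M2 = 0)"

text \<open>Projectivity in the category of finite-dimensional modules.\<close>

definition projective :: "('b, 'k::field, 'm) falg_scheme \<Rightarrow> ('b, 'k) rep \<Rightarrow> bool"
  where "projective A Q \<longleftrightarrow> is_module A Q \<and>
    (\<forall>M N. \<forall>p\<in>mod_hom A M N. \<forall>f\<in>mod_hom A Q N.
      is_module A M \<and> is_module A N \<and>
      (\<forall>w\<in>carrier_vec (fst N). \<exists>v\<in>carrier_vec (fst M). p *\<^sub>v v = w)
      \<longrightarrow> (\<exists>f'\<in>mod_hom A Q M. p * f' = f))"


section \<open>Green rings\<close>

definition iso_cls ::
    "('b, 'k::field, 'm) falg_scheme \<Rightarrow> ('b \<Rightarrow> 'k) set \<Rightarrow> ('b, 'k) rep \<Rightarrow> ('b, 'k) rep set"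
  where "iso_cls A I M = {N \<in> modules A I. mod_iso A M N}"

definition cls_tensor ::
    "('b, 'k::field) hopf \<Rightarrow> ('b \<Rightarrow> 'k) set
      \<Rightarrow> ('b, 'k) rep set \<Rightarrow> ('b, 'k) rep set \<Rightarrow> ('b, 'k) rep set"
  where "cls_tensor A I X Y = (\<Union>M\<in>X. \<Union>N\<in>Y. iso_cls A I (tensor A M N))"

text \<open>
  For a Hopf ideal \<open>I\<close> of \<open>A\<close>: the free abelian group on the isomorphism classes of
  \<open>A / I\<close>-modules, with the biadditive product extending the tensor product of classes.
\<close>

definition free_green ::
    "('b, 'k::field) hopf \<Rightarrow> ('b \<Rightarrow> 'k) set \<Rightarrow> (('b, 'k) rep set \<Rightarrow>\<^sub>0 int) ring"
  where "free_green A I =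
    \<lparr> carrier = carrier (free_Abelian_group (iso_cls A I ` modules A I)),
      monoid.mult = (\<lambda>x y. frag_extend (\<lambda>X. frag_extend (\<lambda>Y. frag_of (cls_tensor A I X Y)) y) x),
      one = frag_of (iso_cls A I (triv A)),
      ring.zero = 0,
      add = (+) \<rparr>"

definition green_rels ::
    "('b, 'k::field) hopf \<Rightarrow> ('b \<Rightarrow> 'k) set \<Rightarrow> (('b, 'k) rep set \<Rightarrow>\<^sub>0 int) set"
  where "green_rels A I = generate (add_monoid (free_green A I))
    {frag_of (iso_cls A I (dsum M N)) - frag_of (iso_cls A I M) - frag_of (iso_cls A I N)
      | M N. M \<in> modules A I \<and> N \<in> modules A I}"

definition green ::
    "('b, 'k::field) hopf \<Rightarrow> ('b \<Rightarrow> 'k) set \<Rightarrow> (('b, 'k) rep set \<Rightarrow>\<^sub>0 int) set ring"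
  where "green A I = free_green A I Quot green_rels A I"

definition green_cls ::
    "('b, 'k::field) hopf \<Rightarrow> ('b \<Rightarrow> 'k) set \<Rightarrow> ('b, 'k) rep \<Rightarrow> (('b, 'k) rep set \<Rightarrow>\<^sub>0 int) set"
  where "green_cls A I M = green_rels A I +>\<^bsub>free_green A I\<^esub> frag_of (iso_cls A I M)"


section \<open>The objects attached to a group datum of non-nilpotent type\<close>

abbreviation zero_ideal :: "('b \<Rightarrow> 'k::field) set"
  where "zero_ideal \<equiv> {\<lambda>_. 0}"

definition e_idem ::
    "('a, 'm) monoid_scheme \<Rightarrow> 'a \<Rightarrow> nat \<Rightarrow> nat \<times> 'a \<Rightarrow> 'k::field"
  where "e_idem G g n = (let r = group.ord G g div n in
    (\<lambda>b. (\<Sum>s<r. bvec (0, g [^]\<^bsub>G\<^esub> (s * n)) b) / of_nat r))"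

text \<open>The ideal \<open>H (1 - e)\<close>; note that \<open>1 - e\<close> is central.\<close>

definition I_bar ::
    "('a, 'm) monoid_scheme \<Rightarrow> ('a \<Rightarrow> 'k::field) \<Rightarrow> 'a \<Rightarrow> nat \<Rightarrow> (nat \<times> 'a \<Rightarrow> 'k) set"
  where "I_bar G \<chi> g n = (let H = H_hopf G \<chi> g n in
    (\<lambda>a. amult H a (\<lambda>b. unt H b - e_idem G g n b)) ` vectors H)"

definition rH ::
    "('a, 'm) monoid_scheme \<Rightarrow> ('a \<Rightarrow> 'k::field) \<Rightarrow> 'a \<Rightarrow> nat
      \<Rightarrow> ((nat \<times> 'a, 'k) rep set \<Rightarrow>\<^sub>0 int) set ring"
  where "rH G \<chi> g n = green (H_hopf G \<chi> g n) zero_ideal"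

definition rHbar ::
    "('a, 'm) monoid_scheme \<Rightarrow> ('a \<Rightarrow> 'k::field) \<Rightarrow> 'a \<Rightarrow> nat
      \<Rightarrow> ((nat \<times> 'a, 'k) rep set \<Rightarrow>\<^sub>0 int) set ring"
  where "rHbar G \<chi> g n = green (H_hopf G \<chi> g n) (I_bar G \<chi> g n)"

text \<open>
  The embedding of \<open>r(H/H(1 - e))\<close> into \<open>r(H)\<close> given by restriction along \<open>H \<rightarrow> H/H(1 - e)\<close>.
  A module isomorphic to one annihilated by \<open>H(1 - e)\<close> is itself annihilated, so a class
  of \<open>H/H(1 - e)\<close>-modules is, as a set, already the class of \<open>H\<close>-modules it is sent to.
\<close>

definition infl ::
    "('a, 'm) monoid_scheme \<Rightarrow> ('a \<Rightarrow> 'k::field) \<Rightarrow> 'a \<Rightarrow> nat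
      \<Rightarrow> ((nat \<times> 'a, 'k) rep set \<Rightarrow>\<^sub>0 int) set \<Rightarrow> ((nat \<times> 'a, 'k) rep set \<Rightarrow>\<^sub>0 int) set"
  where "infl G \<chi> g n X = (let H = H_hopf G \<chi> g n in
    (\<Union>x\<in>X. green_rels H zero_ideal +>\<^bsub>free_green H zero_ideal\<^esub> x))"

definition proj_ideal ::
    "('a, 'm) monoid_scheme \<Rightarrow> ('a \<Rightarrow> 'k::field) \<Rightarrow> 'a \<Rightarrow> nat
      \<Rightarrow> ((nat \<times> 'a, 'k) rep set \<Rightarrow>\<^sub>0 int) set set"
  where "proj_ideal G \<chi> g n = (let H = H_hopf G \<chi> g n in
    generate (add_monoid (rH G \<chi> g n))
      {green_cls H zero_ideal Q | Q. indecomposable H Q \<and> projective H Q})"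

definition lam ::
    "('a, 'm) monoid_scheme \<Rightarrow> 'a \<Rightarrow> nat \<Rightarrow> ('a, 'k::field) rep \<Rightarrow> 'k"
  where "lam G g n V = (THE c. snd V (g [^]\<^bsub>G\<^esub> n) = c \<cdot>\<^sub>m 1\<^sub>m (fst V))"

definition Omega0 ::
    "('a, 'm) monoid_scheme \<Rightarrow> 'a \<Rightarrow> nat \<Rightarrow> 'i set \<Rightarrow> ('i \<Rightarrow> ('a, 'k::field) rep) \<Rightarrow> 'i set"
  where "Omega0 G g n \<Omega> V = {i \<in> \<Omega>. lam G g n (V i) = 1}"

text \<open>
  \<open>M(k,V) = V \<oplus> xV \<oplus> \<dots> \<oplus> x\<^sup>k\<^sup>-\<^sup>1V\<close>. With \<open>d = dim V\<close>, the vector \<open>x\<^sup>s v\<^sub>t\<close> has index \<open>s * d + t\<close>;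
  \<open>h\<close> acts on \<open>x\<^sup>s V\<close> by \<open>\<chi>\<^sup>-\<^sup>s(h)\<close> times its action on \<open>V\<close>, and \<open>y\<close> shifts indices by \<open>d\<close>.
\<close>

definition Mmod ::
    "('a \<Rightarrow> 'k::field) \<Rightarrow> nat \<Rightarrow> ('a, 'k) rep \<Rightarrow> (nat \<times> 'a, 'k) rep"
  where "Mmod \<chi> k V = (let d = fst V; m = k * d;
      Y = mat m m (\<lambda>(r, s). if r = s + d then 1 else 0);
      D = (\<lambda>h. mat m m (\<lambda>(r, s). if r div d = s div d
             then inverse (\<chi> h) ^ (r div d) * (snd V h $$ (r mod d, s mod d)) else 0))
    in (m, \<lambda>(i, h). (Y ^\<^sub>m i) * D h))"

text \<open>
  The ring structure on \<open>r(H/H(1 - e)) \<oplus> \<P>\<close>; elements of \<open>r(H/H(1 - e))\<close> act on \<open>\<P>\<close> as elements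
  of \<open>r(H)\<close>, via \<^const>\<open>infl\<close>.
\<close>

definition sum_ring ::
    "('a, 'm) monoid_scheme \<Rightarrow> ('a \<Rightarrow> 'k::field) \<Rightarrow> 'a \<Rightarrow> nat
      \<Rightarrow> (((nat \<times> 'a, 'k) rep set \<Rightarrow>\<^sub>0 int) set \<times> ((nat \<times> 'a, 'k) rep set \<Rightarrow>\<^sub>0 int) set) ring"
  where "sum_ring G \<chi> g n = (let R = rH G \<chi> g n; B = rHbar G \<chi> g n; \<iota> = infl G \<chi> g n in
    \<lparr> carrier = carrier B \<times> proj_ideal G \<chi> g n,
      monoid.mult = (\<lambda>(b1, c1) (b2, c2).
        (b1 \<otimes>\<^bsub>B\<^esub> b2, (\<iota> b1 \<otimes>\<^bsub>R\<^esub> c2) \<oplus>\<^bsub>R\<^esub> (c1 \<otimes>\<^bsub>R\<^esub> \<iota> b2) \<oplus>\<^bsub>R\<^esub> (c1 \<otimes>\<^bsub>R\<^esub> c2))),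
      one = (\<one>\<^bsub>B\<^esub>, \<zero>\<^bsub>R\<^esub>),
      ring.zero = (\<zero>\<^bsub>B\<^esub>, \<zero>\<^bsub>R\<^esub>),
      add = (\<lambda>(b1, c1) (b2, c2). (b1 \<oplus>\<^bsub>B\<^esub> b2, c1 \<oplus>\<^bsub>R\<^esub> c2)) \<rparr>)"

definition sum_ideal ::
    "('a, 'm) monoid_scheme \<Rightarrow> ('a \<Rightarrow> 'k::field) \<Rightarrow> 'a \<Rightarrow> nat
      \<Rightarrow> 'i set \<Rightarrow> ('i \<Rightarrow> ('a, 'k) rep)
      \<Rightarrow> (((nat \<times> 'a, 'k) rep set \<Rightarrow>\<^sub>0 int) set \<times> ((nat \<times> 'a, 'k) rep set \<Rightarrow>\<^sub>0 int) set) set"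
  where "sum_ideal G \<chi> g n \<Omega> V = (let H = H_hopf G \<chi> g n in
    generate (add_monoid (sum_ring G \<chi> g n))
      {(\<ominus>\<^bsub>rHbar G \<chi> g n\<^esub> green_cls H (I_bar G \<chi> g n) (Mmod \<chi> n (V i)),
        green_cls H zero_ideal (Mmod \<chi> n (V i))) | i. i \<in> Omega0 G g n \<Omega> V})"

end

theory Submission
  imports Defs "HOL-Library.Nat_Bijection" "Jordan_Normal_Form.Char_Poly"
begin

text \<open>
  For a \<open>G\<close>-module \<open>\<sigma>\<close> let \<open>C(k, \<sigma>)\<close> be the module \<open>\<sigma> \<oplus> x\<sigma> \<oplus> \<dots> \<oplus> x\<^sup>k\<^sup>-\<^sup>1\<sigma>\<close>, so that \<open>M(k, i)\<close> and \<open>P\<^sub>j\<close> are the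
  \<open>C(k, V\<^sub>i)\<close> and the \<open>C(n, V\<^sub>j)\<close>. Averaging over \<open>G\<close> shows that each \<open>H\<close>-module is a direct sum of such modules with
  \<open>\<sigma>\<close> simple, and \<open>C(n, \<sigma>)\<close> is the projective module induced from \<open>\<sigma>\<close>. Since \<open>C(n, \<sigma>) \<otimes> X\<close> and \<open>X \<otimes> C(n, \<sigma>)\<close> are
  again induced, \<open>\<P>\<close> is an ideal. The other \<open>C(k, \<sigma>)\<close> are \<open>\<sigma> \<otimes> C(k, 1)\<close>, and commutativity of \<open>r(H)\<close> follows from
  \<open>C(2, 1) \<otimes> C(k, 1) = C(k + 1, 1) \<oplus> C(k - 1, \<chi>\<^sup>-\<^sup>1)\<close> for \<open>2 \<le> k < n\<close>.

  By construction \<open>(b, c) \<mapsto> b + c\<close> is a ring homomorphism to \<open>r(H)\<close>; it is onto because \<open>C(k, V\<^sub>j)\<close> lies in \<open>\<P>\<close> or is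
  annihilated by \<open>1 - e\<close>. The map \<open>[M] \<mapsto> [eM]\<close> is the identity on \<open>r(H/H(1 - e))\<close>, fixes \<open>M[n, i]\<close> and
  kills \<open>P\<^sub>[\<^sub>j\<^sub>]\<close>. Hence an element \<open>(-c, c)\<close> of the kernel satisfies \<open>c = ec\<close>, an integral combination of the \<open>M[n, i]\<close>.
\<close>

section \<open>Linear operators on a space of countable dimension\<close>

text \<open>Each identity in a Green ring comes from an isomorphism of modules, so the proof
  consists largely of explicit operators with explicit inverses. They come from two universal
  properties of C(k, \<sigma>): a G-map i from \<sigma> to X extends by x^s v -> y^s (i v), and a
  linear map from X to \<sigma> that is G-equivariant up to the character of the top layer
  determines a map into C(k, \<sigma>). Weighted averages over G supply both inputs. The flip of a
  tensor product is not H-linear, because g occurs in only one summand of \<Delta>(y). Commutativity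
  therefore holds for indirect reasons: a product with an induced module depends only on the
  underlying G-modules, which can be flipped, and the recursion for C(k, 1) expresses [C(k + 1, 1)]
  through [C(2, 1)], [\<chi>^-1] and shorter modules. That the elements (-M[n, i], M[n, i]) span the
  whole kernel is a statement about integral combinations of classes; M -> eM respects direct sums,
  so it acts on such combinations and separates the M[n, i] from the P_j.\<close>

text \<open>
  All finite-dimensional modules are realised on summands of one space with basis indexed by the
  natural numbers, namely \<open>'k poly\<close> with the basis of monomials. Its operators form a ring with
  a tensor product and with isometries \<open>inc s\<close>, so that isomorphisms, direct sums
  and tensor products of modules become ring identities without dimension side conditions.
\<close>

typedef (overloaded) 'k lop =
  "{f :: 'k::field poly \<Rightarrow> 'k poly. (\<forall>p q. f (p + q) = f p + f q) \<and> (\<forall>c p. f (smult c p) = smult c (f p))}"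
  morphisms ap Abs_lop
  by (rule exI[of _ "\<lambda>p. p"]) auto

setup_lifting type_definition_lop

lemma smult_sum_right: "smult c (\<Sum>x\<in>S. f x) = (\<Sum>x\<in>S. smult c (f x))"
  by (induction S rule: infinite_finite_induct) (simp_all add: smult_add_right)

lemma ap_add: "ap A (p + q) = ap A p + ap A q"
  and ap_smult: "ap A (smult c p) = smult c (ap A p)"
  using ap[of A] by auto

lemma ap_0 [simp]: "ap A 0 = 0"
  using ap_smult[of A 0 0] by simp

lemma ap_uminus: "ap A (- p) = - ap A p"
  by (metis ap_0 ap_add add.right_inverse add_eq_0_iff)

lemma ap_diff: "ap A (p - q) = ap A p - ap A q"
  using ap_add[of A p "- q"] by (simp add: ap_uminus)

lemma ap_sum: "ap A (\<Sum>x\<in>S. f x) = (\<Sum>x\<in>S. ap A (f x))"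
  by (induction S rule: infinite_finite_induct) (simp_all add: ap_add)

instantiation lop :: (field) ring_1
begin

lift_definition zero_lop :: "'a lop" is "\<lambda>p. 0" by simp
lift_definition one_lop :: "'a lop" is "\<lambda>p. p" by simp
lift_definition plus_lop :: "'a lop \<Rightarrow> 'a lop \<Rightarrow> 'a lop" is "\<lambda>f g p. f p + g p"
  by (auto simp: algebra_simps smult_add_right)
lift_definition uminus_lop :: "'a lop \<Rightarrow> 'a lop" is "\<lambda>f p. - f p" by auto
lift_definition minus_lop :: "'a lop \<Rightarrow> 'a lop \<Rightarrow> 'a lop" is "\<lambda>f g p. f p - g p"
  by (auto simp: algebra_simps smult_diff_right)
lift_definition times_lop :: "'a lop \<Rightarrow> 'a lop \<Rightarrow> 'a lop" is "\<lambda>f g p. f (g p)" by auto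

instance
proof
  show "(0::'a lop) \<noteq> 1" by transfer (metis one_neq_zero)
qed (transfer; auto simp: algebra_simps fun_eq_iff)+

end

lemma ap_simps [simp]: "ap 0 p = 0" "ap 1 p = p" "ap (A + B) p = ap A p + ap B p"
  "ap (- A) p = - ap A p" "ap (A - B) p = ap A p - ap B p" "ap (A * B) p = ap A (ap B p)"
  by (transfer; simp)+

lemma lop_fun: "A = B \<Longrightarrow> ap A p = ap B p" by simp

lemma ap_sum_left: "ap (\<Sum>x\<in>S. f x) p = (\<Sum>x\<in>S. ap (f x) p)"
  by (induction S rule: infinite_finite_induct) simp_all

abbreviation e :: "nat \<Rightarrow> 'k::field poly" where "e i \<equiv> monom 1 i"

declare monom_eq_1 [simp del]

lemma poly_expand: "p = (\<Sum>i\<le>degree p. smult (coeff p i) (e i))"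
  by (simp add: smult_monom poly_as_sum_of_monoms)

lemma lop_eqI:
  assumes "\<And>i. ap A (e i) = ap B (e i)"
  shows "A = B"
proof -
  have "ap A p = ap B p" for p
    by (subst (1 2) poly_expand[of p]) (simp only: ap_sum ap_smult assms)
  then show ?thesis by (simp add: ap_inject[symmetric] fun_eq_iff)
qed

lift_definition lext :: "(nat \<Rightarrow> 'k::field poly) \<Rightarrow> 'k lop"
  is "\<lambda>c p. \<Sum>i\<le>degree p. smult (coeff p i) (c i)"
proof (intro CollectI conjI allI)
  fix c :: "nat \<Rightarrow> 'k poly" and p q :: "'k poly" and a :: 'k
  \<comment> \<open>The cut-off at the degree varies with the polynomial. Padding all sums to a
    common bound makes additivity visible, also when leading terms cancel.\<close>
  have *: "(\<Sum>i\<le>degree r. smult (coeff r i) (c i)) = (\<Sum>i\<le>m. smult (coeff r i) (c i))"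
    if "degree r \<le> m" for r m
    using that by (intro sum.mono_neutral_left) (auto simp: coeff_eq_0)
  let ?m = "max (degree p) (degree q)"
  show "(\<Sum>i\<le>degree (p + q). smult (coeff (p + q) i) (c i))
      = (\<Sum>i\<le>degree p. smult (coeff p i) (c i)) + (\<Sum>i\<le>degree q. smult (coeff q i) (c i))"
    using *[of p ?m] *[of q ?m] *[of "p + q" ?m]
    by (simp add: degree_add_le smult_add_left sum.distrib)
  show "(\<Sum>i\<le>degree (smult a p). smult (coeff (smult a p) i) (c i))
      = smult a (\<Sum>i\<le>degree p. smult (coeff p i) (c i))"
    by (subst *[of "smult a p" "degree p"]) (auto simp: smult_sum_right)
qed

lemma ap_lext [simp]: "ap (lext c) (e i) = c i"
proof -
  have "ap (lext c) (e i) = (\<Sum>j\<le>i. if j = i then c i else 0)"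
    unfolding lext.rep_eq by (intro sum.cong) (auto simp: degree_monom_eq)
  then show ?thesis by simp
qed

subsection \<open>Scalars\<close>

lift_definition scl :: "'k::field \<Rightarrow> 'k lop \<Rightarrow> 'k lop" is "\<lambda>c f p. smult c (f p)"
  by (auto simp: smult_add_right mult.commute)

lemma ap_scl [simp]: "ap (scl c A) p = smult c (ap A p)" by transfer simp

lemma scl_simps [simp]: "scl 0 A = 0" "scl 1 A = A" "scl c 0 = 0" "A * scl c B = scl c (A * B)"
  "scl c A * B = scl c (A * B)" "scl a (scl b A) = scl (a * b) A"
  by (rule lop_eqI; simp add: ap_smult)+

lemma scl_add: "scl c (A + B) = scl c A + scl c B" and scl_diff: "scl c (A - B) = scl c A - scl c B"
  and scl_add_left: "scl (a + b) A = scl a A + scl b A"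
  and scl_diff_left: "scl (a - b) A = scl a A - scl b A"
  by (rule lop_eqI; simp add: smult_add_right smult_diff_right smult_add_left smult_diff_left)+

lemma scl_sum: "scl c (\<Sum>x\<in>S. f x) = (\<Sum>x\<in>S. scl c (f x))"
  by (induction S rule: infinite_finite_induct) (simp_all add: scl_add)

lemma scl_sum_left: "scl (\<Sum>x\<in>S. f x) A = (\<Sum>x\<in>S. scl (f x) A)"
  by (induction S rule: infinite_finite_induct) (simp_all add: scl_add_left)

lemma scl_inverse: "c \<noteq> 0 \<Longrightarrow> scl c A = B \<longleftrightarrow> A = scl (inverse c) B"
  by auto

subsection \<open>Renaming basis vectors\<close>

definition ren :: "(nat \<Rightarrow> nat) \<Rightarrow> 'k::field lop" where "ren f = lext (\<lambda>i. e (f i))"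

text \<open>Zero off the range: for injective f this is the transpose of \<open>ren f\<close>, and
  \<open>ren f * unr f\<close> is the projection onto the monomials with exponent in the range of
  f.\<close>

definition unr :: "(nat \<Rightarrow> nat) \<Rightarrow> 'k::field lop"
  where "unr f = lext (\<lambda>j. if j \<in> range f then e (inv_into UNIV f j) else 0)"

lemma ap_ren [simp]: "ap (ren f) (e i) = e (f i)" by (simp add: ren_def)

lemma ap_unr: "inj f \<Longrightarrow> ap (unr f) (e (f i)) = e i"
  "inj f \<Longrightarrow> j \<notin> range f \<Longrightarrow> ap (unr f) (e j) = 0" by (simp_all add: unr_def)

lemma unr_ren: "inj f \<Longrightarrow> unr f * ren f = 1"
  by (rule lop_eqI) (simp add: ap_unr)

abbreviation pr2 :: "nat \<Rightarrow> nat \<Rightarrow> nat" where "pr2 s i \<equiv> prod_encode (s, i)"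

text \<open>With \<open>prj\<close> these satisfy the Leavitt relations for infinitely many
  generators. The space is the direct sum of the images of the \<open>inc s\<close>, but the sum of
  all \<open>inc s * prj s\<close> is infinite and does not exist in the ring;
  \<open>lop_eqI_inc\<close> takes its place.\<close>

definition inc :: "nat \<Rightarrow> 'k::field lop" where "inc s = ren (pr2 s)"
definition prj :: "nat \<Rightarrow> 'k::field lop" where "prj s = unr (pr2 s)"

lemma inj_pr2: "inj (pr2 s)" by (simp add: inj_def)

lemma ap_inc [simp]: "ap (inc s) (e i) = e (pr2 s i)" by (simp add: inc_def)

lemma ap_prj [simp]: "ap (prj s) (e (pr2 t i)) = (if s = t then e i else 0)"
proof (cases "s = t")
  case True then show ?thesis using ap_unr(1)[OF inj_pr2, of s i] by (simp add: prj_def)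
next
  case False
  then have "pr2 t i \<notin> range (pr2 s)" by auto
  then show ?thesis using False ap_unr(2)[OF inj_pr2, of "pr2 t i" s] by (simp add: prj_def)
qed

lemma prj_inc: "prj s * inc t = (if s = t then 1 else 0)"
  by (rule lop_eqI) simp

lemma prj_inc_left: "prj s * (inc t * A) = (if s = t then A else 0)"
  by (simp only: mult.assoc[symmetric] prj_inc) simp

lemma lop_eqI2:
  assumes "\<And>i j. ap A (e (pr2 i j)) = ap B (e (pr2 i j))"
  shows "A = B"
  by (rule lop_eqI) (metis assms prod_decode_inverse surj_pair)

lemma lop_eqI_inc:
  assumes "\<And>s. A * inc s = B * inc s"
  shows "A = B"
proof (rule lop_eqI2)
  fix i j show "ap A (e (pr2 i j)) = ap B (e (pr2 i j))"
    using arg_cong[OF assms[of i], of "\<lambda>C. ap C (e j)"] by simp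
qed

subsection \<open>Tensor products\<close>

text \<open>The pairing function identifies the space with its own tensor square, and
  \<open>pt p q\<close> is the pure tensor of p and q.\<close>

definition pt :: "'k::field poly \<Rightarrow> 'k poly \<Rightarrow> 'k poly"
  where "pt p q = ap (lext (\<lambda>s. ap (inc s) q)) p"

lemma pt_linear: "pt (p + p') q = pt p q + pt p' q" "pt (smult c p) q = smult c (pt p q)"
  "pt 0 q = 0" "pt (p - p') q = pt p q - pt p' q"
  by (simp_all add: pt_def ap_add ap_smult ap_diff)

lemma pt_e [simp]: "pt (e s) q = ap (inc s) q" by (simp add: pt_def)

lemma pt_expand: "pt p q = (\<Sum>s\<le>degree p. smult (coeff p s) (ap (inc s) q))"
  by (subst poly_expand[of p]) (simp add: pt_def ap_sum ap_smult)

lemma pt_linear2: "pt p (q + q') = pt p q + pt p q'" "pt p (smult c q) = smult c (pt p q)"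
  "pt p 0 = 0" "pt p (q - q') = pt p q - pt p q'"
  by (simp_all add: pt_expand ap_add ap_smult ap_diff sum.distrib smult_add_right sum_subtractf
      smult_diff_right smult_sum_right mult.commute)

text \<open>Fixing one factor of a pure tensor leaves an operator in the other factor, so identities
  between vectors become identities between operators, which can be tested on monomials.\<close>

lift_definition lpt1 :: "'k::field poly \<Rightarrow> 'k lop" is "\<lambda>q p. pt p q" by (simp add: pt_linear)
lift_definition lpt2 :: "'k::field poly \<Rightarrow> 'k lop" is "\<lambda>p q. pt p q" by (simp add: pt_linear2)

lemma ap_lpt: "ap (lpt1 q) p = pt p q" "ap (lpt2 p) q = pt p q"
  by (transfer; simp)+

definition tp :: "'k::field lop \<Rightarrow> 'k lop \<Rightarrow> 'k lop"
  where "tp A B = lext (\<lambda>j. case prod_decode j of (s, t) \<Rightarrow> pt (ap A (e s)) (ap B (e t)))"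

lemma ap_tp_e [simp]: "ap (tp A B) (e (pr2 s t)) = pt (ap A (e s)) (ap B (e t))"
  by (simp add: tp_def)

text \<open>Bilinearity is used one variable at a time: q becomes arbitrary while p is a monomial,
  and p afterwards.\<close>

lemma pt_eqI:
  assumes "\<And>s t. ap L (e (pr2 s t)) = pt (ap A (e s)) (ap B (e t))"
  shows "ap L (pt p q) = pt (ap A p) (ap B q)"
proof -
  have 0: "L * lpt2 (e s) = lpt2 (ap A (e s)) * B" for s
    by (rule lop_eqI) (simp add: ap_lpt assms)
  have 1: "ap L (pt (e s) q) = pt (ap A (e s)) (ap B q)" for s
    using lop_fun[OF 0[of s], of q] by (simp add: ap_lpt)
  have "L * lpt1 q = lpt1 (ap B q) * A"
    by (rule lop_eqI) (use 1 in \<open>simp add: ap_lpt\<close>)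
  from lop_fun[OF this, of p] show ?thesis by (simp add: ap_lpt)
qed

lemma ap_tp [simp]: "ap (tp A B) (pt p q) = pt (ap A p) (ap B q)"
  by (rule pt_eqI) simp

lemma tp_mult: "tp A B * tp C D = tp (A * C) (B * D)"
  by (rule lop_eqI2) simp

lemma tp_linear: "tp (A + A') B = tp A B + tp A' B" "tp A (B + B') = tp A B + tp A B'"
  "tp (A - A') B = tp A B - tp A' B" "tp A (B - B') = tp A B - tp A B'"
  "tp 0 B = 0" "tp A 0 = 0" "tp (scl c A) B = scl c (tp A B)" "tp A (scl c B) = scl c (tp A B)"
  by (rule lop_eqI2; simp add: pt_linear pt_linear2)+

lemma tp_sum: "tp (\<Sum>x\<in>S. f x) B = (\<Sum>x\<in>S. tp (f x) B)" "tp A (\<Sum>x\<in>S. f x) = (\<Sum>x\<in>S. tp A (f x))"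
  by (induction S rule: infinite_finite_induct) (simp_all add: tp_linear)

lemma tp_one [simp]: "tp 1 1 = 1"
  by (rule lop_eqI2) simp

definition flip :: "'k::field lop"
  where "flip = ren (\<lambda>j. case prod_decode j of (s, t) \<Rightarrow> pr2 t s)"

lemma flip_e [simp]: "ap flip (e (pr2 s t)) = e (pr2 t s)" by (simp add: flip_def)

lemma flip_flip: "flip * flip = 1" by (rule lop_eqI2) simp

lemma ap_flip: "ap flip (pt p q) = pt q p"
proof -
  have 0: "flip * lpt2 (e s) = lpt1 (e s)" for s :: nat
    by (rule lop_eqI) (simp add: ap_lpt)
  have 1: "ap flip (pt (e s) q) = pt q (e s)" for s
    using lop_fun[OF 0[of s], of q] by (simp add: ap_lpt)
  have "flip * lpt1 q = lpt2 q"
    by (rule lop_eqI) (use 1 in \<open>simp add: ap_lpt\<close>)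
  from lop_fun[OF this, of p] show ?thesis by (simp add: ap_lpt)
qed

lemma flip_tp: "flip * tp A B = tp B A * flip"
  by (rule lop_eqI2) (simp add: ap_flip)

definition asc :: "'k::field lop"
  where "asc = ren (\<lambda>j. case prod_decode j of (st, u) \<Rightarrow> case prod_decode st of (s, t) \<Rightarrow> pr2 s (pr2 t u))"
definition asc' :: "'k::field lop"
  where "asc' = ren (\<lambda>j. case prod_decode j of (s, tu) \<Rightarrow> case prod_decode tu of (t, u) \<Rightarrow> pr2 (pr2 s t) u)"

lemma asc_e [simp]: "ap asc (e (pr2 (pr2 s t) u)) = e (pr2 s (pr2 t u))"
  "ap asc' (e (pr2 s (pr2 t u))) = e (pr2 (pr2 s t) u)"
  by (simp_all add: asc_def asc'_def)

lemma lop_eqI3l: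
  assumes "\<And>i j k. ap A (e (pr2 (pr2 i j) k)) = ap B (e (pr2 (pr2 i j) k))"
  shows "A = B"
  by (rule lop_eqI2) (metis assms prod_decode_inverse surj_pair)

lemma lop_eqI3r:
  assumes "\<And>i j k. ap A (e (pr2 i (pr2 j k))) = ap B (e (pr2 i (pr2 j k)))"
  shows "A = B"
  by (rule lop_eqI2) (metis assms prod_decode_inverse surj_pair)

lemma asc_inv: "asc * asc' = 1" "asc' * asc = 1"
  by (rule lop_eqI3r, simp) (rule lop_eqI3l, simp)

lemma ap_asc: "ap asc (pt (pt p q) r) = pt p (pt q r)"
proof -
  have 0: "asc * lpt2 (e (pr2 s t)) = lpt2 (e s) * lpt2 (e t)" for s t :: nat
    by (rule lop_eqI) (simp add: ap_lpt)
  have 1: "ap asc (pt (e (pr2 s t)) r) = pt (e s) (pt (e t) r)" for s t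
    using lop_fun[OF 0[of s t], of r] by (simp add: ap_lpt)
  have 3: "asc * lpt1 r * lpt2 (e s) = lpt2 (e s) * lpt1 r" for s
    by (rule lop_eqI) (use 1 in \<open>simp add: ap_lpt\<close>)
  have 2: "ap asc (pt (pt (e s) q) r) = pt (e s) (pt q r)" for s
    using lop_fun[OF 3[of s], of q] by (simp add: ap_lpt)
  have "asc * lpt1 r * lpt1 q = lpt1 (pt q r)"
    by (rule lop_eqI) (use 2 in \<open>simp add: ap_lpt\<close>)
  from lop_fun[OF this, of p] show ?thesis by (simp add: ap_lpt)
qed

lemma asc_tp: "asc * tp (tp A B) C = tp A (tp B C) * asc"
  by (rule lop_eqI3l) (simp add: ap_asc)

lemma tp_inc: "tp A B * inc s = lpt2 (ap A (e s)) * B"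
  by (rule lop_eqI) (simp add: ap_lpt)

subsection \<open>Finite rank\<close>

definition pr :: "nat \<Rightarrow> 'k::field lop" where "pr d = lext (\<lambda>i. if i < d then e i else 0)"

lemma ap_pr [simp]: "ap (pr d) (e i) = (if i < d then e i else 0)" by (simp add: pr_def)

lemma pr_pr: "pr d * pr d' = pr (min d d')" by (rule lop_eqI) simp

lemma pr_0 [simp]: "pr 0 = 0" by (rule lop_eqI) simp

lemma coeff_pr: "coeff (ap (pr d) p) i = (if i < d then coeff p i else 0)"
proof -
  have "coeff (ap (pr d) p) i = (\<Sum>j\<le>degree p. if j = i then (if i < d then coeff p i else 0) else 0)"
    by (subst poly_expand[of p], unfold ap_sum ap_smult coeff_sum, intro sum.cong) auto
  then show ?thesis by (auto simp: coeff_eq_0)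
qed

lemma pr_id: "degree p < d \<Longrightarrow> ap (pr d) p = p"
  by (rule poly_eqI) (simp add: coeff_pr coeff_eq_0)

text \<open>This is finite rank: a finite-dimensional space of polynomials involves only finitely
  many monomials.\<close>

definition finr :: "'k::field lop \<Rightarrow> bool" where "finr P \<longleftrightarrow> (\<exists>d. pr d * P = P)"

lemma pr_mono: "pr d * P = P \<Longrightarrow> d \<le> d' \<Longrightarrow> pr d' * P = P"
  by (metis min.absorb2 mult.assoc pr_pr)

lemma finrI:
  assumes "finite {j. ap A (e j) \<noteq> 0}"
  shows "finr A"
proof -
  obtain m where m: "\<And>j. ap A (e j) \<noteq> 0 \<Longrightarrow> degree (ap A (e j)) < m"
  proof
    fix j assume "ap A (e j) \<noteq> 0"
    then show "degree (ap A (e j)) < Suc (Max ((\<lambda>j. degree (ap A (e j))) ` {j. ap A (e j) \<noteq> 0}))"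
      using assms by (auto intro!: le_imp_less_Suc Max_ge)
  qed
  have "pr m * A = A"
  proof (rule lop_eqI)
    fix j show "ap (pr m * A) (e j) = ap A (e j)"
      by (cases "ap A (e j) = 0") (auto simp: pr_id m)
  qed
  then show ?thesis by (auto simp: finr_def)
qed

lemma finr_pr: "finr (pr d)" by (auto simp: finr_def pr_pr intro!: exI[of _ d])

lemma finr_mult_right: "finr P \<Longrightarrow> finr (P * A)" by (auto simp: finr_def) (metis mult.assoc)

text \<open>The defining condition bounds the image of P, not that of \<open>A * P\<close>. But
  \<open>A * pr d\<close> has at most d nonzero columns, so its image is spanned by finitely many
  polynomials.\<close>

lemma finr_mult_left:
  assumes "finr P" shows "finr (A * P)"
proof -
  from assms obtain d where d: "pr d * P = P" by (auto simp: finr_def)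
  have "finr (A * pr d)"
    by (rule finrI, rule finite_subset[of _ "{..<d}"]) auto
  then have "finr (A * pr d * P)" by (rule finr_mult_right)
  then show ?thesis by (simp add: mult.assoc d)
qed

lemma finr_sandwich: "finr P \<Longrightarrow> finr (A * (P * B))"
  by (intro finr_mult_left finr_mult_right)

lemma finr_add: "finr P \<Longrightarrow> finr Q \<Longrightarrow> finr (P + Q)"
proof -
  assume "finr P" "finr Q"
  then obtain d d' where "pr d * P = P" "pr d' * Q = Q" by (auto simp: finr_def)
  then have "pr (max d d') * P = P" "pr (max d d') * Q = Q" by (auto intro: pr_mono)
  then show ?thesis by (auto simp: finr_def distrib_left intro!: exI[of _ "max d d'"])
qed

lemma finr_sum: "(\<And>x. x \<in> S \<Longrightarrow> finr (f x)) \<Longrightarrow> finr (\<Sum>x\<in>S. f x)"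
proof (induction S rule: infinite_finite_induct)
  case (insert x F) then show ?case by (simp add: finr_add)
qed (auto simp: finr_def)

lemma finr_tp:
  assumes "finr P" "finr Q" shows "finr (tp P Q)"
proof -
  from assms obtain d d' where d: "pr d * P = P" "pr d' * Q = Q" by (auto simp: finr_def)
  have "finr (tp (pr d :: 'a lop) (pr d'))"
  proof (rule finrI, rule finite_subset[of _ "prod_encode ` ({..<d} \<times> {..<d'})"])
    show "{j. ap (tp (pr d :: 'a lop) (pr d')) (e j) \<noteq> 0} \<subseteq> prod_encode ` ({..<d} \<times> {..<d'})"
    proof
      fix j assume "j \<in> {j. ap (tp (pr d :: 'a lop) (pr d')) (e j) \<noteq> 0}"
      moreover obtain s t where j: "j = pr2 s t" by (metis prod_decode_inverse surj_pair)
      ultimately show "j \<in> prod_encode ` ({..<d} \<times> {..<d'})"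
        by (auto split: if_splits simp: pt_linear)
    qed
  qed auto
  then have "finr (tp (pr d) (pr d') * tp P Q)" by (rule finr_mult_right)
  then show ?thesis by (simp add: tp_mult d)
qed

section \<open>Projections, left inverses and splitting of idempotents\<close>

interpretation lvs: vector_space "smult :: 'k::field \<Rightarrow> 'k poly \<Rightarrow> 'k poly"
  by unfold_locales (auto simp: smult_add_right smult_add_left)

interpretation lvsp: vector_space_pair "smult :: 'k::field \<Rightarrow> 'k poly \<Rightarrow> 'k poly" "smult :: 'k \<Rightarrow> 'k poly \<Rightarrow> 'k poly"
  by unfold_locales

lemma linear_smult_iff: "Vector_Spaces.linear smult smult (f :: 'k::field poly \<Rightarrow> 'k poly) \<longleftrightarrow>
    (\<forall>p q. f (p + q) = f p + f q) \<and> (\<forall>c p. f (smult c p) = smult c (f p))"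
  by (auto simp: Vector_Spaces.linear_iff lvs.vector_space_axioms)

lemma linear_ap: "Vector_Spaces.linear smult smult (ap A)"
  by (simp add: linear_smult_iff ap_add ap_smult)

lemma linear_imp_lop:
  assumes "Vector_Spaces.linear smult smult f"
  obtains A where "ap A = (f :: 'k::field poly \<Rightarrow> 'k poly)"
  using assms Abs_lop_inverse[of f] by (auto simp: linear_smult_iff)

lemma subspace_range_ap: "lvs.subspace (range (ap A))"
  unfolding lvs.subspace_def
proof (intro conjI ballI allI)
  show "0 \<in> range (ap A)" by (rule range_eqI[of _ _ 0]) simp
  fix x y c assume "x \<in> range (ap A)" "y \<in> range (ap A)"
  then obtain p q where "x = ap A p" "y = ap A q" by auto
  then show "x + y \<in> range (ap A)" "smult c x \<in> range (ap A)"
    by (auto simp flip: ap_add ap_smult)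
qed

lemma lop_projection:
  assumes "lvs.subspace W"
  obtains P where "\<And>p. ap P p \<in> W" "\<And>p. p \<in> W \<Longrightarrow> ap P p = p"
proof -
  have "Vector_Spaces.linear smult smult (\<lambda>p :: 'a poly. p)" by (simp add: linear_smult_iff)
  from lvsp.linear_exists_left_inverse_on[OF this assms] obtain f where
    f: "range f \<subseteq> W" "Vector_Spaces.linear smult smult f" "\<forall>v\<in>W. f v = v" by auto
  from linear_imp_lop[OF f(2)] obtain P where "ap P = f" .
  with f that[of P] show ?thesis by auto
qed

lemma lop_left_inverse:
  assumes inj: "\<And>p. ap A (ap P p) = 0 \<Longrightarrow> ap P p = 0" and P: "P * P = P"
  obtains L where "L * A * P = P"
proof -
  have "inj_on (ap A) (range (ap P))"
  proof (rule inj_onI, clarify)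
    fix p q assume "ap A (ap P p) = ap A (ap P q)"
    then have "ap A (ap P (p - q)) = 0" by (simp add: ap_diff)
    from inj[OF this] show "ap P p = ap P q" by (simp add: ap_diff)
  qed
  from lvsp.linear_exists_left_inverse_on[OF linear_ap subspace_range_ap this] obtain f where
    f: "Vector_Spaces.linear smult smult f" "\<forall>v\<in>range (ap P). f (ap A v) = v" by auto
  from linear_imp_lop[OF f(1)] obtain L where "ap L = f" .
  with f have "L * A * P = P" by (intro lop_eqI) simp
  then show ?thesis by (rule that)
qed

text \<open>The columns of T are a basis of the image of P, and S takes coordinates in it. This
  passes from a module on the image of a projection to a module of matrices.\<close>

lemma idempotent_split:
  assumes P: "P * P = P" and fin: "finr P"
  obtains d T S where "T * S = P" "S * T = pr d" "T * pr d = T" "pr d * S = S"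
proof -
  define W where "W = range (ap P)"
  have W: "lvs.subspace W" by (simp add: W_def subspace_range_ap)
  obtain B where B: "B \<subseteq> W" "lvs.independent B" "W \<subseteq> lvs.span B"
    using lvs.maximal_independent_subset[of W] by blast
  have spanB: "lvs.span B = W" using B W by (metis lvs.span_minimal subset_antisym)
  from fin obtain m where m: "pr m * P = P" by (auto simp: finr_def)
  have "W \<subseteq> lvs.span (e ` {..<m})"
  proof
    fix p assume "p \<in> W"
    then obtain p' where "p = ap P p'" by (auto simp: W_def)
    then have p: "ap (pr m) p = p" using arg_cong[OF m, of "\<lambda>C. ap C p'"] by simp
    have "ap (pr m) p = (\<Sum>i\<le>degree p. smult (coeff p i) (ap (pr m) (e i)))"
      by (subst poly_expand[of p]) (simp only: ap_sum ap_smult)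
    moreover have "\<dots> \<in> lvs.span (e ` {..<m})"
      by (intro lvs.span_sum lvs.span_scale) (auto intro: lvs.span_base lvs.span_zero)
    ultimately show "p \<in> lvs.span (e ` {..<m})" using p by simp
  qed
  then have finB: "finite B"
    using lvs.independent_span_bound[OF _ B(2), of "e ` {..<m}"] B(1) by auto
  obtain b where b: "bij_betw b {..<card B} B"
    using ex_bij_betw_nat_finite[OF finB] by (auto simp: atLeast0LessThan)
  define d where "d = card B"
  define R where "R p j = lvs.representation B (ap P p) (b j)" for p j
  have inW: "ap P p \<in> lvs.span B" for p by (simp add: spanB W_def)
  define f where "f p = (\<Sum>j<d. smult (R p j) (e j))" for p
  have "Vector_Spaces.linear smult smult f"
    by (simp add: linear_smult_iff f_def R_def ap_add ap_smult lvs.representation_add[OF B(2) inW inW]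
        lvs.representation_scale[OF B(2) inW] smult_add_left sum.distrib smult_sum_right)
  from linear_imp_lop[OF this] obtain S where S: "ap S = f" .
  define T :: "'a lop" where "T = lext (\<lambda>j. if j < d then b j else 0)"
  have bW: "b j \<in> B" if "j < d" for j using b that by (auto simp: bij_betw_def d_def)
  have Pb: "ap P (b j) = b j" if "j < d" for j
  proof -
    have "b j \<in> W" using bW that B(1) by blast
    then obtain p where "b j = ap P p" by (auto simp: W_def)
    then show ?thesis using arg_cong[OF P, of "\<lambda>C. ap C p"] by simp
  qed
  have "T * S = P"
  proof (rule lop_eqI)
    fix i
    have "ap (T * S) (e i) = (\<Sum>j<d. smult (R (e i) j) (b j))"
      by (simp add: S f_def ap_sum ap_smult T_def)
    also have "\<dots> = (\<Sum>v\<in>B. smult (lvs.representation B (ap P (e i)) v) v)"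
      unfolding R_def d_def by (rule sum.reindex_bij_betw[OF b])
    also have "\<dots> = ap P (e i)"
      using lvs.sum_representation_eq[OF B(2) inW finB] by simp
    finally show "ap (T * S) (e i) = ap P (e i)" .
  qed
  moreover have "S * T = pr d"
  proof (rule lop_eqI)
    fix i show "ap (S * T) (e i) = ap (pr d) (e i)"
    proof (cases "i < d")
      case True
      have "R (b i) j = (if j = i then 1 else 0)" if "j < d" for j
        using that True b Pb[OF True] bW
        by (auto simp: R_def lvs.representation_basis[OF B(2)] bij_betw_def inj_on_def d_def)
      then have "f (b i) = (\<Sum>j<d. if j = i then e i else 0)"
        unfolding f_def by (intro sum.cong) auto
      with True show ?thesis by (simp add: T_def S)
    qed (simp add: T_def)
  qed
  moreover have "T * pr d = T" by (rule lop_eqI) (simp add: T_def)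
  moreover have "pr d * S = S"
    by (rule lop_eqI) (simp add: S f_def ap_sum ap_smult)
  ultimately show ?thesis using that by blast
qed

subsection \<open>Gaussian binomial coefficients\<close>

text \<open>The q-Pascal rule keeps Gaussian binomials free of division, so that they make sense at
  roots of unity.\<close>

fun qb :: "'k::field \<Rightarrow> nat \<Rightarrow> nat \<Rightarrow> 'k" where
  "qb q m 0 = 1"
| "qb q 0 (Suc k) = 0"
| "qb q (Suc m) (Suc k) = qb q m k + q ^ Suc k * qb q m (Suc k)"

lemma qb_gt: "m < k \<Longrightarrow> qb q m k = 0"
  by (induction q m k rule: qb.induct) auto

text \<open>Here a and b are neighbours in a row of the q-Pascal triangle and
  \<open>a + x * b\<close> is the entry below them; the two conclusions compare that entry with each
  of them.\<close>

lemma qb_ratio_aux: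
  fixes a :: "'k::field"
  assumes "b * (1 - x) = (1 - z) * a"
  shows "(a + x * b) * (1 - x) = (1 - x * z) * a" "(1 - z) * (a + x * b) = (1 - x * z) * b"
proof -
  have "(a + x * b) * (1 - x) = a * (1 - x) + x * (b * (1 - x))" by (simp add: algebra_simps)
  then show "(a + x * b) * (1 - x) = (1 - x * z) * a" by (simp add: assms) (simp add: algebra_simps)
  have "(1 - z) * (a + x * b) = (1 - z) * a + x * (1 - z) * b" by (simp add: algebra_simps)
  then show "(1 - z) * (a + x * b) = (1 - x * z) * b" by (simp flip: assms) (simp add: algebra_simps)
qed

text \<open>The quotient of neighbouring Gaussian binomials, with the denominator cleared because it
  may vanish at a root of unity.\<close>

lemma qb_ratio: "k \<le> m \<Longrightarrow> qb q m (Suc k) * (1 - q ^ Suc k) = (1 - q ^ (m - k)) * qb q m k"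
proof (induction m arbitrary: k)
  case (Suc m)
  show ?case
  proof (cases "k = Suc m")
    case True then show ?thesis by (simp add: qb_gt)
  next
    case False
    then have k: "k \<le> m" using Suc.prems by simp
    have "q ^ Suc k * q ^ (m - k) = q ^ Suc m" using k by (simp flip: power_add)
    then have 1: "qb q (Suc m) (Suc k) * (1 - q ^ Suc k) = (1 - q ^ Suc m) * qb q m k"
      using qb_ratio_aux(1)[OF Suc.IH[OF k]] by simp
    show ?thesis
    proof (cases k)
      case 0 then show ?thesis using 1 by simp
    next
      case (Suc k')
      have "q ^ k * q ^ (m - k') = q ^ Suc m" using k Suc by (simp flip: power_add)
      moreover have "qb q m k * (1 - q ^ k) = (1 - q ^ (m - k')) * qb q m k'"
        using Suc.IH[of k'] k Suc by simp
      moreover have "qb q (Suc m) k = qb q m k' + q ^ k * qb q m k" using Suc by simp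
      ultimately have "(1 - q ^ (m - k')) * qb q (Suc m) k = (1 - q ^ Suc m) * qb q m k"
        using qb_ratio_aux(2)[of "qb q m k" "q ^ k"] by simp
      with 1 Suc show ?thesis by simp
    qed
  qed
qed simp

text \<open>In row n the factor 1 - q^(n - k) is zero for k = 0, so the entry at 1 vanishes. The
  later denominators 1 - q^(k + 1) are nonzero, and the zero propagates up to the entry at n -
  1.\<close>

lemma qb_root_of_unity:
  assumes "q ^ n = 1" "\<forall>m. 0 < m \<and> m < n \<longrightarrow> q ^ m \<noteq> 1" "0 < k" "k < n"
  shows "qb q n k = 0"
  using assms(3,4)
proof (induction k)
  case (Suc k)
  have "q ^ Suc k \<noteq> 1" using assms(2) Suc by blast
  moreover have "(1 - q ^ (n - k)) * qb q n k = 0"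
    using Suc assms(1) by (cases "k = 0") auto
  then have "qb q n (Suc k) * (1 - q ^ Suc k) = 0" using qb_ratio[of k n q] Suc by simp
  ultimately show ?case by (simp only: mult_eq_0_iff) simp
qed simp

lemma mult_assoc_cong: "a * b = c \<Longrightarrow> a * (b * x) = c * (x :: 'k::field lop)"
  by (simp flip: mult.assoc)

lemma power_skew_comm:
  assumes "B * A = scl q (A * B)"
  shows "B * A ^ k = scl (q ^ k) (A ^ k * B)"
proof (induction k)
  case (Suc k)
  have "B * A ^ Suc k = scl q (A * (B * A ^ k))" using mult_assoc_cong[OF assms] by (simp add: mult.assoc)
  then show ?case by (simp add: Suc mult.assoc)
qed simp

lemma q_binomial:
  assumes "B * A = scl q (A * B)"
  shows "(A + B) ^ m = (\<Sum>k\<le>m. scl (qb q m k) (A ^ k * B ^ (m - k)))"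
proof (induction m)
  case (Suc m)
  let ?t = "\<lambda>k. scl (q ^ k * qb q m k) (A ^ k * B ^ (Suc m - k))"
  have "(A + B) ^ Suc m = (\<Sum>k\<le>m. (A + B) * scl (qb q m k) (A ^ k * B ^ (m - k)))"
    by (simp add: Suc sum_distrib_left)
  also have "\<dots> = (\<Sum>k\<le>m. scl (qb q m k) (A ^ Suc k * B ^ (m - k)) + ?t k)"
  proof (rule sum.cong[OF refl])
    fix k assume "k \<in> {..m}"
    then have "B ^ (Suc m - k) = B * B ^ (m - k)" by (simp add: Suc_diff_le)
    then have "B * (A ^ k * B ^ (m - k)) = scl (q ^ k) (A ^ k * B ^ (Suc m - k))"
      using mult_assoc_cong[OF power_skew_comm[OF assms, of k]] by (simp add: mult.assoc)
    then show "(A + B) * scl (qb q m k) (A ^ k * B ^ (m - k)) = scl (qb q m k) (A ^ Suc k * B ^ (m - k)) + ?t k"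
      by (simp add: distrib_right scl_add mult.assoc mult.commute[of "qb q m k"])
  qed
  also have "\<dots> = (\<Sum>k\<le>m. scl (qb q m k) (A ^ Suc k * B ^ (m - k))) + (\<Sum>k\<le>Suc m. ?t k)"
    by (simp add: sum.distrib qb_gt)
  also have "(\<Sum>k\<le>Suc m. ?t k) = B ^ Suc m + (\<Sum>k\<le>m. ?t (Suc k))"
    by (subst sum.atMost_Suc_shift) simp
  also have "(\<Sum>k\<le>m. scl (qb q m k) (A ^ Suc k * B ^ (m - k))) + (B ^ Suc m + (\<Sum>k\<le>m. ?t (Suc k)))
      = B ^ Suc m + (\<Sum>k\<le>m. scl (qb q (Suc m) (Suc k)) (A ^ Suc k * B ^ (Suc m - Suc k)))"
    by (simp add: sum.distrib scl_add_left algebra_simps)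
  also have "\<dots> = (\<Sum>k\<le>Suc m. scl (qb q (Suc m) k) (A ^ k * B ^ (Suc m - k)))"
    by (subst sum.atMost_Suc_shift) simp
  finally show ?case .
qed simp

text \<open>This makes the relation y^n = g^n - 1 survive in tensor products, where y acts as a sum
  of two operators that commute up to q.\<close>

lemma q_binomial_root_of_unity:
  assumes "B * A = scl q (A * B)" "q ^ n = 1" "\<forall>m. 0 < m \<and> m < n \<longrightarrow> q ^ m \<noteq> 1" "0 < n"
  shows "(A + B) ^ n = A ^ n + B ^ n"
proof -
  have nn: "qb q m m = 1" for m by (induction m) (auto simp: qb_gt)
  have "(A + B) ^ n = (\<Sum>k\<le>n. (if k = 0 then B ^ n else 0) + (if k = n then A ^ n else 0))"
    unfolding q_binomial[OF assms(1)]
    using assms(4) by (intro sum.cong) (auto simp: nn qb_root_of_unity[OF assms(2,3)])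
  then show ?thesis by (simp add: sum.distrib add.commute)
qed

text \<open>The exponent is positive because the zeroth power on the left is 1, whereas the
  right-hand side would be \<open>S * T\<close>.\<close>

lemma sandwich_power:
  assumes "T * S = E" "Y * E = (Y :: 'k::field lop)"
  shows "(S * Y * T) ^ Suc m = S * Y ^ Suc m * T"
proof (induction m)
  case (Suc m)
  have "(S * Y * T) ^ Suc (Suc m) = S * Y * (T * S) * Y ^ Suc m * T"
    by (simp only: power_Suc[of _ "Suc m"] Suc) (simp only: mult.assoc)
  then show ?case by (simp add: assms(1) mult.assoc mult_assoc_cong[OF assms(2)])
qed simp

section \<open>Modules as families of operators\<close>

text \<open>
  A module is a pair \<open>(\<rho>, Y)\<close> of the operators \<open>\<rho> h\<close> of \<open>h \<in> G\<close> and \<open>Y\<close> of \<open>y\<close>. Here \<open>\<rho> \<one>\<close> is not the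
  identity but a projection, whose image is the underlying space of the module.
\<close>

type_synonym ('a, 'k) am = "('a \<Rightarrow> 'k lop) \<times> 'k lop"

locale datum = group G for G :: "('a, 'm) monoid_scheme" (structure) +
  fixes \<chi> :: "'a \<Rightarrow> 'k::{alg_closed_field, field_char_0}" and g :: 'a and n :: nat
  assumes fin: "finite (carrier G)"
    and chi_nz: "h \<in> carrier G \<Longrightarrow> \<chi> h \<noteq> 0"
    and chi_mult: "h \<in> carrier G \<Longrightarrow> h' \<in> carrier G \<Longrightarrow> \<chi> (h \<otimes> h') = \<chi> h * \<chi> h'"
    and g_in [simp]: "g \<in> carrier G"
    and g_central: "h \<in> carrier G \<Longrightarrow> g \<otimes> h = h \<otimes> g"
    and n2: "n \<ge> 2" and q_n: "\<chi> g ^ n = 1"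
    and q_prim: "\<forall>m. 0 < m \<and> m < n \<longrightarrow> \<chi> g ^ m \<noteq> 1"
    and chi_n: "h \<in> carrier G \<Longrightarrow> \<chi> h ^ n = 1"
begin

lemma chi_1 [simp]: "\<chi> \<one> = 1"
  using chi_mult[of \<one> \<one>] chi_nz[of \<one>] by simp

lemma chi_inv: "h \<in> carrier G \<Longrightarrow> \<chi> (inv h) = inverse (\<chi> h)"
  using chi_mult[of h "inv h"] chi_nz[of h] by (simp add: field_simps)

lemma chi_pow: "h \<in> carrier G \<Longrightarrow> \<chi> (h [^] (m::nat)) = \<chi> h ^ m"
  by (induction m) (auto simp: chi_mult mult.commute)

lemma chi_gn [simp]: "\<chi> (g [^] n) = 1" by (simp add: chi_pow q_n)

lemma gpow_central: "h \<in> carrier G \<Longrightarrow> (g [^] (m::nat)) \<otimes> h = h \<otimes> (g [^] m)"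
proof (induction m)
  case (Suc m)
  have "(g [^] Suc m) \<otimes> h = g [^] m \<otimes> (h \<otimes> g)" using Suc.prems by (simp add: m_assoc g_central)
  also have "\<dots> = h \<otimes> (g [^] m) \<otimes> g" using Suc by (simp add: m_assoc[symmetric])
  finally show ?case using Suc.prems by (simp add: m_assoc)
qed simp

definition gm :: "('a \<Rightarrow> 'k lop) \<Rightarrow> bool"
  where "gm \<rho> \<longleftrightarrow> (\<forall>h\<in>carrier G. \<forall>h'\<in>carrier G. \<rho> h * \<rho> h' = \<rho> (h \<otimes> h')) \<and> finr (\<rho> \<one>)"

definition hm :: "('a, 'k) am \<Rightarrow> bool"
  where "hm X \<longleftrightarrow> gm (fst X) \<and> fst X \<one> * snd X = snd X \<and> snd X * fst X \<one> = snd X \<and>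
    (\<forall>h\<in>carrier G. snd X * fst X h = scl (\<chi> h) (fst X h * snd X)) \<and>
    snd X ^ n = fst X (g [^] n) - fst X \<one>"

text \<open>The first condition makes T vanish on the kernel of the projection
  \<open>\<rho> \<one>\<close>, and the second one at \<open>\<one>\<close> puts its image into the
  space of \<open>\<sigma>\<close>. So each module map is exactly one operator, and inverse maps
  compose to the two projections.\<close>

definition ghom :: "('a \<Rightarrow> 'k lop) \<Rightarrow> ('a \<Rightarrow> 'k lop) \<Rightarrow> 'k lop \<Rightarrow> bool"
  where "ghom \<rho> \<sigma> T \<longleftrightarrow> T * \<rho> \<one> = T \<and> (\<forall>h\<in>carrier G. T * \<rho> h = \<sigma> h * T)"

definition hhom :: "('a, 'k) am \<Rightarrow> ('a, 'k) am \<Rightarrow> 'k lop \<Rightarrow> bool"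
  where "hhom X Z T \<longleftrightarrow> ghom (fst X) (fst Z) T \<and> T * snd X = snd Z * T"

definition hiso :: "('a, 'k) am \<Rightarrow> ('a, 'k) am \<Rightarrow> bool"
  where "hiso X Z \<longleftrightarrow> (\<exists>T S. hhom X Z T \<and> hhom Z X S \<and> S * T = fst X \<one> \<and> T * S = fst Z \<one>)"

lemma gm_mult: "gm \<rho> \<Longrightarrow> h \<in> carrier G \<Longrightarrow> h' \<in> carrier G \<Longrightarrow> \<rho> h * \<rho> h' = \<rho> (h \<otimes> h')"
  by (simp add: gm_def)

lemma gm_one: "gm \<rho> \<Longrightarrow> h \<in> carrier G \<Longrightarrow> \<rho> \<one> * \<rho> h = \<rho> h"
  "gm \<rho> \<Longrightarrow> h \<in> carrier G \<Longrightarrow> \<rho> h * \<rho> \<one> = \<rho> h"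
  by (simp_all add: gm_mult)

lemma gm_pow: "gm \<rho> \<Longrightarrow> h \<in> carrier G \<Longrightarrow> \<rho> h ^ m * \<rho> \<one> = \<rho> (h [^] m)"
proof (induction m)
  case (Suc m)
  have "\<rho> h ^ Suc m * \<rho> \<one> = \<rho> h * \<rho> (h [^] m)" using Suc by (simp add: mult.assoc)
  also have "\<dots> = \<rho> (h \<otimes> h [^] m)" using Suc.prems by (simp add: gm_mult)
  also have "h \<otimes> h [^] m = h [^] Suc m" using Suc.prems by (metis nat_pow_Suc2)
  finally show ?case .
qed simp

lemma gm_pow_Suc: "gm \<rho> \<Longrightarrow> h \<in> carrier G \<Longrightarrow> m > 0 \<Longrightarrow> \<rho> h ^ m = \<rho> (h [^] m)"
proof (cases m)
  case (Suc k)
  assume "gm \<rho>" "h \<in> carrier G"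
  then show ?thesis using gm_pow[of \<rho> h m] gm_one(2)[of \<rho> h] unfolding Suc power_Suc2 by (simp only: mult.assoc)
qed simp

lemma gm_inv: "gm \<rho> \<Longrightarrow> h \<in> carrier G \<Longrightarrow> \<rho> h * \<rho> (inv h) = \<rho> \<one>"
  "gm \<rho> \<Longrightarrow> h \<in> carrier G \<Longrightarrow> \<rho> (inv h) * \<rho> h = \<rho> \<one>"
  by (simp_all add: gm_mult)

lemma gm_g: "gm \<rho> \<Longrightarrow> h \<in> carrier G \<Longrightarrow> \<rho> (g [^] (m::nat)) * \<rho> h = \<rho> h * \<rho> (g [^] m)"
  by (simp add: gm_mult gpow_central)

lemma hmD: assumes "hm X"
  shows hm_gm: "gm (fst X)" and hm_1Y: "fst X \<one> * snd X = snd X" and hm_Y1: "snd X * fst X \<one> = snd X"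
    and hm_Yh: "h \<in> carrier G \<Longrightarrow> snd X * fst X h = scl (\<chi> h) (fst X h * snd X)"
    and hm_Yn: "snd X ^ n = fst X (g [^] n) - fst X \<one>"
  using assms by (auto simp: hm_def)

lemma hm_Yh_pow: "hm X \<Longrightarrow> h \<in> carrier G \<Longrightarrow> snd X ^ s * fst X h = scl (\<chi> h ^ s) (fst X h * snd X ^ s)"
proof (induction s)
  case (Suc s)
  have "snd X ^ Suc s * fst X h = snd X * (snd X ^ s * fst X h)" by (simp add: mult.assoc)
  also have "\<dots> = scl (\<chi> h ^ s) (snd X * fst X h * snd X ^ s)" using Suc by (simp add: mult.assoc)
  finally show ?case using Suc.prems by (simp add: hm_Yh mult.assoc mult.commute)
qed simp

lemma ghomD: assumes "ghom \<rho> \<sigma> T"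
  shows ghom_1: "T * \<rho> \<one> = T" and ghom_h: "h \<in> carrier G \<Longrightarrow> T * \<rho> h = \<sigma> h * T"
    and ghom_1': "\<sigma> \<one> * T = T"
  using assms by (auto simp: ghom_def)

lemma hhomD: assumes "hhom X Z T"
  shows hhom_ghom: "ghom (fst X) (fst Z) T" and hhom_1: "T * fst X \<one> = T"
    and hhom_h: "h \<in> carrier G \<Longrightarrow> T * fst X h = fst Z h * T"
    and hhom_Y: "T * snd X = snd Z * T" and hhom_1': "fst Z \<one> * T = T"
  using assms ghomD[of "fst X" "fst Z" T] by (auto simp: hhom_def)

lemma hhom_Y_pow: "hhom X Z T \<Longrightarrow> T * snd X ^ s = snd Z ^ s * T"
proof (induction s)
  case (Suc s)
  have "T * snd X ^ Suc s = T * snd X * snd X ^ s" by (simp add: mult.assoc)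
  also have "\<dots> = snd Z * (T * snd X ^ s)" using Suc.prems by (simp add: hhom_Y mult.assoc)
  finally show ?case using Suc by (simp add: mult.assoc)
qed simp

lemma ghom_comp: assumes "ghom \<rho> \<sigma> T" "ghom \<sigma> \<tau> S" shows "ghom \<rho> \<tau> (S * T)"
  using assms unfolding ghom_def by (metis mult.assoc)

lemma hhom_comp: assumes "hhom X Z T" "hhom Z W S" shows "hhom X W (S * T)"
  using assms ghom_comp unfolding hhom_def by (metis mult.assoc)

lemma ghom_id: "gm \<rho> \<Longrightarrow> ghom \<rho> \<rho> (\<rho> \<one>)" by (simp add: ghom_def gm_one)

lemma hhom_id: "hm X \<Longrightarrow> hhom X X (fst X \<one>)"
  by (simp add: hhom_def ghom_id hmD)

lemma hhom_diff: "hhom X Z T \<Longrightarrow> hhom X Z S \<Longrightarrow> hhom X Z (T - S)"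
  by (simp add: hhom_def ghom_def left_diff_distrib right_diff_distrib)

lemma hiso_refl: "hm X \<Longrightarrow> hiso X X"
  unfolding hiso_def by (rule exI[of _ "fst X \<one>"], rule exI[of _ "fst X \<one>"])
    (simp add: hhom_id gm_one hm_gm)

lemma hiso_sym: "hiso X Z \<Longrightarrow> hiso Z X" unfolding hiso_def by blast

lemma hiso_trans: assumes "hiso X Z" "hiso Z W" shows "hiso X W"
proof -
  from assms obtain T S T' S' where *: "hhom X Z T" "hhom Z X S" "S * T = fst X \<one>" "T * S = fst Z \<one>"
    "hhom Z W T'" "hhom W Z S'" "S' * T' = fst Z \<one>" "T' * S' = fst W \<one>"
    unfolding hiso_def by blast
  have "(S * S') * (T' * T) = S * (S' * T') * T" "(T' * T) * (S * S') = T' * (T * S) * S'"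
    by (simp_all only: mult.assoc)
  then have "(S * S') * (T' * T) = fst X \<one>" "(T' * T) * (S * S') = fst W \<one>"
    using * by (simp_all add: hhom_1)
  then show ?thesis unfolding hiso_def
    using hhom_comp[OF *(1,5)] hhom_comp[OF *(6,2)] by blast
qed

lemma hisoI: "hhom X Z T \<Longrightarrow> hhom Z X S \<Longrightarrow> S * T = fst X \<one> \<Longrightarrow> T * S = fst Z \<one> \<Longrightarrow> hiso X Z"
  unfolding hiso_def by blast

text \<open>The inverse of an equivariant bijection is equivariant. S is any linear inverse on the
  two underlying spaces; compressed to \<open>S'\<close> it has the right support, and equivariance
  of T carries over to it.\<close>

lemma hiso_linI:
  assumes "hhom X Z T" "S * T = fst X \<one>" "T * S = fst Z \<one>" "hm X" "hm Z"
  shows "hiso X Z"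
proof -
  note gX = hm_gm[OF assms(4)] and gZ = hm_gm[OF assms(5)] and T = assms(1)
  define S' where "S' = fst X \<one> * S * fst Z \<one>"
  note R = hhom_1[OF T] hhom_1'[OF T] gm_one[OF gX one_closed] gm_one[OF gZ one_closed] assms(2,3)
  have 1: "S' * T = fst X \<one>" and 2: "T * S' = fst Z \<one>"
    and e1: "S' * fst Z \<one> = S'" "fst X \<one> * S' = S'"
    by (simp_all add: S'_def mult.assoc R R[THEN mult_assoc_cong])
  have "S' * fst Z h = fst X h * S'" if h: "h \<in> carrier G" for h
  proof -
    have "S' * fst Z h = S' * (fst Z h * (T * S'))" by (simp add: 2 gm_one[OF gZ h])
    also have "\<dots> = S' * T * fst X h * S'" by (simp add: mult.assoc hhom_h[OF T h, THEN mult_assoc_cong])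
    finally show ?thesis by (simp add: 1 gm_one[OF gX h])
  qed
  moreover have "S' * snd Z = snd X * S'"
  proof -
    have "S' * snd Z = S' * (snd Z * (T * S'))" by (simp add: 2 hm_Y1[OF assms(5)])
    also have "\<dots> = S' * T * snd X * S'" by (simp add: mult.assoc hhom_Y[OF T, THEN mult_assoc_cong])
    finally show ?thesis by (simp add: 1 hm_1Y[OF assms(4)])
  qed
  ultimately have "hhom Z X S'" using e1 by (simp add: hhom_def ghom_def)
  with T 1 2 show ?thesis by (intro hisoI)
qed

text \<open>Transport of structure along S and T: the product \<open>S * T\<close> becomes the
  projection onto the new underlying space. The factor \<open>fst Z \<one>\<close> in the last claim
  takes care of i = 0, where the power alone is 1 and not \<open>S * T\<close>.\<close>

lemma hm_conj:
  assumes X: "hm X" and TS: "T * S = fst X \<one>" and S1: "S * fst X \<one> = S"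
  defines "Z \<equiv> (\<lambda>h. S * fst X h * T, S * snd X * T)"
  shows "hm Z" "hiso X Z" "fst Z \<one> = S * T" "snd Z ^ i * fst Z \<one> = S * snd X ^ i * T"
proof -
  note gX = hm_gm[OF X]
  note R = TS S1 gm_one[OF gX one_closed] hm_1Y[OF X] hm_Y1[OF X]
  note R' = R R[THEN mult_assoc_cong]
  show Z1: "fst Z \<one> = S * T" by (simp add: Z_def S1)
  have sp: "snd Z ^ m = S * snd X ^ m * T" if "m > 0" for m
    using that sandwich_power[OF TS hm_Y1[OF X], of "m - 1"] by (simp add: Z_def)
  have Y1: "snd X ^ m * fst X \<one> = snd X ^ m" if "m > 0" for m
    using that hm_Y1[OF X] by (cases m) (simp_all only: power_Suc2 mult.assoc)
  show "snd Z ^ i * fst Z \<one> = S * snd X ^ i * T"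
  proof (cases "i > 0")
    case True
    then show ?thesis by (simp add: sp Z1 mult.assoc R' mult_assoc_cong[OF Y1])
  qed (simp add: Z1)
  have n0: "n > 0" using n2 by simp
  show hmZ: "hm Z"
    unfolding hm_def gm_def
  proof (intro conjI ballI)
    show "finr (fst Z \<one>)" using gX by (auto simp: Z_def gm_def intro: finr_mult_left finr_mult_right)
    show "fst Z h * fst Z h' = fst Z (h \<otimes> h')" if h: "h \<in> carrier G" "h' \<in> carrier G" for h h'
      by (simp add: Z_def mult.assoc R' mult_assoc_cong[OF gm_one(1)[OF gX h(2)]] mult_assoc_cong[OF gm_mult[OF gX h]])
    show "snd Z * fst Z h = scl (\<chi> h) (fst Z h * snd Z)" if h: "h \<in> carrier G" for h
      by (simp add: Z_def mult.assoc R' mult_assoc_cong[OF gm_one(1)[OF gX h]]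
          mult_assoc_cong[OF hm_Yh[OF X h]])
    show "fst Z \<one> * snd Z = snd Z" "snd Z * fst Z \<one> = snd Z"
      by (simp_all add: Z_def mult.assoc R')
    show "snd Z ^ n = fst Z (g [^] n) - fst Z \<one>"
      unfolding sp[OF n0] hm_Yn[OF X] by (simp add: Z_def algebra_simps)
  qed
  have "hhom X Z S"
    unfolding hhom_def ghom_def using gm_one[OF gX]
    by (auto simp: Z_def mult.assoc R')
  moreover have "fst X \<one> * T * S = fst X \<one>" by (simp add: mult.assoc R')
  moreover have "S * (fst X \<one> * T) = fst Z \<one>" by (simp add: Z1 mult.assoc R')
  ultimately show "hiso X Z" using hiso_linI X hmZ by blast
qed

end

lemma tp_power: "tp A B ^ m = tp (A ^ m) (B ^ m)"
  by (induction m) (simp_all add: tp_mult)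

context datum
begin

lemma n_pos [simp]: "0 < n" using n2 by simp

text \<open>For operators such as \<open>asc\<close> that are invertible on the whole ambient space;
  multiplying by \<open>fst X \<one>\<close> cuts them down to module maps.\<close>

lemma hiso_bij:
  assumes "V * U = 1" "U * V = 1" "\<And>h. h \<in> carrier G \<Longrightarrow> U * fst X h = fst Z h * U"
    "U * snd X = snd Z * U" "hm X" "hm Z"
  shows "hiso X Z"
proof (rule hiso_linI[of X Z "U * fst X \<one>" V])
  note gX = hm_gm[OF assms(5)] and gZ = hm_gm[OF assms(6)]
  show "hhom X Z (U * fst X \<one>)"
    unfolding hhom_def ghom_def
    by (auto simp: mult.assoc gm_one[OF gX] gm_one[OF gZ] assms(3,4) hm_1Y[OF assms(5)] hm_Y1[OF assms(6)]
        simp flip: mult_assoc_cong[OF assms(3)] mult_assoc_cong[OF assms(4)])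
      (simp_all add: assms(3,4) gm_one[OF gX] gm_one[OF gZ] hm_1Y[OF assms(5)] hm_Y1[OF assms(6)] mult_assoc_cong[OF gm_one(2)[OF gZ]]
         mult_assoc_cong[OF hm_Y1[OF assms(6)]] mult_assoc_cong[OF gm_one(1)[OF gZ]] mult_assoc_cong[OF hm_1Y[OF assms(6)]])
  show "V * (U * fst X \<one>) = fst X \<one>" using assms(1) by (simp flip: mult.assoc)
  show "U * fst X \<one> * V = fst Z \<one>" using assms(2,3) by (simp add: mult.assoc)
qed (use assms in auto)

subsection \<open>Tensor products\<close>

definition gt :: "('a \<Rightarrow> 'k lop) \<Rightarrow> ('a \<Rightarrow> 'k lop) \<Rightarrow> 'a \<Rightarrow> 'k lop"
  where "gt \<rho> \<sigma> = (\<lambda>h. tp (\<rho> h) (\<sigma> h))"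

text \<open>The second component is the action of \<Delta>(y) = y \<otimes> g + 1 \<otimes> y, with
  \<open>fst X \<one>\<close> as the action of 1.\<close>

definition ht :: "('a, 'k) am \<Rightarrow> ('a, 'k) am \<Rightarrow> ('a, 'k) am"
  where "ht X Z = (gt (fst X) (fst Z), tp (snd X) (fst Z g) + tp (fst X \<one>) (snd Z))"

lemma gm_gt: "gm \<rho> \<Longrightarrow> gm \<sigma> \<Longrightarrow> gm (gt \<rho> \<sigma>)"
  by (simp add: gm_def gt_def tp_mult finr_tp)

lemma fst_ht: "fst (ht X Z) = gt (fst X) (fst Z)" by (simp add: ht_def)

lemma hm_ht: assumes X: "hm X" and Z: "hm Z" shows "hm (ht X Z)"
proof -
  note gX = hm_gm[OF X] and gZ = hm_gm[OF Z]
  let ?A = "tp (snd X) (fst Z g)" and ?B = "tp (fst X \<one>) (snd Z)"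
  note R = gm_one[OF gX] gm_one[OF gZ] hm_1Y[OF X] hm_1Y[OF Z] hm_Y1[OF X] hm_Y1[OF Z]
    hm_Yh[OF X] hm_Yh[OF Z]
  \<comment> \<open>Since y g = \<chi>(g) g y in the second factor, \<open>?B * ?A\<close> is q
    times \<open>?A * ?B\<close>, and only the pure powers survive. The sum (g^n - 1) \<otimes> g^n
    + 1 \<otimes> (g^n - 1) then telescopes to g^n \<otimes> g^n - 1 \<otimes> 1.\<close>
  have "(?A + ?B) ^ n = ?A ^ n + ?B ^ n"
    by (rule q_binomial_root_of_unity[OF _ q_n q_prim]) (simp_all add: tp_mult R tp_linear)
  also have "\<dots> = fst (ht X Z) (g [^] n) - fst (ht X Z) \<one>"
    by (simp add: tp_power gm_pow_Suc[OF gZ] gm_pow_Suc[OF gX] hm_Yn[OF X] hm_Yn[OF Z] fst_ht gt_def tp_linear)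
  finally have "snd (ht X Z) ^ n = fst (ht X Z) (g [^] n) - fst (ht X Z) \<one>" by (simp add: ht_def)
  moreover have "fst Z g * fst Z h = fst Z h * fst Z g" if "h \<in> carrier G" for h
    using that by (simp add: gm_mult[OF gZ] g_central)
  ultimately show ?thesis
    unfolding hm_def
    by (simp add: gm_gt gX gZ fst_ht) (simp add: ht_def gt_def distrib_left distrib_right tp_mult R tp_linear scl_add)
qed

lemma ghom_gt: "ghom \<rho> \<rho>' T \<Longrightarrow> ghom \<sigma> \<sigma>' S \<Longrightarrow> ghom (gt \<rho> \<sigma>) (gt \<rho>' \<sigma>') (tp T S)"
  by (simp add: ghom_def gt_def tp_mult)

lemma hhom_ht: assumes T: "hhom X X' T" and S: "hhom Z Z' S" shows "hhom (ht X Z) (ht X' Z') (tp T S)"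
  unfolding hhom_def fst_ht
  by (simp add: ghom_gt hhom_ghom[OF T] hhom_ghom[OF S])
    (simp add: ht_def distrib_left distrib_right tp_mult hhom_1[OF T] hhom_1'[OF T] hhom_Y[OF T] hhom_Y[OF S] hhom_h[OF S])

lemma hiso_ht: assumes "hiso X X'" "hiso Z Z'" shows "hiso (ht X Z) (ht X' Z')"
proof -
  from assms obtain T S T' S' where *: "hhom X X' T" "hhom X' X S" "S * T = fst X \<one>" "T * S = fst X' \<one>"
    "hhom Z Z' T'" "hhom Z' Z S'" "S' * T' = fst Z \<one>" "T' * S' = fst Z' \<one>"
    unfolding hiso_def by blast
  show ?thesis
    by (rule hisoI[OF hhom_ht[OF *(1,5)] hhom_ht[OF *(2,6)]]) (simp_all add: fst_ht gt_def tp_mult *)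
qed

lemma hiso_ht_assoc:
  assumes "hm X" "hm Z" "hm W" shows "hiso (ht (ht X Z) W) (ht X (ht Z W))"
  by (rule hiso_bij[OF asc_inv(2,1)])
    (auto simp: fst_ht gt_def asc_tp hm_ht assms, simp add: ht_def gt_def distrib_left distrib_right asc_tp tp_linear)

definition tv :: "('a, 'k) am" where "tv = (\<lambda>h. pr 1, 0)"

lemma pr1_pr1 [simp]: "pr (Suc 0) * pr (Suc 0) = pr (Suc 0)" by (simp add: pr_pr)

lemma hm_tv: "hm tv" by (simp add: hm_def gm_def tv_def finr_pr zero_power)

lemma tp_pr1: "tp (pr (Suc 0)) A * inc 0 = inc 0 * A" "inc 0 * (A * prj 0) = tp (pr (Suc 0)) A"
  by (rule lop_eqI, simp) (rule lop_eqI2, simp add: pt_linear)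

lemma tp_pr1': "tp A (pr (Suc 0)) * (flip * inc 0) = flip * inc 0 * A"
  "flip * (inc 0 * (A * (prj 0 * flip))) = tp A (pr (Suc 0))"
proof -
  show "tp A (pr (Suc 0)) * (flip * inc 0) = flip * inc 0 * A"
    by (simp add: flip_tp[symmetric] tp_pr1 mult.assoc flip: mult.assoc[of "tp A _"])
  have "flip * (inc 0 * (A * (prj 0 * flip))) = flip * (inc 0 * (A * prj 0)) * flip" by (simp add: mult.assoc)
  then show "flip * (inc 0 * (A * (prj 0 * flip))) = tp A (pr (Suc 0))"
    by (simp add: tp_pr1 flip_tp) (simp add: mult.assoc flip_flip)
qed

lemma hiso_tv_ht: assumes X: "hm X" shows "hiso X (ht tv X)"
proof (rule hiso_linI[of _ _ "inc 0 * fst X \<one>" "prj 0"])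
  note R = gm_one[OF hm_gm[OF X]] hm_1Y[OF X] hm_Y1[OF X]
  show "hhom X (ht tv X) (inc 0 * fst X \<one>)"
    unfolding hhom_def ghom_def
    by (auto simp: ht_def gt_def tv_def mult.assoc R mult_assoc_cong[OF tp_pr1(1)] tp_linear)
  show "hm (ht tv X)" by (rule hm_ht[OF hm_tv X])
qed (auto simp: mult.assoc prj_inc_left tp_pr1 fst_ht gt_def tv_def X)

lemma hiso_ht_tv: assumes X: "hm X" shows "hiso X (ht X tv)"
proof (rule hiso_linI[of _ _ "flip * inc 0 * fst X \<one>" "prj 0 * flip"])
  note R = gm_one[OF hm_gm[OF X]] hm_1Y[OF X] hm_Y1[OF X]
  have t: "tp A (pr (Suc 0)) * (flip * (inc 0 * B)) = flip * (inc 0 * (A * B))" for A B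
    using mult_assoc_cong[OF tp_pr1'(1)[of A], of B] by (simp add: mult.assoc)
  show "hhom X (ht X tv) (flip * inc 0 * fst X \<one>)"
    unfolding hhom_def ghom_def
    by (auto simp: ht_def gt_def tv_def mult.assoc R t tp_linear)
  show "hm (ht X tv)" by (rule hm_ht[OF X hm_tv])
qed (auto simp: mult.assoc mult_assoc_cong[OF flip_flip] prj_inc_left tp_pr1' fst_ht gt_def tv_def X)

subsection \<open>Direct sums\<close>

definition ds :: "('a, 'k) am \<Rightarrow> ('a, 'k) am \<Rightarrow> ('a, 'k) am"
  where "ds X Z = (\<lambda>h. inc 0 * (fst X h * prj 0) + inc 1 * (fst Z h * prj 1), inc 0 * (snd X * prj 0) + inc 1 * (snd Z * prj 1))"

lemmas ps = mult.assoc distrib_left distrib_right prj_inc_left prj_inc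

lemma hm_ds: assumes X: "hm X" and Z: "hm Z" shows "hm (ds X Z)"
proof -
  note gX = hm_gm[OF X] and gZ = hm_gm[OF Z]
  have "snd (ds X Z) ^ Suc m = inc 0 * (snd X ^ Suc m * prj 0) + inc 1 * (snd Z ^ Suc m * prj 1)" for m
  proof (induction m)
    case (Suc m) show ?case by (subst power_Suc, subst Suc) (simp add: ds_def ps)
  qed (simp add: ds_def)
  from this[of "n - 1"] have "snd (ds X Z) ^ n = inc 0 * (snd X ^ n * prj 0) + inc 1 * (snd Z ^ n * prj 1)" by simp
  then have "snd (ds X Z) ^ n = fst (ds X Z) (g [^] n) - fst (ds X Z) \<one>"
    by (simp add: hm_Yn[OF X] hm_Yn[OF Z] ds_def left_diff_distrib right_diff_distrib)
  moreover have "gm (fst (ds X Z))"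
    using gX gZ unfolding gm_def
    by (auto simp: ds_def ps mult_assoc_cong[OF gm_mult[OF gX]] mult_assoc_cong[OF gm_mult[OF gZ]]
        intro!: finr_add finr_sandwich)
  moreover note R = hm_1Y[OF X] hm_1Y[OF Z] hm_Y1[OF X] hm_Y1[OF Z] hm_Yh[OF X] hm_Yh[OF Z]
  ultimately show ?thesis
    unfolding hm_def by (auto simp: ds_def ps mult_assoc_cong[OF R(1)] mult_assoc_cong[OF R(2)] mult_assoc_cong[OF R(3)]
        mult_assoc_cong[OF R(4)] mult_assoc_cong[OF R(5)] mult_assoc_cong[OF R(6)] scl_add)
qed

lemma hiso_dsI:
  assumes "hm X" "hm A" "hm B" "hhom A X i1" "hhom B X i2" "hhom X A p1" "hhom X B p2"
    "p1 * i1 = fst A \<one>" "p2 * i2 = fst B \<one>" "p1 * i2 = 0" "p2 * i1 = 0" "i1 * p1 + i2 * p2 = fst X \<one>"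
  shows "hiso X (ds A B)"
proof (rule hiso_linI[of _ _ "inc 0 * p1 + inc 1 * p2" "i1 * prj 0 + i2 * prj 1"])
  show "hhom X (ds A B) (inc 0 * p1 + inc 1 * p2)"
    unfolding hhom_def ghom_def
    by (auto simp: ds_def ps hhom_1[OF assms(6)] hhom_1[OF assms(7)] hhom_h[OF assms(6)] hhom_h[OF assms(7)]
      hhom_Y[OF assms(6)] hhom_Y[OF assms(7)])
  show "(i1 * prj 0 + i2 * prj 1) * (inc 0 * p1 + inc 1 * p2) = fst X \<one>"
    by (simp add: ps assms)
  show "(inc 0 * p1 + inc 1 * p2) * (i1 * prj 0 + i2 * prj 1) = fst (ds A B) \<one>"
    by (simp add: ds_def ps mult_assoc_cong[OF assms(8)] mult_assoc_cong[OF assms(9)] mult_assoc_cong[OF assms(10)] mult_assoc_cong[OF assms(11)])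
qed (use assms hm_ds in auto)

lemma hhom_inc_prj: assumes X: "hm X" and Z: "hm Z"
  shows "hhom X (ds X Z) (inc 0 * fst X \<one>)" "hhom Z (ds X Z) (inc 1 * fst Z \<one>)"
    "hhom (ds X Z) X (fst X \<one> * prj 0)" "hhom (ds X Z) Z (fst Z \<one> * prj 1)"
proof -
  note gX = hm_gm[OF X] and gZ = hm_gm[OF Z]
  note R = hm_1Y[OF X] hm_1Y[OF Z] hm_Y1[OF X] hm_Y1[OF Z]
  note R' = R mult_assoc_cong[OF R(1)] mult_assoc_cong[OF R(2)] mult_assoc_cong[OF R(3)] mult_assoc_cong[OF R(4)]
    gm_one[OF gX] gm_one[OF gZ] mult_assoc_cong[OF gm_one(1)[OF gX]] mult_assoc_cong[OF gm_one(1)[OF gZ]]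
    mult_assoc_cong[OF gm_one(2)[OF gX]] mult_assoc_cong[OF gm_one(2)[OF gZ]]
  show "hhom X (ds X Z) (inc 0 * fst X \<one>)" "hhom Z (ds X Z) (inc 1 * fst Z \<one>)"
    "hhom (ds X Z) X (fst X \<one> * prj 0)" "hhom (ds X Z) Z (fst Z \<one> * prj 1)"
    unfolding hhom_def ghom_def by (auto simp: ds_def ps R')
qed

lemma hiso_ds:
  assumes "hiso X X'" "hiso Z Z'" "hm X" "hm Z" "hm X'" "hm Z'" shows "hiso (ds X Z) (ds X' Z')"
proof -
  from assms obtain T S T' S' where *: "hhom X X' T" "hhom X' X S" "S * T = fst X \<one>" "T * S = fst X' \<one>"
    "hhom Z Z' T'" "hhom Z' Z S'" "S' * T' = fst Z \<one>" "T' * S' = fst Z' \<one>"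
    unfolding hiso_def by blast
  note h = hhom_inc_prj[OF assms(3,4)]
  have i: "hhom X' (ds X Z) (inc 0 * S)" "hhom Z' (ds X Z) (inc 1 * S')" "hhom (ds X Z) X' (T * prj 0)" "hhom (ds X Z) Z' (T' * prj 1)"
    using hhom_comp[OF *(2) h(1)] hhom_comp[OF *(6) h(2)] hhom_comp[OF h(3) *(1)] hhom_comp[OF h(4) *(5)]
    by (simp_all add: mult.assoc hhom_1'[OF *(2)] hhom_1'[OF *(6)] mult_assoc_cong[OF hhom_1[OF *(1)]] mult_assoc_cong[OF hhom_1[OF *(5)]])
  show ?thesis
    by (rule hiso_dsI[OF hm_ds[OF assms(3,4)] assms(5,6) i])
      (simp_all add: ps * mult_assoc_cong[OF *(3)] mult_assoc_cong[OF *(7)] ds_def)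
qed

lemma hiso_ht_ds:
  assumes X: "hm X" and Z: "hm Z" and W: "hm W"
  shows "hiso (ht (ds X Z) W) (ds (ht X W) (ht Z W))" "hiso (ht W (ds X Z)) (ds (ht W X) (ht W Z))"
proof -
  note h = hhom_inc_prj[OF X Z] and w = hhom_id[OF W]
  note s = tp_mult ps gm_one[OF hm_gm[OF X]] gm_one[OF hm_gm[OF Z]] gm_one[OF hm_gm[OF W]] fst_ht gt_def tp_linear
    mult_assoc_cong[OF gm_one(1)[OF hm_gm[OF X]]] mult_assoc_cong[OF gm_one(1)[OF hm_gm[OF Z]]]
  show "hiso (ht (ds X Z) W) (ds (ht X W) (ht Z W))"
    by (rule hiso_dsI[OF hm_ht[OF hm_ds[OF X Z] W] hm_ht[OF X W] hm_ht[OF Z W] hhom_ht[OF h(1) w] hhom_ht[OF h(2) w] hhom_ht[OF h(3) w] hhom_ht[OF h(4) w]])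
      (simp_all add: s, simp add: ds_def tp_linear)
  show "hiso (ht W (ds X Z)) (ds (ht W X) (ht W Z))"
    by (rule hiso_dsI[OF hm_ht[OF W hm_ds[OF X Z]] hm_ht[OF W X] hm_ht[OF W Z] hhom_ht[OF w h(1)] hhom_ht[OF w h(2)] hhom_ht[OF w h(3)] hhom_ht[OF w h(4)]])
      (simp_all add: s, simp add: ds_def tp_linear)
qed

section \<open>Summands cut out by idempotent endomorphisms\<close>

definition restr :: "'k lop \<Rightarrow> ('a, 'k) am \<Rightarrow> ('a, 'k) am"
  where "restr \<epsilon> X = (\<lambda>h. \<epsilon> * fst X h, \<epsilon> * snd X)"

lemma restr:
  assumes X: "hm X" and e: "hhom X X \<epsilon>" "\<epsilon> * \<epsilon> = \<epsilon>"
  shows hm_restr: "hm (restr \<epsilon> X)" and fst_restr: "fst (restr \<epsilon> X) \<one> = \<epsilon>"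
    and hhom_restr: "hhom X (restr \<epsilon> X) \<epsilon>" "hhom (restr \<epsilon> X) X \<epsilon>"
proof -
  note gX = hm_gm[OF X] 
  show 1: "fst (restr \<epsilon> X) \<one> = \<epsilon>" by (simp add: restr_def hhom_1[OF e(1)])
  note ee = mult_assoc_cong[OF e(2)] and Y = hhom_Y[OF e(1)]
  have Y': "snd X * \<epsilon> = \<epsilon> * snd X" "snd X * (\<epsilon> * A) = \<epsilon> * (snd X * A)" for A
    using Y by (simp_all flip: mult.assoc)
  have "snd (restr \<epsilon> X) ^ Suc m = \<epsilon> * snd X ^ Suc m" for m
  proof (induction m)
    case (Suc m) show ?case by (subst power_Suc, subst Suc) (simp add: restr_def mult.assoc Y' ee)
  qed (simp add: restr_def)
  from this[of "n - 1"] have "snd (restr \<epsilon> X) ^ n = \<epsilon> * snd X ^ n" by simp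
  then have "snd (restr \<epsilon> X) ^ n = fst (restr \<epsilon> X) (g [^] n) - fst (restr \<epsilon> X) \<one>"
    by (simp add: hm_Yn[OF X] restr_def right_diff_distrib)
  moreover have h: "fst X h * \<epsilon> = \<epsilon> * fst X h" "fst X h * (\<epsilon> * A) = \<epsilon> * (fst X h * A)" if "h \<in> carrier G" for h A
    using hhom_h[OF e(1) that] by (simp_all flip: mult.assoc)
  moreover have "gm (fst (restr \<epsilon> X))"
    using gX unfolding gm_def
    by (auto simp: restr_def mult.assoc h ee e intro!: finr_mult_left)
  ultimately show "hm (restr \<epsilon> X)"
    unfolding hm_def using hm_1Y[OF X] hm_Y1[OF X] hm_Yh[OF X] by (auto simp: restr_def mult.assoc ee e Y' hhom_1[OF e(1)])
  show "hhom X (restr \<epsilon> X) \<epsilon>" "hhom (restr \<epsilon> X) X \<epsilon>"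
    unfolding hhom_def ghom_def by (auto simp: restr_def mult.assoc ee e h Y' hhom_1[OF e(1)])
qed

lemma hiso_restr:
  assumes X: "hm X" and e: "hhom X X \<epsilon>" "\<epsilon> * \<epsilon> = \<epsilon>"
  shows "hm (restr (fst X \<one> - \<epsilon>) X)" "hiso X (ds (restr \<epsilon> X) (restr (fst X \<one> - \<epsilon>) X))"
proof -
  note r = hhom_1[OF e(1)] hhom_1'[OF e(1)] e(2) gm_one[OF hm_gm[OF X]]
  have e': "hhom X X (fst X \<one> - \<epsilon>)" by (rule hhom_diff[OF hhom_id[OF X] e(1)])
  have e'': "(fst X \<one> - \<epsilon>) * (fst X \<one> - \<epsilon>) = fst X \<one> - \<epsilon>"
    by (simp add: left_diff_distrib right_diff_distrib r)
  show "hm (restr (fst X \<one> - \<epsilon>) X)" by (rule hm_restr[OF X e' e''])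
  show "hiso X (ds (restr \<epsilon> X) (restr (fst X \<one> - \<epsilon>) X))"
    by (rule hiso_dsI[OF X hm_restr[OF X e] hm_restr[OF X e' e''] hhom_restr(2)[OF X e] hhom_restr(2)[OF X e' e'']
       hhom_restr(1)[OF X e] hhom_restr(1)[OF X e' e'']])
     (simp_all add: fst_restr[OF X e] fst_restr[OF X e' e''] r e'' left_diff_distrib right_diff_distrib)
qed

text \<open>F is a split monomorphism with retraction K, so \<open>F * K\<close> is an idempotent
  endomorphism whose image is isomorphic to C. The complement \<open>X'\<close> is the image of the
  complementary idempotent.\<close>

lemma hiso_summand:
  assumes X: "hm X" and C: "hm C" and F: "hhom C X F" and K: "hhom X C K" and KF: "K * F = fst C \<one>"
  obtains X' where "hm X'" "hiso X (ds C X')"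
proof -
  define \<epsilon> where "\<epsilon> = F * K"
  have e: "hhom X X \<epsilon>" unfolding \<epsilon>_def by (rule hhom_comp[OF K F])
  have ee: "\<epsilon> * \<epsilon> = \<epsilon>" by (simp add: \<epsilon>_def mult.assoc mult_assoc_cong[OF KF] hhom_1'[OF K])
  have h: "hm (restr \<epsilon> X)" by (rule hm_restr[OF X e ee])
  have "hiso (restr \<epsilon> X) C"
  proof (rule hisoI)
    show "hhom (restr \<epsilon> X) C K" using hhom_comp[OF hhom_restr(2)[OF X e ee] K]
      by (simp add: \<epsilon>_def mult_assoc_cong[OF KF] hhom_1'[OF K])
    show "hhom C (restr \<epsilon> X) F" using hhom_comp[OF F hhom_restr(1)[OF X e ee]]
      by (simp add: \<epsilon>_def mult.assoc KF hhom_1[OF F])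
    show "F * K = fst (restr \<epsilon> X) \<one>" by (simp add: fst_restr[OF X e ee]) (simp add: \<epsilon>_def)
  qed (rule KF)
  then have "hiso (ds (restr \<epsilon> X) (restr (fst X \<one> - \<epsilon>) X)) (ds C (restr (fst X \<one> - \<epsilon>) X))"
    using hiso_restr[OF X e ee] h C by (intro hiso_ds hiso_refl)
  then show ?thesis using hiso_restr[OF X e ee] that hiso_trans by blast
qed

end

lemma power_absorb: "Y * E = (Y :: 'k::field lop) \<Longrightarrow> 0 < m \<Longrightarrow> Y ^ m * E = Y ^ m"
  by (cases m) (simp_all only: power_Suc2 mult.assoc)

context datum
begin

subsection \<open>Cyclic modules\<close>

text \<open>
  \<open>cyc k \<sigma>\<close> is \<open>\<sigma> \<oplus> x\<sigma> \<oplus> \<dots> \<oplus> x\<^sup>k\<^sup>-\<^sup>1\<sigma>\<close> with \<open>y (x\<^sup>k\<^sup>-\<^sup>1 v) = (g\<^sup>n - 1) v\<close>. For \<open>k = n\<close> this is the module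
  induced from \<open>\<sigma>\<close>; if \<open>g\<^sup>n\<close> acts trivially on \<open>\<sigma>\<close> it is \<open>M(k, \<sigma>)\<close>.
\<close>

definition cyc :: "nat \<Rightarrow> ('a \<Rightarrow> 'k lop) \<Rightarrow> ('a, 'k) am"
  where "cyc k \<sigma> = (\<lambda>h. \<Sum>s<k. scl (inverse (\<chi> h) ^ s) (inc s * (\<sigma> h * prj s)),
    (\<Sum>s<k - 1. inc (Suc s) * (\<sigma> \<one> * prj s)) + inc 0 * ((\<sigma> (g [^] n) - \<sigma> \<one>) * prj (k - 1)))"

text \<open>On the cyclic module y^k acts as g^n - 1. This is the required value of y^n for k = n;
  for k < n the arrow from the last layer to the first has to be zero, that is, g^n acts
  trivially.\<close>

definition cyc_ok :: "nat \<Rightarrow> ('a \<Rightarrow> 'k lop) \<Rightarrow> bool"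
  where "cyc_ok k \<sigma> \<longleftrightarrow> gm \<sigma> \<and> 1 \<le> k \<and> k \<le> n \<and> (k = n \<or> \<sigma> (g [^] n) = \<sigma> \<one>)"

lemma sum_prj_inc: "(\<Sum>s<k. f s * (prj s * inc t)) = (if t < k then f t else 0)"
proof -
  have "(\<Sum>s<k. f s * (prj s * inc t)) = (\<Sum>s<k. if s = t then f t else 0)"
    by (intro sum.cong) (auto simp: prj_inc)
  then show ?thesis by simp
qed

lemma sum_inc_prj: "(\<Sum>s<k. prj t * (inc s * f s)) = (if t < k then f t else 0)"
proof -
  have "(\<Sum>s<k. prj t * (inc s * f s)) = (\<Sum>s<k. if s = t then f t else 0)"
    by (intro sum.cong) (auto simp: prj_inc_left)
  then show ?thesis by simp
qed

lemma row_inc: "(\<Sum>s<k. f s * prj s) * inc t = (if t < k then f t else 0)"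
  by (simp add: sum_distrib_right mult.assoc sum_prj_inc)

lemma col_prj: "prj t * (\<Sum>s<k. inc s * f s) = (if t < k then f t else 0)"
  by (simp add: sum_distrib_left sum_inc_prj)

lemma fst_cyc: "fst (cyc k \<sigma>) h = (\<Sum>s<k. (scl (inverse (\<chi> h) ^ s) (inc s * \<sigma> h)) * prj s)"
  by (simp add: cyc_def mult.assoc)

lemma fst_cyc': "fst (cyc k \<sigma>) h = (\<Sum>s<k. inc s * scl (inverse (\<chi> h) ^ s) (\<sigma> h * prj s))"
  by (simp add: cyc_def mult.assoc)

lemma fst_cyc_inc: "fst (cyc k \<sigma>) h * inc t = (if t < k then scl (inverse (\<chi> h) ^ t) (inc t * \<sigma> h) else 0)"
  unfolding fst_cyc row_inc ..

lemma prj_fst_cyc: "prj t * fst (cyc k \<sigma>) h = (if t < k then scl (inverse (\<chi> h) ^ t) (\<sigma> h * prj t) else 0)"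
  unfolding fst_cyc' col_prj ..

lemma snd_cyc_inc: "1 \<le> k \<Longrightarrow> snd (cyc k \<sigma>) * inc t =
    (if Suc t < k then inc (Suc t) * \<sigma> \<one> else if Suc t = k then inc 0 * (\<sigma> (g [^] n) - \<sigma> \<one>) else 0)"
  using row_inc[of "\<lambda>s. inc (Suc s) * \<sigma> \<one>" "k - 1" t]
  by (auto simp: cyc_def distrib_right mult.assoc prj_inc less_diff_conv)

lemma prj_snd_cyc: "1 \<le> k \<Longrightarrow> prj t * snd (cyc k \<sigma>) =
    (if t = 0 then (\<sigma> (g [^] n) - \<sigma> \<one>) * prj (k - 1) else if t < k then \<sigma> \<one> * prj (t - 1) else 0)"
proof -
  have "(\<Sum>s<k - 1. prj t * (inc (Suc s) * (\<sigma> \<one> * prj s))) = (\<Sum>s<k - 1. if s = t - 1 then (if t = 0 then 0 else \<sigma> \<one> * prj (t - 1)) else 0)"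
    by (intro sum.cong) (auto simp: prj_inc_left)
  then show "1 \<le> k \<Longrightarrow> ?thesis"
    by (auto simp: cyc_def distrib_left sum_distrib_left prj_inc_left)
qed

lemma snd_cyc_pow:
  assumes s: "gm \<sigma>" and k: "1 \<le> k"
  shows "t < k \<Longrightarrow> snd (cyc k \<sigma>) ^ t * (inc 0 * \<sigma> \<one>) = inc t * \<sigma> \<one>"
    and "snd (cyc k \<sigma>) ^ k * (inc 0 * \<sigma> \<one>) = inc 0 * (\<sigma> (g [^] n) - \<sigma> \<one>)"
proof -
  show *: "snd (cyc k \<sigma>) ^ t * (inc 0 * \<sigma> \<one>) = inc t * \<sigma> \<one>" if "t < k" for t
    using that
  proof (induction t)
    case (Suc t)
    have "snd (cyc k \<sigma>) ^ Suc t * (inc 0 * \<sigma> \<one>) = snd (cyc k \<sigma>) * inc t * \<sigma> \<one>"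
      using Suc by (simp add: mult.assoc)
    then show ?case using Suc.prems by (simp add: snd_cyc_inc[OF k] mult.assoc gm_one[OF s])
  qed simp
  have "snd (cyc k \<sigma>) ^ k = snd (cyc k \<sigma>) * snd (cyc k \<sigma>) ^ (k - 1)" using k by (simp flip: power_Suc)
  then have "snd (cyc k \<sigma>) ^ k * (inc 0 * \<sigma> \<one>) = snd (cyc k \<sigma>) * inc (k - 1) * \<sigma> \<one>"
    using *[of "k - 1"] k by (simp add: mult.assoc)
  also have "\<dots> = inc 0 * (\<sigma> (g [^] n) - \<sigma> \<one>)"
    using k by (simp add: snd_cyc_inc[OF k] mult.assoc gm_one[OF s] left_diff_distrib)
  finally show "snd (cyc k \<sigma>) ^ k * (inc 0 * \<sigma> \<one>) = inc 0 * (\<sigma> (g [^] n) - \<sigma> \<one>)" .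
qed

lemma finr_cyc: "gm \<sigma> \<Longrightarrow> finr (fst (cyc k \<sigma>) \<one>)"
  unfolding gm_def by (simp add: cyc_def finr_sum finr_sandwich)

lemma hm_cyc:
  assumes ok: "cyc_ok k \<sigma>"
  shows "hm (cyc k \<sigma>)"
proof -
  let ?r = "fst (cyc k \<sigma>)" and ?Y = "snd (cyc k \<sigma>)"
  have s: "gm \<sigma>" and k: "1 \<le> k" "k \<le> n" and kn: "k = n \<or> \<sigma> (g [^] n) = \<sigma> \<one>"
    using ok by (auto simp: cyc_ok_def)
  have comm: "(\<sigma> (g [^] n) - \<sigma> \<one>) * \<sigma> h = \<sigma> h * (\<sigma> (g [^] n) - \<sigma> \<one>)" if "h \<in> carrier G" for h
    using that by (simp add: left_diff_distrib right_diff_distrib gm_g[OF s] gm_one[OF s])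
  have mult: "?r h * ?r h' = ?r (h \<otimes> h')" if h: "h \<in> carrier G" "h' \<in> carrier G" for h h'
  proof (rule lop_eqI_inc)
    fix t show "?r h * ?r h' * inc t = ?r (h \<otimes> h') * inc t"
      using h by (simp add: mult.assoc fst_cyc_inc mult_assoc_cong[OF fst_cyc_inc] gm_mult[OF s] chi_mult
        power_mult_distrib mult.commute)
  qed
  have Y1: "?Y * ?r \<one> = ?Y"
  proof (rule lop_eqI_inc)
    fix t show "?Y * ?r \<one> * inc t = ?Y * inc t"
      by (simp add: mult.assoc fst_cyc_inc snd_cyc_inc[OF k(1)] mult_assoc_cong[OF snd_cyc_inc[OF k(1)]] gm_one[OF s]
        left_diff_distrib)
  qed
  have Yh: "?Y * ?r h = scl (\<chi> h) (?r h * ?Y)" if h: "h \<in> carrier G" for h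
  proof (rule lop_eqI_inc)
    fix t
    \<comment> \<open>The arrow from the last layer to the first changes the twist from
      \<chi>^-(k-1) to the trivial one, which agrees with y h = \<chi>(h) h y only if \<chi>(h)^k =
      1. A nonzero arrow forces k = n, and \<chi>^n = 1.\<close>
    have "inverse (\<chi> h) ^ (k - 1) = \<chi> h" if "\<sigma> (g [^] n) \<noteq> \<sigma> \<one>"
    proof -
      have "\<chi> h * \<chi> h ^ (k - 1) = 1" using that kn k chi_n[OF h] by (cases k) auto
      then show ?thesis using chi_nz[OF h] by (simp add: power_inverse field_simps)
    qed
    then have *: "Suc t = k \<Longrightarrow> scl (inverse (\<chi> h) ^ t) (inc 0 * (\<sigma> h * (\<sigma> (g [^] n) - \<sigma> \<one>))) = scl (\<chi> h) (inc 0 * (\<sigma> h * (\<sigma> (g [^] n) - \<sigma> \<one>)))"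
      by (cases "\<sigma> (g [^] n) = \<sigma> \<one>") auto
    have **: "\<chi> h * (inverse (\<chi> h) * z) = z" for z using chi_nz[OF h] by simp
    show "?Y * ?r h * inc t = scl (\<chi> h) (?r h * ?Y) * inc t"
      using h k * by (auto simp: ** mult.assoc fst_cyc_inc snd_cyc_inc[OF k(1)] mult_assoc_cong[OF snd_cyc_inc[OF k(1)]] gm_one[OF s]
        mult_assoc_cong[OF fst_cyc_inc] comm)
  qed
  have 1: "?r \<one> * ?Y = ?Y"
    using Yh[OF one_closed] Y1 by simp
  \<comment> \<open>The bottom layer generates the module, and y^n commutes with the powers of y
    that reach the other layers. So the relation for y^n is checked on the bottom layer
    alone.\<close>
  have Yn: "?Y ^ n * (inc 0 * \<sigma> \<one>) = inc 0 * (\<sigma> (g [^] n) - \<sigma> \<one>)"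
  proof (cases "k = n")
    case False
    then have z: "\<sigma> (g [^] n) = \<sigma> \<one>" using kn by simp
    have "?Y ^ n = ?Y ^ (n - k) * ?Y ^ k" using k by (simp flip: power_add)
    then show ?thesis using snd_cyc_pow(2)[OF s k(1)] z by (simp add: mult.assoc)
  qed (use snd_cyc_pow(2)[OF s k(1)] in simp)
  have "?Y ^ n = ?r (g [^] n) - ?r \<one>"
  proof (rule lop_eqI_inc)
    fix t
    have "?Y ^ n * inc t = ?Y ^ n * (?r \<one> * inc t)"
      by (simp add: power_absorb[OF Y1] flip: mult.assoc)
    also have "\<dots> = (?r (g [^] n) - ?r \<one>) * inc t"
    proof (cases "t < k")
      case True
      have "?Y ^ n * (?r \<one> * inc t) = ?Y ^ n * (?Y ^ t * (inc 0 * \<sigma> \<one>))"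
        using True by (simp add: fst_cyc_inc snd_cyc_pow(1)[OF s k(1)])
      also have "\<dots> = ?Y ^ t * (?Y ^ n * (inc 0 * \<sigma> \<one>))" by (simp add: add.commute flip: mult.assoc power_add)
      also have "\<dots> = ?Y ^ t * (inc 0 * \<sigma> \<one>) * (\<sigma> (g [^] n) - \<sigma> \<one>)"
        by (simp add: Yn mult.assoc gm_one[OF s] right_diff_distrib)
      finally show ?thesis
        using True by (simp add: snd_cyc_pow(1)[OF s k(1)] fst_cyc_inc left_diff_distrib right_diff_distrib mult.assoc gm_one[OF s])
    qed (simp add: left_diff_distrib fst_cyc_inc)
    finally show "?Y ^ n * inc t = (?r (g [^] n) - ?r \<one>) * inc t" .
  qed
  then show ?thesis unfolding hm_def gm_def using 1 Y1 Yh mult finr_cyc[OF s] by auto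
qed

text \<open>Frobenius reciprocity: x^s v has to go to y^s (i v). The arrow from the last layer to
  the first is respected for k = n by y^n = g^n - 1 in X, and for k < n because y^k kills the image
  of i.\<close>

lemma hhom_from_cyc:
  assumes X: "hm X" and ok: "cyc_ok k \<sigma>" and i: "ghom \<sigma> (fst X) i"
    and Yk: "k = n \<or> snd X ^ k * i = 0"
  shows "hhom (cyc k \<sigma>) X (\<Sum>s<k. snd X ^ s * i * prj s)" (is "hhom _ _ ?F")
proof -
  have s: "gm \<sigma>" and k: "1 \<le> k" "k \<le> n" and kn: "k = n \<or> \<sigma> (g [^] n) = \<sigma> \<one>"
    using ok by (auto simp: cyc_ok_def)
  define F where "F = ?F"
  have F: "F * inc t = (if t < k then snd X ^ t * i else 0)" for t unfolding F_def by (rule row_inc)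
  note F' = mult_assoc_cong[OF F]
  have ch: "\<chi> h ^ t * inverse (\<chi> h) ^ t = 1" if "h \<in> carrier G" for h t
    using chi_nz[OF that] by (simp flip: power_mult_distrib)
  have hh: "F * fst (cyc k \<sigma>) h = fst X h * F" if h: "h \<in> carrier G" for h
  proof (rule lop_eqI_inc)
    fix t show "F * fst (cyc k \<sigma>) h * inc t = fst X h * F * inc t"
      using hm_Yh_pow[OF X h] by (simp add: mult.assoc fst_cyc_inc F F' ghom_h[OF i h] mult_assoc_cong[OF hm_Yh_pow[OF X h]] ch[OF h] mult.commute)
  qed
  have h1: "F * fst (cyc k \<sigma>) \<one> = F"
    by (rule lop_eqI_inc) (simp add: mult.assoc fst_cyc_inc F F' ghom_1[OF i])
  have Ykk: "snd X ^ k * i = i * (\<sigma> (g [^] n) - \<sigma> \<one>)"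
  proof (cases "k = n")
    case True then show ?thesis
      by (simp add: hm_Yn[OF X] left_diff_distrib right_diff_distrib ghom_h[OF i])
  qed (use Yk kn in simp)
  have "F * snd (cyc k \<sigma>) = snd X * F"
  proof (rule lop_eqI_inc)
    fix t
    have "snd X * (snd X ^ t * i) = snd X ^ Suc t * i" by (simp add: mult.assoc)
    then show "F * snd (cyc k \<sigma>) * inc t = snd X * F * inc t"
      using Ykk k by (cases "Suc t = k") (auto simp: mult.assoc snd_cyc_inc[OF k(1)] mult_assoc_cong[OF F] F ghom_1[OF i] simp del: power_Suc)
  qed
  with hh h1 show ?thesis unfolding F_def[symmetric] by (auto simp: hhom_def ghom_def)
qed

text \<open>The dual universal property: a map into the cyclic module is determined by its
  coefficient \<psi> in the top layer, since the coefficient at x^s of a vector is the top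
  coefficient of y^(k-1-s) applied to it. The weight \<chi>^-(k-1) is the twist of the top
  layer.\<close>

lemma hhom_to_cyc:
  assumes X: "hm X" and ok: "cyc_ok k \<sigma>" and p1: "\<psi> * fst X \<one> = \<psi>"
    and p: "\<And>h. h \<in> carrier G \<Longrightarrow> \<psi> * fst X h = scl (inverse (\<chi> h) ^ (k - 1)) (\<sigma> h * \<psi>)"
    and Yk: "k = n \<or> \<psi> * snd X ^ k = 0"
  shows "hhom X (cyc k \<sigma>) (\<Sum>s<k. inc s * (\<psi> * snd X ^ (k - 1 - s)))" (is "hhom _ _ ?K")
proof -
  have s: "gm \<sigma>" and k: "1 \<le> k" "k \<le> n" and kn: "k = n \<or> \<sigma> (g [^] n) = \<sigma> \<one>"
    using ok by (auto simp: cyc_ok_def)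
  have pY: "\<psi> * snd X ^ m * fst X \<one> = \<psi> * snd X ^ m" for m
    by (simp add: mult.assoc hm_Yh_pow[OF X one_closed] mult_assoc_cong[OF p1])
  have sp: "\<sigma> \<one> * \<psi> = \<psi>" using p[OF one_closed] p1 by simp
  have hh: "?K * fst X h = fst (cyc k \<sigma>) h * ?K" if h: "h \<in> carrier G" for h
  proof -
    have c: "\<chi> h ^ (k - Suc s) * inverse (\<chi> h) ^ (k - Suc 0) = inverse (\<chi> h) ^ s" if "s < k" for s
    proof -
      have "k - Suc 0 = (k - Suc s) + s" using that by simp
      then have "inverse (\<chi> h) ^ (k - Suc 0) = inverse (\<chi> h) ^ (k - Suc s) * inverse (\<chi> h) ^ s"
        by (metis power_add)
      then show ?thesis using chi_nz[OF h] by (simp add: power_inverse)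
    qed
    have "fst (cyc k \<sigma>) h * ?K = (\<Sum>s<k. scl (inverse (\<chi> h) ^ s) (inc s * (\<sigma> h * (\<psi> * snd X ^ (k - 1 - s)))))"
      unfolding cyc_def by (simp add: sum_distrib_right mult.assoc col_prj)
    also have "\<dots> = ?K * fst X h"
      unfolding sum_distrib_right
      using c by (intro sum.cong) (auto simp: mult.assoc hm_Yh_pow[OF X h] mult_assoc_cong[OF p[OF h]])
    finally show ?thesis by simp
  qed
  have h1: "?K * fst X \<one> = ?K"
    by (simp add: sum_distrib_right mult.assoc pY[unfolded mult.assoc])
  have Ykk: "\<psi> * snd X ^ k = (\<sigma> (g [^] n) - \<sigma> \<one>) * \<psi>"
  proof (cases "k = n")
    case True
    have "inverse (\<chi> (g [^] n)) ^ (k - 1) = 1" by simp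
    then show ?thesis using True
      by (simp add: hm_Yn[OF X] left_diff_distrib right_diff_distrib p p1 sp)
  qed (use Yk kn in simp)
  have "?K * snd X = snd (cyc k \<sigma>) * ?K"
  proof -
    have "snd (cyc k \<sigma>) * ?K = (\<Sum>s<k - 1. inc (Suc s) * (\<psi> * snd X ^ (k - 1 - s))) + inc 0 * (\<psi> * snd X ^ k)"
      unfolding cyc_def using k
      by (auto simp: sum_distrib_right mult.assoc col_prj distrib_right mult_assoc_cong[OF sp] Ykk intro!: sum.cong)
    also have "\<dots> = (\<Sum>s<k. inc s * (\<psi> * snd X ^ (k - s)))"
    proof -
      obtain k' where "k = Suc k'" using k by (cases k) auto
      then show ?thesis by (simp only: sum.lessThan_Suc_shift) simp
    qed
    also have "\<dots> = ?K * snd X"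
    proof -
      have "snd X ^ (k - s) = snd X ^ (k - 1 - s) * snd X" if "s < k" for s
        using that by (metis Suc_diff_Suc diff_diff_left plus_1_eq_Suc power_Suc2)
      then show ?thesis unfolding sum_distrib_right by (intro sum.cong) (auto simp: mult.assoc)
    qed
    finally show ?thesis by simp
  qed
  with hh h1 show ?thesis by (auto simp: hhom_def ghom_def)
qed

lemma hiso_cyc:
  assumes ok: "cyc_ok k \<sigma>" "cyc_ok k \<tau>" and T: "ghom \<sigma> \<tau> T" "ghom \<tau> \<sigma> S" "S * T = \<sigma> \<one>" "T * S = \<tau> \<one>"
  shows "hiso (cyc k \<sigma>) (cyc k \<tau>)"
proof -
  have hom: "hhom (cyc k \<sigma>) (cyc k \<tau>) (\<Sum>s<k. inc s * T * prj s)"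
    if ok: "cyc_ok k \<sigma>" "cyc_ok k \<tau>" and T: "ghom \<sigma> \<tau> T" for \<sigma> \<tau> T
  proof -
    have s: "gm \<tau>" and k: "1 \<le> k" "k \<le> n" and kn: "k = n \<or> \<tau> (g [^] n) = \<tau> \<one>"
      using ok by (auto simp: cyc_ok_def)
    have T1: "inc 0 * \<tau> \<one> * T = inc 0 * T" "inc s * \<tau> \<one> * T = inc s * T" for s
      using ghom_1'[OF T] by (simp_all add: mult.assoc)
    have 1: "ghom \<sigma> (fst (cyc k \<tau>)) (inc 0 * T)"
      using k by (auto simp: ghom_def mult.assoc ghom_1[OF T] ghom_h[OF T] mult_assoc_cong[OF fst_cyc_inc])
    have "k = n \<or> snd (cyc k \<tau>) ^ k * (inc 0 * T) = 0"
      using kn mult_assoc_cong[OF snd_cyc_pow(2)[OF s k(1)], of T] T1 by (auto simp: mult.assoc)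
    note hhom_from_cyc[OF hm_cyc[OF ok(2)] ok(1) 1 this]
    moreover have "snd (cyc k \<tau>) ^ s * (inc 0 * T) = inc s * T" if "s < k" for s
      using mult_assoc_cong[OF snd_cyc_pow(1)[OF s k(1) that], of T] T1 by (simp add: mult.assoc)
    ultimately show ?thesis by simp
  qed
  show ?thesis
  proof (rule hisoI[OF hom[OF ok T(1)] hom[OF ok(2,1) T(2)]])
    have "(\<Sum>s<k. inc s * A * prj s) * (\<Sum>s<k. inc s * B * prj s) = fst (cyc k \<rho>) \<one>"
      if "A * B = \<rho> \<one>" for A B \<rho>
    proof (rule lop_eqI_inc)
      fix t
      show "(\<Sum>s<k. inc s * A * prj s) * (\<Sum>s<k. inc s * B * prj s) * inc t = fst (cyc k \<rho>) \<one> * inc t"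
        by (simp only: mult.assoc[of "sum _ _"] row_inc fst_cyc_inc)
          (auto simp: mult.assoc[of "inc t"] that row_inc simp flip: mult.assoc[of _ "inc t"])
    qed
    from this[of S T \<sigma>, OF T(3)] this[of T S \<tau>, OF T(4)]
    show "(\<Sum>s<k. inc s * S * prj s) * (\<Sum>s<k. inc s * T * prj s) = fst (cyc k \<sigma>) \<one>"
      "(\<Sum>s<k. inc s * T * prj s) * (\<Sum>s<k. inc s * S * prj s) = fst (cyc k \<tau>) \<one>" .
  qed
qed

end

text \<open>The geometric series inverts 1 + L, and multiplication by E turns this into an inverse
  in the corner ring with unit E.\<close>

lemma unipotent_inverse:
  fixes L :: "'k::field lop"
  assumes "E * E = E" "L * E = L" "E * L = L" "L ^ m = 0"
  obtains N where "(E + L) * N = E" "N * (E + L) = E"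
proof
  define W where "W = (\<Sum>i<m. (- L) ^ i)"
  have "(1 + L) * (\<Sum>i<m. (- L) ^ i) = 1 - (- L) ^ m" "(\<Sum>i<m. (- L) ^ i) * (1 + L) = 1 - (- L) ^ m" for m
    by (induction m) (auto simp: algebra_simps power_commuting_commutes[of "- L" L])
  moreover have "(- L) ^ m = 0" using assms(4) by (simp add: power_minus[of L])
  ultimately have W: "(1 + L) * W = 1" "W * (1 + L) = 1" by (auto simp: W_def)
  have "(E + L) * (E * W) = E * ((1 + L) * W)" using assms by (simp add: distrib_left distrib_right flip: mult.assoc)
  then show "(E + L) * (E * W) = E" by (simp add: W)
  have "E * W * (E + L) = E * (W * (1 + L)) * E" using assms by (simp add: distrib_left distrib_right mult.assoc)
  then show "E * W * (E + L) = E" by (simp add: W assms)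
qed

section \<open>Tensor products with induced modules\<close>

context datum
begin

lemma cyc_ok_n: "gm \<sigma> \<Longrightarrow> cyc_ok n \<sigma>"
  using n2 by (simp add: cyc_ok_def)

text \<open>Criterion for X to be induced from \<sigma>. The \<open>P t\<close> are coordinates on X
  with values in \<sigma>, the \<open>Q t\<close> reassemble a vector from them, and y moves
  coordinate t - 1 to t up to a diagonal term \<open>A t\<close>. In these coordinates x^s v -> y^s
  (j v) is unitriangular, hence invertible.\<close>

lemma hiso_cyc_n:
  assumes X: "hm X" and U: "gm \<sigma>" and j: "ghom \<sigma> (fst X) j"
    and Pj: "P 0 * j = \<sigma> \<one>" "\<And>t. 0 < t \<Longrightarrow> t < n \<Longrightarrow> P t * j = 0"
    and PY: "\<And>t. 0 < t \<Longrightarrow> t < n \<Longrightarrow> P t * snd X = A t * P t + P (t - 1)"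
    and P: "\<And>t. \<sigma> \<one> * P t = P t"
    and QP: "(\<Sum>t<n. Q t * P t) = fst X \<one>"
  shows "hiso (cyc n \<sigma>) X"
proof -
  note ok = cyc_ok_n[OF U]
  let ?Y = "snd X" and ?E = "fst (cyc n \<sigma>) \<one>"
  \<comment> \<open>Each factor y raises the highest nonzero coordinate by at most one, with leading
    coefficient preserved.\<close>
  have tri: "(s < t \<longrightarrow> P t * (?Y ^ s * j) = 0) \<and> (s = t \<longrightarrow> P t * (?Y ^ s * j) = \<sigma> \<one>)" if "t < n" for s t
    using that
  proof (induction s arbitrary: t)
    case 0 then show ?case using Pj by (cases "t = 0") auto
  next
    case (Suc s)
    show ?case
    proof (cases "Suc s \<le> t")
      case True
      have "P t * (?Y ^ Suc s * j) = A t * (P t * (?Y ^ s * j)) + P (t - 1) * (?Y ^ s * j)"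
        using PY[of t] True Suc.prems by (simp add: mult.assoc[symmetric]) (simp add: mult.assoc distrib_right)
      then show ?thesis using Suc.IH[of t] Suc.IH[of "t - 1"] Suc.prems True by auto
    qed simp
  qed
  define F where "F = (\<Sum>s<n. ?Y ^ s * j * prj s)"
  have F: "hhom (cyc n \<sigma>) X F" unfolding F_def by (rule hhom_from_cyc[OF X ok j]) simp
  define M where "M = (\<Sum>t<n. inc t * P t)"
  have EM: "?E * M = M"
    by (simp add: M_def sum_distrib_left flip: mult.assoc) (simp add: fst_cyc_inc mult.assoc P)
  \<comment> \<open>The strictly triangular part of \<open>M * F\<close>: it sends layer s into the
    layers t < s, so its n-th power is zero.\<close>
  define L where "L = M * F - ?E"
  have EE: "?E * ?E = ?E" using gm_one[OF hm_gm[OF hm_cyc[OF ok]]] by simp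
  have EL: "?E * L = L" using EM EE by (simp add: L_def right_diff_distrib flip: mult.assoc)
  have LE: "L * ?E = L" using hhom_1[OF F] EE by (simp add: L_def left_diff_distrib mult.assoc)
  have Linc: "L * inc s = (\<Sum>t<s. inc t * (P t * (?Y ^ s * j)))" if "s < n" for s
  proof -
    have "M * (F * inc s) = (\<Sum>t<n. inc t * (P t * (?Y ^ s * j)))"
      using that unfolding F_def row_inc by (simp add: M_def sum_distrib_right mult.assoc)
    also have "\<dots> = (\<Sum>t<Suc s. inc t * (P t * (?Y ^ s * j)))"
      using that tri by (intro sum.mono_neutral_right) auto
    finally show ?thesis using that tri[of s s] by (simp add: L_def left_diff_distrib mult.assoc fst_cyc_inc)
  qed
  have Lm: "L ^ m * inc s = 0" if "s < m" "s < n" for m s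
    using that
  proof (induction m arbitrary: s)
    case (Suc m)
    have "L ^ Suc m * inc s = L ^ m * (L * inc s)" by (simp only: power_Suc2 mult.assoc)
    also have "\<dots> = (\<Sum>t<s. L ^ m * inc t * (P t * (?Y ^ s * j)))"
      using Suc.prems by (simp add: Linc sum_distrib_left mult.assoc)
    also have "\<dots> = 0" using Suc by (intro sum.neutral) auto
    finally show ?case .
  qed simp
  have "L ^ n = 0"
  proof (rule lop_eqI_inc)
    fix s show "L ^ n * inc s = 0 * inc s"
    proof (cases "s < n")
      case False
      have "L ^ n * inc s = L ^ n * (?E * inc s)" by (simp add: power_absorb[OF LE] flip: mult.assoc)
      then show ?thesis using False by (simp add: fst_cyc_inc)
    qed (simp add: Lm)
  qed
  from unipotent_inverse[OF EE LE EL this] obtain N where N: "(M * F) * N = ?E" "N * (M * F) = ?E"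
    unfolding L_def by auto
  \<comment> \<open>\<open>M'\<close> is a left inverse of M. It turns the inverse of
    \<open>M * F\<close> into a two-sided inverse of F.\<close>
  define M' where "M' = (\<Sum>t<n. Q t * prj t)"
  have MM: "M' * M = fst X \<one>"
    unfolding M_def M'_def sum_distrib_left by (simp add: mult.assoc[symmetric] row_inc) (simp add: QP)
  show ?thesis
  proof (rule hiso_linI[OF F _ _ hm_cyc[OF ok] X, of "N * M"])
    show "N * M * F = ?E" using N by (simp add: mult.assoc)
    have "F * (N * M) = M' * ((M * F * N) * M)" using MM hhom_1'[OF F] by (simp flip: mult.assoc)
    then show "F * (N * M) = fst X \<one>" by (simp only: N EM MM)
  qed
qed

text \<open>In \<Delta>(y) = y \<otimes> g + 1 \<otimes> y the second summand shifts the layers X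
  \<otimes> x^t \<sigma>. The first one preserves them, and \<chi>(g)^-t in the diagonal term is the
  twist of g on layer t.\<close>

lemma hiso_ht_ind:
  assumes X: "hm X" and U: "gm \<sigma>"
  shows "hiso (cyc n (gt (fst X) \<sigma>)) (ht X (cyc n \<sigma>))"
proof -
  note gX = hm_gm[OF X] and C = hm_cyc[OF cyc_ok_n[OF U]]
  note s = fst_ht gt_def tp_mult mult.assoc gm_one[OF gX] gm_one[OF U] tp_linear
  show ?thesis
  proof (rule hiso_cyc_n[OF hm_ht[OF X C] gm_gt[OF gX U],
      where j = "tp (fst X \<one>) (inc 0 * \<sigma> \<one>)" and P = "\<lambda>t. tp (fst X \<one>) (\<sigma> \<one> * prj t)"
      and Q = "\<lambda>t. tp (fst X \<one>) (inc t * \<sigma> \<one>)" and A = "\<lambda>t. scl (inverse (\<chi> g) ^ t) (tp (snd X) (\<sigma> g))"])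
    show "ghom (gt (fst X) \<sigma>) (fst (ht X (cyc n \<sigma>))) (tp (fst X \<one>) (inc 0 * \<sigma> \<one>))"
      unfolding ghom_def by (auto simp: s mult_assoc_cong[OF fst_cyc_inc])
    show "tp (fst X \<one>) (\<sigma> \<one> * prj 0) * tp (fst X \<one>) (inc 0 * \<sigma> \<one>) = gt (fst X) \<sigma> \<one>"
      by (simp add: s prj_inc_left)
    show "tp (fst X \<one>) (\<sigma> \<one> * prj t) * tp (fst X \<one>) (inc 0 * \<sigma> \<one>) = 0" if "0 < t" for t
      using that by (simp add: s prj_inc_left)
    show "tp (fst X \<one>) (\<sigma> \<one> * prj t) * snd (ht X (cyc n \<sigma>)) =
       scl (inverse (\<chi> g) ^ t) (tp (snd X) (\<sigma> g)) * tp (fst X \<one>) (\<sigma> \<one> * prj t) + tp (fst X \<one>) (\<sigma> \<one> * prj (t - 1))"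
      if "0 < t" "t < n" for t
      using that by (simp add: ht_def distrib_left s hm_1Y[OF X] hm_Y1[OF X] prj_fst_cyc prj_snd_cyc
          mult_assoc_cong[OF gm_one(1)[OF U]] mult_assoc_cong[OF gm_one(2)[OF U]])
    show "gt (fst X) \<sigma> \<one> * tp (fst X \<one>) (\<sigma> \<one> * prj t) = tp (fst X \<one>) (\<sigma> \<one> * prj t)" for t
      by (simp add: s mult_assoc_cong[OF gm_one(1)[OF U]])
    show "(\<Sum>t<n. tp (fst X \<one>) (inc t * \<sigma> \<one>) * tp (fst X \<one>) (\<sigma> \<one> * prj t)) = fst (ht X (cyc n \<sigma>)) \<one>"
      by (simp add: s mult_assoc_cong[OF gm_one(1)[OF U]] cyc_def flip: tp_sum)
  qed
qed

text \<open>Here y \<otimes> g shifts the layers and applies g to the second factor. The coordinate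
  at x^t therefore carries g^-t, which cancels the accumulated factors of g; moving y past g^-t
  produces \<chi>(g)^t in the diagonal term.\<close>

lemma hiso_ind_ht:
  assumes X: "hm X" and U: "gm \<sigma>"
  shows "hiso (cyc n (gt \<sigma> (fst X))) (ht (cyc n \<sigma>) X)"
proof -
  note gX = hm_gm[OF X] and C = hm_cyc[OF cyc_ok_n[OF U]]
  note s = fst_ht gt_def tp_mult mult.assoc gm_one[OF gX] gm_one[OF U] tp_linear
  let ?i = "\<lambda>t::nat. fst X (inv g [^] t)"
  have ig: "inv g [^] t \<otimes> g [^] t = \<one>" for t :: nat
  proof (induction t)
    case (Suc t)
    have "inv g [^] Suc t \<otimes> g [^] Suc t = inv g [^] t \<otimes> (inv g \<otimes> (g \<otimes> g [^] t))"
      by (simp add: m_assoc g_central)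
    also have "inv g \<otimes> (g \<otimes> g [^] t) = g [^] t" by (simp flip: m_assoc)
    finally show ?case using Suc by simp
  qed simp
  have ic: "inv g [^] t \<otimes> h = h \<otimes> inv g [^] t" if "h \<in> carrier G" for t :: nat and h
  proof -
    have "inv g [^] t \<otimes> h = inv g [^] t \<otimes> (h \<otimes> (g [^] t \<otimes> inv g [^] t))"
      using that gpow_central[of "inv g [^] t" t] ig[of t] by simp
    also have "\<dots> = (inv g [^] t \<otimes> g [^] t) \<otimes> (h \<otimes> inv g [^] t)"
      using that gpow_central[OF that, of t] by (simp add: m_assoc) (simp flip: m_assoc)
    finally show ?thesis using that by (simp add: ig)
  qed
  have i1: "?i t * fst X g = ?i (t - 1)" if t: "0 < t" for t
  proof -
    obtain k where k: "t = Suc k" using t by (cases t) auto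
    have "inv g [^] t \<otimes> g = inv g [^] k" by (simp add: k m_assoc)
    then show ?thesis by (simp add: gm_mult[OF gX] k)
  qed
  have iY: "?i t * snd X = scl (\<chi> g ^ t) (snd X * ?i t)" for t
    by (simp add: hm_Yh[OF X] chi_pow chi_inv chi_nz flip: power_mult_distrib)
  show ?thesis
  proof (rule hiso_cyc_n[OF hm_ht[OF C X] gm_gt[OF U gX],
      where j = "tp (inc 0 * \<sigma> \<one>) (fst X \<one>)" and P = "\<lambda>t. tp (\<sigma> \<one> * prj t) (?i t)"
      and Q = "\<lambda>t. tp (inc t * \<sigma> \<one>) (fst X (g [^] t))" and A = "\<lambda>t. scl (\<chi> g ^ t) (tp (\<sigma> \<one>) (snd X))"])
    show "ghom (gt \<sigma> (fst X)) (fst (ht (cyc n \<sigma>) X)) (tp (inc 0 * \<sigma> \<one>) (fst X \<one>))"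
      unfolding ghom_def by (auto simp: s mult_assoc_cong[OF fst_cyc_inc])
    show "tp (\<sigma> \<one> * prj 0) (?i 0) * tp (inc 0 * \<sigma> \<one>) (fst X \<one>) = gt \<sigma> (fst X) \<one>"
      by (simp add: s prj_inc_left)
    show "tp (\<sigma> \<one> * prj t) (?i t) * tp (inc 0 * \<sigma> \<one>) (fst X \<one>) = 0" if "0 < t" for t
      using that by (simp add: s prj_inc_left)
    show "tp (\<sigma> \<one> * prj t) (?i t) * snd (ht (cyc n \<sigma>) X) =
       scl (\<chi> g ^ t) (tp (\<sigma> \<one>) (snd X)) * tp (\<sigma> \<one> * prj t) (?i t) + tp (\<sigma> \<one> * prj (t - 1)) (?i (t - 1))"
      if "0 < t" "t < n" for t
      using that i1 iY by (simp add: ht_def distrib_left s prj_fst_cyc prj_snd_cyc mult_assoc_cong[OF gm_one(1)[OF U]])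
    show "gt \<sigma> (fst X) \<one> * tp (\<sigma> \<one> * prj t) (?i t) = tp (\<sigma> \<one> * prj t) (?i t)" for t
      by (simp add: s mult_assoc_cong[OF gm_one(1)[OF U]])
    have gi: "fst X (g [^] t) * ?i t = fst X \<one>" for t :: nat
      using ig[of t] ic[of "g [^] t" t] by (simp add: gm_mult[OF gX])
    show "(\<Sum>t<n. tp (inc t * \<sigma> \<one>) (fst X (g [^] t)) * tp (\<sigma> \<one> * prj t) (?i t)) = fst (ht (cyc n \<sigma>) X) \<one>"
      by (simp add: s gi mult_assoc_cong[OF gm_one(1)[OF U]] cyc_def flip: tp_sum)
  qed
qed

lemma ghom_flip:
  assumes "gm \<rho>" "gm \<sigma>"
  shows "ghom (gt \<rho> \<sigma>) (gt \<sigma> \<rho>) (flip * gt \<rho> \<sigma> \<one>)" "flip * gt \<sigma> \<rho> \<one> * (flip * gt \<rho> \<sigma> \<one>) = gt \<rho> \<sigma> \<one>"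
proof -
  have f: "tp B C * (flip * A) = flip * (tp C B * A)" for A B C :: "'k lop"
    by (simp add: flip_tp flip: mult.assoc)
  show "ghom (gt \<rho> \<sigma>) (gt \<sigma> \<rho>) (flip * gt \<rho> \<sigma> \<one>)"
    unfolding ghom_def by (auto simp: gt_def mult.assoc f tp_mult gm_one[OF assms(1)] gm_one[OF assms(2)])
  show "flip * gt \<sigma> \<rho> \<one> * (flip * gt \<rho> \<sigma> \<one>) = gt \<rho> \<sigma> \<one>"
    by (simp add: gt_def mult.assoc f mult_assoc_cong[OF flip_flip] tp_mult gm_one[OF assms(1)] gm_one[OF assms(2)])
qed

text \<open>Both products are induced from tensor products of G-modules, and on those the flip is an
  isomorphism.\<close>

lemma hiso_ind_comm:
  assumes X: "hm X" and U: "gm \<sigma>"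
  shows "hiso (ht (cyc n \<sigma>) X) (ht X (cyc n \<sigma>))"
proof -
  note gX = hm_gm[OF X]
  have "hiso (cyc n (gt \<sigma> (fst X))) (cyc n (gt (fst X) \<sigma>))"
    by (rule hiso_cyc[OF cyc_ok_n cyc_ok_n ghom_flip(1) ghom_flip(1)])
      (simp_all add: gm_gt gX U ghom_flip(2))
  then show ?thesis by (rule hiso_trans[OF hiso_sym[OF hiso_ind_ht[OF X U]] hiso_trans[OF _ hiso_ht_ind[OF X U]]])
qed

subsection \<open>Averaging over the group\<close>

text \<open>For a multiplicative weight c the average intertwines \<rho> with \<sigma> twisted by c.
  The weight 1 gives G-maps, and \<chi>^-(k-1) gives the maps to a top layer that
  \<open>hhom_to_cyc\<close> takes as input.\<close>

definition avg :: "('a \<Rightarrow> 'k) \<Rightarrow> ('a \<Rightarrow> 'k lop) \<Rightarrow> ('a \<Rightarrow> 'k lop) \<Rightarrow> 'k lop \<Rightarrow> 'k lop"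
  where "avg c \<rho> \<sigma> T = scl (inverse (of_nat (card (carrier G)))) (\<Sum>h\<in>carrier G. scl (c h) (\<sigma> h * (T * \<rho> (inv h))))"

lemma avg_equivariant:
  assumes \<rho>: "gm \<rho>" and \<sigma>: "gm \<sigma>" and c: "\<And>h h'. h \<in> carrier G \<Longrightarrow> h' \<in> carrier G \<Longrightarrow> c (h \<otimes> h') = c h * c h'"
    and k: "k \<in> carrier G"
  shows "avg c \<rho> \<sigma> T * \<rho> k = scl (c k) (\<sigma> k * avg c \<rho> \<sigma> T)"
proof -
  have "(\<Sum>h\<in>carrier G. scl (c h) (\<sigma> h * (T * \<rho> (inv h)))) * \<rho> k
      = (\<Sum>h\<in>carrier G. scl (c h) (\<sigma> h * (T * \<rho> (inv h \<otimes> k))))"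
    using k by (auto simp: sum_distrib_right mult.assoc gm_mult[OF \<rho>] intro!: sum.cong)
  also have "\<dots> = (\<Sum>h\<in>(\<lambda>h. k \<otimes> h) ` carrier G. scl (c h) (\<sigma> h * (T * \<rho> (inv h \<otimes> k))))"
    using surj_const_mult[OF k] by simp
  also have "\<dots> = (\<Sum>h\<in>carrier G. scl (c (k \<otimes> h)) (\<sigma> (k \<otimes> h) * (T * \<rho> (inv (k \<otimes> h) \<otimes> k))))"
    by (rule sum.reindex[OF inj_on_cmult[OF k], unfolded comp_def])
  also have "\<dots> = scl (c k) (\<sigma> k * (\<Sum>h\<in>carrier G. scl (c h) (\<sigma> h * (T * \<rho> (inv h)))))"
    using k by (auto simp: sum_distrib_left scl_sum c inv_mult_group m_assoc mult_assoc_cong[OF gm_mult[OF \<sigma> k]] intro!: sum.cong)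
  finally show ?thesis by (simp add: avg_def mult.commute)
qed

lemma avg_1: "gm \<sigma> \<Longrightarrow> \<sigma> \<one> * avg c \<rho> \<sigma> T = avg c \<rho> \<sigma> T" "gm \<rho> \<Longrightarrow> avg c \<rho> \<sigma> T * \<rho> \<one> = avg c \<rho> \<sigma> T"
proof -
  assume "gm \<sigma>"
  note mult_assoc_cong[OF gm_one(1)[OF this]]
  then show "\<sigma> \<one> * avg c \<rho> \<sigma> T = avg c \<rho> \<sigma> T" by (simp add: avg_def sum_distrib_left)
next
  assume "gm \<rho>"
  note gm_one(2)[OF this]
  then show "avg c \<rho> \<sigma> T * \<rho> \<one> = avg c \<rho> \<sigma> T" by (simp add: avg_def sum_distrib_right mult.assoc)
qed

lemma avg_const:
  assumes "\<And>h. h \<in> carrier G \<Longrightarrow> scl (c h) (A * (\<sigma> h * (T * (\<rho> (inv h) * B)))) = C"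
  shows "A * avg c \<rho> \<sigma> T * B = C"
proof -
  have "A * avg c \<rho> \<sigma> T * B = scl (inverse (of_nat (card (carrier G)))) (\<Sum>h\<in>carrier G. C)"
    using assms by (auto simp: avg_def sum_distrib_left sum_distrib_right mult.assoc intro!: arg_cong[of _ _ "scl _"] sum.cong)
  also have "(\<Sum>h\<in>carrier G. C) = scl (of_nat (card (carrier G))) C"
  proof -
    have "of_nat m * C = scl (of_nat m) C" for m :: nat
      by (induction m) (simp_all add: scl_add_left distrib_right)
    then show ?thesis by simp
  qed
  moreover have "(of_nat (card (carrier G)) :: 'k) \<noteq> 0" using fin one_closed by auto
  ultimately show ?thesis by simp
qed

text \<open>A map out of an induced module is determined by its restriction j to the bottom layer.
  Since r is only linear, so is the lift \<open>r * j\<close>; averaging makes it G-equivariant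
  without changing its image under p, and Frobenius reciprocity extends it.\<close>

lemma ind_lift:
  assumes A: "hm A" and B: "hm B" and U: "gm \<sigma>" and p: "hhom A B p" and r: "p * r = fst B \<one>" and f: "hhom (cyc n \<sigma>) B f"
  obtains f' where "hhom (cyc n \<sigma>) A f'" "p * f' = f"
proof
  note gA = hm_gm[OF A] and gB = hm_gm[OF B] and C = hm_cyc[OF cyc_ok_n[OF U]]
  define j where "j = f * (inc 0 * \<sigma> \<one>)"
  have j: "j * \<sigma> \<one> = j" "j * \<sigma> h = fst B h * j" "fst B \<one> * j = j" if h: "h \<in> carrier G" for h
  proof -
    show "j * \<sigma> \<one> = j" by (simp add: j_def mult.assoc gm_one[OF U])
    have "fst B h * j = f * fst (cyc n \<sigma>) h * (inc 0 * \<sigma> \<one>)"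
      unfolding j_def hhom_h[OF f h] mult.assoc ..
    then show "j * \<sigma> h = fst B h * j"
      by (simp add: j_def mult.assoc mult_assoc_cong[OF fst_cyc_inc] gm_one[OF U] h)
    show "fst B \<one> * j = j" unfolding j_def mult_assoc_cong[OF hhom_1'[OF f]] ..
  qed
  define i where "i = avg (\<lambda>_. 1) \<sigma> (fst A) (r * j)"
  have i: "ghom \<sigma> (fst A) i"
    using avg_equivariant[OF U gA, of "\<lambda>_. 1"] avg_1(2)[OF U] by (simp add: ghom_def i_def)
  have "p * i * 1 = j"
    unfolding i_def
  proof (rule avg_const)
    fix h assume h: "h \<in> carrier G"
    have "p * (fst A h * (r * j * (\<sigma> (inv h) * 1))) = fst B h * (p * r) * (j * \<sigma> (inv h))"
      using hhom_h[OF p h] by (simp flip: mult.assoc)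
    then show "scl 1 (p * (fst A h * (r * j * (\<sigma> (inv h) * 1)))) = j"
      using h j(3)[OF h] by (simp add: r j(2) mult.assoc gm_one[OF gB] mult_assoc_cong[OF gm_inv(1)[OF gB]])
  qed
  then have pi: "p * i = j" by simp
  show "hhom (cyc n \<sigma>) A (\<Sum>s<n. snd A ^ s * i * prj s)"
    by (rule hhom_from_cyc[OF A cyc_ok_n[OF U] i]) simp
  show "p * (\<Sum>s<n. snd A ^ s * i * prj s) = f"
  proof (rule lop_eqI_inc)
    fix t
    have "f * inc t = f * (fst (cyc n \<sigma>) \<one> * inc t)" using hhom_1[OF f] by (simp flip: mult.assoc)
    also have "\<dots> = (if t < n then snd B ^ t * j else 0)"
      using snd_cyc_pow(1)[OF U, of n t, symmetric] mult_assoc_cong[OF hhom_Y_pow[OF f]] by (simp add: fst_cyc_inc j_def mult.assoc)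
    also have "\<dots> = p * (if t < n then snd A ^ t * i else 0)"
      using mult_assoc_cong[OF hhom_Y_pow[OF p], of t i] pi by (simp add: mult.assoc)
    finally show "p * (\<Sum>s<n. snd A ^ s * i * prj s) * inc t = f * inc t"
      by (simp only: mult.assoc[of p] row_inc)
  qed
qed

subsection \<open>Tensor products of cyclic modules\<close>

text \<open>The \<open>G\<close>-module \<open>\<rho>\<close> with \<open>y\<close> acting as zero.\<close>

definition vz :: "('a \<Rightarrow> 'k lop) \<Rightarrow> ('a, 'k) am" where "vz \<rho> = (\<rho>, 0)"

lemma hm_vz: "gm \<rho> \<Longrightarrow> \<rho> (g [^] n) = \<rho> \<one> \<Longrightarrow> hm (vz \<rho>)"
  by (simp add: hm_def vz_def zero_power)

lemma fst_vz [simp]: "fst (vz \<rho>) = \<rho>" by (simp add: vz_def)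

lemma gm_one_pow: "gm \<rho> \<Longrightarrow> \<rho> \<one> ^ s * \<rho> \<one> = \<rho> \<one>"
  using gm_pow[of \<rho> \<one> s] by simp

lemma cyc_ok_gt:
  assumes "gm \<rho>" "\<rho> (g [^] n) = \<rho> \<one>" "cyc_ok k \<sigma>"
  shows "cyc_ok k (gt \<rho> \<sigma>)" "cyc_ok k (gt \<sigma> \<rho>)"
  using assms by (simp_all add: cyc_ok_def gm_gt) (auto simp: gt_def)

text \<open>Since y is zero on the left factor, it acts on the product through the right factor
  alone, and \<rho> is carried along unchanged.\<close>

lemma hiso_vz_cyc:
  assumes r: "gm \<rho>" "\<rho> (g [^] n) = \<rho> \<one>" and ok: "cyc_ok k \<sigma>"
  shows "hiso (cyc k (gt \<rho> \<sigma>)) (ht (vz \<rho>) (cyc k \<sigma>))"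
proof -
  have s: "gm \<sigma>" and k: "1 \<le> k" "k \<le> n" and kn: "k = n \<or> \<sigma> (g [^] n) = \<sigma> \<one>"
    using ok by (auto simp: cyc_ok_def)
  let ?X = "ht (vz \<rho>) (cyc k \<sigma>)"
  have X: "hm ?X" by (intro hm_ht hm_vz hm_cyc r ok)
  define i where "i = tp (\<rho> \<one>) (inc 0 * \<sigma> \<one>)"
  note n = fst_ht gt_def tp_mult mult.assoc gm_one[OF r(1)] gm_one[OF s] tp_linear
  have i: "ghom (gt \<rho> \<sigma>) (fst ?X) i"
    using k unfolding ghom_def by (auto simp: n i_def mult_assoc_cong[OF fst_cyc_inc])
  have Y: "snd ?X ^ t * i = tp (\<rho> \<one>) (snd (cyc k \<sigma>) ^ t * (inc 0 * \<sigma> \<one>))" for t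
    by (simp add: ht_def tp_linear vz_def i_def tp_power tp_mult gm_one_pow[OF r(1)])
  have Yk: "k = n \<or> snd ?X ^ k * i = 0"
    using kn by (auto simp: Y snd_cyc_pow(2)[OF s k(1)] tp_linear)
  let ?F = "\<Sum>s<k. snd ?X ^ s * i * prj s"
  let ?S = "\<Sum>s<k. inc s * tp (\<rho> \<one>) (\<sigma> \<one> * prj s)"
  have F: "?F = (\<Sum>s<k. tp (\<rho> \<one>) (inc s * \<sigma> \<one>) * prj s)"
    using snd_cyc_pow(1)[OF s k(1)] by (simp add: Y)
  show ?thesis
  proof (rule hiso_linI[OF hhom_from_cyc[OF X cyc_ok_gt(1)[OF r ok] i Yk] _ _ hm_cyc[OF cyc_ok_gt(1)[OF r ok]] X, of ?S])
    show "?S * ?F = fst (cyc k (gt \<rho> \<sigma>)) \<one>"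
    proof (rule lop_eqI_inc)
      fix t
      show "?S * ?F * inc t = fst (cyc k (gt \<rho> \<sigma>)) \<one> * inc t"
      proof (cases "t < k")
        case True
        have "?S * tp (\<rho> \<one>) (inc t * \<sigma> \<one>) = (\<Sum>s<k. if s = t then inc t * gt \<rho> \<sigma> \<one> else 0)"
          unfolding sum_distrib_right by (intro sum.cong) (auto simp: n prj_inc_left)
        then show ?thesis using True unfolding F by (simp add: mult.assoc[of ?S] row_inc fst_cyc_inc del: mult.assoc)
      qed (simp add: F mult.assoc[of ?S] row_inc fst_cyc_inc)
    qed
    have "?F * ?S = (\<Sum>t<k. ?F * inc t * tp (\<rho> \<one>) (\<sigma> \<one> * prj t))"
      by (simp only: sum_distrib_left mult.assoc)
    also have "\<dots> = (\<Sum>t<k. tp (\<rho> \<one>) (inc t * (\<sigma> \<one> * prj t)))"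
      unfolding F row_inc by (intro sum.cong) (auto simp: n mult_assoc_cong[OF gm_one(1)[OF s]])
    finally show "?F * ?S = fst ?X \<one>" by (simp add: n cyc_def tp_sum)
  qed
qed

lemma inv_gpow: "inv g [^] t \<otimes> g [^] (t::nat) = \<one>"
proof (induction t)
  case (Suc t)
  have "inv g [^] Suc t \<otimes> g [^] Suc t = inv g [^] t \<otimes> (inv g \<otimes> (g \<otimes> g [^] t))"
    by (simp add: m_assoc g_central)
  also have "inv g \<otimes> (g \<otimes> g [^] t) = g [^] t" by (simp flip: m_assoc)
  finally show ?case using Suc by simp
qed simp

lemma inv_gpow': "g [^] t \<otimes> inv g [^] (t::nat) = \<one>"
  using gpow_central[of "inv g [^] t" t] inv_gpow[of t] by simp

text \<open>Now y acts as y \<otimes> g, so x^t (v \<otimes> w) corresponds to x^t v \<otimes> g^t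
  w, and the inverse map carries g^-t.\<close>

lemma hiso_cyc_vz:
  assumes r: "gm \<rho>" "\<rho> (g [^] n) = \<rho> \<one>" and ok: "cyc_ok k \<sigma>" and s1: "\<sigma> (g [^] n) = \<sigma> \<one>"
  shows "hiso (cyc k (gt \<sigma> \<rho>)) (ht (cyc k \<sigma>) (vz \<rho>))"
proof -
  have s: "gm \<sigma>" and k: "1 \<le> k" "k \<le> n" using ok by (auto simp: cyc_ok_def)
  let ?X = "ht (cyc k \<sigma>) (vz \<rho>)"
  have X: "hm ?X" by (intro hm_ht hm_vz hm_cyc r ok)
  define i where "i = tp (inc 0 * \<sigma> \<one>) (\<rho> \<one>)"
  note n = fst_ht gt_def tp_mult mult.assoc gm_one[OF r(1)] gm_one[OF s] tp_linear
  have i: "ghom (gt \<sigma> \<rho>) (fst ?X) i"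
    using k unfolding ghom_def by (auto simp: n i_def mult_assoc_cong[OF fst_cyc_inc])
  have Y: "snd ?X ^ t * i = tp (snd (cyc k \<sigma>) ^ t * (inc 0 * \<sigma> \<one>)) (\<rho> (g [^] t))" for t
    by (simp add: ht_def tp_linear vz_def i_def tp_power tp_mult gm_pow[OF r(1)])
  have Yk: "snd ?X ^ k * i = 0"
    by (auto simp: Y snd_cyc_pow(2)[OF s k(1)] tp_linear s1)
  let ?F = "\<Sum>s<k. snd ?X ^ s * i * prj s"
  let ?S = "\<Sum>s<k. inc s * tp (\<sigma> \<one> * prj s) (\<rho> (inv g [^] s))"
  have F: "?F = (\<Sum>s<k. tp (inc s * \<sigma> \<one>) (\<rho> (g [^] s)) * prj s)"
    using snd_cyc_pow(1)[OF s k(1)] by (simp add: Y)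
  have ig: "\<rho> (inv g [^] t) * \<rho> (g [^] t) = \<rho> \<one>" "\<rho> (g [^] t) * \<rho> (inv g [^] t) = \<rho> \<one>" for t :: nat
    by (simp_all add: gm_mult[OF r(1)] inv_gpow inv_gpow')
  show ?thesis
  proof (rule hiso_linI[OF hhom_from_cyc[OF X cyc_ok_gt(2)[OF r ok] i disjI2[OF Yk]] _ _ hm_cyc[OF cyc_ok_gt(2)[OF r ok]] X, of ?S])
    show "?S * ?F = fst (cyc k (gt \<sigma> \<rho>)) \<one>"
    proof (rule lop_eqI_inc)
      fix t
      show "?S * ?F * inc t = fst (cyc k (gt \<sigma> \<rho>)) \<one> * inc t"
      proof (cases "t < k")
        case True
        have "?S * tp (inc t * \<sigma> \<one>) (\<rho> (g [^] t)) = (\<Sum>s<k. if s = t then inc t * gt \<sigma> \<rho> \<one> else 0)"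
          unfolding sum_distrib_right by (intro sum.cong) (auto simp: n prj_inc_left ig)
        then show ?thesis using True unfolding F by (simp add: mult.assoc[of ?S] row_inc fst_cyc_inc del: mult.assoc)
      qed (simp add: F mult.assoc[of ?S] row_inc fst_cyc_inc)
    qed
    have "?F * ?S = (\<Sum>t<k. ?F * inc t * tp (\<sigma> \<one> * prj t) (\<rho> (inv g [^] t)))"
      by (simp only: sum_distrib_left mult.assoc)
    also have "\<dots> = (\<Sum>t<k. tp (inc t * (\<sigma> \<one> * prj t)) (\<rho> \<one>))"
      unfolding F row_inc by (intro sum.cong) (auto simp: n ig mult_assoc_cong[OF gm_one(1)[OF s]])
    finally show "?F * ?S = fst ?X \<one>" by (simp add: n cyc_def tp_sum)
  qed
qed

definition gtriv :: "'a \<Rightarrow> 'k lop" where "gtriv = (\<lambda>h. pr 1)"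
definition gchi :: "'a \<Rightarrow> 'k lop" where "gchi = (\<lambda>h. scl (inverse (\<chi> h)) (pr 1))"

lemma gm_gtriv: "gm gtriv" by (simp add: gm_def gtriv_def finr_pr)

lemma gm_gchi: "gm gchi" by (simp add: gm_def gchi_def finr_pr chi_mult mult.commute)

lemma gtriv_gchi [simp]: "gtriv h = pr (Suc 0)" "gchi h = scl (inverse (\<chi> h)) (pr (Suc 0))"
  by (simp_all add: gtriv_def gchi_def)

lemma cyc_ok_gtriv: "1 \<le> k \<Longrightarrow> k \<le> n \<Longrightarrow> cyc_ok k gtriv" "1 \<le> k \<Longrightarrow> k \<le> n \<Longrightarrow> cyc_ok k gchi"
  by (simp_all add: cyc_ok_def gm_gtriv gm_gchi)

text \<open>
  In \<open>C\<^sub>2 \<otimes> C\<^sub>k\<close> with \<open>a\<^sub>s = 1 \<otimes> x\<^sup>s\<close> and \<open>b\<^sub>s = x \<otimes> x\<^sup>s\<close>, the vector \<open>u\<^sub>0 = a\<^sub>0\<close> generates \<open>C\<^sub>k\<^sub>+\<^sub>1\<close> and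
  \<open>w\<^sub>0 = a\<^sub>1 + (1 - [k]) b\<^sub>0\<close> generates a complement, where \<open>[k] = 1 + q\<^sup>-\<^sup>1 + \<dots> + q\<^sup>-\<^sup>(\<^sup>k\<^sup>-\<^sup>1\<^sup>)\<close> is nonzero
  because \<open>k < n\<close>.
\<close>

lemma hiso_clebsch_gordan:
  assumes k: "2 \<le> k" "k < n"
  shows "hiso (ds (cyc (Suc k) gtriv) (cyc (k - 1) gchi)) (ht (cyc 2 gtriv) (cyc k gtriv))" (is "hiso ?D ?X")
proof -
  have ok: "cyc_ok 2 gtriv" "cyc_ok k gtriv" "cyc_ok (Suc k) gtriv" "cyc_ok (k - 1) gchi"
    using k by (auto intro!: cyc_ok_gtriv)
  have X: "hm ?X" and D: "hm ?D" using ok by (auto intro!: hm_ht hm_ds hm_cyc)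
  \<comment> \<open>All layers are one-dimensional. The operator \<open>z\<close> identifies the
    line spanned by \<open>e 0\<close> with its tensor square, and \<open>z'\<close> is its
    inverse.\<close>
  define z :: "'k lop" where "z = inc 0 * pr 1"
  define z' :: "'k lop" where "z' = pr 1 * prj 0"
  define a where "a s = (if s < k then tp (inc 0) (inc s) * z else 0)" for s
  define b where "b s = (if s < k then tp (inc 1) (inc s) * z else 0)" for s
  define a' where "a' s = z' * tp (prj 0) (prj s)" for s :: nat
  define b' where "b' s = z' * tp (prj 1) (prj s)" for s :: nat
  have z: "tp (A * pr (Suc 0)) (B * pr (Suc 0)) * z = tp A B * z" for A B :: "'k lop"
  proof -
    have "tp (pr (Suc 0)) (pr (Suc 0)) * z = z" by (simp add: z_def mult_assoc_cong[OF tp_pr1(1)] mult.assoc)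
    then show ?thesis by (simp add: mult.assoc flip: tp_mult)
  qed
  have zs: "tp (A * pr (Suc 0)) (scl c (B * pr (Suc 0))) * z = scl c (tp A B * z)" 
    "tp (scl c (A * pr (Suc 0))) (B * pr (Suc 0)) * z = scl c (tp A B * z)" for A B c
    by (simp_all add: tp_linear z)
  have zz: "z' * z = pr (Suc 0)" "z * pr (Suc 0) = z" "z * z' = tp (pr (Suc 0)) (pr (Suc 0))"
    by (simp_all add: z_def z'_def mult.assoc prj_inc_left mult_assoc_cong[OF pr1_pr1] flip: tp_pr1(2))
  define Y where "Y = snd ?X"
  have YX: "Y = tp (snd (cyc 2 gtriv)) (fst (cyc k gtriv) g) + tp (fst (cyc 2 gtriv) \<one>) (snd (cyc k gtriv))"
    by (simp add: Y_def ht_def)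
  have k1: "1 \<le> k" using k by simp
  define qi where "qi = inverse (\<chi> g)"
  \<comment> \<open>The first summand of \<Delta>(y) gives b_s with the factor \<chi>(g)^-s, by
    which g acts on x^s; the second gives a_(s+1), which is zero for s + 1 = k.\<close>
  have Ya: "Y * a s = a (Suc s) + scl (qi ^ s) (b s)" for s
    using snd_cyc_inc[of 2 gtriv 0] snd_cyc_inc[OF k1, of gtriv s]
    by (auto simp: a_def b_def YX distrib_right tp_mult fst_cyc_inc tp_linear z zs qi_def simp flip: mult.assoc)
  have Yb: "Y * b s = b (Suc s)" for s
    using snd_cyc_inc[of 2 gtriv 1] snd_cyc_inc[OF k1, of gtriv s]
    by (auto simp: b_def YX distrib_right tp_mult fst_cyc_inc tp_linear z zs simp flip: mult.assoc)
  have ra: "fst ?X h * a s = scl (inverse (\<chi> h) ^ s) (a s)" for h s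
    by (auto simp: a_def fst_ht gt_def tp_mult fst_cyc_inc tp_linear z zs simp flip: mult.assoc)
  have rb: "fst ?X h * b s = scl (inverse (\<chi> h) ^ Suc s) (b s)" for h s
    by (auto simp: b_def fst_ht gt_def tp_mult fst_cyc_inc tp_linear z zs mult.commute simp flip: mult.assoc)
  have apr: "a s * pr (Suc 0) = a s" "b s * pr (Suc 0) = b s" for s
    by (simp_all add: a_def b_def mult.assoc zz)
  define qn where "qn t = (\<Sum>i<t. qi ^ i)" for t
  have qn: "qn 0 = 0" "qn (Suc t) = qn t + qi ^ t" for t by (simp_all add: qn_def)
  have qk: "qn k \<noteq> 0"
  proof
    assume "qn k = 0"
    moreover have "qn k * (1 - qi) = 1 - qi ^ k"
      by (simp add: qn_def one_diff_power_eq mult.commute)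
    ultimately have "qi ^ k = 1" by simp
    then have "\<chi> g ^ k = 1" by (simp add: qi_def power_inverse)
    then show False using q_prim k by auto
  qed
  \<comment> \<open>The closed form of y^t a_0. At t = 0 the index t - 1 is cut off to 0, but its
    coefficient \<open>qn 0\<close> is zero.\<close>
  define u where "u t = a t + scl (qn t) (b (t - 1))" for t
  \<comment> \<open>The closed form of y^t w_0. The constant \<open>qn k\<close> is chosen so that
    w_(k-1) is zero: there a_k vanishes, and so does the coefficient of b_(k-1).\<close>
  define w where "w t = a (Suc t) + scl (qn (Suc t) - qn k) (b t)" for t
  have Yu: "Y * u t = u (Suc t)" for t
  proof (cases t)
    case (Suc t') then show ?thesis by (simp add: u_def distrib_left Ya Yb qn scl_add_left)
  qed (simp add: u_def qn Ya)
  have Yw: "Y * w t = w (Suc t)" for t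
    by (simp add: w_def distrib_left right_diff_distrib Ya Yb qn scl_add_left scl_diff_left)
  have Yu': "Y ^ t * u 0 = u t" and Yw': "Y ^ t * w 0 = w t" for t
    by (induction t) (simp_all add: mult.assoc Yu Yw)
  define i1 where "i1 = (\<Sum>s<Suc k. snd ?X ^ s * u 0 * prj s)"
  define i2 where "i2 = (\<Sum>s<k - 1. snd ?X ^ s * w 0 * prj s)"
  have h1: "hhom (cyc (Suc k) gtriv) ?X i1"
    unfolding i1_def
  proof (rule hhom_from_cyc[OF X ok(3)])
    show "ghom gtriv (fst ?X) (u 0)" by (simp add: ghom_def u_def qn apr ra)
    have "Y ^ Suc k * u 0 = 0" unfolding Yu' by (simp add: u_def a_def b_def)
    then show "Suc k = n \<or> snd ?X ^ Suc k * u 0 = 0" by (simp add: Y_def)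
  qed
  have h2: "hhom (cyc (k - 1) gchi) ?X i2"
    unfolding i2_def
  proof (rule hhom_from_cyc[OF X ok(4)])
    show "ghom gchi (fst ?X) (w 0)" by (simp add: ghom_def w_def apr ra rb distrib_left distrib_right scl_add mult.commute)
    have "Y ^ (k - 1) * w 0 = 0" unfolding Yw' using k by (simp add: w_def a_def)
    then show "k - 1 = n \<or> snd ?X ^ (k - 1) * w 0 = 0" by (simp add: Y_def)
  qed
  have i1: "i1 * inc t = (if t < Suc k then u t else 0)" and i2: "i2 * inc t = (if t < k - 1 then w t else 0)" for t
    unfolding i1_def i2_def row_inc using Yu' Yw' by (auto simp: Y_def)
  define T where "T = i1 * prj 0 + i2 * prj 1"
  have "hhom ?D ?X (i1 * prj 0)" "hhom ?D ?X (i2 * prj 1)"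
    using hhom_comp[OF hhom_inc_prj(3) h1, of "cyc (k - 1) gchi"] hhom_comp[OF hhom_inc_prj(4) h2, of "cyc (Suc k) gtriv"] ok
    by (simp_all add: hm_cyc mult_assoc_cong[OF hhom_1[OF h1]] mult_assoc_cong[OF hhom_1[OF h2]] del: One_nat_def)
  then have T: "hhom ?D ?X T"
    unfolding hhom_def ghom_def T_def by (auto simp: distrib_left distrib_right)
  define U :: "nat \<Rightarrow> 'k lop" where "U t = (if t < Suc k then inc 0 * (inc t * pr 1) else 0)" for t
  define W :: "nat \<Rightarrow> 'k lop" where "W t = (if t < k - 1 then inc 1 * (inc t * pr 1) else 0)" for t
  have wk: "w t = 0" if "\<not> t < k - 1" for t
  proof (cases "t = k - 1")
    case False
    then have "\<not> t < k" using that by linarith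
    then show ?thesis by (simp add: w_def a_def b_def)
  qed (use k in \<open>simp add: w_def a_def\<close>)
  have upr: "u t * pr (Suc 0) = u t" "w t * pr (Suc 0) = w t" for t
    by (simp_all add: u_def w_def distrib_right apr)
  have TU: "T * U t = u t" if "t < Suc k" for t
    using that by (simp add: T_def U_def distrib_right mult.assoc prj_inc_left mult_assoc_cong[OF i1] upr)
  have TW: "T * W t = w t" for t
    by (auto simp: T_def W_def distrib_right mult.assoc prj_inc_left mult_assoc_cong[OF i2] upr wk)
  \<comment> \<open>The change of basis is inverted by solving u_(t+1) - w_t = [k] b_t for b_t, and
    u_t = a_t + [t] b_(t-1) for a_t.\<close>
  define Sb where "Sb t = scl (inverse (qn k)) (U (Suc t) - W t)" for t
  define Sa where "Sa t = U t - scl (qn t) (Sb (t - 1))" for t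
  define S where "S = (\<Sum>s<k. Sa s * a' s + Sb s * b' s)"
  have d: "a' s * a t = (if s = t \<and> t < k then pr (Suc 0) else 0)" "b' s * b t = (if s = t \<and> t < k then pr (Suc 0) else 0)"
    "a' s * b t = 0" "b' s * a t = 0" for s t
    by (auto simp: a'_def a_def b'_def b_def mult.assoc mult_assoc_cong[OF tp_mult] prj_inc tp_linear zz)
  have Upr: "U t * pr (Suc 0) = U t" "W t * pr (Suc 0) = W t" for t by (simp_all add: U_def W_def mult.assoc)
  then have Spr: "Sb t * pr (Suc 0) = Sb t" "Sa t * pr (Suc 0) = Sa t" for t
    by (simp_all add: Sb_def Sa_def left_diff_distrib)
  have Sab: "S * a t = Sa t" "S * b t = Sb t" if "t < k" for t
  proof -
    have "S * a t = (\<Sum>s<k. if s = t then Sa t else 0)"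
      unfolding S_def sum_distrib_right by (rule sum.cong) (auto simp: distrib_right mult.assoc d Spr)
    moreover have "S * b t = (\<Sum>s<k. if s = t then Sb t else 0)"
      unfolding S_def sum_distrib_right by (rule sum.cong) (auto simp: distrib_right mult.assoc d Spr)
    ultimately show "S * a t = Sa t" "S * b t = Sb t" using that by auto
  qed
  have ak: "a t = 0" "b t = 0" if "\<not> t < k" for t using that by (simp_all add: a_def b_def)
  have Su: "S * u t = U t" if t: "t < Suc k" for t
  proof (cases "t < k")
    case True
    then show ?thesis using t by (cases t) (auto simp: u_def distrib_left Sab Sa_def qn)
  next
    case False
    then have "t = k" using t by simp
    then show ?thesis using k qk by (simp add: u_def ak distrib_left Sab Sb_def W_def)
  qed
  have Sw: "S * w t = W t" if t: "t < k - 1" for t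
    using that qk by (simp add: w_def distrib_left Sab Sa_def scl_diff_left scl_diff right_diff_distrib)
      (simp add: Sb_def scl_diff)
  have "S * T = fst ?D \<one>"
  proof (rule lop_eqI_inc)
    fix s
    have "fst ?D \<one> * inc s = (if s = 0 then inc 0 * fst (cyc (Suc k) gtriv) \<one> else if s = 1 then inc 1 * fst (cyc (k - 1) gchi) \<one> else 0)"
      by (auto simp: ds_def distrib_right mult.assoc prj_inc)
    moreover have "T * inc s = (if s = 0 then i1 else if s = 1 then i2 else 0)"
      by (auto simp: T_def distrib_right mult.assoc prj_inc)
    moreover have "S * i1 = inc 0 * fst (cyc (Suc k) gtriv) \<one>"
      by (rule lop_eqI_inc) (simp add: mult.assoc i1 fst_cyc_inc Su U_def)
    moreover have "S * i2 = inc 1 * fst (cyc (k - 1) gchi) \<one>"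
      by (rule lop_eqI_inc) (simp add: mult.assoc i2 fst_cyc_inc Sw W_def)
    ultimately show "S * T * inc s = fst ?D \<one> * inc s" by (simp add: mult.assoc)
  qed
  moreover have "T * S = fst ?X \<one>"
  proof -
    have b: "T * Sb t = b t" if "t < k" for t
    proof -
      have "u (Suc t) - w t = scl (qn k) (b t)" by (simp add: u_def w_def scl_diff_left)
      then show ?thesis using that qk by (simp add: Sb_def right_diff_distrib TU TW)
    qed
    have a: "T * Sa t = a t" if "t < k" for t
      using that b[of "t - 1"] by (cases "t = 0") (auto simp: Sa_def right_diff_distrib TU u_def qn)
    have "T * S = (\<Sum>s<k. a s * a' s + b s * b' s)"
      unfolding S_def sum_distrib_left by (intro sum.cong) (auto simp: distrib_left a b simp flip: mult.assoc)
    also have "\<dots> = (\<Sum>s<k. tp (inc 0 * pr 1 * prj 0) (inc s * pr 1 * prj s) + tp (inc 1 * pr 1 * prj 1) (inc s * pr 1 * prj s))"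
    proof (rule sum.cong[OF refl])
      fix s assume "s \<in> {..<k}"
      moreover have "tp A B * z * (z' * tp C D) = tp (A * pr 1 * C) (B * pr 1 * D)" for A B C D :: "'k lop"
        by (simp add: mult.assoc mult_assoc_cong[OF zz(3)] tp_mult)
      ultimately show "a s * a' s + b s * b' s =
        tp (inc 0 * pr 1 * prj 0) (inc s * pr 1 * prj s) + tp (inc 1 * pr 1 * prj 1) (inc s * pr 1 * prj s)"
        by (simp add: a_def b_def a'_def b'_def)
    qed
    also have "\<dots> = fst ?X \<one>"
      by (simp add: fst_ht gt_def cyc_def tp_sum tp_linear sum.distrib numeral_2_eq_2 mult.assoc)
    finally show ?thesis .
  qed
  ultimately show ?thesis by (rule hiso_linI[OF T _ _ D X])
qed

end

section \<open>Matrices as operators\<close>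

definition opr :: "'k::field mat \<Rightarrow> 'k lop"
  where "opr A = lext (\<lambda>j. if j < dim_col A then \<Sum>i<dim_row A. monom (A $$ (i, j)) i else 0)"

lemma coeff_opr: "coeff (ap (opr A) (e j)) i = (if i < dim_row A \<and> j < dim_col A then A $$ (i, j) else 0)"
  by (simp add: opr_def coeff_sum)

lemma opr_e: "j < dim_col A \<Longrightarrow> ap (opr A) (e j) = (\<Sum>i<dim_row A. smult (A $$ (i, j)) (e i))"
  by (simp add: opr_def smult_monom)

lemma lop_coeffI: "(\<And>i j. coeff (ap A (e j)) i = coeff (ap B (e j)) i) \<Longrightarrow> A = B"
  by (intro lop_eqI poly_eqI) auto

lemma opr_mult: "dim_col A = dim_row B \<Longrightarrow> opr (A * B) = opr A * opr B"
proof (rule lop_coeffI)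
  fix i j assume AB: "dim_col A = dim_row B"
  show "coeff (ap (opr (A * B)) (e j)) i = coeff (ap (opr A * opr B) (e j)) i"
  proof (cases "j < dim_col B")
    case True
    have "coeff (ap (opr A * opr B) (e j)) i = (\<Sum>k<dim_row B. B $$ (k, j) * coeff (ap (opr A) (e k)) i)"
      using True by (simp add: opr_e[of j B] ap_sum ap_smult coeff_sum)
    also have "\<dots> = coeff (ap (opr (A * B)) (e j)) i"
      using True AB by (auto simp: coeff_opr scalar_prod_def mult.commute lessThan_atLeast0 intro!: sum.cong)
    finally show ?thesis by simp
  qed (simp add: opr_def)
qed

lemma opr_one: "opr (1\<^sub>m d) = pr d"
  by (rule lop_coeffI) (simp add: coeff_opr)

lemma opr_zero [simp]: "opr (0\<^sub>m d d') = 0"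
  by (rule lop_coeffI) (simp add: coeff_opr)

lemma opr_pr: "A \<in> carrier_mat d d' \<Longrightarrow> pr d * opr A = opr A" "A \<in> carrier_mat d d' \<Longrightarrow> opr A * pr d' = opr A"
  by (auto simp flip: opr_one opr_mult)

lemma opr_inj: "A \<in> carrier_mat d d' \<Longrightarrow> B \<in> carrier_mat d d' \<Longrightarrow> opr A = opr B \<Longrightarrow> A = B"
proof (rule eq_matI)
  fix i j assume "A \<in> carrier_mat d d'" "B \<in> carrier_mat d d'" "opr A = opr B" "i < dim_row B" "j < dim_col B"
  then show "A $$ (i, j) = B $$ (i, j)"
    using coeff_opr[of A j i] coeff_opr[of B j i] by auto
qed auto

definition tm :: "nat \<Rightarrow> nat \<Rightarrow> 'k::field lop \<Rightarrow> 'k mat"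
  where "tm d d' X = mat d d' (\<lambda>(i, j). coeff (ap X (e j)) i)"

lemma tm_carrier [simp]: "tm d d' X \<in> carrier_mat d d'" by (simp add: tm_def)

lemma opr_tm: assumes "pr d * X = X" "X * pr d' = X" shows "opr (tm d d' X) = X"
proof (rule lop_coeffI)
  fix i j
  have "coeff (ap X (e j)) i = 0" if "\<not> i < d"
    using lop_fun[OF assms(1), of "e j"] that coeff_pr[of d "ap X (e j)" i] by simp
  moreover have "ap X (e j) = 0" if "\<not> j < d'"
    using lop_fun[OF assms(2), of "e j"] that by simp
  ultimately show "coeff (ap (opr (tm d d' X)) (e j)) i = coeff (ap X (e j)) i"
    by (auto simp: coeff_opr tm_def)
qed

lemma pr_inj: "pr d = (pr d' :: 'k::field lop) \<Longrightarrow> d = d'"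
proof (rule ccontr)
  assume *: "pr d = (pr d' :: 'k lop)" and "d \<noteq> d'"
  moreover have False if "a < b" "pr a = (pr b :: 'k lop)" for a b
    using lop_fun[OF that(2), of "e a"] that(1) by simp
  ultimately show False by (metis linorder_neqE_nat)
qed

lemma opr_sum:
  "opr (mat d d' (\<lambda>(r, s). \<Sum>x\<in>S. u x * f x r s)) = (\<Sum>x\<in>S. scl (u x) (opr (mat d d' (\<lambda>(r, s). f x r s))))"
  by (rule lop_coeffI) (auto simp: coeff_opr ap_sum_left coeff_sum)

definition OA :: "('b, 'k::field, 'm) falg_scheme \<Rightarrow> ('b \<Rightarrow> 'k lop) \<Rightarrow> ('b \<Rightarrow> 'k) \<Rightarrow> 'k lop"
  where "OA A X u = (\<Sum>b\<in>bas A. scl (u b) (X b))"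

text \<open>Multiplicativity on basis elements, as recorded by \<open>is_module\<close>, extends
  bilinearly. It is applied to H and also to H \<otimes> H, where coproducts live.\<close>

lemma OA_amult:
  assumes "\<And>b c. b \<in> bas A \<Longrightarrow> c \<in> bas A \<Longrightarrow> X b * X c = OA A X (prd A b c)"
  shows "OA A X (amult A u v) = OA A X u * OA A X v"
proof -
  have "OA A X u * OA A X v = (\<Sum>b\<in>bas A. \<Sum>c\<in>bas A. scl (u b * v c) (OA A X (prd A b c)))"
    unfolding OA_def[of A X u] OA_def[of A X v] sum_product
    using assms by (intro sum.cong refl) (simp add: mult.commute)
  also have "\<dots> = (\<Sum>b\<in>bas A. \<Sum>d\<in>bas A. \<Sum>c\<in>bas A. scl (u b * v c * prd A b c d) (X d))"
    unfolding OA_def scl_sum by (rule sum.cong[OF refl]) (subst sum.swap, simp)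
  also have "\<dots> = OA A X (amult A u v)"
    unfolding OA_def amult_def by (subst sum.swap) (simp add: scl_sum_left)
  finally show ?thesis by simp
qed

lemma OA_bvec: "finite (bas A) \<Longrightarrow> b \<in> bas A \<Longrightarrow> OA A X (bvec b) = X b"
proof -
  assume *: "finite (bas A)" "b \<in> bas A"
  have "OA A X (bvec b) = (\<Sum>c\<in>bas A. if c = b then X b else 0)"
    unfolding OA_def bvec_def by (intro sum.cong) auto
  with * show ?thesis by simp
qed

lemma OA_linear: "OA A X (\<lambda>d. u d + v d) = OA A X u + OA A X v" "OA A X (\<lambda>d. u d - v d) = OA A X u - OA A X v"
  "OA A X (\<lambda>d. c * u d) = scl c (OA A X u)" "OA A X (\<lambda>d. 0) = 0"
  by (simp_all add: OA_def scl_add_left scl_diff_left sum.distrib sum_subtractf scl_sum)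

lemma OA_apow:
  assumes "\<And>b c. b \<in> bas A \<Longrightarrow> c \<in> bas A \<Longrightarrow> X b * X c = OA A X (prd A b c)"
  shows "OA A X (apow A u m) = OA A X (unt A) * OA A X u ^ m"
  by (induction m) (simp_all add: apow_def OA_amult[of A X, OF assms] power_Suc2 mult.assoc del: power_Suc)

lemma opr_act:
  assumes "\<forall>b\<in>bas A. snd M b \<in> carrier_mat (fst M) (fst M)"
  shows "opr (act A M u) = OA A (\<lambda>b. opr (snd M b)) u"
  unfolding act_def OA_def opr_sum
proof (intro sum.cong refl arg_cong[of _ _ "scl _"] arg_cong[of _ _ opr])
  fix b assume "b \<in> bas A"
  then have "snd M b \<in> carrier_mat (fst M) (fst M)" using assms by auto
  then show "mat (fst M) (fst M) (\<lambda>(r, s). snd M b $$ (r, s)) = snd M b" by (intro eq_matI) auto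
qed

lemma act_carrier [simp]: "act A M u \<in> carrier_mat (fst M) (fst M)" by (simp add: act_def)

lemma is_module_iff:
  "is_module A M \<longleftrightarrow> (\<forall>b\<in>bas A. snd M b \<in> carrier_mat (fst M) (fst M)) \<and>
    OA A (\<lambda>b. opr (snd M b)) (unt A) = pr (fst M) \<and>
    (\<forall>b\<in>bas A. \<forall>c\<in>bas A. opr (snd M b) * opr (snd M c) = OA A (\<lambda>b. opr (snd M b)) (prd A b c))"
proof (cases "\<forall>b\<in>bas A. snd M b \<in> carrier_mat (fst M) (fst M)")
  case True
  have "act A M (unt A) = 1\<^sub>m (fst M) \<longleftrightarrow> opr (act A M (unt A)) = pr (fst M)"
    using opr_inj[OF act_carrier[of A M "unt A"] one_carrier_mat] by (auto simp: opr_one)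
  moreover have "snd M b * snd M c = act A M (prd A b c) \<longleftrightarrow> opr (snd M b) * opr (snd M c) = opr (act A M (prd A b c))"
    if "b \<in> bas A" "c \<in> bas A" for b c
  proof -
    have "snd M b \<in> carrier_mat (fst M) (fst M)" "snd M c \<in> carrier_mat (fst M) (fst M)" using that True by auto
    then have *: "opr (snd M b * snd M c) = opr (snd M b) * opr (snd M c)" "snd M b * snd M c \<in> carrier_mat (fst M) (fst M)"
      by (auto intro!: opr_mult)
    show ?thesis using opr_inj[OF *(2) act_carrier] by (auto simp: * simp flip: *(1))
  qed
  ultimately show ?thesis using True by (simp add: is_module_def opr_act[OF True])
qed (auto simp: is_module_def)

text \<open>Renaming by \<open>\<kappa> f\<close> turns the index \<open>i * f + j\<close> used for tensor products of matrices into the pair \<open>(i, j)\<close>.\<close>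

definition \<kappa> :: "nat \<Rightarrow> nat \<Rightarrow> nat" where "\<kappa> f k = pr2 (k div f) (k mod f)"

lemma inj_\<kappa>: "inj (\<kappa> f)"
  by (rule injI) (auto simp: \<kappa>_def, metis div_mult_mod_eq)

lemma ren_unr_\<kappa>: "ren (\<kappa> f) * pr (d * f) * (pr (d * f) * unr (\<kappa> f)) = tp (pr d) (pr f)"
proof (rule lop_eqI2)
  fix i j
  show "ap (ren (\<kappa> f) * pr (d * f) * (pr (d * f) * unr (\<kappa> f))) (e (pr2 i j)) = ap (tp (pr d) (pr f)) (e (pr2 i j))"
  proof (cases "j < f")
    case True
    then have k: "pr2 i j = \<kappa> f (i * f + j)" by (simp add: \<kappa>_def)
    have "i * f + j < d * f \<longleftrightarrow> i < d"
    proof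
      assume "i < d"
      then have "Suc i * f \<le> d * f" by (intro mult_le_mono1) simp
      then show "i * f + j < d * f" using True by simp
    next
      assume "i * f + j < d * f"
      then have "i * f < d * f" by linarith
      then show "i < d" by simp
    qed
    then show ?thesis using True by (simp add: k ap_unr inj_\<kappa>) (simp add: pt_linear flip: k)
  next
    case False
    show ?thesis
    proof (cases "pr2 i j \<in> range (\<kappa> f)")
      case True
      \<comment> \<open>As \<open>k mod 0\<close> is k, the range of \<open>\<kappa> 0\<close>
        contains pairs with arbitrary second entry. In that case both sides are zero.\<close>
      then have "f = 0" using False by (auto simp: \<kappa>_def) (metis mod_less_divisor gr0I)
      then show ?thesis by (simp add: pt_linear2)
    qed (use False in \<open>simp add: ap_unr inj_\<kappa> pt_linear2\<close>)
  qed
qed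

text \<open>The matrix on the right is a Kronecker product, which is how \<open>tensor\<close> and
  \<open>Mmod\<close> are written; renaming by \<open>\<kappa>\<close> turns it into
  \<open>tp\<close>.\<close>

lemma unr_\<kappa>_tp:
  assumes A: "A \<in> carrier_mat d d" and B: "B \<in> carrier_mat f f"
  shows "pr (d * f) * unr (\<kappa> f) * tp (opr A) (opr B) * (ren (\<kappa> f) * pr (d * f))
    = opr (mat (d * f) (d * f) (\<lambda>(r, s). A $$ (r div f, s div f) * B $$ (r mod f, s mod f)))" (is "?L = opr ?R")
proof -
  have cu: "coeff (ap (unr (\<kappa> f)) p) i = coeff p (\<kappa> f i)" for p i
  proof -
    have *: "coeff (ap (unr (\<kappa> f)) (e j)) i = coeff (e j) (\<kappa> f i)" for j
      using inj_\<kappa>[of f] by (cases "j \<in> range (\<kappa> f)") (auto simp: ap_unr inj_\<kappa> dest: injD)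
    show ?thesis
      by (subst (1 2) poly_expand[of p]) (simp only: ap_sum ap_smult coeff_sum coeff_smult *)
  qed
  have cp: "coeff (pt p q) (pr2 a b) = coeff p a * coeff q b" for p q a b
  proof -
    have ci: "coeff (ap (inc s) q) (pr2 a b) = (if s = a then coeff q b else 0)" for s
    proof -
      have "coeff (ap (inc s) (e j)) (pr2 a b) = (if s = a then coeff (e j) b else 0)" for j by auto
      then show ?thesis
        by (subst (1 2) poly_expand[of q]) (simp only: ap_sum ap_smult coeff_sum coeff_smult, simp)
    qed
    have "coeff (pt p q) (pr2 a b) = (\<Sum>s\<le>degree p. if s = a then coeff p a * coeff q b else 0)"
      unfolding pt_expand coeff_sum by (intro sum.cong) (auto simp: ci)
    then show ?thesis by (simp add: coeff_eq_0)
  qed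
  show ?thesis
  proof (rule lop_coeffI)
    fix i j
    have "i div f < d \<and> i mod f < f" if "i < d * f" for i
      using that less_mult_imp_div_less[of i d f] by (cases f) auto
    then show "coeff (ap ?L (e j)) i = coeff (ap (opr ?R) (e j)) i"
      using A B by (auto simp: coeff_pr cu coeff_opr) (auto simp: \<kappa>_def cp coeff_opr)
  qed
qed

context datum
begin

section \<open>Modules over the Hopf algebra as families of operators\<close>

abbreviation H :: "(nat \<times> 'a, 'k) hopf" where "H \<equiv> H_hopf G \<chi> g n"
abbreviation Ha :: "(nat \<times> 'a, 'k) falg" where "Ha \<equiv> H_alg G \<chi> g n"
abbreviation HT :: "((nat \<times> 'a) \<times> (nat \<times> 'a), 'k) falg" where "HT \<equiv> alg_tensor Ha Ha"

lemma Ha_simps [simp]: "bas Ha = {0..<n} \<times> carrier G" "unt Ha = bvec (0, \<one>)"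
  by (simp_all add: H_alg_def)

lemma H_simps [simp]: "bas H = {0..<n} \<times> carrier G" "unt H = bvec (0, \<one>)" "prd H = prd Ha"
  "counit H = (\<lambda>(i, h). if i = 0 then 1 else 0)"
  by (simp_all add: H_hopf_def falg.defs Let_def)

lemma comul_H: "comul H (i, h) = amult HT (apow HT (\<lambda>d. vtensor (bvec (1, \<one>)) (bvec (0, g)) d + vtensor (bvec (0, \<one>)) (bvec (1, \<one>)) d) i)
    (vtensor (bvec (0, h)) (bvec (0, h)))"
  by (simp add: H_hopf_def falg.defs Let_def)

lemma finite_bas [simp]: "finite ({0..<n} \<times> carrier G)" using fin by simp

lemma OA_H: "OA H X u = OA Ha X u" by (simp add: OA_def)

lemma OA_prd:
  assumes "i < n" "j < n" "h \<in> carrier G" "h' \<in> carrier G"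
  shows "OA Ha X (prd Ha (i, h) (j, h')) = scl (inverse (\<chi> h) ^ j)
    (if i + j < n then X (i + j, h \<otimes> h') else X (i + j - n, g [^] n \<otimes> (h \<otimes> h')) - X (i + j - n, h \<otimes> h'))"
proof -
  have b: "OA Ha X (bvec (m, k)) = X (m, k)" if "m < n" "k \<in> carrier G" for m k
    using that by (intro OA_bvec) auto
  have "i + j - n < n" using assms by linarith
  then show ?thesis
    using assms by (auto simp: H_alg_def[of G \<chi> g n, THEN arg_cong[of _ _ prd]] OA_linear b)
qed

definition am :: "(nat \<times> 'a, 'k) rep \<Rightarrow> ('a, 'k) am"
  where "am M = (\<lambda>h. opr (snd M (0, h)), opr (snd M (1, \<one>)))"

definition rep_of :: "(nat \<times> 'a, 'k) rep \<Rightarrow> ('a, 'k) am \<Rightarrow> bool"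
  where "rep_of M X \<longleftrightarrow> hm X \<and> fst X \<one> = pr (fst M) \<and>
    (\<forall>i<n. \<forall>h\<in>carrier G. snd M (i, h) \<in> carrier_mat (fst M) (fst M) \<and> opr (snd M (i, h)) = snd X ^ i * fst X h)"

lemma rep_of_module: assumes "rep_of M X" shows "is_module H M"
proof -
  have X: "hm X" and 1: "fst X \<one> = pr (fst M)"
    and M: "\<And>i h. i < n \<Longrightarrow> h \<in> carrier G \<Longrightarrow> snd M (i, h) \<in> carrier_mat (fst M) (fst M)"
      "\<And>i h. i < n \<Longrightarrow> h \<in> carrier G \<Longrightarrow> opr (snd M (i, h)) = snd X ^ i * fst X h"
    using assms by (auto simp: rep_of_def)
  note gX = hm_gm[OF X]
  have "opr (snd M (i, h)) * opr (snd M (j, h')) = OA Ha (\<lambda>b. opr (snd M b)) (prd Ha (i, h) (j, h'))"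
    if ij: "i < n" "j < n" and h: "h \<in> carrier G" "h' \<in> carrier G" for i j h h'
  proof -
    have "snd X ^ i * fst X h * (snd X ^ j * fst X h') = scl (inverse (\<chi> h) ^ j) (snd X ^ (i + j) * fst X (h \<otimes> h'))"
    proof -
      have "fst X h * snd X ^ j = scl (inverse (\<chi> h) ^ j) (snd X ^ j * fst X h)"
        using chi_nz[OF h(1)] by (simp add: hm_Yh_pow[OF X h(1)] flip: power_mult_distrib)
      then show ?thesis
        using mult_assoc_cong[of "fst X h" "snd X ^ j" _ "fst X h'"] h
        by (simp add: mult.assoc gm_mult[OF gX] power_add)
    qed
    moreover have "snd X ^ (i + j) * fst X k = snd X ^ (i + j - n) * (fst X (g [^] n \<otimes> k) - fst X k)"
      if "\<not> i + j < n" "k \<in> carrier G" for k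
    proof -
      have "snd X ^ (i + j) = snd X ^ (i + j - n) * snd X ^ n" using that by (simp flip: power_add)
      then show ?thesis using that by (simp add: hm_Yn[OF X] mult.assoc left_diff_distrib gm_mult[OF gX])
    qed
    moreover have "i + j - n < n" using ij by linarith
    ultimately show ?thesis
      using ij h by (simp add: OA_prd M right_diff_distrib)
  qed
  moreover have "OA Ha (\<lambda>b. opr (snd M b)) (bvec (0, \<one>)) = pr (fst M)"
    by (subst OA_bvec) (simp_all add: M 1)
  ultimately show ?thesis
    unfolding is_module_iff OA_H by (auto simp: M(1))
qed

text \<open>Outside the carrier of G the values of \<open>fst X\<close> carry no information about
  the module.\<close>

definition eqv :: "('a, 'k) am \<Rightarrow> ('a, 'k) am \<Rightarrow> bool"
  where "eqv X Z \<longleftrightarrow> (\<forall>h\<in>carrier G. fst X h = fst Z h) \<and> snd X = snd Z"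

lemma hiso_eqv: "eqv X Z \<Longrightarrow> hm X \<Longrightarrow> hiso X Z"
  using hiso_refl[of X] unfolding hiso_def hhom_def ghom_def by (auto simp: eqv_def)

lemma rep_of_eqv: "rep_of M X \<Longrightarrow> eqv X (am M)"
  using n2 hm_Y1[of X] by (auto simp: rep_of_def eqv_def am_def)

lemma rep_of_iso: "rep_of M X \<Longrightarrow> hiso X (am M)"
  using rep_of_eqv hiso_eqv by (auto simp: rep_of_def)

lemma rep_of_am: assumes "is_module H M" shows "rep_of M (am M)"
proof -
  define X where "X b = opr (snd M b)" for b
  have n1: "Suc 0 < n" using n2 by simp
  have c: "\<And>i h. i < n \<Longrightarrow> h \<in> carrier G \<Longrightarrow> snd M (i, h) \<in> carrier_mat (fst M) (fst M)"
    and "OA Ha X (bvec (0, \<one>)) = pr (fst M)"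
    and "\<And>i h j h'. i < n \<Longrightarrow> h \<in> carrier G \<Longrightarrow> j < n \<Longrightarrow> h' \<in> carrier G \<Longrightarrow> X (i, h) * X (j, h') = OA Ha X (prd Ha (i, h) (j, h'))"
    using assms unfolding is_module_iff OA_H by (auto simp: X_def[abs_def])
  then have 1: "X (0, \<one>) = pr (fst M)"
    and m: "\<And>i h j h'. i < n \<Longrightarrow> h \<in> carrier G \<Longrightarrow> j < n \<Longrightarrow> h' \<in> carrier G \<Longrightarrow> X (i, h) * X (j, h') = scl (inverse (\<chi> h) ^ j)
    (if i + j < n then X (i + j, h \<otimes> h') else X (i + j - n, g [^] n \<otimes> (h \<otimes> h')) - X (i + j - n, h \<otimes> h'))"
    by (simp_all add: OA_prd OA_bvec)
  let ?Y = "X (1, \<one>)"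
  have YX: "?Y ^ i * X (0, h) = X (i, h)" if "i < n" "h \<in> carrier G" for i h
    using that
  proof (induction i)
    case (Suc i) then show ?case using n1 by (simp add: m mult.assoc)
  qed simp
  have Y1: "?Y * X (0, \<one>) = ?Y" "X (0, \<one>) * ?Y = ?Y" using n1 by (simp_all add: m)
  have "?Y ^ n = ?Y ^ n * X (0, \<one>)" by (rule power_absorb[OF Y1(1) n_pos, symmetric])
  also have "\<dots> = ?Y * (?Y ^ (n - 1) * X (0, \<one>))" using n1 by (simp flip: mult.assoc power_Suc)
  also have "\<dots> = X (0, g [^] n) - X (0, \<one>)" using n1 YX[of "n - 1" \<one>] by (simp add: m)
  finally have Yn: "?Y ^ n = X (0, g [^] n) - X (0, \<one>)" .
  have "hm (am M)"
    unfolding hm_def gm_def am_def using n1 Y1 Yn chi_nz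
    by (auto simp: m 1 finr_pr simp flip: X_def)
  then show ?thesis using c YX 1 by (auto simp: rep_of_def am_def X_def)
qed

lemma hm_am: "is_module H M \<Longrightarrow> hm (am M)" using rep_of_am by (auto simp: rep_of_def)

text \<open>Splitting the projection \<open>fst X \<one>\<close> gives coordinates on the underlying
  space. Conjugation by them moves the module to the first d monomials, where operators are
  matrices.\<close>

lemma realize: assumes X: "hm X" obtains M Z where "rep_of M Z" "hiso X Z"
proof -
  have "fst X \<one> * fst X \<one> = fst X \<one>" "finr (fst X \<one>)" using hm_gm[OF X] by (auto simp: gm_def)
  from idempotent_split[OF this] obtain d T S where
    TS: "T * S = fst X \<one>" "S * T = pr d" "T * pr d = T" "pr d * S = S" by blast
  have S1: "S * fst X \<one> = S" unfolding TS(1)[symmetric] by (simp add: mult_assoc_cong[OF TS(2)] TS(4))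
  note c = hm_conj[OF X TS(1) S1]
  define Z where "Z = (\<lambda>h. S * fst X h * T, S * snd X * T)"
  define M where "M = (d, \<lambda>(i, h). tm d d (snd Z ^ i * fst Z h))"
  have Z: "hm Z" "hiso X Z" "fst Z \<one> = pr d" using c TS by (simp_all add: Z_def)
  have "pr d * (snd Z ^ i * fst Z h) = snd Z ^ i * fst Z h" "snd Z ^ i * fst Z h * pr d = snd Z ^ i * fst Z h" if "h \<in> carrier G" for i h
  proof -
    have "pr d * snd Z ^ i = snd Z ^ i * pr d" using hm_Yh_pow[OF Z(1) one_closed, of i] Z(3) by simp
    then show "pr d * (snd Z ^ i * fst Z h) = snd Z ^ i * fst Z h" "snd Z ^ i * fst Z h * pr d = snd Z ^ i * fst Z h"
      using gm_one[OF hm_gm[OF Z(1)] that] Z(3) by (simp_all add: mult.assoc mult_assoc_cong[of "pr d"])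
  qed
  then have "rep_of M Z" unfolding rep_of_def using Z by (auto simp: M_def opr_tm)
  with Z(2) show ?thesis using that by blast
qed

lemma mod_hom_iff:
  assumes M: "is_module H M" and N: "is_module H N" and T: "T \<in> carrier_mat (fst N) (fst M)"
  shows "T \<in> mod_hom H M N \<longleftrightarrow> hhom (am M) (am N) (opr T)"
proof -
  have r: "rep_of M (am M)" "rep_of N (am N)" using M N by (simp_all add: rep_of_am)
  have eq: "T * snd M (i, h) = snd N (i, h) * T \<longleftrightarrow> opr T * (snd (am M) ^ i * fst (am M) h) = snd (am N) ^ i * fst (am N) h * opr T"
    if "i < n" "h \<in> carrier G" for i h
  proof -
    have c: "snd M (i, h) \<in> carrier_mat (fst M) (fst M)" "snd N (i, h) \<in> carrier_mat (fst N) (fst N)"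
      and o: "opr (snd M (i, h)) = snd (am M) ^ i * fst (am M) h" "opr (snd N (i, h)) = snd (am N) ^ i * fst (am N) h"
      using r that by (auto simp: rep_of_def)
    have "opr (T * snd M (i, h)) = opr T * opr (snd M (i, h))" "opr (snd N (i, h) * T) = opr (snd N (i, h)) * opr T"
      using T c by (auto intro!: opr_mult)
    moreover have "T * snd M (i, h) \<in> carrier_mat (fst N) (fst M)" "snd N (i, h) * T \<in> carrier_mat (fst N) (fst M)"
      using T c by auto
    ultimately show ?thesis using opr_inj by (metis o)
  qed
  have T1: "opr T * fst (am M) \<one> = opr T" "fst (am N) \<one> * opr T = opr T" using r opr_pr[OF T] by (auto simp: rep_of_def)
  show ?thesis
  proof
    assume "T \<in> mod_hom H M N"
    then have *: "opr T * (snd (am M) ^ i * fst (am M) h) = snd (am N) ^ i * fst (am N) h * opr T" if "i < n" "h \<in> carrier G" for i h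
      using that eq by (auto simp: mod_hom_def)
    have "opr T * fst (am M) h = fst (am N) h * opr T" if "h \<in> carrier G" for h using *[of 0 h] that by simp
    moreover have "opr T * snd (am M) = snd (am N) * opr T"
      using *[of 1 \<one>] n2 hm_Y1[OF hm_am[OF M]] hm_Y1[OF hm_am[OF N]] by simp
    ultimately show "hhom (am M) (am N) (opr T)" using T1 by (auto simp: hhom_def ghom_def)
  next
    assume h: "hhom (am M) (am N) (opr T)"
    have "T * snd M (i, h') = snd N (i, h') * T" if "i < n" "h' \<in> carrier G" for i h'
      using that by (simp add: eq mult.assoc mult_assoc_cong[OF hhom_Y_pow[OF h]] hhom_h[OF h])
    then show "T \<in> mod_hom H M N" using T by (auto simp: mod_hom_def)
  qed
qed

lemma hhom_imp_mod_hom: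
  assumes M: "is_module H M" and N: "is_module H N" and T: "hhom (am M) (am N) T"
  shows "tm (fst N) (fst M) T \<in> mod_hom H M N" "opr (tm (fst N) (fst M) T) = T"
proof -
  have r: "rep_of M (am M)" "rep_of N (am N)" using M N by (simp_all add: rep_of_am)
  show o: "opr (tm (fst N) (fst M) T) = T"
    using hhom_1[OF T] hhom_1'[OF T] r by (intro opr_tm) (auto simp: rep_of_def)
  show "tm (fst N) (fst M) T \<in> mod_hom H M N" using T by (simp add: mod_hom_iff[OF M N] o)
qed

lemma mod_iso_iff:
  assumes M: "is_module H M" and N: "is_module H N"
  shows "mod_iso H M N \<longleftrightarrow> hiso (am M) (am N)"
proof -
  have 1: "fst (am M) \<one> = pr (fst M)" "fst (am N) \<one> = pr (fst N)" using rep_of_am M N by (auto simp: rep_of_def)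
  have c: "T * S = 1\<^sub>m (fst N) \<longleftrightarrow> opr T * opr S = pr (fst N)" "S * T = 1\<^sub>m (fst M) \<longleftrightarrow> opr S * opr T = pr (fst M)"
    if "T \<in> carrier_mat (fst N) (fst M)" "S \<in> carrier_mat (fst M) (fst N)" for T S
  proof -
    have "opr (T * S) = opr T * opr S" "opr (S * T) = opr S * opr T" using that by (auto intro!: opr_mult)
    moreover have "T * S \<in> carrier_mat (fst N) (fst N)" "S * T \<in> carrier_mat (fst M) (fst M)" using that by auto
    ultimately show "T * S = 1\<^sub>m (fst N) \<longleftrightarrow> opr T * opr S = pr (fst N)" "S * T = 1\<^sub>m (fst M) \<longleftrightarrow> opr S * opr T = pr (fst M)"
      using opr_inj one_carrier_mat by (metis opr_one)+
  qed
  show ?thesis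
  proof
    assume "mod_iso H M N"
    then obtain T S where *: "T \<in> mod_hom H M N" "S \<in> mod_hom H N M" "T * S = 1\<^sub>m (fst N)" "S * T = 1\<^sub>m (fst M)"
      unfolding mod_iso_def by blast
    then have "T \<in> carrier_mat (fst N) (fst M)" "S \<in> carrier_mat (fst M) (fst N)" by (auto simp: mod_hom_def)
    with * show "hiso (am M) (am N)"
      by (intro hisoI[of _ _ "opr T" "opr S"]) (simp_all add: c 1 mod_hom_iff M N)
  next
    assume "hiso (am M) (am N)"
    then obtain T S where *: "hhom (am M) (am N) T" "hhom (am N) (am M) S" "S * T = pr (fst M)" "T * S = pr (fst N)"
      unfolding hiso_def 1 by blast
    note t = hhom_imp_mod_hom[OF M N *(1)] hhom_imp_mod_hom[OF N M *(2)]
    then show "mod_iso H M N" unfolding mod_iso_def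
      by (intro bexI[OF _ t(1)] bexI[OF _ t(3)]) (simp add: c t *)
  qed
qed

text \<open>The common route from matrices to operators for \<open>tensor\<close>,
  \<open>dsum\<close> and \<open>Mmod\<close>: each of them is an operator module X written in the
  coordinates S, with inverse T.\<close>

lemma rep_of_conj:
  assumes X: "hm X" and TS: "T * S = fst X \<one>" "S * T = pr (fst M)" and S1: "S * fst X \<one> = S"
    and M: "\<And>i h. i < n \<Longrightarrow> h \<in> carrier G \<Longrightarrow> snd M (i, h) \<in> carrier_mat (fst M) (fst M) \<and>
      opr (snd M (i, h)) = S * (snd X ^ i * fst X h) * T"
  shows "is_module H M" "hiso (am M) X"
proof -
  note c = hm_conj[OF X TS(1) S1]
  let ?Z = "(\<lambda>h. S * fst X h * T, S * snd X * T)"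
  have "snd ?Z ^ i * fst ?Z h = S * (snd X ^ i * fst X h) * T" if "h \<in> carrier G" for i h
  proof -
    have "snd ?Z ^ i * fst ?Z h = snd ?Z ^ i * fst ?Z \<one> * fst ?Z h"
      using gm_one(1)[OF hm_gm[OF c(1)] that] by (simp add: mult.assoc)
    also have "\<dots> = S * snd X ^ i * T * fst ?Z h" by (simp only: c(4))
    also have "\<dots> = S * snd X ^ i * T * (S * fst X h * T)" by (simp only: fst_conv)
    also have "\<dots> = S * snd X ^ i * (T * S) * fst X h * T" by (simp only: mult.assoc)
    finally show ?thesis using gm_one(1)[OF hm_gm[OF X] that] by (simp add: TS(1) mult.assoc mult_assoc_cong[OF gm_one(1)[OF hm_gm[OF X] that]])
  qed
  then have "rep_of M ?Z" unfolding rep_of_def using c TS M by auto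
  then show "is_module H M" "hiso (am M) X"
    using rep_of_module hiso_sym[OF hiso_trans[OF c(2) rep_of_iso]] by blast+
qed

lemma tensor_am:
  assumes M: "is_module H M" and N: "is_module H N"
  shows "is_module H (tensor H M N)" "hiso (am (tensor H M N)) (ht (am M) (am N))"
proof -
  define X where "X b = opr (snd M b)" for b
  define Z where "Z b = opr (snd N b)" for b
  define XZ where "XZ = (\<lambda>(b, c). tp (X b) (Z c))"
  have cM: "snd M b \<in> carrier_mat (fst M) (fst M)" and cN: "snd N b \<in> carrier_mat (fst N) (fst N)" if "b \<in> bas H" for b
    using that M N by (auto simp: is_module_def)
  have mX: "X b * X c = OA Ha X (prd Ha b c)" and mZ: "Z b * Z c = OA Ha Z (prd Ha b c)" if "b \<in> bas Ha" "c \<in> bas Ha" for b c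
    using that M N unfolding is_module_iff OA_H by (auto simp: X_def[abs_def] Z_def[abs_def])
  have vt: "OA HT XZ (vtensor u v) = tp (OA Ha X u) (OA Ha Z v)" for u v
  proof -
    have "tp (OA Ha X u) (OA Ha Z v) = (\<Sum>b\<in>bas Ha. \<Sum>c\<in>bas Ha. scl (u b * v c) (tp (X b) (Z c)))"
      unfolding OA_def tp_sum(1) unfolding tp_sum(2) by (simp add: tp_linear mult.commute)
    then show ?thesis
      by (simp add: OA_def XZ_def alg_tensor_def vtensor_def sum.cartesian_product split_def)
  qed
  have m: "XZ b * XZ c = OA HT XZ (prd HT b c)" if "b \<in> bas HT" "c \<in> bas HT" for b c
  proof -
    obtain b1 b2 c1 c2 where [simp]: "b = (b1, b2)" "c = (c1, c2)" by (metis surj_pair)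
    have "prd HT b c = vtensor (prd Ha b1 c1) (prd Ha b2 c2)" by (simp add: alg_tensor_def)
    moreover have "b1 \<in> bas Ha" "b2 \<in> bas Ha" "c1 \<in> bas Ha" "c2 \<in> bas Ha"
      using that by (auto simp: alg_tensor_def)
    ultimately show ?thesis by (simp only: vt) (simp add: XZ_def tp_mult mX mZ)
  qed
  have rM: "rep_of M (am M)" and rN: "rep_of N (am N)" using M N by (simp_all add: rep_of_am)
  have am1: "X (0, h) = fst (am M) h" "Z (0, h) = fst (am N) h" "X (1, \<one>) = snd (am M)" "Z (1, \<one>) = snd (am N)" for h
    by (simp_all add: am_def X_def Z_def)
  have b: "OA Ha W (bvec (m, k)) = W (m, k)" if "m < n" "k \<in> carrier G" for m k W
    using that by (intro OA_bvec) auto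
  have am': "OA HT XZ (amult HT u v) = OA HT XZ u * OA HT XZ v" for u v
    by (rule OA_amult) (rule m)
  have ap': "OA HT XZ (apow HT u i) = OA HT XZ (unt HT) * OA HT XZ u ^ i" for u i
    by (rule OA_apow) (rule m)
  let ?T = "ht (am M) (am N)"
  have T: "hm ?T" using M N by (intro hm_ht hm_am)
  have n1: "1 < n" using n2 by simp
  \<comment> \<open>The coproduct of y^i h is built from products in H \<otimes> H, whose action
    through \<open>XZ\<close> is multiplicative. So it acts by the i-th power of the action of
    \<Delta>(y), times that of h \<otimes> h.\<close>
  have cm: "OA HT XZ (comul H (i, h)) = snd ?T ^ i * fst ?T h" if h: "h \<in> carrier G" for i h
  proof -
    have u: "unt HT = vtensor (bvec (0, \<one>)) (bvec (0, \<one>))" by (simp add: alg_tensor_def)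
    have "OA HT XZ (comul H (i, h)) = fst ?T \<one> * snd ?T ^ i * fst ?T h"
      using h n1 unfolding comul_H am' ap' OA_linear vt u
      by (simp add: b am1 am1(3,4)[unfolded One_nat_def] ht_def gt_def)
    also have "\<dots> = snd ?T ^ i * fst ?T h"
      using hm_Yh_pow[OF T one_closed, of i, symmetric] gm_one(1)[OF hm_gm[OF T] h] by (simp add: mult.assoc)
    finally show ?thesis .
  qed
  let ?d = "fst M" and ?f = "fst N"
  let ?S = "pr (?d * ?f) * unr (\<kappa> ?f)" and ?U = "ren (\<kappa> ?f) * pr (?d * ?f)"
  have op: "opr (snd (tensor H M N) b) = ?S * OA HT XZ (comul H b) * ?U" for b
  proof -
    have "opr (snd (tensor H M N) b) = (\<Sum>x\<in>bas H \<times> bas H. scl (comul H b x)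
        (opr (mat (?d * ?f) (?d * ?f) (\<lambda>(r, s). snd M (fst x) $$ (r div ?f, s div ?f) * snd N (snd x) $$ (r mod ?f, s mod ?f)))))"
      unfolding tensor_def snd_conv split_def mult.assoc prod.collapse by (rule opr_sum[unfolded split_def])
    also have "\<dots> = (\<Sum>x\<in>bas H \<times> bas H. scl (comul H b x) (?S * XZ x * ?U))"
    proof (intro sum.cong refl arg_cong[of _ _ "scl _"])
      fix x assume "x \<in> bas H \<times> bas H"
      then have x: "fst x \<in> bas H" "snd x \<in> bas H" by auto
      have "?S * tp (opr (snd M (fst x))) (opr (snd N (snd x))) * ?U = opr (mat (?d * ?f) (?d * ?f) (\<lambda>(r, s). snd M (fst x) $$ (r div ?f, s div ?f) * snd N (snd x) $$ (r mod ?f, s mod ?f)))"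
        by (rule unr_\<kappa>_tp[OF cM cN]) (use x in auto)
      then show "opr (mat (?d * ?f) (?d * ?f) (\<lambda>(r, s). snd M (fst x) $$ (r div ?f, s div ?f) * snd N (snd x) $$ (r mod ?f, s mod ?f))) = ?S * XZ x * ?U"
        by (simp add: XZ_def X_def Z_def split_def)
    qed
    also have "\<dots> = ?S * OA HT XZ (comul H b) * ?U"
      unfolding OA_def sum_distrib_left sum_distrib_right by (simp add: alg_tensor_def)
    finally show ?thesis .
  qed
  have TS: "?U * ?S = fst ?T \<one>" using ren_unr_\<kappa>[of ?f ?d] rM rN by (simp add: fst_ht gt_def rep_of_def)
  have ST: "?S * ?U = pr (fst (tensor H M N))"
    by (simp add: tensor_def mult.assoc mult_assoc_cong[OF unr_ren[OF inj_\<kappa>]] pr_pr)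
  have S1: "?S * fst ?T \<one> = ?S"
    unfolding TS[symmetric] by (simp add: mult.assoc mult_assoc_cong[OF unr_ren[OF inj_\<kappa>]] pr_pr mult_assoc_cong[OF pr_pr])
  have c: "snd (tensor H M N) b \<in> carrier_mat (fst (tensor H M N)) (fst (tensor H M N))" for b
    by (simp add: tensor_def)
  show "is_module H (tensor H M N)" "hiso (am (tensor H M N)) ?T"
    using rep_of_conj[OF T TS ST S1] c by (simp_all add: op cm)
qed

end

lemma coeff_ren_add: "coeff (ap (ren ((+) d)) p) i = (if d \<le> i then coeff p (i - d) else 0)"
proof -
  have *: "coeff (ap (ren ((+) d)) (e j)) i = (if d \<le> i then coeff (e j) (i - d) else 0)" for j by auto
  show ?thesis
    by (subst (1 2) poly_expand[of p], simp only: ap_sum ap_smult coeff_sum coeff_smult *) (simp add: sum_distrib_left)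
qed

lemma unr_add: "ap (unr ((+) d)) (e j) = (if d \<le> j then e (j - d) else 0)"
proof (cases "d \<le> j")
  case True
  then have "j = d + (j - d)" by simp
  then show ?thesis using ap_unr(1)[of "(+) d" "j - d"] True by simp
next
  case False
  then have "j \<notin> range ((+) d)" by auto
  then show ?thesis using False ap_unr(2)[of "(+) d" j] by simp
qed

lemma opr_four_block:
  assumes "A \<in> carrier_mat d d" "B \<in> carrier_mat f f"
  shows "opr (four_block_mat A (0\<^sub>m d f) (0\<^sub>m f d) B) = opr A + ren ((+) d) * (opr B * unr ((+) d))"
  by (rule lop_coeffI) (use assms in \<open>auto simp: coeff_opr coeff_ren_add unr_add\<close>)

lemma pr_ren_add: "pr d * ren ((+) d) = 0" "unr ((+) d) * pr d = 0" "unr ((+) d) * ren ((+) d) = 1"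
  "pr d + ren ((+) d) * (pr f * unr ((+) d)) = pr (d + f)"
  by (rule lop_eqI, simp) (rule lop_eqI, simp add: unr_add, rule unr_ren, simp, rule lop_eqI, auto simp: unr_add)

lemma lpt2_e: "lpt2 (e t) = inc t" by (rule lop_eqI) (simp add: ap_lpt)

context datum
begin

lemma ds_pow: "snd (ds X Z) ^ i * fst (ds X Z) h =
    inc 0 * (snd X ^ i * (fst X h * prj 0)) + inc 1 * (snd Z ^ i * (fst Z h * prj 1))"
proof (induction i)
  case (Suc i)
  have "snd (ds X Z) ^ Suc i * fst (ds X Z) h = snd (ds X Z) * (snd (ds X Z) ^ i * fst (ds X Z) h)" by (simp add: mult.assoc)
  then show ?case unfolding Suc by (simp add: ds_def ps)
qed (simp add: ds_def)

lemma dsum_am: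
  assumes M: "is_module H M" and N: "is_module H N"
  shows "is_module H (dsum M N)" "hiso (am (dsum M N)) (ds (am M) (am N))"
proof -
  let ?d = "fst M" and ?f = "fst N" and ?X = "ds (am M) (am N)"
  let ?sh = "ren ((+) ?d)" and ?sh' = "unr ((+) ?d)"
  have rM: "rep_of M (am M)" and rN: "rep_of N (am N)" using M N by (simp_all add: rep_of_am)
  have 1: "fst (am M) \<one> = pr ?d" "fst (am N) \<one> = pr ?f" using rM rN by (simp_all add: rep_of_def)
  define S :: "'k lop" where "S = pr ?d * prj 0 + ?sh * (pr ?f * prj 1)"
  define T :: "'k lop" where "T = inc 0 * pr ?d + inc 1 * (pr ?f * ?sh')"
  note z = mult_assoc_cong[OF pr_ren_add(1)] mult_assoc_cong[OF pr_ren_add(2)] mult_assoc_cong[OF pr_ren_add(3)]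
    mult_assoc_cong[OF pr_pr] pr_pr pr_ren_add
  have X: "hm ?X" using M N by (simp add: hm_ds hm_am)
  have "T * S = fst ?X \<one>" by (simp add: S_def T_def ps z) (simp add: ds_def 1)
  moreover have "S * T = pr (fst (dsum M N))" by (simp add: S_def T_def ps z dsum_def)
  moreover have "S * fst ?X \<one> = S" by (simp add: ds_def 1 S_def ps z)
  moreover have "snd (dsum M N) (i, h) \<in> carrier_mat (fst (dsum M N)) (fst (dsum M N)) \<and>
      opr (snd (dsum M N) (i, h)) = S * (snd ?X ^ i * fst ?X h) * T" if "i < n" "h \<in> carrier G" for i h
  proof -
    have c: "snd M (i, h) \<in> carrier_mat ?d ?d" "snd N (i, h) \<in> carrier_mat ?f ?f"
      and o: "opr (snd M (i, h)) = snd (am M) ^ i * fst (am M) h" "opr (snd N (i, h)) = snd (am N) ^ i * fst (am N) h"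
      using rM rN that by (auto simp: rep_of_def)
    have p: "pr ?d * (snd (am M) ^ i * (fst (am M) h * A)) = snd (am M) ^ i * (fst (am M) h * A)"
      "pr ?f * (snd (am N) ^ i * (fst (am N) h * A)) = snd (am N) ^ i * (fst (am N) h * A)"
      "snd (am M) ^ i * (fst (am M) h * (pr ?d * A)) = snd (am M) ^ i * (fst (am M) h * A)"
      "snd (am N) ^ i * (fst (am N) h * (pr ?f * A)) = snd (am N) ^ i * (fst (am N) h * A)" for A
      using mult_assoc_cong[OF opr_pr(1)[OF c(1)], of A] mult_assoc_cong[OF opr_pr(1)[OF c(2)], of A]
        mult_assoc_cong[OF opr_pr(2)[OF c(1)], of A] mult_assoc_cong[OF opr_pr(2)[OF c(2)], of A]
      by (simp_all add: o mult.assoc)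
    have "opr (snd (dsum M N) (i, h)) = snd (am M) ^ i * fst (am M) h + ?sh * (snd (am N) ^ i * fst (am N) h * ?sh')"
      by (simp add: dsum_def opr_four_block[OF c] o)
    also have "\<dots> = S * (snd ?X ^ i * fst ?X h) * T"
      unfolding ds_pow using p[of 1] by (simp add: S_def T_def ps z p)
    finally show ?thesis using c by (auto simp: dsum_def)
  qed
  ultimately show "is_module H (dsum M N)" "hiso (am (dsum M N)) ?X"
    using rep_of_conj[OF X, of T S "dsum M N"] by blast+
qed

lemma triv_am: "is_module H (triv H)" "hiso (am (triv H)) tv"
proof -
  have o: "opr (mat 1 1 (\<lambda>_. c)) = scl c (pr 1)" for c :: 'k
    by (rule lop_coeffI) (auto simp: coeff_opr)
  have "rep_of (triv H) tv"
    unfolding rep_of_def using hm_tv o[unfolded One_nat_def] by (auto simp: triv_def tv_def power_0_left)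
  then show "is_module H (triv H)" "hiso (am (triv H)) tv"
    using rep_of_module rep_of_iso hiso_sym by blast+
qed

subsection \<open>Modules over the group algebra\<close>

abbreviation KG :: "('a, 'k) falg" where "KG \<equiv> group_alg G"

definition gr :: "('a, 'k) rep \<Rightarrow> 'a \<Rightarrow> 'k lop" where "gr V = (\<lambda>h. opr (snd V h))"

lemma KG_module_iff: "is_module KG V \<longleftrightarrow> (\<forall>h\<in>carrier G. snd V h \<in> carrier_mat (fst V) (fst V)) \<and>
    gr V \<one> = pr (fst V) \<and> (\<forall>h\<in>carrier G. \<forall>h'\<in>carrier G. gr V h * gr V h' = gr V (h \<otimes> h'))"
proof -
  have "OA KG X (bvec h) = X h" if "h \<in> carrier G" for X h
    using fin that by (intro OA_bvec) (auto simp: group_alg_def)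
  then show ?thesis unfolding is_module_iff by (simp add: gr_def) (simp add: group_alg_def)
qed

lemma gm_gr: "is_module KG V \<Longrightarrow> gm (gr V)"
  by (auto simp: KG_module_iff gm_def finr_pr)

lemma gr_1: "is_module KG V \<Longrightarrow> gr V \<one> = pr (fst V)"
  by (auto simp: KG_module_iff)

lemma Mmod_am:
  assumes V: "is_module KG V" and k: "cyc_ok k (gr V)" and tr: "gr V (g [^] n) = gr V \<one>"
  shows "is_module H (Mmod \<chi> k V)" "hiso (am (Mmod \<chi> k V)) (cyc k (gr V))"
proof -
  let ?d = "fst V" and ?C = "cyc k (gr V)"
  define U :: "'k lop" where "U = ren (\<kappa> ?d) * pr (k * ?d)"
  define S :: "'k lop" where "S = pr (k * ?d) * unr (\<kappa> ?d)"
  have C: "hm ?C" by (rule hm_cyc[OF k])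
  have cV: "snd V h \<in> carrier_mat ?d ?d" if "h \<in> carrier G" for h using V that by (auto simp: KG_module_iff)
  have k1: "1 \<le> k" using k by (simp add: cyc_ok_def)
  \<comment> \<open>In blocks of size dim V the matrices of \<open>Mmod\<close> are Kronecker
    products: of \<open>Dg h\<close> with the action of h on V, and of the nilpotent shift
    \<open>J\<close> with an identity matrix.\<close>
  define Dg where "Dg h = mat k k (\<lambda>(r, s). if r = s then inverse (\<chi> h) ^ r else 0)" for h
  define J :: "'k mat" where "J = mat k k (\<lambda>(r, s). if r = Suc s then 1 else 0)"
  have eD: "ap (opr (Dg h)) (e t) = (if t < k then smult (inverse (\<chi> h) ^ t) (e t) else 0)" for h t
    by (rule poly_eqI) (auto simp: coeff_opr Dg_def)
  have eJ: "ap (opr J) (e t) = (if Suc t < k then e (Suc t) else 0)" for t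
    by (rule poly_eqI) (auto simp: coeff_opr J_def)
  have l0: "lpt2 0 = 0" by (rule lop_eqI) (simp add: ap_lpt pt_linear)
  have ls: "lpt2 (smult c p) = scl c (lpt2 p)" for c p by (rule lop_eqI) (simp add: ap_lpt pt_linear)
  have fC: "fst ?C h = tp (opr (Dg h)) (opr (snd V h))" for h
    by (rule lop_eqI_inc) (simp add: fst_cyc_inc tp_inc eD l0 ls lpt2_e gr_def)
  have sC: "snd ?C = tp (opr J) (opr (1\<^sub>m ?d))"
    by (rule lop_eqI_inc) (auto simp: snd_cyc_inc[OF k1] tp_inc eJ l0 lpt2_e gr_1[OF V] tr opr_one)
  have D1: "Dg \<one> = 1\<^sub>m k" by (rule eq_matI) (auto simp: Dg_def)
  have US: "U * S = fst ?C \<one>"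
  proof -
    have "opr (snd V \<one>) = pr ?d" using gr_1[OF V] by (simp add: gr_def)
    then show ?thesis using ren_unr_\<kappa>[of ?d k] by (simp add: U_def S_def fC D1 opr_one)
  qed
  have SU: "S * U = pr (k * ?d)"
    by (simp add: U_def S_def mult.assoc mult_assoc_cong[OF unr_ren[OF inj_\<kappa>]] pr_pr)
  have S1: "S * fst ?C \<one> = S"
    unfolding US[symmetric] by (simp add: mult_assoc_cong[OF SU]) (simp add: S_def mult_assoc_cong[OF pr_pr])
  define Y where "Y = mat (k * ?d) (k * ?d) (\<lambda>(r, s). if r = s + ?d then 1 else (0 :: 'k))"
  define D where "D h = mat (k * ?d) (k * ?d) (\<lambda>(r, s). if r div ?d = s div ?d
             then inverse (\<chi> h) ^ (r div ?d) * (snd V h $$ (r mod ?d, s mod ?d)) else 0)" for h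
  have idx: "i div ?d < k \<and> i mod ?d < ?d" if "i < k * ?d" for i
    using that less_mult_imp_div_less[of i k ?d] by (cases ?d) auto
  have oD: "opr (D h) = S * fst ?C h * U" if h: "h \<in> carrier G" for h
  proof -
    have "S * fst ?C h * U = opr (mat (k * ?d) (k * ?d) (\<lambda>(r, s). Dg h $$ (r div ?d, s div ?d) * snd V h $$ (r mod ?d, s mod ?d)))"
      unfolding fC S_def U_def by (rule unr_\<kappa>_tp[OF _ cV[OF h]]) (simp add: Dg_def)
    moreover have "mat (k * ?d) (k * ?d) (\<lambda>(r, s). Dg h $$ (r div ?d, s div ?d) * snd V h $$ (r mod ?d, s mod ?d)) = D h"
      by (rule eq_matI) (auto simp: Dg_def D_def idx)
    ultimately show ?thesis by simp
  qed
  have oY: "opr Y = S * snd ?C * U"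
  proof -
    have "S * snd ?C * U = opr (mat (k * ?d) (k * ?d) (\<lambda>(r, s). J $$ (r div ?d, s div ?d) * 1\<^sub>m ?d $$ (r mod ?d, s mod ?d)))"
      unfolding sC S_def U_def by (rule unr_\<kappa>_tp) (simp_all add: J_def)
    moreover have "mat (k * ?d) (k * ?d) (\<lambda>(r, s). J $$ (r div ?d, s div ?d) * 1\<^sub>m ?d $$ (r mod ?d, s mod ?d)) = Y"
    proof (rule eq_matI)
      fix r s assume "r < dim_row Y" "s < dim_col Y"
      then have rs: "r < k * ?d" "s < k * ?d" by (simp_all add: Y_def)
      have "r div ?d = Suc (s div ?d) \<and> r mod ?d = s mod ?d \<longleftrightarrow> r = s + ?d"
      proof
        assume a: "r div ?d = Suc (s div ?d) \<and> r mod ?d = s mod ?d"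
        have "r = Suc (s div ?d) * ?d + s mod ?d" using a div_mult_mod_eq[of r ?d] by simp
        then show "r = s + ?d" using div_mult_mod_eq[of s ?d] by simp
      qed (use idx[OF rs(1)] in auto)
      then show "mat (k * ?d) (k * ?d) (\<lambda>(r, s). J $$ (r div ?d, s div ?d) * 1\<^sub>m ?d $$ (r mod ?d, s mod ?d)) $$ (r, s) = Y $$ (r, s)"
        using rs idx[OF rs(1)] idx[OF rs(2)] by (auto simp: J_def Y_def)
    qed (simp_all add: Y_def)
    ultimately show ?thesis by simp
  qed
  have M: "fst (Mmod \<chi> k V) = k * ?d" "snd (Mmod \<chi> k V) (i, h) = Y ^\<^sub>m i * D h" for i h
    by (simp_all add: Mmod_def Let_def Y_def D_def)
  have Yc: "Y ^\<^sub>m i \<in> carrier_mat (k * ?d) (k * ?d)" for i by (intro pow_carrier_mat) (simp add: Y_def)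
  have Dc: "D h \<in> carrier_mat (k * ?d) (k * ?d)" for h by (simp add: D_def)
  have oYD: "opr (Y ^\<^sub>m i * D h) = S * (snd ?C ^ i * fst ?C h) * U" if h: "h \<in> carrier G" for i h
  proof -
    \<comment> \<open>The zeroth powers differ: on matrices it is the identity of size k * dim V, on
      operators that of the whole space. They agree after multiplication by such an X.\<close>
    have *: "opr (Y ^\<^sub>m i) * X = opr Y ^ i * X" if "pr (k * ?d) * X = X" for X
      using that
    proof (induction i arbitrary: X)
      case 0 then show ?case by (simp add: opr_one Y_def)
    next
      case (Suc i)
      have yc: "Y \<in> carrier_mat (k * ?d) (k * ?d)" by (simp add: Y_def)
      have "opr (Y ^\<^sub>m Suc i) = opr (Y ^\<^sub>m i) * opr Y" using Yc[of i] yc by (simp add: opr_mult)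
      moreover have "pr (k * ?d) * (opr Y * X) = opr Y * X" by (simp add: mult_assoc_cong[OF opr_pr(1)[OF yc]])
      ultimately show ?case using Suc by (simp add: mult.assoc power_Suc2 del: power_Suc)
    qed
    have "opr (Y ^\<^sub>m i * D h) = opr Y ^ i * opr (D h)"
      using carrier_matD[OF Yc[of i]] carrier_matD[OF Dc[of h]] *[OF opr_pr(1)[OF Dc[of h]]] by (subst opr_mult) auto
    moreover have "opr Y ^ i * opr (D h) = S * (snd ?C ^ i * fst ?C h) * U"
    proof (induction i)
      case (Suc i)
      have "opr Y ^ Suc i * opr (D h) = opr Y * (opr Y ^ i * opr (D h))" by (simp add: mult.assoc)
      also have "\<dots> = S * snd ?C * (U * S) * (snd ?C ^ i * fst ?C h) * U"
        unfolding Suc by (simp add: oY mult.assoc)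
      finally show ?case by (simp add: US mult.assoc mult_assoc_cong[OF hm_Y1[OF C]])
    qed (simp add: oD[OF h] mult.assoc)
    ultimately show ?thesis by simp
  qed
  have "snd (Mmod \<chi> k V) (i, h) \<in> carrier_mat (fst (Mmod \<chi> k V)) (fst (Mmod \<chi> k V)) \<and>
      opr (snd (Mmod \<chi> k V) (i, h)) = S * (snd ?C ^ i * fst ?C h) * U" if "h \<in> carrier G" for i h
    using mult_carrier_mat[OF Yc Dc] oYD[OF that] by (simp add: M)
  then show "is_module H (Mmod \<chi> k V)" "hiso (am (Mmod \<chi> k V)) ?C"
    using rep_of_conj[OF C US _ S1, of "Mmod \<chi> k V"] SU by (simp_all add: M(1))
qed

end

section \<open>Simple G-modules: Schur's lemma and Maschke's theorem\<close>

definition pv :: "'k::field vec \<Rightarrow> 'k poly" where "pv v = (\<Sum>i<dim_vec v. monom (v $ i) i)"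

lemma coeff_pv: "coeff (pv v) i = (if i < dim_vec v then v $ i else 0)"
  by (simp add: pv_def coeff_sum)

lemma pv_add: "v \<in> carrier_vec d \<Longrightarrow> w \<in> carrier_vec d \<Longrightarrow> pv (v + w) = pv v + pv w"
  by (rule poly_eqI) (auto simp: coeff_pv)

lemma pv_smult: "pv (c \<cdot>\<^sub>v v) = smult c (pv v)"
  by (rule poly_eqI) (auto simp: coeff_pv)

lemma pv_zero: "pv (0\<^sub>v d) = 0"
  by (rule poly_eqI) (auto simp: coeff_pv)

lemma pv_inj: "v \<in> carrier_vec d \<Longrightarrow> w \<in> carrier_vec d \<Longrightarrow> pv v = pv w \<Longrightarrow> v = w"
proof (rule eq_vecI)
  fix i assume "v \<in> carrier_vec d" "w \<in> carrier_vec d" "pv v = pv w" "i < dim_vec w"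
  then show "v $ i = w $ i" using coeff_pv[of v i] coeff_pv[of w i] by auto
qed auto

lemma pv_vec: "pv (vec d (coeff p)) = ap (pr d) p"
  by (rule poly_eqI) (auto simp: coeff_pv coeff_pr)

lemma pr_pv: "v \<in> carrier_vec d \<Longrightarrow> ap (pr d) (pv v) = pv v"
  by (rule poly_eqI) (auto simp: coeff_pv coeff_pr)

lemma opr_pv:
  assumes "A \<in> carrier_mat d d'" "v \<in> carrier_vec d'"
  shows "ap (opr A) (pv v) = pv (A *\<^sub>v v)"
proof -
  have pv: "pv v = (\<Sum>j<d'. smult (v $ j) (e j))" using assms by (simp add: pv_def smult_monom)
  show ?thesis
  proof (rule poly_eqI)
    fix i
    have "coeff (ap (opr A) (pv v)) i = (\<Sum>j<d'. v $ j * (if i < d then A $$ (i, j) else 0))"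
      using assms by (auto simp: pv ap_sum ap_smult coeff_sum coeff_opr intro!: sum.cong)
    also have "\<dots> = coeff (pv (A *\<^sub>v v)) i"
      using assms by (auto simp: coeff_pv scalar_prod_def mult.commute lessThan_atLeast0 intro!: sum.cong)
    finally show "coeff (ap (opr A) (pv v)) i = coeff (pv (A *\<^sub>v v)) i" .
  qed
qed

lemma lop_eq_pvI:
  assumes "A * pr d = A" "B * pr d = B" "\<And>v. v \<in> carrier_vec d \<Longrightarrow> ap A (pv v) = ap B (pv v)"
  shows "A = B"
proof (rule lop_eqI)
  fix i
  have "ap A (ap (pr d) (e i)) = ap B (ap (pr d) (e i))" unfolding pv_vec[symmetric] by (intro assms) simp
  then show "ap A (e i) = ap B (e i)" using lop_fun[OF assms(1), of "e i"] lop_fun[OF assms(2), of "e i"] by simp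
qed

text \<open>For r \<ge> d the operators S and T would be square matrices of size r with
  \<open>S * T\<close> = 1. Then also \<open>T * S\<close> = 1, which makes E the full projection.
  The lemma bounds the dimension of proper summands and yields the invariance of dimension.\<close>

lemma split_rank_less:
  assumes "S * T = pr r" "T * S = (E :: 'k::field lop)" "T * pr r = T" "pr r * S = S" "pr d * E = E" "E * pr d = E" "E \<noteq> pr d"
  shows "r < d"
proof (rule ccontr)
  assume "\<not> r < d"
  then have dr: "min d r = d" "min r d = d" by auto
  have T: "pr d * T = T" "S * pr d = S"
  proof -
    have "E * T = T" unfolding assms(2)[symmetric] mult.assoc assms(1) by (rule assms(3))
    then show "pr d * T = T" using assms(5) by (metis mult.assoc)
    have "S * E = S" unfolding assms(2)[symmetric] mult_assoc_cong[OF assms(1)] by (rule assms(4))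
    then show "S * pr d = S" using assms(6) by (metis mult.assoc)
  qed
  have rd: "pr r * T = T" "S * pr r = S"
    using T by (metis pr_pr dr(2) mult.assoc) (metis T(2) pr_pr dr(1) mult.assoc)
  let ?S = "tm r r S" and ?T = "tm r r T"
  have o: "opr ?S = S" "opr ?T = T" using rd assms by (simp_all add: opr_tm)
  have c: "?S * ?T \<in> carrier_mat r r" "?T * ?S \<in> carrier_mat r r"
    by (rule mult_carrier_mat[OF tm_carrier tm_carrier])+
  have oo: "opr (?S * ?T) = pr r" "opr (?T * ?S) = E"
    by (subst opr_mult, simp_all add: o assms carrier_matD[OF tm_carrier])+
  then have "?S * ?T = 1\<^sub>m r" using opr_inj[OF c(1) one_carrier_mat] by (simp add: opr_one)
  then have "?T * ?S = 1\<^sub>m r" by (rule mat_mult_left_right_inverse[OF tm_carrier tm_carrier])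
  then have "E = pr r" using oo(2) by (simp add: opr_one)
  moreover from this have "E = pr d" using assms(5) by (simp add: pr_pr dr)
  ultimately show False using assms(7) by simp
qed

context datum
begin

lemma simple_KG: "simple_module KG V \<Longrightarrow> is_module KG V"
  by (simp add: simple_module_def)

text \<open>The dichotomy for simple modules as a rule about predicates; it is applied to an
  eigenspace and to a kernel.\<close>

lemma simple_subspace:
  assumes V: "simple_module KG V" and P: "\<And>v w. v \<in> carrier_vec (fst V) \<Longrightarrow> w \<in> carrier_vec (fst V) \<Longrightarrow> P v \<Longrightarrow> P w \<Longrightarrow> P (v + w)"
    "P (0\<^sub>v (fst V))" "\<And>c v. v \<in> carrier_vec (fst V) \<Longrightarrow> P v \<Longrightarrow> P (c \<cdot>\<^sub>v v)"
    "\<And>h v. h \<in> carrier G \<Longrightarrow> v \<in> carrier_vec (fst V) \<Longrightarrow> P v \<Longrightarrow> P (snd V h *\<^sub>v v)"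
  shows "(\<forall>v\<in>carrier_vec (fst V). P v \<longrightarrow> v = 0\<^sub>v (fst V)) \<or> (\<forall>v\<in>carrier_vec (fst V). P v)"
proof -
  let ?W = "{v \<in> carrier_vec (fst V). P v}"
  have c: "snd V h *\<^sub>v v \<in> carrier_vec (fst V)" if "h \<in> carrier G" "v \<in> carrier_vec (fst V)" for h v
    using simple_KG[OF V] that by (auto simp: KG_module_iff intro: mult_mat_vec_carrier)
  have *: "?W \<subseteq> carrier_vec (fst V)" by auto
  have "0\<^sub>v (fst V) \<in> ?W \<and> (\<forall>v\<in>?W. \<forall>w\<in>?W. v + w \<in> ?W) \<and> (\<forall>c. \<forall>v\<in>?W. c \<cdot>\<^sub>v v \<in> ?W) \<and>
      (\<forall>b\<in>bas KG. \<forall>v\<in>?W. snd V b *\<^sub>v v \<in> ?W)"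
    using P c by (auto simp: group_alg_def)
  then have "?W = {0\<^sub>v (fst V)} \<or> ?W = carrier_vec (fst V)"
    using V * unfolding simple_module_def by blast
  then show ?thesis by blast
qed

text \<open>An eigenspace of the central element is a submodule, hence everything. The eigenvalue is
  nonzero because z acts invertibly on a nonzero space.\<close>

lemma schur_central:
  assumes V: "simple_module KG V" and z: "z \<in> carrier G" "\<And>h. h \<in> carrier G \<Longrightarrow> z \<otimes> h = h \<otimes> z"
  obtains c where "snd V z = c \<cdot>\<^sub>m 1\<^sub>m (fst V)" "gr V z = scl c (pr (fst V))" "c \<noteq> 0"
proof -
  let ?d = "fst V" and ?A = "snd V z"
  have M: "is_module KG V" and d: "?d \<noteq> 0" using V by (auto simp: simple_module_def)
  have cV: "snd V h \<in> carrier_mat ?d ?d" if "h \<in> carrier G" for h using M that by (auto simp: KG_module_iff)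
  have A: "?A \<in> carrier_mat ?d ?d" using cV z by auto
  have "degree (char_poly ?A) > 0" using degree_monic_char_poly[OF A] d by simp
  then obtain c where "poly (char_poly ?A) c = 0" using alg_closed_imp_poly_has_root by blast
  then obtain v where v: "v \<in> carrier_vec ?d" "v \<noteq> 0\<^sub>v ?d" "?A *\<^sub>v v = c \<cdot>\<^sub>v v"
    using eigenvalue_root_char_poly[OF A] A by (auto simp: eigenvalue_def eigenvector_def)
  have "(\<forall>v\<in>carrier_vec ?d. ?A *\<^sub>v v = c \<cdot>\<^sub>v v \<longrightarrow> v = 0\<^sub>v ?d) \<or> (\<forall>v\<in>carrier_vec ?d. ?A *\<^sub>v v = c \<cdot>\<^sub>v v)"
  proof (rule simple_subspace[OF V])
    fix h v assume h: "h \<in> carrier G" and v: "v \<in> carrier_vec ?d" "?A *\<^sub>v v = c \<cdot>\<^sub>v v"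
    have "opr (?A * snd V h) = opr ?A * opr (snd V h)" "opr (snd V h * ?A) = opr (snd V h) * opr ?A"
      using cV[OF h] A by (auto intro!: opr_mult)
    moreover have "gr V z * gr V h = gr V h * gr V z" using M h z by (simp add: KG_module_iff)
    ultimately have "opr (?A * snd V h) = opr (snd V h * ?A)" by (simp add: gr_def)
    then have "?A * snd V h = snd V h * ?A"
      using opr_inj[OF mult_carrier_mat[OF A cV[OF h]] mult_carrier_mat[OF cV[OF h] A]] by simp
    then have "?A *\<^sub>v (snd V h *\<^sub>v v) = snd V h *\<^sub>v (?A *\<^sub>v v)"
      using assoc_mult_mat_vec[OF A cV[OF h] v(1)] assoc_mult_mat_vec[OF cV[OF h] A v(1)] by simp
    then show "?A *\<^sub>v (snd V h *\<^sub>v v) = c \<cdot>\<^sub>v (snd V h *\<^sub>v v)"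
      using v cV[OF h] by (simp add: mult_mat_vec)
  qed (use A in \<open>auto simp: mult_add_distrib_mat_vec smult_add_distrib_vec mult_mat_vec smult_smult_assoc mult.commute\<close>)
  with v have all: "\<forall>v\<in>carrier_vec ?d. ?A *\<^sub>v v = c \<cdot>\<^sub>v v" by blast
  have g: "gr V z = scl c (pr ?d)"
  proof (rule lop_eq_pvI)
    show "gr V z * pr ?d = gr V z" using opr_pr(2)[OF A] by (simp add: gr_def)
    show "scl c (pr ?d) * pr ?d = scl c (pr ?d)" by (simp add: pr_pr)
  qed (use all in \<open>simp add: gr_def opr_pv[OF A] pr_pv pv_smult\<close>)
  have s: "opr (c \<cdot>\<^sub>m 1\<^sub>m ?d) = scl c (pr ?d)"
    by (rule lop_coeffI) (auto simp: coeff_opr)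
  have "?A = c \<cdot>\<^sub>m 1\<^sub>m ?d"
    by (rule opr_inj[OF A]) (use g in \<open>simp_all add: gr_def s\<close>)
  moreover have "c \<noteq> 0"
  proof
    assume "c = 0"
    then have "pr ?d = (0 :: 'k lop)" using gm_inv(1)[OF gm_gr[OF M] z(1)] g gr_1[OF M] by simp
    then show False using d pr_inj[of ?d 0, where 'k = 'k] by simp
  qed
  ultimately show ?thesis using g that by blast
qed

lemma sub_KG:
  assumes r: "gm \<rho>" and \<epsilon>: "ghom \<rho> \<rho> \<epsilon>" and TS: "T * S = \<epsilon>" "S * T = pr r" "T * pr r = T" "pr r * S = S"
  shows "is_module KG (r, \<lambda>h. tm r r (S * \<rho> h * T))"
    "ghom (gr (r, \<lambda>h. tm r r (S * \<rho> h * T))) \<rho> T" "ghom \<rho> (gr (r, \<lambda>h. tm r r (S * \<rho> h * T))) S"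
proof -
  let ?V = "(r, \<lambda>h. tm r r (S * \<rho> h * T))"
  have eT: "\<epsilon> * T = T" using TS by (metis mult.assoc)
  have Se: "S * \<epsilon> = S" using TS by (metis mult.assoc)
  have ST': "S * (T * A) = pr r * A" for A using mult_assoc_cong[OF TS(2)] .
  have TS': "T * (S * A) = \<epsilon> * A" for A using mult_assoc_cong[OF TS(1)] .
  have g: "gr ?V h = S * \<rho> h * T" for h
    unfolding gr_def snd_conv using TS by (intro opr_tm) (simp_all add: mult.assoc mult_assoc_cong[OF TS(4)])
  have e: "\<epsilon> * \<rho> h = \<rho> h * \<epsilon>" "\<epsilon> * (\<rho> h * A) = \<rho> h * (\<epsilon> * A)" if "h \<in> carrier G" for h A
    using ghom_h[OF \<epsilon> that] by (simp_all flip: mult.assoc)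
  have T1: "\<rho> \<one> * T = T" using eT ghom_1'[OF \<epsilon>] by (metis mult.assoc)
  have S1: "S * \<rho> \<one> = S" using Se ghom_1[OF \<epsilon>] by (metis mult.assoc)
  have Sr: "S * (\<rho> h * \<epsilon>) = S * \<rho> h" if "h \<in> carrier G" for h
    unfolding ghom_h[OF \<epsilon> that, symmetric] mult_assoc_cong[OF Se] ..
  show "is_module KG ?V"
    unfolding KG_module_iff g
    by (auto simp: mult.assoc T1 TS TS' e eT gm_mult[OF r] mult_assoc_cong[OF gm_mult[OF r]])
  show "ghom (gr ?V) \<rho> T" "ghom \<rho> (gr ?V) S"
    unfolding ghom_def g using T1 S1 Sr by (auto simp: mult.assoc TS TS' e eT S1 Se)
qed

text \<open>Complete reducibility with a marker: the summand is chosen so that a given operator A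
  does not vanish on it, and A will be a power of y. An invariant subspace splits off by averaging,
  A is nonzero on one of the two pieces, and the dimension drops.\<close>

lemma simple_summand:
  assumes "is_module KG V" "A * pr (fst V) \<noteq> 0"
  shows "\<exists>W i p. simple_module KG W \<and> ghom (gr W) (gr V) i \<and> ghom (gr V) (gr W) p \<and> p * i = pr (fst W) \<and> A * i \<noteq> 0"
  using assms
proof (induction "fst V" arbitrary: V A rule: less_induct)
  case less
  let ?d = "fst V"
  note gV = gm_gr[OF less.prems(1)] and r1 = gr_1[OF less.prems(1)]
  have cV: "snd V h \<in> carrier_mat ?d ?d" if "h \<in> carrier G" for h using less.prems(1) that by (auto simp: KG_module_iff)
  have d: "?d \<noteq> 0"
  proof
    assume "?d = 0" then show False using less.prems(2) by simp
  qed
  show ?case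
  proof (cases "simple_module KG V")
    case True
    then show ?thesis using less.prems(2) ghom_id[OF gV] by (intro exI[of _ V] exI[of _ "pr ?d"]) (simp add: r1 pr_pr)
  next
    case False
    then obtain W where W: "W \<subseteq> carrier_vec ?d" "0\<^sub>v ?d \<in> W" "\<forall>v\<in>W. \<forall>w\<in>W. v + w \<in> W" "\<forall>c. \<forall>v\<in>W. c \<cdot>\<^sub>v v \<in> W"
      "\<forall>h\<in>carrier G. \<forall>v\<in>W. snd V h *\<^sub>v v \<in> W" "W \<noteq> {0\<^sub>v ?d}" "W \<noteq> carrier_vec ?d"
      using less.prems(1) d unfolding simple_module_def by (auto simp: group_alg_def)
    have sub: "lvs.subspace (pv ` W)"
      unfolding lvs.subspace_def
    proof (intro conjI ballI allI)
      show "0 \<in> pv ` W" using W(2) pv_zero by (metis imageI)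
      fix x y c assume "x \<in> pv ` W" "y \<in> pv ` W"
      then obtain v w where vw: "x = pv v" "y = pv w" "v \<in> W" "w \<in> W" by auto
      then have "v \<in> carrier_vec ?d" "w \<in> carrier_vec ?d" using W(1) by auto
      then have "x + y = pv (v + w)" using vw by (simp add: pv_add)
      then show "x + y \<in> pv ` W" using vw W(3) by auto
      have "smult c x = pv (c \<cdot>\<^sub>v v)" using vw by (simp add: pv_smult)
      then show "smult c x \<in> pv ` W" using vw W(4) by auto
    qed
    from lop_projection[OF sub] obtain P where P: "\<And>p. ap P p \<in> pv ` W" "\<And>p. p \<in> pv ` W \<Longrightarrow> ap P p = p" by blast
    have inv: "P * (gr V h * P) = gr V h * P" if "h \<in> carrier G" for h
    proof (rule lop_eqI)
      fix i
      obtain v where v: "v \<in> W" "ap P (e i) = pv v" using P(1)[of "e i"] by auto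
      then have "ap (gr V h) (ap P (e i)) = pv (snd V h *\<^sub>v v)" using opr_pv[OF cV[OF that], of v] W(1) by (auto simp: gr_def)
      then have "ap (gr V h) (ap P (e i)) \<in> pv ` W" using v W(5) that by auto
      then show "ap (P * (gr V h * P)) (e i) = ap (gr V h * P) (e i)" using P(2) by simp
    qed
    have dP: "pr ?d * P = P"
    proof (rule lop_eqI)
      fix i
      obtain v where "v \<in> W" "ap P (e i) = pv v" using P(1)[of "e i"] by auto
      then show "ap (pr ?d * P) (e i) = ap P (e i)" using pr_pv[of v ?d] W(1) by auto
    qed
    \<comment> \<open>P is a linear projection onto an invariant subspace. Invariance yields
      \<open>P * \<epsilon> = \<epsilon>\<close> and \<open>\<epsilon> * P = P\<close>, so the
      average is an equivariant projection onto the same subspace.\<close>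
    define \<epsilon> where "\<epsilon> = avg (\<lambda>_. 1) (gr V) (gr V) P"
    have Pe: "P * \<epsilon> = \<epsilon>"
      unfolding \<epsilon>_def avg_def
      by (simp add: sum_distrib_left, intro arg_cong[of _ _ "scl _"] sum.cong refl)
        (simp add: mult_assoc_cong[OF mult.assoc[symmetric]] mult.assoc[symmetric] inv[unfolded mult.assoc[symmetric]])
    have eP: "\<epsilon> * P = P"
    proof -
      have "1 * \<epsilon> * P = P" unfolding \<epsilon>_def
      proof (rule avg_const)
        fix h assume h: "h \<in> carrier G"
        have "P * (gr V (inv h) * P) = gr V (inv h) * P" using inv h by simp
        then show "scl 1 (1 * (gr V h * (P * (gr V (inv h) * P)))) = P"
          using mult_assoc_cong[OF gm_inv(1)[OF gV h], of P] by (simp add: r1 dP)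
      qed
      then show ?thesis by simp
    qed
    have ee: "\<epsilon> * \<epsilon> = \<epsilon>" using Pe eP by (metis mult.assoc)
    have ge: "ghom (gr V) (gr V) \<epsilon>"
      using avg_equivariant[OF gV gV, of "\<lambda>_. 1"] avg_1(2)[OF gV] by (simp add: ghom_def \<epsilon>_def)
    have de: "pr ?d * \<epsilon> = \<epsilon>" "\<epsilon> * pr ?d = \<epsilon>" using ghom_1[OF ge] ghom_1'[OF ge] r1 by simp_all
    have ne0: "\<epsilon> \<noteq> 0"
    proof
      assume "\<epsilon> = 0"
      then have "P = 0" using eP by simp
      have "v = 0\<^sub>v ?d" if "v \<in> W" for v
      proof -
        have "pv v = pv (0\<^sub>v ?d)" using P(2)[of "pv v"] \<open>P = 0\<close> that by (simp add: pv_zero)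
        then show ?thesis by (rule pv_inj[rotated 2]) (use that W(1) in auto)
      qed
      then show False using W(2,6) by blast
    qed
    have ne1: "\<epsilon> \<noteq> pr ?d"
    proof
      assume "\<epsilon> = pr ?d"
      then have "P * pr ?d = pr ?d" using Pe by simp
      have "v \<in> W" if v: "v \<in> carrier_vec ?d" for v
      proof -
        have "ap P (pv v) = pv v" using lop_fun[OF \<open>P * pr ?d = pr ?d\<close>, of "pv v"] pr_pv[OF v] by simp
        then obtain w where "w \<in> W" "pv v = pv w" using P(1)[of "pv v"] by auto
        then show ?thesis using pv_inj[OF v, of w] W(1) by auto
      qed
      then show False using W(1,7) by blast
    qed
    have step: ?thesis if \<epsilon>: "ghom (gr V) (gr V) \<epsilon>" "\<epsilon> * \<epsilon> = \<epsilon>" "\<epsilon> \<noteq> pr ?d" "A * \<epsilon> \<noteq> 0" for \<epsilon>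
    proof -
      have de: "pr ?d * \<epsilon> = \<epsilon>" "\<epsilon> * pr ?d = \<epsilon>" using ghom_1[OF \<epsilon>(1)] ghom_1'[OF \<epsilon>(1)] r1 by simp_all
      then have "finr \<epsilon>" by (auto simp: finr_def)
      from idempotent_split[OF \<epsilon>(2) this] obtain r T S where
        TS: "T * S = \<epsilon>" "S * T = pr r" "T * pr r = T" "pr r * S = S" by blast
      note V' = sub_KG[OF gV \<epsilon>(1) TS]
      let ?V = "(r, \<lambda>h. tm r r (S * gr V h * T))"
      have "r < ?d" by (rule split_rank_less[OF TS(2,1,3,4) de \<epsilon>(3)])
      moreover have "A * T * pr (fst ?V) \<noteq> 0"
      proof
        assume "A * T * pr (fst ?V) = 0"
        then have "A * (T * S) = 0" using TS(3) by (simp add: mult.assoc) (simp flip: mult.assoc)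
        then show False using TS(1) \<epsilon>(4) by simp
      qed
      ultimately obtain W i p where *: "simple_module KG W" "ghom (gr W) (gr ?V) i" "ghom (gr ?V) (gr W) p" "p * i = pr (fst W)" "A * T * i \<noteq> 0"
        using less.hyps[of ?V "A * T"] V'(1) by (simp only: fst_conv) blast
      have "p * S * (T * i) = p * (pr r * i)" by (simp add: mult.assoc mult_assoc_cong[OF TS(2)])
      also have "pr r * i = i" using ghom_1'[OF *(2)] gr_1[OF V'(1)] by simp
      finally show ?thesis
        using * ghom_comp[OF *(2) V'(2)] ghom_comp[OF V'(3) *(3)]
        by (intro exI[of _ W] exI[of _ "T * i"] exI[of _ "p * S"]) (simp add: mult.assoc)
    qed
    have "A * pr ?d = A * \<epsilon> + A * (pr ?d - \<epsilon>)" by (simp add: right_diff_distrib)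
    then consider "A * \<epsilon> \<noteq> 0" | "A * (pr ?d - \<epsilon>) \<noteq> 0" using less.prems(2) by fastforce
    then show ?thesis
    proof cases
      case 1 show ?thesis by (rule step[OF ge ee ne1 1])
    next
      case 2
      show ?thesis
      proof (rule step[OF _ _ _ 2])
        show "ghom (gr V) (gr V) (pr ?d - \<epsilon>)"
          using ghom_id[OF gV] ge by (simp add: ghom_def r1 left_diff_distrib right_diff_distrib)
        show "(pr ?d - \<epsilon>) * (pr ?d - \<epsilon>) = pr ?d - \<epsilon>"
          by (simp add: left_diff_distrib right_diff_distrib de ee pr_pr)
      qed (use ne0 in simp)
    qed
  qed
qed

lemma gr_simple_nz: "simple_module KG V \<Longrightarrow> pr (fst V) \<noteq> (0 :: 'k lop)"
  using pr_inj[of "fst V" 0, where 'k = 'k] by (auto simp: simple_module_def)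

lemma KG_iso:
  assumes "is_module KG V" "is_module KG W" "mod_iso KG V W"
  obtains T S where "ghom (gr V) (gr W) T" "ghom (gr W) (gr V) S" "S * T = pr (fst V)" "T * S = pr (fst W)"
proof -
  from assms(3) obtain T S where *: "T \<in> mod_hom KG V W" "S \<in> mod_hom KG W V" "T * S = 1\<^sub>m (fst W)" "S * T = 1\<^sub>m (fst V)"
    unfolding mod_iso_def by blast
  have h: "ghom (gr V) (gr W) (opr T)" if "T \<in> mod_hom KG V W" "is_module KG V" "is_module KG W" for V W T
  proof -
    have T: "T \<in> carrier_mat (fst W) (fst V)" using that by (auto simp: mod_hom_def)
    have "opr T * opr (snd V h) = opr (snd W h) * opr T" if h: "h \<in> carrier G" for h
    proof -
      have "snd V h \<in> carrier_mat (fst V) (fst V)" "snd W h \<in> carrier_mat (fst W) (fst W)"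
        using h \<open>is_module KG V\<close> \<open>is_module KG W\<close> by (auto simp: KG_module_iff)
      then have "opr T * opr (snd V h) = opr (T * snd V h)" "opr (snd W h) * opr T = opr (snd W h * T)"
        using T by (auto intro!: opr_mult[symmetric])
      moreover have "T * snd V h = snd W h * T"
        using h \<open>T \<in> mod_hom KG V W\<close> by (auto simp: mod_hom_def group_alg_def)
      ultimately show ?thesis by simp
    qed
    then show ?thesis using opr_pr(2)[OF T] gr_1[OF that(2)] by (auto simp: ghom_def gr_def)
  qed
  have c: "T \<in> carrier_mat (fst W) (fst V)" "S \<in> carrier_mat (fst V) (fst W)" using * by (auto simp: mod_hom_def)
  then have "opr S * opr T = opr (S * T)" "opr T * opr S = opr (T * S)" by (auto intro!: opr_mult[symmetric])
  then show ?thesis using that[of "opr T" "opr S"] h[OF *(1) assms(1,2)] h[OF *(2) assms(2,1)] * by (simp add: opr_one)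
qed

text \<open>
  The largest \<open>k \<le> n\<close> with \<open>y\<^sup>k\<^sup>-\<^sup>1 X \<noteq> 0\<close> works for nilpotent and for invertible \<open>y\<close> alike: a simple \<open>G\<close>-submodule
  \<open>V\<close> on which \<open>y\<^sup>k\<^sup>-\<^sup>1\<close> is injective generates a copy of \<open>cyc k V\<close>, and a \<open>G\<close>-equivariant retraction of
  \<open>y\<^sup>k\<^sup>-\<^sup>1\<close> on \<open>V\<close> extends to a retraction of \<open>H\<close>-modules, because \<open>g\<close> acts on the layers \<open>y\<^sup>t V\<close> by distinct scalars.
\<close>

lemma cyc_summand:
  assumes Vs: "complete_simples KG \<Omega> V" and M: "is_module H M" and nz: "fst M \<noteq> 0"
  obtains j k X' where "j \<in> \<Omega>" "cyc_ok k (gr (V j))" "hm X'" "hiso (am M) (ds (cyc k (gr (V j))) X')"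
proof -
  let ?X = "am M"
  define \<rho> where "\<rho> = fst ?X"
  define Y where "Y = snd ?X"
  note X = hm_am[OF M]
  have g\<rho>: "gm \<rho>" using hm_gm[OF X] by (simp add: \<rho>_def)
  have r1: "\<rho> \<one> = pr (fst M)" using rep_of_am[OF M] by (simp add: rep_of_def \<rho>_def)
  let ?V0 = "(fst M, \<lambda>h. snd M (0, h))"
  have gV0: "gr ?V0 = \<rho>" by (simp add: gr_def \<rho>_def am_def)
  have V0: "is_module KG ?V0"
    using rep_of_am[OF M] gm_mult[OF g\<rho>] unfolding KG_module_iff gV0 by (simp add: r1 rep_of_def)
  define K where "K = {k. 1 \<le> k \<and> k \<le> n \<and> Y ^ (k - 1) * \<rho> \<one> \<noteq> 0}"
  have "pr (fst M) \<noteq> (0 :: 'k lop)" using pr_inj[of "fst M" 0, where 'k = 'k] nz by auto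
  then have "1 \<in> K" using n2 by (simp add: K_def r1)
  have fK: "finite K" by (rule finite_subset[of _ "{..n}"]) (auto simp: K_def)
  define k where "k = Max K"
  have "k \<in> K" unfolding k_def using fK \<open>1 \<in> K\<close> by (intro Max_in) auto
  then have k: "1 \<le> k" "k \<le> n" and Yk1: "Y ^ (k - 1) * pr (fst M) \<noteq> 0" by (auto simp: K_def r1)
  have Yk: "k = n \<or> Y ^ k = 0"
  proof (rule disjCI)
    assume "Y ^ k \<noteq> 0"
    then have "Y ^ k * \<rho> \<one> \<noteq> 0" using power_absorb[OF hm_Y1[OF X], of k] k by (simp add: Y_def \<rho>_def)
    then have "Suc k \<le> n \<Longrightarrow> Suc k \<in> K" by (simp add: K_def)
    then show "k = n" using k Max_ge[OF fK, of "Suc k"] by (cases "Suc k \<le> n") (auto simp: k_def)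
  qed
  obtain W i0 p0 where W: "simple_module KG W" "ghom (gr W) \<rho> i0" "ghom \<rho> (gr W) p0" "p0 * i0 = pr (fst W)" "Y ^ (k - 1) * i0 \<noteq> 0"
    using simple_summand[OF V0, of "Y ^ (k - 1)"] Yk1 unfolding gV0 by auto
  from Vs W(1) obtain j where j: "j \<in> \<Omega>" "mod_iso KG W (V j)" "simple_module KG (V j)"
    unfolding complete_simples_def by blast
  note Vj = simple_KG[OF j(3)]
  obtain T S where TS: "ghom (gr W) (gr (V j)) T" "ghom (gr (V j)) (gr W) S" "S * T = pr (fst W)" "T * S = pr (fst (V j))"
    using KG_iso[OF simple_KG[OF W(1)] Vj j(2)] .
  define \<sigma> where "\<sigma> = gr (V j)"
  define i where "i = i0 * S"
  have s: "gm \<sigma>" and s1: "\<sigma> \<one> = pr (fst (V j))" using gm_gr[OF Vj] gr_1[OF Vj] by (simp_all add: \<sigma>_def)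
  have i: "ghom \<sigma> \<rho> i" unfolding i_def \<sigma>_def by (rule ghom_comp[OF TS(2) W(2)])
  have "Y ^ (k - 1) * i * T = Y ^ (k - 1) * i0"
    using ghom_1[OF W(2)] gr_1[OF simple_KG[OF W(1)]] by (simp add: i_def mult.assoc TS(3))
  then have Yi: "Y ^ (k - 1) * i \<noteq> 0" using W(5) by auto
  have pi: "T * p0 * i = \<sigma> \<one>"
    using ghom_1'[OF TS(2)] gr_1[OF simple_KG[OF W(1)]] by (simp add: i_def mult.assoc mult_assoc_cong[OF W(4)] TS(4) s1)
  have Yh: "Y ^ m * \<rho> h = scl (\<chi> h ^ m) (\<rho> h * Y ^ m)" if "h \<in> carrier G" for h m
    unfolding Y_def \<rho>_def by (rule hm_Yh_pow[OF X that])
  let ?A = "Y ^ (k - 1) * i"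
  have Ah: "?A * \<sigma> h = scl (\<chi> h ^ (k - 1)) (\<rho> h * ?A)" if "h \<in> carrier G" for h
    using ghom_h[OF i that] mult_assoc_cong[OF Yh[OF that]] by (simp add: mult.assoc)
  have A1: "?A * pr (fst (V j)) = ?A" using ghom_1[OF i] by (simp add: mult.assoc s1)
  let ?d = "fst (V j)"
  have cV: "snd (V j) h \<in> carrier_mat ?d ?d" if "h \<in> carrier G" for h using Vj that by (auto simp: KG_module_iff)
  \<comment> \<open>The kernel of y^(k-1) on V is a submodule, since y^(k-1) commutes with G up to
    scalars. It is proper by the choice of V, so y^(k-1) is injective on V.\<close>
  have "(\<forall>v\<in>carrier_vec ?d. ap ?A (pv v) = 0 \<longrightarrow> v = 0\<^sub>v ?d) \<or> (\<forall>v\<in>carrier_vec ?d. ap ?A (pv v) = 0)"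
  proof (rule simple_subspace[OF j(3)])
    fix h v assume h: "h \<in> carrier G" and v: "v \<in> carrier_vec ?d" "ap ?A (pv v) = 0"
    have "pv (snd (V j) h *\<^sub>v v) = ap (\<sigma> h) (pv v)" using opr_pv[OF cV[OF h] v(1)] by (simp add: \<sigma>_def gr_def)
    then have "ap ?A (pv (snd (V j) h *\<^sub>v v)) = ap (?A * \<sigma> h) (pv v)" by simp
    also have "\<dots> = 0" unfolding Ah[OF h] using v(2) by simp
    finally show "ap ?A (pv (snd (V j) h *\<^sub>v v)) = 0" .
  next
    fix v w assume "v \<in> carrier_vec ?d" "w \<in> carrier_vec ?d" "ap ?A (pv v) = 0" "ap ?A (pv w) = 0"
    then show "ap ?A (pv (v + w)) = 0" by (simp add: pv_add[of v ?d w] ap_add del: ap_simps)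
  qed (simp_all add: pv_zero pv_smult ap_smult del: ap_simps)
  moreover have "\<not> (\<forall>v\<in>carrier_vec ?d. ap ?A (pv v) = 0)"
  proof
    assume "\<forall>v\<in>carrier_vec ?d. ap ?A (pv v) = 0"
    then have "?A = 0" by (intro lop_eq_pvI[OF A1]) simp_all
    with Yi show False by simp
  qed
  ultimately have inj: "v = 0\<^sub>v ?d" if "v \<in> carrier_vec ?d" "ap ?A (pv v) = 0" for v using that by blast
  obtain L where "L * ?A * pr ?d = pr ?d"
  proof (rule lop_left_inverse)
    fix p assume "ap ?A (ap (pr ?d) p) = 0"
    then have "ap ?A (pv (vec ?d (coeff p))) = 0" by (simp only: pv_vec)
    then have "vec ?d (coeff p) = 0\<^sub>v ?d" by (rule inj[rotated]) simp
    then show "ap (pr ?d) p = 0" by (metis pv_vec pv_zero)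
  qed (simp add: pr_pr)
  then have L: "L * (?A * B) = pr ?d * B" if "pr ?d * B = B" for B using that A1 by (metis mult.assoc)
  \<comment> \<open>The twist of the top layer x^(k-1) V, as in \<open>hhom_to_cyc\<close>.\<close>
  define c where "c h = inverse (\<chi> h) ^ (k - 1)" for h
  have cm: "c (h \<otimes> h') = c h * c h'" if "h \<in> carrier G" "h' \<in> carrier G" for h h'
    using that by (simp add: c_def chi_mult power_mult_distrib)
  define \<psi> where "\<psi> = avg c \<rho> \<sigma> L"
  have \<psi>1: "\<psi> * \<rho> \<one> = \<psi>" "\<sigma> \<one> * \<psi> = \<psi>" using avg_1[OF s, of c \<rho> L] avg_1(2)[OF g\<rho>, of c \<sigma> L] by (simp_all add: \<psi>_def)
  have \<psi>h: "\<psi> * \<rho> h = scl (inverse (\<chi> h) ^ (k - 1)) (\<sigma> h * \<psi>)" if "h \<in> carrier G" for h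
    unfolding \<psi>_def c_def[symmetric] by (rule avg_equivariant[OF g\<rho> s cm that])
  have "1 * \<psi> * ?A = pr ?d"
    unfolding \<psi>_def
  proof (rule avg_const)
    fix h assume h: "h \<in> carrier G"
    have sc: "pr ?d * \<sigma> (inv h) = \<sigma> (inv h)" using gm_one(1)[OF s, of "inv h"] h s1 by simp
    have "\<rho> (inv h) * ?A = scl (\<chi> h ^ (k - 1)) (?A * \<sigma> (inv h))"
      by (subst Ah) (use h chi_nz[OF h] in \<open>simp_all add: chi_inv power_inverse\<close>)
    then have "L * (\<rho> (inv h) * ?A) = scl (\<chi> h ^ (k - 1)) (\<sigma> (inv h))"
      using L[OF sc] sc by simp
    then show "scl (c h) (1 * (\<sigma> h * (L * (\<rho> (inv h) * ?A)))) = pr ?d"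
      using h chi_nz[OF h] gm_inv(1)[OF s h] by (simp add: c_def s1 flip: power_mult_distrib)
  qed
  then have \<psi>A: "\<psi> * ?A = \<sigma> \<one>" by (simp add: s1)
  have ok: "cyc_ok k \<sigma>"
  proof -
    have "\<sigma> (g [^] n) = \<sigma> \<one>" if "k \<noteq> n"
    proof -
      have "Y ^ n = Y ^ (n - k) * Y ^ k" using k by (simp flip: power_add)
      then have "Y ^ n = 0" using Yk that by simp
      then have "\<rho> (g [^] n) = \<rho> \<one>" using hm_Yn[OF X] by (simp add: Y_def \<rho>_def)
      then have "i * \<sigma> (g [^] n) = i" using ghom_h[OF i, of "g [^] n"] ghom_1'[OF i] by simp
      then have "T * p0 * i * \<sigma> (g [^] n) = T * p0 * i" by (simp add: mult.assoc)
      then show ?thesis using gm_one(1)[OF s, of "g [^] n"] by (simp add: pi)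
    qed
    then show ?thesis using s k by (auto simp: cyc_ok_def)
  qed
  obtain \<omega> where \<omega>: "\<sigma> g = scl \<omega> (\<sigma> \<one>)" "\<omega> \<noteq> 0"
    using schur_central[OF j(3) g_in g_central] by (metis s1 \<sigma>_def)
  \<comment> \<open>On y^m V the element g acts by \<omega> \<chi>(g)^-m, and \<psi> sees only the
    scalar belonging to m = k - 1. The two scalars agree only if n divides the difference of m and k
    - 1, which the bounds exclude.\<close>
  have z: "\<psi> * (Y ^ m * i) = 0" if m: "m \<noteq> k - 1" "m < k - 1 + n" "k - 1 < m + n" for m
  proof (rule ccontr)
    assume ne: "\<psi> * (Y ^ m * i) \<noteq> 0"
    let ?B = "\<psi> * (Y ^ m * i)"
    have B1: "?B * \<sigma> \<one> = ?B" "\<sigma> \<one> * ?B = ?B" using ghom_1[OF i] mult_assoc_cong[OF \<psi>1(2)] by (simp_all add: mult.assoc)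
    have "scl \<omega> ?B = ?B * \<sigma> g" by (simp add: \<omega>(1) B1)
    also have "\<dots> = \<psi> * (Y ^ m * \<rho> g) * i" using ghom_h[OF i g_in] by (simp add: mult.assoc)
    also have "\<dots> = scl (\<chi> g ^ m) (\<psi> * \<rho> g * Y ^ m * i)" by (simp add: Yh mult.assoc)
    also have "\<dots> = scl (\<chi> g ^ m * inverse (\<chi> g) ^ (k - 1) * \<omega>) ?B"
      by (simp add: \<psi>h \<omega>(1) mult.assoc \<psi>1(2) mult_assoc_cong[OF \<psi>1(2)] mult.commute mult.left_commute)
    finally have "scl (\<omega> - \<chi> g ^ m * inverse (\<chi> g) ^ (k - 1) * \<omega>) ?B = 0" by (simp add: scl_diff_left)
    then have "\<omega> - \<chi> g ^ m * inverse (\<chi> g) ^ (k - 1) * \<omega> = 0"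
      using ne scl_inverse[of _ ?B 0] by (cases "\<omega> - \<chi> g ^ m * inverse (\<chi> g) ^ (k - 1) * \<omega> = 0") auto
    then have "\<chi> g ^ m * inverse (\<chi> g) ^ (k - 1) = 1" using \<omega>(2) by (simp add: algebra_simps)
    then have q: "\<chi> g ^ m = \<chi> g ^ (k - 1)" using chi_nz[OF g_in] by (simp add: power_inverse field_simps)
    have False if "a < b" "b < a + n" "\<chi> g ^ a = \<chi> g ^ b" for a b
    proof -
      have "\<chi> g ^ b = \<chi> g ^ a * \<chi> g ^ (b - a)" using that(1) by (simp flip: power_add)
      then have "\<chi> g ^ (b - a) = 1" using that(3) chi_nz[OF g_in] by simp
      then show False using q_prim that by (auto simp: less_diff_conv2)
    qed
    then show False using q m by (metis linorder_neqE_nat)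
  qed
  have F: "hhom (cyc k \<sigma>) ?X (\<Sum>s<k. Y ^ s * i * prj s)"
    unfolding Y_def by (rule hhom_from_cyc[OF X ok]) (use i Yk in \<open>auto simp: \<rho>_def Y_def\<close>)
  have Kh: "hhom ?X (cyc k \<sigma>) (\<Sum>s<k. inc s * (\<psi> * Y ^ (k - 1 - s)))"
    unfolding Y_def by (rule hhom_to_cyc[OF X ok]) (use \<psi>1 \<psi>h Yk in \<open>auto simp: \<rho>_def Y_def\<close>)
  \<comment> \<open>The entry in row s and column t is \<psi> y^(k-1-s+t) i. Its exponent is k - 1
    exactly on the diagonal, and it differs from k - 1 by less than n elsewhere.\<close>
  have KF: "(\<Sum>s<k. inc s * (\<psi> * Y ^ (k - 1 - s))) * (\<Sum>s<k. Y ^ s * i * prj s) = fst (cyc k \<sigma>) \<one>" (is "?K * ?F = _")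
  proof (rule lop_eqI_inc)
    fix t
    have "?K * (Y ^ t * i) = inc t * \<sigma> \<one>" if t: "t < k"
    proof -
      have "?K * (Y ^ t * i) = (\<Sum>s<k. if s = t then inc t * \<sigma> \<one> else 0)"
        unfolding sum_distrib_right
      proof (rule sum.cong[OF refl])
        fix s assume "s \<in> {..<k}"
        have "inc s * (\<psi> * Y ^ (k - 1 - s)) * (Y ^ t * i) = inc s * (\<psi> * (Y ^ (k - 1 - s + t) * i))"
          by (simp add: mult.assoc power_add)
        also have "\<dots> = (if s = t then inc t * \<sigma> \<one> else 0)"
        proof (cases "s = t")
          case True then show ?thesis using t \<psi>A by simp
        next
          case False
          then have "\<psi> * (Y ^ (k - 1 - s + t) * i) = 0" using \<open>s \<in> {..<k}\<close> t k by (intro z) auto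
          then show ?thesis using False by simp
        qed
        finally show "inc s * (\<psi> * Y ^ (k - 1 - s)) * (Y ^ t * i) = (if s = t then inc t * \<sigma> \<one> else 0)" .
      qed
      then show ?thesis using t by simp
    qed
    then show "?K * ?F * inc t = fst (cyc k \<sigma>) \<one> * inc t"
      unfolding mult.assoc[of ?K] row_inc by (simp add: fst_cyc_inc)
  qed
  from hiso_summand[OF X hm_cyc[OF ok] F Kh KF] obtain X' where "hm X'" "hiso ?X (ds (cyc k \<sigma>) X')" .
  with j(1) ok show ?thesis using that unfolding \<sigma>_def by blast
qed

subsection \<open>The idempotent\<close>

lemma q_dvd: "\<chi> g ^ m = 1 \<Longrightarrow> n dvd m"
proof -
  assume *: "\<chi> g ^ m = 1"
  have "\<chi> g ^ m = (\<chi> g ^ n) ^ (m div n) * \<chi> g ^ (m mod n)"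
    unfolding power_mult[symmetric] power_add[symmetric] by simp
  then have q1: "\<chi> g ^ (m mod n) = 1" using * q_n by simp
  have "m mod n = 0"
  proof (rule ccontr)
    assume "m mod n \<noteq> 0"
    then have "0 < m mod n \<and> m mod n < n" using n_pos by (simp add: mod_less_divisor)
    from q_prim[rule_format, OF this] show False using q1 by simp
  qed
  then show ?thesis by auto
qed

lemma ord_g: "ord g div n * n = ord g" "0 < ord g div n"
proof -
  have "\<chi> g ^ ord g = 1" using chi_pow[OF g_in, of "ord g"] pow_ord_eq_1[OF g_in] by simp
  then have "n dvd ord g" by (rule q_dvd)
  then show *: "ord g div n * n = ord g" by simp
  have "ord g \<ge> 1" using fin by (intro ord_ge_1) auto
  then show "0 < ord g div n" using * by (metis gr0I mult_0 not_one_le_zero)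
qed

definition ep :: "('a \<Rightarrow> 'k lop) \<Rightarrow> 'k lop"
  where "ep \<rho> = scl (inverse (of_nat (ord g div n))) (\<Sum>s\<in>{..<ord g div n}. \<rho> (g [^] (s * n)))"

text \<open>Multiplication by g^n permutes the powers of g^n cyclically, because the order of g is r
  n.\<close>

lemma ep_g: assumes "gm \<rho>" shows "\<rho> (g [^] n) * ep \<rho> = ep \<rho>"
proof -
  let ?f = "\<lambda>s. \<rho> (g [^] (s * n))" and ?r = "ord g div n"
  have "(\<Sum>s<?r. ?f (Suc s)) + ?f 0 = (\<Sum>s<?r. ?f s) + ?f ?r"
    using sum.lessThan_Suc_shift[of ?f ?r] by (simp add: add.commute)
  then have "(\<Sum>s<?r. ?f (Suc s)) = (\<Sum>s<?r. ?f s)" by (simp add: ord_g pow_ord_eq_1)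
  moreover have "\<rho> (g [^] n) * (\<Sum>s<?r. ?f s) = (\<Sum>s<?r. ?f (Suc s))"
    by (simp add: sum_distrib_left gm_mult[OF assms] nat_pow_mult)
  ultimately have "\<rho> (g [^] n) * (\<Sum>s<?r. ?f s) = (\<Sum>s<?r. ?f s)" by simp
  then show ?thesis by (simp add: ep_def)
qed

lemma ep_1: assumes "gm \<rho>" shows "\<rho> \<one> * ep \<rho> = ep \<rho>" "ep \<rho> * \<rho> \<one> = ep \<rho>"
  by (simp_all add: ep_def sum_distrib_left sum_distrib_right gm_one[OF assms])

lemma ep_pow: assumes "gm \<rho>" shows "\<rho> (g [^] (s * n)) * ep \<rho> = ep \<rho>"
proof (induction s)
  case (Suc s)
  have "\<rho> (g [^] (Suc s * n)) = \<rho> (g [^] n) * \<rho> (g [^] (s * n))"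
    by (simp add: gm_mult[OF assms] nat_pow_mult)
  then show ?case using Suc ep_g[OF assms] by (simp add: mult.assoc)
qed (simp add: ep_1 assms)

lemma sum_const_scl: "(\<Sum>s<r. C) = scl (of_nat r) (C :: 'k lop)"
  by (induction r) (simp_all add: scl_add_left algebra_simps del: sum_constant)

lemma ep_sum_const: assumes "\<And>s. \<rho> (g [^] (s * n)) * A = C" shows "ep \<rho> * A = C"
  using ord_g(2) unfolding ep_def by (simp add: sum_distrib_right assms sum_const_scl del: sum_constant)

lemma ep_ep: assumes "gm \<rho>" shows "ep \<rho> * ep \<rho> = ep \<rho>"
  by (rule ep_sum_const) (rule ep_pow[OF assms])

lemma ep_trivial: assumes r: "gm \<rho>" and g: "\<rho> (g [^] n) = \<rho> \<one>" shows "ep \<rho> = \<rho> \<one>"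
proof -
  have "\<rho> (g [^] (s * n)) = \<rho> \<one>" for s
  proof (induction s)
    case (Suc s)
    have "\<rho> (g [^] (Suc s * n)) = \<rho> (g [^] n) * \<rho> (g [^] (s * n))"
      by (simp add: gm_mult[OF r] nat_pow_mult)
    then show ?case using Suc g gm_one[OF r] by simp
  qed simp
  then have "ep \<rho> * 1 = \<rho> \<one>" by (intro ep_sum_const) simp
  then show ?thesis by simp
qed

text \<open>The image of e is fixed by g^n, which here acts as a scalar different from 1.\<close>

lemma ep_scalar: assumes r: "gm \<rho>" and g: "\<rho> (g [^] n) = scl c (\<rho> \<one>)" "c \<noteq> 1" shows "ep \<rho> = 0"
proof -
  have "scl c (ep \<rho>) = ep \<rho>" using ep_g[OF r] by (simp add: g ep_1[OF r])
  then have "scl (1 - c) (ep \<rho>) = 0" by (simp add: scl_diff_left)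
  then show ?thesis using scl_inverse[of "1 - c" "ep \<rho>" 0] g(2) by simp
qed

lemma ep_natural: "ghom \<rho> \<sigma> T \<Longrightarrow> T * ep \<rho> = ep \<sigma> * T"
  by (simp add: ep_def sum_distrib_left sum_distrib_right ghom_h)

lemma ghom_ep: "gm \<rho> \<Longrightarrow> ghom \<rho> \<rho> (ep \<rho>)"
proof -
  assume r: "gm \<rho>"
  have "\<rho> (g [^] (s * n)) * \<rho> h = \<rho> h * \<rho> (g [^] (s * n))" if "h \<in> carrier G" for h s by (rule gm_g[OF r that])
  then show ?thesis by (simp add: ghom_def ep_1[OF r]) (simp add: ep_def sum_distrib_left sum_distrib_right)
qed

text \<open>e commutes with y because \<chi>(g^n) = 1.\<close>

lemma hhom_ep: assumes X: "hm X" shows "hhom X X (ep (fst X))"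
proof -
  have "\<chi> (g [^] (s * n)) = 1" for s using q_n by (simp add: chi_pow mult.commute[of s] power_mult)
  then have "snd X * fst X (g [^] (s * n)) = fst X (g [^] (s * n)) * snd X" for s by (simp add: hm_Yh[OF X])
  then show ?thesis
    using ghom_ep[OF hm_gm[OF X]] by (simp add: hhom_def) (simp add: ep_def sum_distrib_left sum_distrib_right)
qed

definition eX :: "('a, 'k) am \<Rightarrow> ('a, 'k) am" where "eX X = restr (ep (fst X)) X"

lemma eX: assumes X: "hm X"
  shows hm_eX: "hm (eX X)" and fst_eX: "fst (eX X) \<one> = ep (fst X)" "fst (eX X) (g [^] n) = fst (eX X) \<one>"
    and hhom_eX: "hhom X (eX X) (ep (fst X))" "hhom (eX X) X (ep (fst X))"
proof -
  note gX = hm_gm[OF X]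
  note r = restr[OF X hhom_ep[OF X] ep_ep[OF gX]]
  show "hm (eX X)" "hhom X (eX X) (ep (fst X))" "hhom (eX X) X (ep (fst X))" using r by (simp_all add: eX_def)
  show 1: "fst (eX X) \<one> = ep (fst X)" using r by (simp add: eX_def)
  show "fst (eX X) (g [^] n) = fst (eX X) \<one>"
    unfolding 1 using ep_g[OF gX] ghom_h[OF ghom_ep[OF gX], of "g [^] n"] by (simp add: eX_def restr_def)
qed

lemma hiso_eX: assumes "hm X" "hm Z" "hiso X Z" shows "hiso (eX X) (eX Z)"
proof -
  from assms(3) obtain T S where *: "hhom X Z T" "hhom Z X S" "S * T = fst X \<one>" "T * S = fst Z \<one>"
    unfolding hiso_def by blast
  have gX: "gm (fst X)" "gm (fst Z)" using assms hm_gm by auto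
  have c: "hhom (eX X) (eX Z) (ep (fst Z) * (T * ep (fst X)))" "hhom (eX Z) (eX X) (ep (fst X) * (S * ep (fst Z)))"
    using hhom_comp[OF hhom_comp[OF hhom_eX(2)[OF assms(1)] *(1)] hhom_eX(1)[OF assms(2)]]
      hhom_comp[OF hhom_comp[OF hhom_eX(2)[OF assms(2)] *(2)] hhom_eX(1)[OF assms(1)]] by auto
  note s = ep_natural[OF hhom_ghom[OF *(1)]] ep_natural[OF hhom_ghom[OF *(2)]]
  show ?thesis
    by (rule hisoI[OF c])
      (simp_all add: fst_eX assms mult.assoc s ep_ep[OF gX(1)] ep_ep[OF gX(2)] mult_assoc_cong[OF ep_ep[OF gX(1)]]
        mult_assoc_cong[OF ep_ep[OF gX(2)]] mult_assoc_cong[OF s(1)] mult_assoc_cong[OF s(2)] * ep_1[OF gX(1)] ep_1[OF gX(2)])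
qed

lemma eX_ds: "eX (ds X Z) = ds (eX X) (eX Z)"
proof -
  have "ep (fst (ds X Z)) = inc 0 * (ep (fst X) * prj 0) + inc 1 * (ep (fst Z) * prj 1)"
    by (simp add: ep_def ds_def sum.distrib scl_add sum_distrib_left sum_distrib_right)
  then show ?thesis by (simp add: eX_def restr_def ds_def ps)
qed

lemma eX_trivial: assumes X: "hm X" and g: "fst X (g [^] n) = fst X \<one>" shows "hiso (eX X) X"
proof -
  have e: "ep (fst X) = fst X \<one>" by (rule ep_trivial[OF hm_gm[OF X] g])
  have "eqv X (eX X)" unfolding eqv_def eX_def restr_def e using gm_one[OF hm_gm[OF X]] hm_1Y[OF X] by simp
  then show ?thesis by (rule hiso_sym[OF hiso_eqv[OF _ X]])
qed

lemma modules_zero: "modules H zero_ideal = {M. is_module H M}"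
proof -
  have "opr (act H M (\<lambda>_. 0)) = 0" if "is_module H M" for M
  proof -
    have "\<forall>b\<in>bas H. snd M b \<in> carrier_mat (fst M) (fst M)" using that by (simp add: is_module_def)
    from opr_act[OF this] show ?thesis by (simp add: OA_linear)
  qed
  then show ?thesis
    unfolding modules_def using opr_inj[OF act_carrier zero_carrier_mat] by fastforce
qed

text \<open>The ideal contains 1 - e, so annihilation means that e acts as the identity, which
  happens exactly when g^n does.\<close>

lemma modules_bar: "modules H (I_bar G \<chi> g n) = {M. is_module H M \<and> fst (am M) (g [^] n) = fst (am M) \<one>}"
proof -
  have *: "(\<forall>u\<in>I_bar G \<chi> g n. act H M u = 0\<^sub>m (fst M) (fst M)) \<longleftrightarrow> fst (am M) (g [^] n) = fst (am M) \<one>"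
    if M: "is_module H M" for M
  proof -
    let ?X = "\<lambda>b. opr (snd M b)"
    have c: "\<forall>b\<in>bas H. snd M b \<in> carrier_mat (fst M) (fst M)"
      and m: "b \<in> bas H \<Longrightarrow> c \<in> bas H \<Longrightarrow> ?X b * ?X c = OA H ?X (prd H b c)" for b c
      using M by (auto simp: is_module_iff simp del: H_simps)
    note X = hm_am[OF M] and g = hm_gm[OF hm_am[OF M]]
    have b: "OA Ha W (bvec (m, k)) = W (m, k)" if "m < n" "k \<in> carrier G" for m k W
      using that by (intro OA_bvec) auto
    have u: "OA H ?X (unt H) = fst (am M) \<one>" by (simp add: OA_H b am_def)
    have s: "OA Ha ?X (\<lambda>d. \<Sum>s<r. f s d) = (\<Sum>s<r. OA Ha ?X (f s))" for f :: "nat \<Rightarrow> _" and r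
      by (induction r) (simp_all add: OA_linear)
    have e: "e_idem G g n = (\<lambda>d. inverse (of_nat (ord g div n)) * (\<Sum>s\<in>{..<ord g div n}. bvec (0, g [^] (s * n)) d))"
      by (simp add: e_idem_def Let_def divide_inverse mult.commute fun_eq_iff)
    have "OA H ?X (e_idem G g n) = ep (fst (am M))"
      unfolding e OA_H OA_linear(3) s ep_def using n2 by (simp add: b am_def)
    then have "act H M u = 0\<^sub>m (fst M) (fst M) \<longleftrightarrow> OA H ?X a * (fst (am M) \<one> - ep (fst (am M))) = 0"
      if "u = amult H a (\<lambda>b. unt H b - e_idem G g n b)" for a u
    proof -
      assume e: "OA H ?X (e_idem G g n) = ep (fst (am M))"
      have "OA H ?X u = OA H ?X a * (fst (am M) \<one> - ep (fst (am M)))"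
        unfolding that by (subst OA_amult, rule m) (simp_all only: OA_linear e u)
      then show ?thesis
        using opr_act[OF c, of u] opr_inj[OF act_carrier[of H M u] zero_carrier_mat] by auto
    qed
    then have "(\<forall>u\<in>I_bar G \<chi> g n. act H M u = 0\<^sub>m (fst M) (fst M)) \<longleftrightarrow>
        (\<forall>a\<in>vectors H. OA H ?X a * (fst (am M) \<one> - ep (fst (am M))) = 0)"
      unfolding I_bar_def Let_def by blast
    also have "\<dots> \<longleftrightarrow> fst (am M) \<one> - ep (fst (am M)) = 0"
    proof
      assume *: "\<forall>a\<in>vectors H. OA H ?X a * (fst (am M) \<one> - ep (fst (am M))) = 0"
      have "unt H \<in> vectors H" using n2 by (auto simp: vectors_def bvec_def)
      with * have "fst (am M) \<one> * (fst (am M) \<one> - ep (fst (am M))) = 0" unfolding u[symmetric] by blast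
      then show "fst (am M) \<one> - ep (fst (am M)) = 0" by (simp add: right_diff_distrib gm_one[OF g] ep_1[OF g])
    qed simp
    also have "\<dots> \<longleftrightarrow> fst (am M) (g [^] n) = fst (am M) \<one>"
      using ep_trivial[OF g] ep_g[OF g] gm_one(2)[OF g, of "g [^] n"] by auto
    finally show ?thesis .
  qed
  then show ?thesis unfolding modules_def by blast
qed

subsection \<open>Projective modules\<close>

lemma projective_ind:
  assumes M: "is_module H M" and s: "gm \<sigma>" and iso: "hiso (am M) (cyc n \<sigma>)"
  shows "projective H M"
  unfolding projective_def
proof (intro conjI allI ballI impI M)
  fix A B p f
  assume p: "p \<in> mod_hom H A B" and f: "f \<in> mod_hom H M B"
    and "is_module H A \<and> is_module H B \<and> (\<forall>w\<in>carrier_vec (fst B). \<exists>v\<in>carrier_vec (fst A). p *\<^sub>v v = w)"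
  then have A: "is_module H A" and B: "is_module H B"
    and sur: "\<And>w. w \<in> carrier_vec (fst B) \<Longrightarrow> \<exists>v\<in>carrier_vec (fst A). p *\<^sub>v v = w" by auto
  have pc: "p \<in> carrier_mat (fst B) (fst A)" and fc: "f \<in> carrier_mat (fst B) (fst M)" using p f by (auto simp: mod_hom_def)
  \<comment> \<open>Preimages of the unit vectors give a linear section of p, the input r of
    \<open>ind_lift\<close>.\<close>
  have "\<forall>j\<in>{..<fst B}. \<exists>v. v \<in> carrier_vec (fst A) \<and> p *\<^sub>v v = unit_vec (fst B) j"
    using sur[OF unit_vec_carrier] by (simp add: Bex_def)
  from bchoice[OF this] obtain v where
    v: "\<And>j. j < fst B \<Longrightarrow> v j \<in> carrier_vec (fst A) \<and> p *\<^sub>v v j = unit_vec (fst B) j" by auto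
  have "opr p * lext (\<lambda>j. if j < fst B then pv (v j) else 0) = pr (fst B)"
  proof (rule lop_eqI)
    fix j
    have "pv (unit_vec (fst B) j) = e j" if "j < fst B" by (rule poly_eqI) (use that in \<open>auto simp: coeff_pv\<close>)
    then show "ap (opr p * lext (\<lambda>j. if j < fst B then pv (v j) else 0)) (e j) = ap (pr (fst B)) (e j)"
      using v[of j] opr_pv[OF pc, of "v j"] by auto
  qed
  then have r: "opr p * lext (\<lambda>j. if j < fst B then pv (v j) else 0) = fst (am B) \<one>"
    using rep_of_am[OF B] by (simp add: rep_of_def)
  have ph: "hhom (am A) (am B) (opr p)" and fh: "hhom (am M) (am B) (opr f)"
    using p f mod_hom_iff[OF A B pc] mod_hom_iff[OF M B fc] by auto
  from iso obtain T S where *: "hhom (am M) (cyc n \<sigma>) T" "hhom (cyc n \<sigma>) (am M) S" "S * T = fst (am M) \<one>"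
    unfolding hiso_def by blast
  obtain f' where f': "hhom (cyc n \<sigma>) (am A) f'" "opr p * f' = opr f * S"
    using ind_lift[OF hm_am[OF A] hm_am[OF B] s ph r hhom_comp[OF *(2) fh]] .
  note t = hhom_imp_mod_hom[OF M A hhom_comp[OF *(1) f'(1)]]
  let ?t = "tm (fst A) (fst M) (f' * T)"
  have "opr (p * ?t) = opr p * opr ?t" using pc by (intro opr_mult) (simp add: carrier_matD[OF tm_carrier])
  then have "opr (p * ?t) = opr f"
    using mult_assoc_cong[OF f'(2), of T] hhom_1[OF fh] by (simp add: t(2) mult.assoc *(3))
  then have "p * ?t = f" using opr_inj[OF mult_carrier_mat[OF pc tm_carrier] fc] by simp
  then show "\<exists>f'\<in>mod_hom H M A. p * f' = f" using t(1) by blast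
qed

lemma projective_lift:
  assumes "projective H Q" "is_module H A" "is_module H B" "hhom (am A) (am B) p" "p * r = fst (am B) \<one>" "hhom (am Q) (am B) f"
  obtains f' where "hhom (am Q) (am A) f'" "p * f' = f"
proof -
  have Q: "is_module H Q" using assms(1) by (simp add: projective_def)
  note P = hhom_imp_mod_hom[OF assms(2,3,4)] and F = hhom_imp_mod_hom[OF Q assms(3,6)]
  let ?p = "tm (fst B) (fst A) p" and ?f = "tm (fst B) (fst Q) f"
  have 1: "fst (am A) \<one> = pr (fst A)" "fst (am B) \<one> = pr (fst B)"
    using rep_of_am[OF assms(2)] rep_of_am[OF assms(3)] by (auto simp: rep_of_def)
  have "\<exists>v\<in>carrier_vec (fst A). ?p *\<^sub>v v = w" if w: "w \<in> carrier_vec (fst B)" for w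
  proof -
    let ?v = "vec (fst A) (coeff (ap r (pv w)))"
    have v: "?v \<in> carrier_vec (fst A)" by simp
    have "pv (?p *\<^sub>v ?v) = ap p (ap (pr (fst A)) (ap r (pv w)))"
      using opr_pv[OF tm_carrier v, of "fst B" p] P(2) by (simp add: pv_vec)
    also have "\<dots> = ap (p * r) (pv w)" using lop_fun[OF hhom_1[OF assms(4)], of "ap r (pv w)"] by (simp add: 1)
    also have "\<dots> = pv w" using assms(5) w by (simp add: 1 pr_pv)
    finally have "?p *\<^sub>v ?v = w" by (rule pv_inj[rotated 2]) (use w in \<open>auto intro!: mult_mat_vec_carrier[OF tm_carrier]\<close>)
    then show ?thesis using v by blast
  qed
  then obtain f' where f': "f' \<in> mod_hom H Q A" "?p * f' = ?f"
    using assms(1-3) P(1) F(1) unfolding projective_def by blast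
  then have c: "f' \<in> carrier_mat (fst A) (fst Q)" by (simp add: mod_hom_def)
  have "p * opr f' = f" using arg_cong[OF f'(2), of opr] c P(2) F(2) by (subst (asm) opr_mult) (auto simp: carrier_matD[OF tm_carrier])
  moreover have "hhom (am Q) (am A) (opr f')" using mod_hom_iff[OF Q assms(2) c] f'(1) by simp
  ultimately show ?thesis using that by blast
qed

text \<open>For k < n the map p from C(n, \<sigma>) onto C(k, \<sigma>) would split. A section sends
  the generators to vectors killed by y^k, but y^k is injective on the bottom layer of C(n,
  \<sigma>), so these vectors have no component there. That component is what p preserves, a
  contradiction.\<close>

lemma projective_cyc:
  assumes Q: "projective H Q" and iso: "hiso (am Q) (cyc k \<sigma>)" and ok: "cyc_ok k \<sigma>" and nz: "\<sigma> \<one> \<noteq> 0"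
  shows "k = n"
proof (rule ccontr)
  assume kn: "k \<noteq> n"
  have s: "gm \<sigma>" and k: "1 \<le> k" "k < n" and g1: "\<sigma> (g [^] n) = \<sigma> \<one>" using ok kn by (auto simp: cyc_ok_def)
  let ?C = "cyc n \<sigma>" and ?D = "cyc k \<sigma>"
  note okn = cyc_ok_n[OF s]
  have i: "ghom \<sigma> (fst ?D) (inc 0 * \<sigma> \<one>)"
    using k unfolding ghom_def by (auto simp: mult.assoc mult_assoc_cong[OF fst_cyc_inc] gm_one[OF s])
  let ?p = "\<Sum>s<n. snd ?D ^ s * (inc 0 * \<sigma> \<one>) * prj s"
  have p: "hhom ?C ?D ?p" by (rule hhom_from_cyc[OF hm_cyc[OF ok] okn i]) simp
  have pinc: "?p * inc t = (if t < k then inc t * \<sigma> \<one> else 0)" for t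
  proof -
    have "snd ?D ^ t * (inc 0 * \<sigma> \<one>) = 0" if "k \<le> t"
    proof -
      have "snd ?D ^ t = snd ?D ^ (t - k) * snd ?D ^ k" using that by (simp flip: power_add)
      then show ?thesis using snd_cyc_pow(2)[OF s k(1)] g1 by (simp add: mult.assoc)
    qed
    then show ?thesis unfolding row_inc using snd_cyc_pow(1)[OF s k(1), of t] k by auto
  qed
  have pr: "?p * fst ?D \<one> = fst ?D \<one>"
  proof (rule lop_eqI_inc)
    fix t show "?p * fst ?D \<one> * inc t = fst ?D \<one> * inc t"
      using gm_one(1)[OF s one_closed]
      by (simp add: mult.assoc[of ?p] fst_cyc_inc mult_assoc_cong[OF pinc] mult.assoc[of "inc t"])
  qed
  obtain A Z where A: "rep_of A Z" "hiso ?C Z" using realize[OF hm_cyc[OF okn]] .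
  have A': "is_module H A" "hiso (am A) ?C"
    using rep_of_module[OF A(1)] hiso_sym[OF hiso_trans[OF A(2) rep_of_iso[OF A(1)]]] by auto
  have Q': "is_module H Q" using Q by (simp add: projective_def)
  obtain T S where TS: "hhom (am A) ?C T" "hhom ?C (am A) S" "S * T = fst (am A) \<one>" "T * S = fst ?C \<one>"
    using A'(2) unfolding hiso_def by blast
  obtain T' S' where TS': "hhom (am Q) ?D T'" "hhom ?D (am Q) S'" "S' * T' = fst (am Q) \<one>" "T' * S' = fst ?D \<one>"
    using iso unfolding hiso_def by blast
  have sec: "S' * ?p * T * (S * fst ?D \<one> * T') = fst (am Q) \<one>"
  proof -
    have "S' * ?p * T * (S * fst ?D \<one> * T') = S' * (?p * (T * S) * fst ?D \<one> * T')" by (simp only: mult.assoc)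
    then have "S' * ?p * T * (S * fst ?D \<one> * T') = S' * (fst ?D \<one> * T')" by (simp only: TS(4) hhom_1[OF p] pr)
    then show ?thesis using TS'(3) hhom_1'[OF TS'(1)] by simp
  qed
  obtain f where f: "hhom (am Q) (am A) f" "S' * ?p * T * f = fst (am Q) \<one>"
    using projective_lift[OF Q A'(1) Q' hhom_comp[OF TS(1) hhom_comp[OF p TS'(2)]] sec hhom_id[OF hm_am[OF Q']]] .
  define t where "t = T * f * S'"
  have t: "hhom ?D ?C t" unfolding t_def using hhom_comp[OF TS'(2) hhom_comp[OF f(1) TS(1)]] by simp
  have pt: "?p * t = fst ?D \<one>"
  proof -
    have "?p * t = fst ?D \<one> * ?p * t" by (simp only: hhom_1'[OF p])
    then have "?p * t = T' * (S' * ?p * T * f) * S'" unfolding TS'(4)[symmetric] t_def by (simp only: mult.assoc)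
    then show ?thesis using TS'(4) hhom_1[OF TS'(1)] by (simp only: f(2))
  qed
  define j where "j = t * (inc 0 * \<sigma> \<one>)"
  have "snd ?C ^ k * j = t * (snd ?D ^ k * (inc 0 * \<sigma> \<one>))"
    unfolding j_def using hhom_Y_pow[OF t, of k] by (simp flip: mult.assoc)
  also have "\<dots> = 0" using snd_cyc_pow(2)[OF s k(1)] g1 by simp
  finally have Yj: "snd ?C ^ k * j = 0" .
  \<comment> \<open>For m < n nothing returns from the last layer to layer m, so the component of
    y^m w at x^m is that of w at x^0.\<close>
  have "prj m * snd ?C ^ m = \<sigma> \<one> ^ m * prj 0" if "m < n" for m
    using that
  proof (induction m)
    case (Suc m)
    have "prj (Suc m) * snd ?C ^ Suc m = (prj (Suc m) * snd ?C) * snd ?C ^ m" by (simp add: mult.assoc)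
    also have "\<dots> = \<sigma> \<one> * (prj m * snd ?C ^ m)"
      using Suc.prems n_pos prj_snd_cyc[of n "Suc m" \<sigma>] by (simp add: mult.assoc)
    finally show ?case using Suc by (simp add: mult.assoc)
  qed simp
  from mult_assoc_cong[OF this[OF k(2)], of j] have "\<sigma> \<one> ^ k * prj 0 * j = 0" using Yj by (simp add: mult.assoc)
  moreover have "\<sigma> \<one> ^ k = \<sigma> \<one>" using gm_pow_Suc[OF s one_closed, of k] k by simp
  ultimately have j0: "\<sigma> \<one> * (prj 0 * j) = 0" by (simp add: mult.assoc)
  have p0: "prj 0 * ?p = \<sigma> \<one> * prj 0"
  proof (rule lop_eqI_inc)
    fix m show "prj 0 * ?p * inc m = \<sigma> \<one> * prj 0 * inc m"
      unfolding mult.assoc[of "prj 0"] pinc using k by (simp add: prj_inc_left prj_inc mult.assoc)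
  qed
  have "prj 0 * (?p * j) = \<sigma> \<one>"
    unfolding j_def using mult_assoc_cong[OF pt, of "inc 0 * \<sigma> \<one>"] k
    by (simp add: mult_assoc_cong[OF fst_cyc_inc] prj_inc_left gm_one[OF s] mult.assoc)
  moreover have "prj 0 * (?p * j) = 0" using mult_assoc_cong[OF p0, of j] j0 by (simp add: mult.assoc)
  ultimately show False using nz by simp
qed

lemma gr_simple_1: "simple_module KG V \<Longrightarrow> gr V \<one> \<noteq> 0"
  by (simp add: gr_1 simple_KG gr_simple_nz)

lemma hiso_ds_zero:
  assumes X: "hm X" and Z: "hm Z" and z: "fst Z \<one> = 0" shows "hiso X (ds X Z)"
proof (rule hisoI[OF hhom_inc_prj(1)[OF X Z] hhom_inc_prj(3)[OF X Z]])
  show "fst X \<one> * prj 0 * (inc 0 * fst X \<one>) = fst X \<one>" by (simp add: ps gm_one[OF hm_gm[OF X]])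
  show "inc 0 * fst X \<one> * (fst X \<one> * prj 0) = fst (ds X Z) \<one>"
    by (simp add: ds_def z mult.assoc mult_assoc_cong[OF gm_one(1)[OF hm_gm[OF X] one_closed]])
qed

lemma realize_module:
  assumes "hm X" obtains M where "is_module H M" "hiso (am M) X"
proof -
  obtain M Z where M: "rep_of M Z" "hiso X Z" using realize[OF assms] .
  show ?thesis by (rule that[OF rep_of_module[OF M(1)] hiso_sym[OF hiso_trans[OF M(2) rep_of_iso[OF M(1)]]]])
qed

lemma fst_am_1: "is_module H M \<Longrightarrow> fst (am M) \<one> = pr (fst M)"
  using rep_of_am[of M] by (simp add: rep_of_def)

lemma hiso_zero: "hiso X Z \<Longrightarrow> fst X \<one> = 0 \<longleftrightarrow> fst Z \<one> = 0"
proof -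
  assume "hiso X Z"
  then obtain T S where *: "hhom X Z T" "hhom Z X S" "S * T = fst X \<one>" "T * S = fst Z \<one>" unfolding hiso_def by blast
  have "T = 0" if "fst X \<one> = 0 \<or> fst Z \<one> = 0" using that hhom_1[OF *(1)] hhom_1'[OF *(1)] by auto
  then show ?thesis using *(3,4) by auto
qed

text \<open>If M had smaller dimension than N, the projection onto the first dim M monomials would
  split through dim N of them, against \<open>split_rank_less\<close>.\<close>

lemma hiso_dim: assumes M: "is_module H M" and N: "is_module H N" and i: "hiso (am M) (am N)"
  shows "fst N \<le> fst M"
proof (rule ccontr)
  obtain T S where *: "hhom (am N) (am M) S" "hhom (am M) (am N) T" "S * T = fst (am M) \<one>" "T * S = fst (am N) \<one>"
    using i unfolding hiso_def by blast
  note f = fst_am_1[OF M] fst_am_1[OF N]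
  assume "\<not> fst N \<le> fst M"
  then have lt: "fst M < fst N" by simp
  have "fst N < fst N"
  proof (rule split_rank_less[where S = T and T = S and E = "pr (fst M)" and r = "fst N" and d = "fst N"])
    show "pr (fst M) \<noteq> (pr (fst N) :: 'k lop)" using lt pr_inj[of "fst M" "fst N", where 'k = 'k] by auto
  qed (use hhom_1[OF *(1)] hhom_1'[OF *(2)] lt in \<open>simp_all add: * f pr_pr\<close>)
  then show False by simp
qed

lemma cyc_nonzero:
  assumes V: "simple_module KG V" and ok: "cyc_ok k (gr V)"
  shows "fst (cyc k (gr V)) \<one> \<noteq> 0"
proof
  assume "fst (cyc k (gr V)) \<one> = 0"
  then have "inc 0 * gr V \<one> = 0" using fst_cyc_inc[of k "gr V" \<one> 0] ok by (simp add: cyc_ok_def)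
  then have "gr V \<one> = 0" using prj_inc_left[of 0 0 "gr V \<one>"] by simp
  then show False using gr_simple_1[OF V] by simp
qed

lemma cyc_split:
  assumes Vs: "complete_simples KG \<Omega> V" and M: "is_module H M" and nz: "fst M \<noteq> 0"
  obtains j k M1 M2 where "j \<in> \<Omega>" "cyc_ok k (gr (V j))" "is_module H M1" "is_module H M2"
    "hiso (am M1) (cyc k (gr (V j)))" "hiso (am M) (am (dsum M1 M2))" "fst M1 \<noteq> 0"
proof -
  obtain j k X' where c: "j \<in> \<Omega>" "cyc_ok k (gr (V j))" "hm X'" "hiso (am M) (ds (cyc k (gr (V j))) X')"
    using cyc_summand[OF Vs M nz] .
  note C = hm_cyc[OF c(2)]
  obtain M1 where M1: "is_module H M1" "hiso (am M1) (cyc k (gr (V j)))" using realize_module[OF C] .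
  obtain M2 where M2: "is_module H M2" "hiso (am M2) X'" using realize_module[OF c(3)] .
  have i: "hiso (am M) (am (dsum M1 M2))"
    using c(4) hiso_sym[OF hiso_trans[OF dsum_am(2)[OF M1(1) M2(1)] hiso_ds[OF M1(2) M2(2) hm_am[OF M1(1)] hm_am[OF M2(1)] C c(3)]]]
    by (rule hiso_trans)
  have "simple_module KG (V j)" using Vs c(1) unfolding complete_simples_def by blast
  then have "fst (cyc k (gr (V j))) \<one> \<noteq> 0" by (rule cyc_nonzero[OF _ c(2)])
  then have "pr (fst M1) \<noteq> (0 :: 'k lop)" using hiso_zero[OF M1(2)] fst_am_1[OF M1(1)] by simp
  then have "fst M1 \<noteq> 0" using pr_0 by metis
  then show ?thesis using that[OF c(1,2) M1(1) M2(1) M1(2) i] by simp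
qed

lemma indecomposable_cyc:
  assumes Vs: "complete_simples KG \<Omega> V" and M: "indecomposable H M"
  obtains j k where "j \<in> \<Omega>" "cyc_ok k (gr (V j))" "hiso (am M) (cyc k (gr (V j)))"
proof -
  have M': "is_module H M" "fst M \<noteq> 0"
    and ind: "\<forall>M1 M2. is_module H M1 \<and> is_module H M2 \<and> mod_iso H M (dsum M1 M2) \<longrightarrow> fst M1 = 0 \<or> fst M2 = 0"
    using M unfolding indecomposable_def by (rule conjunct1, rule conjunct1[OF conjunct2], rule conjunct2[OF conjunct2])
  obtain j k M1 M2 where c: "j \<in> \<Omega>" "cyc_ok k (gr (V j))" and m: "is_module H M1" "is_module H M2"
    and i: "hiso (am M1) (cyc k (gr (V j)))" "hiso (am M) (am (dsum M1 M2))" and nz: "fst M1 \<noteq> 0"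
    using cyc_split[OF Vs M'] .
  note D = dsum_am[OF m]
  have "mod_iso H M (dsum M1 M2)" using i(2) by (rule mod_iso_iff[OF M'(1) D(1), THEN iffD2])
  then have "fst M1 = 0 \<or> fst M2 = 0" by (rule ind[rule_format, OF conjI[OF m(1) conjI[OF m(2)]]])
  then have "fst (am M2) \<one> = 0" using nz by (simp add: fst_am_1[OF m(2)])
  then have "hiso (am M1) (ds (am M1) (am M2))" by (rule hiso_ds_zero[OF hm_am[OF m(1)] hm_am[OF m(2)]])
  then have "hiso (am M) (cyc k (gr (V j)))"
    by (rule hiso_trans[OF i(2) hiso_trans[OF D(2) hiso_trans[OF hiso_sym i(1)]]])
  with c show ?thesis using that by blast
qed

lemma projective_indecomposable:
  assumes Vs: "complete_simples KG \<Omega> V" and M: "indecomposable H M" "projective H M"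
  obtains j where "j \<in> \<Omega>" "hiso (am M) (cyc n (gr (V j)))"
proof -
  obtain j k where c: "j \<in> \<Omega>" "cyc_ok k (gr (V j))" "hiso (am M) (cyc k (gr (V j)))"
    using indecomposable_cyc[OF Vs M(1)] .
  have "simple_module KG (V j)" using Vs c(1) unfolding complete_simples_def by blast
  then have "gr (V j) \<one> \<noteq> 0" by (simp_all add: gr_simple_1)
  then have "k = n" using projective_cyc[OF M(2) c(3,2)] by simp
  with c show ?thesis using that by blast
qed

end

section \<open>Green rings\<close>

definition bil :: "('x \<Rightarrow> 'x \<Rightarrow> 'x) \<Rightarrow> ('x \<Rightarrow>\<^sub>0 int) \<Rightarrow> ('x \<Rightarrow>\<^sub>0 int) \<Rightarrow> ('x \<Rightarrow>\<^sub>0 int)"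
  where "bil ct = (\<lambda>x y. frag_extend (\<lambda>X. frag_extend (\<lambda>Y. frag_of (ct X Y)) y) x)"

lemma frag_extend_fun_diff: "frag_extend (\<lambda>X. F X - G X) x = frag_extend F x - frag_extend G x"
  by (rule frag_induction[of x UNIV]) (auto simp: frag_extend_diff)

lemma frag_extend_fun_add: "frag_extend (\<lambda>X. F X + G X) x = frag_extend F x + frag_extend G x"
  by (rule frag_induction[of x UNIV]) (auto simp: frag_extend_diff)

lemma frag_extend_fun_0: "frag_extend (\<lambda>X. 0) x = 0"
  by (simp add: frag_extend_eq_0)

lemma bil_simps [simp]: "bil ct (frag_of X) (frag_of Y) = frag_of (ct X Y)"
  "bil ct 0 y = 0" "bil ct x 0 = 0"
  by (simp_all add: bil_def frag_extend_fun_0)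

lemma bil_add: "bil ct (x + x') y = bil ct x y + bil ct x' y" "bil ct x (y + y') = bil ct x y + bil ct x y'"
  by (simp_all add: bil_def frag_extend_add frag_extend_fun_add)

lemma bil_diff: "bil ct (x - x') y = bil ct x y - bil ct x' y" "bil ct x (y - y') = bil ct x y - bil ct x y'"
  by (simp_all add: bil_def frag_extend_diff frag_extend_fun_diff)

context datum
begin

text \<open>
  A boolean selects between \<open>H/H(1 - e)\<close> (\<open>True\<close>) and \<open>H\<close> (\<open>False\<close>), so that both Green rings are treated at once:
  \<open>RG True\<close> below is \<open>r(H/H(1 - e))\<close>, \<open>RG False\<close> is \<open>r(H)\<close>, and \<open>gc B X\<close> is the class of \<open>X\<close>.
\<close>

definition J :: "bool \<Rightarrow> (nat \<times> 'a \<Rightarrow> 'k) set" where "J B = (if B then I_bar G \<chi> g n else zero_ideal)"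

definition mB :: "bool \<Rightarrow> ('a, 'k) am \<Rightarrow> bool"
  where "mB B X \<longleftrightarrow> hm X \<and> (B \<longrightarrow> fst X (g [^] n) = fst X \<one>)"

text \<open>One class serves both rings: a module isomorphic to one annihilated by H(1 - e) is
  itself annihilated.\<close>

definition cl :: "('a, 'k) am \<Rightarrow> (nat \<times> 'a, 'k) rep set"
  where "cl X = {M. is_module H M \<and> hiso (am M) X}"

definition CL :: "bool \<Rightarrow> (nat \<times> 'a, 'k) rep set set" where "CL B = cl ` {X. mB B X}"

lemma mB_hm: "mB B X \<Longrightarrow> hm X" by (simp add: mB_def)

lemma mB_mono: "mB True X \<Longrightarrow> mB B X" by (simp add: mB_def)

lemma mB_iso: assumes "hiso X Z" "mB B X" "hm Z" shows "mB B Z"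
proof -
  obtain T S where *: "hhom X Z T" "hhom Z X S" "S * T = fst X \<one>" "T * S = fst Z \<one>"
    using assms(1) unfolding hiso_def by blast
  have "fst Z (g [^] n) = fst Z (g [^] n) * (T * S)" using assms(3) by (simp add: * gm_one hm_gm)
  also have "\<dots> = T * (fst X (g [^] n) * S)" using mult_assoc_cong[OF hhom_h[OF *(1), of "g [^] n"], of S] by (simp add: mult.assoc)
  finally show ?thesis using assms(2,3) * hhom_1'[OF *(2)] by (simp add: mB_def)
qed

lemma modules_J: "modules H (J B) = {M. is_module H M \<and> mB B (am M)}"
  by (auto simp: J_def mB_def modules_zero modules_bar hm_am)

lemma mB_ht: "mB B X \<Longrightarrow> mB B Z \<Longrightarrow> mB B (ht X Z)"
  by (simp add: mB_def hm_ht fst_ht gt_def)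

lemma mB_ds: "mB B X \<Longrightarrow> mB B Z \<Longrightarrow> mB B (ds X Z)"
  by (simp add: mB_def hm_ds) (simp add: ds_def)

lemma mB_tv: "mB B tv" using hm_tv by (simp add: mB_def tv_def)

lemma cl_eq: assumes "hm X" "hm Z" shows "cl X = cl Z \<longleftrightarrow> hiso X Z"
proof
  assume "cl X = cl Z"
  moreover obtain M where M: "is_module H M" "hiso (am M) X" using realize_module[OF assms(1)] .
  ultimately have "hiso (am M) Z" unfolding cl_def by blast
  then show "hiso X Z" by (rule hiso_trans[OF hiso_sym[OF M(2)]])
next
  assume XZ: "hiso X Z"
  show "cl X = cl Z" unfolding cl_def
  proof (intro Collect_cong conj_cong refl iffI)
    fix M assume "hiso (am M) X" then show "hiso (am M) Z" by (rule hiso_trans[OF _ XZ])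
  next
    fix M assume "hiso (am M) Z" then show "hiso (am M) X" by (rule hiso_trans[OF _ hiso_sym[OF XZ]])
  qed
qed

lemma cl_cong: "hiso X Z \<Longrightarrow> hm X \<Longrightarrow> hm Z \<Longrightarrow> cl X = cl Z" by (simp add: cl_eq)

lemma iso_cls_cl: assumes "M \<in> modules H (J B)" shows "iso_cls H (J B) M = cl (am M)"
proof -
  have M: "is_module H M" "mB B (am M)" using assms by (simp_all add: modules_J)
  have "N \<in> modules H (J B) \<and> mod_iso H M N \<longleftrightarrow> is_module H N \<and> hiso (am N) (am M)" for N
  proof (cases "is_module H N")
    case True
    have "hiso (am N) (am M) \<Longrightarrow> mB B (am N)" using mB_iso[OF hiso_sym M(2) hm_am[OF True]] by simp
    moreover have "hiso (am N) (am M) \<longleftrightarrow> hiso (am M) (am N)" using hiso_sym by metis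
    ultimately show ?thesis using True mod_iso_iff[OF M(1) True] by (auto simp: modules_J)
  qed (simp add: modules_J)
  then show ?thesis unfolding iso_cls_def cl_def by simp
qed

lemma realize_J: assumes "mB B X" obtains M where "M \<in> modules H (J B)" "M \<in> cl X" "cl (am M) = cl X" "hiso (am M) X"
proof -
  obtain M where M: "is_module H M" "hiso (am M) X" using realize_module[OF mB_hm[OF assms]] .
  have "mB B (am M)" by (rule mB_iso[OF hiso_sym[OF M(2)] assms hm_am[OF M(1)]])
  then show ?thesis using that[of M] M cl_cong[OF M(2) hm_am[OF M(1)] mB_hm[OF assms]] by (simp add: modules_J cl_def)
qed

lemma iso_cls_CL: "iso_cls H (J B) ` modules H (J B) = CL B"
proof
  show "iso_cls H (J B) ` modules H (J B) \<subseteq> CL B"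
    using iso_cls_cl by (auto simp: CL_def modules_J)
  show "CL B \<subseteq> iso_cls H (J B) ` modules H (J B)"
  proof
    fix C assume "C \<in> CL B"
    then obtain X where X: "mB B X" "C = cl X" by (auto simp: CL_def)
    obtain M where "M \<in> modules H (J B)" "cl (am M) = cl X" using realize_J[OF X(1)] by metis
    then show "C \<in> iso_cls H (J B) ` modules H (J B)" using iso_cls_cl X(2) by (metis image_eqI)
  qed
qed

text \<open>The product is a union over all pairs of representatives, and each pair contributes the
  same class.\<close>

lemma cls_tensor_cl:
  assumes X: "mB B X" and Z: "mB B Z"
  shows "cls_tensor H (J B) (cl X) (cl Z) = cl (ht X Z)"
proof -
  have *: "iso_cls H (J B) (tensor H M N) = cl (ht X Z)" if "M \<in> cl X" "N \<in> cl Z" for M N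
  proof -
    have M: "is_module H M" "hiso (am M) X" and N: "is_module H N" "hiso (am N) Z" using that by (auto simp: cl_def)
    note t = tensor_am[OF M(1) N(1)]
    have i: "hiso (am (tensor H M N)) (ht X Z)" by (rule hiso_trans[OF t(2) hiso_ht[OF M(2) N(2)]])
    then have "mB B (am (tensor H M N))" by (rule mB_iso[OF hiso_sym mB_ht[OF X Z] hm_am[OF t(1)]])
    then have "iso_cls H (J B) (tensor H M N) = cl (am (tensor H M N))" by (intro iso_cls_cl) (simp add: modules_J t)
    then show ?thesis using cl_cong[OF i hm_am[OF t(1)] mB_hm[OF mB_ht[OF X Z]]] by simp
  qed
  obtain M where "M \<in> cl X" using realize_J[OF X] by metis
  moreover obtain N where "N \<in> cl Z" using realize_J[OF Z] by metis
  ultimately show ?thesis unfolding cls_tensor_def using * by blast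
qed

section \<open>The free ring on isomorphism classes\<close>

abbreviation FG :: "bool \<Rightarrow> ((nat \<times> 'a, 'k) rep set \<Rightarrow>\<^sub>0 int) ring" where "FG B \<equiv> free_green H (J B)"
abbreviation ct :: "bool \<Rightarrow> (nat \<times> 'a, 'k) rep set \<Rightarrow> (nat \<times> 'a, 'k) rep set \<Rightarrow> (nat \<times> 'a, 'k) rep set"
  where "ct B \<equiv> cls_tensor H (J B)"

lemma FG_simps: "carrier (FG B) = {c. Poly_Mapping.keys c \<subseteq> CL B}" "monoid.mult (FG B) = bil (ct B)"
  "monoid.one (FG B) = frag_of (cl tv)" "ring.zero (FG B) = 0" "ring.add (FG B) = (+)"
proof -
  have "triv H \<in> modules H (J B)"
    using triv_am by (simp add: modules_J mB_iso[OF hiso_sym[OF triv_am(2)] mB_tv hm_am])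
  then have "iso_cls H (J B) (triv H) = cl tv"
    using iso_cls_cl cl_cong[OF triv_am(2) hm_am[OF triv_am(1)] hm_tv] by simp
  then show "monoid.one (FG B) = frag_of (cl tv)" by (simp add: free_green_def)
qed (simp_all add: free_green_def free_Abelian_group_def bil_def iso_cls_CL)

lemma FG_of [simp]: "mB B X \<Longrightarrow> frag_of (cl X) \<in> carrier (FG B)"
  by (auto simp: FG_simps CL_def)

lemma FG_closed: "0 \<in> carrier (FG B)" "x \<in> carrier (FG B) \<Longrightarrow> y \<in> carrier (FG B) \<Longrightarrow> x + y \<in> carrier (FG B)"
  "x \<in> carrier (FG B) \<Longrightarrow> - x \<in> carrier (FG B)"
  "x \<in> carrier (FG B) \<Longrightarrow> y \<in> carrier (FG B) \<Longrightarrow> x - y \<in> carrier (FG B)"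
  using keys_add[of x y] keys_diff[of x y] by (auto simp: FG_simps)

text \<open>Identities between multiadditive maps are reduced to classes of modules by one
  application of this rule per variable.\<close>

lemma FG_ind [consumes 1, case_names zero cls diff]:
  assumes "x \<in> carrier (FG B)" "P 0" "\<And>X. mB B X \<Longrightarrow> P (frag_of (cl X))"
    "\<And>a b. P a \<Longrightarrow> P b \<Longrightarrow> P (a - b)"
  shows "P x"
proof (rule frag_induction[of x "CL B"])
  show "Poly_Mapping.keys x \<subseteq> CL B" using assms(1) by (simp add: FG_simps)
  fix C assume "C \<in> CL B" then show "P (frag_of C)" using assms(3) by (auto simp: CL_def)
qed (use assms in auto)

lemma FG_mult_closed:
  assumes x: "x \<in> carrier (FG B)" and y: "y \<in> carrier (FG B)" shows "bil (ct B) x y \<in> carrier (FG B)"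
  using x
proof (induction x rule: FG_ind)
  case (cls X)
  show ?case using y
    by (induction y rule: FG_ind) (simp_all add: FG_closed bil_diff cls_tensor_cl cls mB_ht)
qed (simp_all add: FG_closed bil_diff)

lemma FG_assoc:
  assumes x: "x \<in> carrier (FG B)" and y: "y \<in> carrier (FG B)" and z: "z \<in> carrier (FG B)"
  shows "bil (ct B) (bil (ct B) x y) z = bil (ct B) x (bil (ct B) y z)"
  using x
proof (induction x rule: FG_ind)
  case X: (cls X)
  show ?case using y
  proof (induction y rule: FG_ind)
    case Z: (cls Z)
    show ?case using z
    proof (induction z rule: FG_ind)
      case W: (cls W)
      have "cl (ht (ht X Z) W) = cl (ht X (ht Z W))"
        using X Z W by (intro cl_cong hiso_ht_assoc hm_ht) (auto simp: mB_hm)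
      then show ?case using X Z W by (simp add: cls_tensor_cl mB_ht)
    qed (simp_all add: bil_diff)
  qed (simp_all add: bil_diff)
qed (simp_all add: bil_diff)

lemma FG_one:
  assumes x: "x \<in> carrier (FG B)"
  shows "bil (ct B) (frag_of (cl tv)) x = x" "bil (ct B) x (frag_of (cl tv)) = x"
proof -
  show "bil (ct B) (frag_of (cl tv)) x = x" using x
  proof (induction x rule: FG_ind)
    case (cls X)
    have "cl (ht tv X) = cl X" using cls by (intro cl_cong hiso_sym[OF hiso_tv_ht] hm_ht hm_tv) (auto simp: mB_hm)
    then show ?case using cls mB_tv by (simp add: cls_tensor_cl)
  qed (simp_all add: bil_diff)
  show "bil (ct B) x (frag_of (cl tv)) = x" using x
  proof (induction x rule: FG_ind)
    case (cls X)
    have "cl (ht X tv) = cl X" using cls by (intro cl_cong hiso_sym[OF hiso_ht_tv] hm_ht hm_tv) (auto simp: mB_hm)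
    then show ?case using cls mB_tv by (simp add: cls_tensor_cl)
  qed (simp_all add: bil_diff)
qed

lemma FG_ring: "ring (FG B)"
proof (rule ringI)
  show "abelian_group (FG B)"
  proof (rule abelian_groupI)
    fix x assume "x \<in> carrier (FG B)"
    then show "\<exists>y\<in>carrier (FG B). y \<oplus>\<^bsub>FG B\<^esub> x = \<zero>\<^bsub>FG B\<^esub>"
      by (intro bexI[of _ "- x"]) (simp_all only: FG_simps(4,5) FG_closed ab_left_minus)
  qed (simp_all add: FG_simps(4,5) FG_closed ac_simps)
  show "Group.monoid (FG B)"
    by (rule monoidI) (simp_all only: FG_simps(2,3) FG_mult_closed FG_assoc FG_one FG_of mB_tv)
qed (simp_all only: FG_simps(2,5) bil_add)

lemma FG_minus: "x \<in> carrier (FG B) \<Longrightarrow> a_inv (FG B) x = - x" 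
  "x \<in> carrier (FG B) \<Longrightarrow> y \<in> carrier (FG B) \<Longrightarrow> a_minus (FG B) x y = x - y"
proof -
  interpret ring "FG B" by (rule FG_ring)
  show 1: "a_inv (FG B) x = - x" if "x \<in> carrier (FG B)" for x
    using that by (intro minus_equality) (simp_all only: FG_simps(4,5) FG_closed ab_left_minus)
  show "x \<in> carrier (FG B) \<Longrightarrow> y \<in> carrier (FG B) \<Longrightarrow> a_minus (FG B) x y = x - y"
    by (simp add: a_minus_def 1 FG_simps(5))
qed

section \<open>The relations and the quotient ring\<close>

abbreviation rels :: "bool \<Rightarrow> ((nat \<times> 'a, 'k) rep set \<Rightarrow>\<^sub>0 int) set" where "rels B \<equiv> green_rels H (J B)"

definition rgen :: "bool \<Rightarrow> ((nat \<times> 'a, 'k) rep set \<Rightarrow>\<^sub>0 int) set"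
  where "rgen B = {frag_of (cl (ds X Z)) - frag_of (cl X) - frag_of (cl Z) | X Z. mB B X \<and> mB B Z}"

lemma rels_rgen: "rels B = generate (add_monoid (FG B)) (rgen B)"
proof -
  have d: "iso_cls H (J B) (dsum M N) = cl (ds X Z)" 
    if M: "M \<in> modules H (J B)" and N: "N \<in> modules H (J B)" and X: "hiso (am M) X" "hm X" and Z: "hiso (am N) Z" "hm Z" for M N X Z
  proof -
    have m: "is_module H M" "is_module H N" "mB B (am M)" "mB B (am N)" using M N by (simp_all add: modules_J)
    note dd = dsum_am[OF m(1,2)]
    have i: "hiso (am (dsum M N)) (ds X Z)"
      by (rule hiso_trans[OF dd(2) hiso_ds[OF X(1) Z(1) hm_am[OF m(1)] hm_am[OF m(2)] X(2) Z(2)]])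
    have "mB B (am (dsum M N))" by (rule mB_iso[OF hiso_sym[OF dd(2)] mB_ds[OF m(3,4)] hm_am[OF dd(1)]])
    then have "iso_cls H (J B) (dsum M N) = cl (am (dsum M N))" by (intro iso_cls_cl) (simp add: modules_J dd)
    then show ?thesis using cl_cong[OF i hm_am[OF dd(1)] hm_ds[OF X(2) Z(2)]] by simp
  qed
  have "{frag_of (iso_cls H (J B) (dsum M N)) - frag_of (iso_cls H (J B) M) - frag_of (iso_cls H (J B) N)
      | M N. M \<in> modules H (J B) \<and> N \<in> modules H (J B)} = rgen B" (is "?L = _")
  proof
    show "?L \<subseteq> rgen B"
    proof
      fix x assume "x \<in> ?L"
      then obtain M N where x: "x = frag_of (iso_cls H (J B) (dsum M N)) - frag_of (iso_cls H (J B) M) - frag_of (iso_cls H (J B) N)"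
        and M: "M \<in> modules H (J B)" and N: "N \<in> modules H (J B)" by blast
      have m: "hm (am M)" "hm (am N)" "mB B (am M)" "mB B (am N)" using M N by (simp_all add: modules_J hm_am)
      have "x = frag_of (cl (ds (am M) (am N))) - frag_of (cl (am M)) - frag_of (cl (am N))"
        unfolding x d[OF M N hiso_refl[OF m(1)] m(1) hiso_refl[OF m(2)] m(2)] iso_cls_cl[OF M] iso_cls_cl[OF N] ..
      then show "x \<in> rgen B" using m unfolding rgen_def by blast
    qed
    show "rgen B \<subseteq> ?L"
    proof
      fix x assume "x \<in> rgen B"
      then obtain X Z where x: "x = frag_of (cl (ds X Z)) - frag_of (cl X) - frag_of (cl Z)" and X: "mB B X" and Z: "mB B Z"
        unfolding rgen_def by blast
      obtain M where M: "M \<in> modules H (J B)" "cl (am M) = cl X" "hiso (am M) X" using realize_J[OF X] by metis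
      obtain N where N: "N \<in> modules H (J B)" "cl (am N) = cl Z" "hiso (am N) Z" using realize_J[OF Z] by metis
      have "x = frag_of (iso_cls H (J B) (dsum M N)) - frag_of (iso_cls H (J B) M) - frag_of (iso_cls H (J B) N)"
        unfolding x d[OF M(1) N(1) M(3) mB_hm[OF X] N(3) mB_hm[OF Z]] iso_cls_cl[OF M(1)] iso_cls_cl[OF N(1)] M(2) N(2) ..
      then show "x \<in> ?L" using M(1) N(1) by blast
    qed
  qed
  then show ?thesis unfolding green_rels_def by simp
qed

lemma rgen_carrier: "rgen B \<subseteq> carrier (FG B)"
  unfolding rgen_def by (auto intro!: FG_closed(4) FG_of mB_ds)

lemma rels_subgroup: "additive_subgroup (rels B) (FG B)"
proof -
  interpret ring "FG B" by (rule FG_ring)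
  show ?thesis unfolding rels_rgen
    by (rule additive_subgroupI, rule add.generate_is_subgroup) (use rgen_carrier in simp)
qed

lemma rels_closed: "0 \<in> rels B" "x \<in> rels B \<Longrightarrow> y \<in> rels B \<Longrightarrow> x + y \<in> rels B" "x \<in> rels B \<Longrightarrow> - x \<in> rels B"
  "x \<in> rels B \<Longrightarrow> y \<in> rels B \<Longrightarrow> x - y \<in> rels B" "x \<in> rels B \<Longrightarrow> x \<in> carrier (FG B)"
proof -
  interpret ring "FG B" by (rule FG_ring)
  interpret additive_subgroup "rels B" "FG B" by (rule rels_subgroup)
  show "0 \<in> rels B" using zero_closed by (simp add: FG_simps)
  show add: "x + y \<in> rels B" if "x \<in> rels B" "y \<in> rels B" for x y using a_closed[OF that] by (simp add: FG_simps)
  show c: "x \<in> carrier (FG B)" if "x \<in> rels B" for x using a_subset that by blast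
  show neg: "- x \<in> rels B" if "x \<in> rels B" for x using a_inv_closed[OF that] FG_minus(1)[OF c[OF that]] by simp
  show "x - y \<in> rels B" if "x \<in> rels B" "y \<in> rels B" for x y using add[OF that(1) neg[OF that(2)]] by simp
qed

lemma rels_ind [consumes 1, case_names zero gen diff]:
  assumes "x \<in> rels B" "P 0" "\<And>X Z. mB B X \<Longrightarrow> mB B Z \<Longrightarrow> P (frag_of (cl (ds X Z)) - frag_of (cl X) - frag_of (cl Z))"
    "\<And>a b. P a \<Longrightarrow> P b \<Longrightarrow> P (a - b)"
  shows "P x"
proof -
  have gen: "P h" if "h \<in> rgen B" for h using that assms(3) unfolding rgen_def by blast
  have "x \<in> generate (add_monoid (FG B)) (rgen B)" using assms(1) by (simp add: rels_rgen)
  then show ?thesis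
  proof (induction x rule: generate.induct)
    case one then show ?case using assms(2) by (simp add: FG_simps)
  next
    case (incl h) then show ?case by (rule gen)
  next
    case (inv h)
    then have "inv\<^bsub>add_monoid (FG B)\<^esub> h = - h" using FG_minus(1)[of h B] rgen_carrier by (auto simp: a_inv_def)
    then show ?case using assms(4)[OF assms(2) gen[OF inv]] by simp
  next
    case (eng a b)
    have "P (a - (0 - b))" by (intro assms(4) assms(2) eng)
    then show ?case by (simp add: FG_simps)
  qed
qed

text \<open>Tensoring the relation for a direct sum with W gives the relation for the two products,
  because the tensor product distributes over direct sums on either side.\<close>

lemma rels_ideal: "ideal (rels B) (FG B)"
proof (rule idealI[OF FG_ring])
  show "subgroup (rels B) (add_monoid (FG B))" using rels_subgroup by (simp add: additive_subgroup_def)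
  have gen: "frag_of (cl (ds X Z)) - frag_of (cl X) - frag_of (cl Z) \<in> rels B" if "mB B X" "mB B Z" for X Z
    unfolding rels_rgen rgen_def using that by (intro generate.incl) blast
  fix a x assume a: "a \<in> rels B" and x: "x \<in> carrier (FG B)"
  show "x \<otimes>\<^bsub>FG B\<^esub> a \<in> rels B"
    unfolding FG_simps(2) using x
  proof (induction x rule: FG_ind)
    case W: (cls W)
    show ?case using a
    proof (induction a rule: rels_ind)
      case (gen X Z)
      have "cl (ht W (ds X Z)) = cl (ds (ht W X) (ht W Z))"
        using gen W by (intro cl_cong hiso_ht_ds hm_ht hm_ds) (auto simp: mB_hm)
      then show ?case using gen W \<open>\<And>X Z. mB B X \<Longrightarrow> mB B Z \<Longrightarrow> _\<close>[of "ht W X" "ht W Z"]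
        by (simp add: bil_diff cls_tensor_cl mB_ht mB_ds)
    qed (simp_all add: bil_diff rels_closed)
  qed (simp_all add: bil_diff rels_closed)
  show "a \<otimes>\<^bsub>FG B\<^esub> x \<in> rels B"
    unfolding FG_simps(2) using x
  proof (induction x rule: FG_ind)
    case W: (cls W)
    show ?case using a
    proof (induction a rule: rels_ind)
      case (gen X Z)
      have "cl (ht (ds X Z) W) = cl (ds (ht X W) (ht Z W))"
        using gen W by (intro cl_cong hiso_ht_ds hm_ht hm_ds) (auto simp: mB_hm)
      then show ?case using gen W \<open>\<And>X Z. mB B X \<Longrightarrow> mB B Z \<Longrightarrow> _\<close>[of "ht X W" "ht Z W"]
        by (simp add: bil_diff cls_tensor_cl mB_ht mB_ds)
    qed (simp_all add: bil_diff rels_closed)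
  qed (simp_all add: bil_diff rels_closed)
qed

abbreviation RG :: "bool \<Rightarrow> ((nat \<times> 'a, 'k) rep set \<Rightarrow>\<^sub>0 int) set ring" where "RG B \<equiv> green H (J B)"
abbreviation cs :: "bool \<Rightarrow> ((nat \<times> 'a, 'k) rep set \<Rightarrow>\<^sub>0 int) \<Rightarrow> ((nat \<times> 'a, 'k) rep set \<Rightarrow>\<^sub>0 int) set"
  where "cs B x \<equiv> rels B +>\<^bsub>FG B\<^esub> x"

definition gc :: "bool \<Rightarrow> ('a, 'k) am \<Rightarrow> ((nat \<times> 'a, 'k) rep set \<Rightarrow>\<^sub>0 int) set"
  where "gc B X = cs B (frag_of (cl X))"

lemma RG_ring: "ring (RG B)" unfolding green_def by (rule ideal.quotient_is_ring[OF rels_ideal])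

lemma cs_hom: "ring_hom_ring (FG B) (RG B) (cs B)"
  unfolding green_def by (rule ideal.rcos_ring_hom_ring[OF rels_ideal])

lemma cs_set: "cs B x = {r + x | r. r \<in> rels B}"
  by (auto simp: a_r_coset_def' FG_simps(5))

lemma cs_eq: "cs B x = cs B y \<longleftrightarrow> x - y \<in> rels B"
proof
  assume "cs B x = cs B y"
  moreover have "x \<in> cs B x" using rels_closed(1) by (auto simp: cs_set intro!: exI[of _ 0])
  ultimately obtain r where "x = r + y" "r \<in> rels B" by (auto simp: cs_set)
  then show "x - y \<in> rels B" by simp
next
  assume xy: "x - y \<in> rels B"
  show "cs B x = cs B y"
  proof
    show "cs B x \<subseteq> cs B y"
    proof
      fix z assume "z \<in> cs B x"
      then obtain r where "z = r + x" "r \<in> rels B" by (auto simp: cs_set)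
      then have "z = (r + (x - y)) + y" "r + (x - y) \<in> rels B" using xy rels_closed by auto
      then show "z \<in> cs B y" unfolding cs_set by blast
    qed
    show "cs B y \<subseteq> cs B x"
    proof
      fix z assume "z \<in> cs B y"
      then obtain r where "z = r + y" "r \<in> rels B" by (auto simp: cs_set)
      then have "z = (r - (x - y)) + x" "r - (x - y) \<in> rels B" using xy rels_closed by auto
      then show "z \<in> cs B x" unfolding cs_set by blast
    qed
  qed
qed

lemma RG_carrier: "y \<in> carrier (RG B) \<longleftrightarrow> (\<exists>x\<in>carrier (FG B). y = cs B x)"
  by (auto simp: green_def FactRing_def A_RCOSETS_def')

lemma cs_closed: "x \<in> carrier (FG B) \<Longrightarrow> cs B x \<in> carrier (RG B)"
  by (auto simp: RG_carrier)

lemma cs_simps: assumes "x \<in> carrier (FG B)" "y \<in> carrier (FG B)"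
  shows "cs B x \<oplus>\<^bsub>RG B\<^esub> cs B y = cs B (x + y)" "cs B x \<otimes>\<^bsub>RG B\<^esub> cs B y = cs B (bil (ct B) x y)"
    "cs B x \<ominus>\<^bsub>RG B\<^esub> cs B y = cs B (x - y)"
proof -
  interpret h: ring_hom_ring "FG B" "RG B" "cs B" by (rule cs_hom)
  show a: "cs B x \<oplus>\<^bsub>RG B\<^esub> cs B y = cs B (x + y)" using h.hom_add[OF assms] by (simp add: FG_simps)
  show "cs B x \<otimes>\<^bsub>RG B\<^esub> cs B y = cs B (bil (ct B) x y)" using h.hom_mult[OF assms] by (simp add: FG_simps)
  show "cs B x \<ominus>\<^bsub>RG B\<^esub> cs B y = cs B (x - y)"
  proof -
    have "cs B (x - y) = cs B (x \<oplus>\<^bsub>FG B\<^esub> (\<ominus>\<^bsub>FG B\<^esub> y))" by (simp add: FG_simps(5) FG_minus assms)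
    also have "\<dots> = cs B x \<oplus>\<^bsub>RG B\<^esub> (\<ominus>\<^bsub>RG B\<^esub> cs B y)" using assms by (simp only: h.hom_add h.hom_a_inv h.R.a_inv_closed)
    finally show ?thesis by (simp add: a_minus_def)
  qed
qed

lemma RG_zero: "\<zero>\<^bsub>RG B\<^esub> = cs B 0"
proof -
  interpret h: ring_hom_ring "FG B" "RG B" "cs B" by (rule cs_hom)
  show ?thesis using h.hom_zero by (simp add: FG_simps)
qed

lemma RG_ind [consumes 1, case_names cls diff]:
  assumes "y \<in> carrier (RG B)" "\<And>X. mB B X \<Longrightarrow> Q (gc B X)"
    "\<And>a b. a \<in> carrier (RG B) \<Longrightarrow> b \<in> carrier (RG B) \<Longrightarrow> Q a \<Longrightarrow> Q b \<Longrightarrow> Q (a \<ominus>\<^bsub>RG B\<^esub> b)"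
  shows "Q y"
proof -
  interpret ring "RG B" by (rule RG_ring)
  obtain x where x: "x \<in> carrier (FG B)" "y = cs B x" using assms(1) by (auto simp: RG_carrier)
  have t: "gc B tv \<in> carrier (RG B)" unfolding gc_def by (intro cs_closed FG_of mB_tv)
  have z: "Q (cs B 0)" using assms(3)[OF t t assms(2)[OF mB_tv] assms(2)[OF mB_tv]] t by (simp add: a_minus_def r_neg RG_zero)
  have "x \<in> carrier (FG B) \<and> Q (cs B x)" using x(1)
  proof (induction x rule: FG_ind)
    case (cls X) then show ?case using assms(2) by (simp add: gc_def)
  next
    case (diff a b)
    then show ?case using assms(3)[of "cs B a" "cs B b"] cs_closed[of a B] cs_closed[of b B] cs_simps[of a B b] by (simp add: FG_closed)
  qed (simp add: z FG_closed)
  then show ?thesis using x(2) by simp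
qed

lemma gc_closed [simp]: "mB B X \<Longrightarrow> gc B X \<in> carrier (RG B)"
  unfolding gc_def by (intro cs_closed FG_of)

lemma gc_iso: "hiso X Z \<Longrightarrow> mB B X \<Longrightarrow> mB B Z \<Longrightarrow> gc B X = gc B Z"
  unfolding gc_def using cl_cong mB_hm by metis

lemma gc_ht: "mB B X \<Longrightarrow> mB B Z \<Longrightarrow> gc B (ht X Z) = gc B X \<otimes>\<^bsub>RG B\<^esub> gc B Z"
  unfolding gc_def by (simp add: cs_simps cls_tensor_cl)

lemma gc_ds: "mB B X \<Longrightarrow> mB B Z \<Longrightarrow> gc B (ds X Z) = gc B X \<oplus>\<^bsub>RG B\<^esub> gc B Z"
proof -
  assume X: "mB B X" and Z: "mB B Z"
  have "frag_of (cl (ds X Z)) - frag_of (cl X) - frag_of (cl Z) \<in> rels B"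
    unfolding rels_rgen rgen_def using X Z by (intro generate.incl) blast
  then show ?thesis unfolding gc_def using X Z by (simp add: cs_simps cs_eq diff_diff_eq)
qed

lemma gc_one: "gc B tv = \<one>\<^bsub>RG B\<^esub>"
proof -
  interpret h: ring_hom_ring "FG B" "RG B" "cs B" by (rule cs_hom)
  show ?thesis using h.hom_one by (simp add: FG_simps gc_def)
qed

text \<open>A zero module is isomorphic to its direct sum with itself, so its class is idempotent
  for addition.\<close>

lemma gc_zero: assumes X: "mB B X" and z: "fst X \<one> = 0" shows "gc B X = \<zero>\<^bsub>RG B\<^esub>"
proof -
  interpret ring "RG B" by (rule RG_ring)
  have "hiso X (ds X X)" using hiso_ds_zero[of X X] z mB_hm[OF X] by simp
  then have "gc B X = gc B X \<oplus>\<^bsub>RG B\<^esub> gc B X" using gc_iso[of X "ds X X" B] gc_ds[OF X X] X mB_ds[OF X X] by simp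
  then show ?thesis using add.r_cancel_one'[of "gc B X" "gc B X"] X by simp
qed

lemma green_cls_gc: "M \<in> modules H (J B) \<Longrightarrow> green_cls H (J B) M = gc B (am M)"
  unfolding green_cls_def gc_def by (simp add: iso_cls_cl)

text \<open>Well-definedness of additive maps between quotients that are written as unions over a
  coset, as \<open>infl\<close> and \<open>EB\<close> are.\<close>

lemma induced_coset:
  assumes f: "\<And>a b. f (a - b) = f a - f b" and r: "\<And>x. x \<in> rels B \<Longrightarrow> f x \<in> rels B'"
  shows "(\<Union>y\<in>cs B x. cs B' (f y)) = cs B' (f x)"
proof -
  have "cs B' (f y) = cs B' (f x)" if "y \<in> cs B x" for y
  proof -
    obtain s where "y = s + x" "s \<in> rels B" using \<open>y \<in> cs B x\<close> by (auto simp: cs_set)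
    then have "f y - f x \<in> rels B'" using f[of y x] r[of s] by simp
    then show ?thesis by (simp add: cs_eq)
  qed
  moreover have "x \<in> cs B x" using rels_closed(1) by (auto simp: cs_set intro!: exI[of _ 0])
  ultimately show ?thesis by blast
qed

section \<open>The inclusion of Green rings and its retraction\<close>

abbreviation \<iota> where "\<iota> \<equiv> infl G \<chi> g n"

lemma rels_mono: "x \<in> rels True \<Longrightarrow> x \<in> rels False"
proof (induction x rule: rels_ind)
  case (gen X Z)
  then show ?case unfolding rels_rgen rgen_def by (intro generate.incl) (use mB_mono in blast)
qed (simp_all add: rels_closed)

lemma FG_mono: "x \<in> carrier (FG True) \<Longrightarrow> x \<in> carrier (FG False)"
  by (induction x rule: FG_ind) (simp_all add: FG_closed mB_mono)

lemma infl_cs: "\<iota> (cs True x) = cs False x"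
  using induced_coset[of "\<lambda>y. y" True False x] rels_mono by (simp add: infl_def Let_def J_def)

lemma infl_gc: "\<iota> (gc True X) = gc False X"
  by (simp add: gc_def infl_cs)

lemma infl_hom: "\<iota> \<in> Ring.ring_hom (RG True) (RG False)"
proof (rule ring_hom_memI)
  have bil: "bil (ct True) x y = bil (ct False) x y" if "x \<in> carrier (FG True)" "y \<in> carrier (FG True)" for x y
    using that(1)
  proof (induction x rule: FG_ind)
    case (cls X) show ?case using that(2)
      by (induction y rule: FG_ind) (simp_all add: bil_diff cls_tensor_cl cls mB_mono)
  qed (simp_all add: bil_diff)
  fix x y assume "x \<in> carrier (RG True)" "y \<in> carrier (RG True)"
  then obtain a b where ab: "a \<in> carrier (FG True)" "b \<in> carrier (FG True)" "x = cs True a" "y = cs True b" by (auto simp: RG_carrier)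
  note m = FG_mono[OF ab(1)] FG_mono[OF ab(2)]
  show "\<iota> x \<in> carrier (RG False)" using ab m by (simp add: infl_cs cs_simps cs_closed)
  show "\<iota> (x \<otimes>\<^bsub>RG True\<^esub> y) = \<iota> x \<otimes>\<^bsub>RG False\<^esub> \<iota> y" using ab m bil by (simp add: infl_cs cs_simps cs_closed)
  show "\<iota> (x \<oplus>\<^bsub>RG True\<^esub> y) = \<iota> x \<oplus>\<^bsub>RG False\<^esub> \<iota> y" using ab m by (simp add: infl_cs cs_simps cs_closed)
next
  show "\<iota> \<one>\<^bsub>RG True\<^esub> = \<one>\<^bsub>RG False\<^esub>" by (simp add: infl_gc flip: gc_one)
qed

text \<open>The additive map \<open>[M] \<mapsto> [eM]\<close> splits the inclusion \<open>\<iota>\<close> of Green rings.\<close>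

definition Ef :: "((nat \<times> 'a, 'k) rep set \<Rightarrow>\<^sub>0 int) \<Rightarrow> ((nat \<times> 'a, 'k) rep set \<Rightarrow>\<^sub>0 int)"
  where "Ef = frag_extend (\<lambda>C. frag_of (cl (eX (am (SOME M. M \<in> C)))))"

lemma mB_eX: "hm X \<Longrightarrow> mB True (eX X)" by (simp add: mB_def hm_eX fst_eX)

text \<open>The representative chosen in \<open>Ef\<close> does not matter, because M -> eM respects
  isomorphisms.\<close>

lemma Ef_of: assumes X: "hm X" shows "Ef (frag_of (cl X)) = frag_of (cl (eX X))"
proof -
  have "mB False X" using X by (simp add: mB_def)
  then obtain M where "M \<in> cl X" using realize_J by metis
  then have "(SOME M. M \<in> cl X) \<in> cl X" by (rule someI)
  then have "is_module H (SOME M. M \<in> cl X)" "hiso (am (SOME M. M \<in> cl X)) X" by (auto simp: cl_def)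
  then have "cl (eX (am (SOME M. M \<in> cl X))) = cl (eX X)" using X by (intro cl_cong hiso_eX hm_eX hm_am) auto
  then show ?thesis by (simp add: Ef_def)
qed

lemma Ef_diff: "Ef (a - b) = Ef a - Ef b" by (simp add: Ef_def frag_extend_diff)

lemma Ef_carrier: "x \<in> carrier (FG False) \<Longrightarrow> Ef x \<in> carrier (FG True)"
  by (induction x rule: FG_ind) (simp_all add: Ef_diff FG_closed Ef_of mB_hm mB_eX, simp add: Ef_def FG_closed)

lemma Ef_rels: "x \<in> rels False \<Longrightarrow> Ef x \<in> rels True"
proof (induction x rule: rels_ind)
  case zero show ?case by (simp add: Ef_def rels_closed)
next
  case (gen X Z)
  then have "hm X" "hm Z" by (auto simp: mB_hm)
  then have "Ef (frag_of (cl (ds X Z)) - frag_of (cl X) - frag_of (cl Z)) =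
     frag_of (cl (ds (eX X) (eX Z))) - frag_of (cl (eX X)) - frag_of (cl (eX Z))"
    by (simp add: Ef_diff Ef_of hm_ds eX_ds)
  then show ?case unfolding rels_rgen rgen_def using mB_eX[OF \<open>hm X\<close>] mB_eX[OF \<open>hm Z\<close>]
    by (intro generate.incl) blast
qed (simp add: Ef_diff rels_closed)

definition EB :: "((nat \<times> 'a, 'k) rep set \<Rightarrow>\<^sub>0 int) set \<Rightarrow> ((nat \<times> 'a, 'k) rep set \<Rightarrow>\<^sub>0 int) set"
  where "EB Y = (\<Union>y\<in>Y. cs True (Ef y))"

lemma EB_cs: "EB (cs False x) = cs True (Ef x)"
  unfolding EB_def by (rule induced_coset) (simp_all add: Ef_diff Ef_rels)

lemma EB_gc: "hm X \<Longrightarrow> EB (gc False X) = gc True (eX X)"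
  by (simp add: gc_def EB_cs Ef_of)

lemma EB_hom: assumes "x \<in> carrier (RG False)" "y \<in> carrier (RG False)"
  shows "EB x \<in> carrier (RG True)" "EB (x \<ominus>\<^bsub>RG False\<^esub> y) = EB x \<ominus>\<^bsub>RG True\<^esub> EB y"
proof -
  obtain a b where ab: "a \<in> carrier (FG False)" "b \<in> carrier (FG False)" "x = cs False a" "y = cs False b"
    using assms by (auto simp: RG_carrier)
  then show "EB x \<in> carrier (RG True)" "EB (x \<ominus>\<^bsub>RG False\<^esub> y) = EB x \<ominus>\<^bsub>RG True\<^esub> EB y"
    by (simp_all add: EB_cs cs_simps cs_closed Ef_carrier Ef_diff)
qed

lemma EB_infl: "x \<in> carrier (RG True) \<Longrightarrow> EB (\<iota> x) = x"
proof (induction x rule: RG_ind)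
  case (cls X)
  then have "hm X" "fst X (g [^] n) = fst X \<one>" by (auto simp: mB_def)
  then show ?case using cls by (simp add: infl_gc EB_gc gc_iso eX_trivial mB_eX)
next
  case (diff a b)
  then obtain x y where xy: "x \<in> carrier (FG True)" "y \<in> carrier (FG True)" "a = cs True x" "b = cs True y" by (auto simp: RG_carrier)
  have "EB (\<iota> (a \<ominus>\<^bsub>RG True\<^esub> b)) = cs True (Ef x) \<ominus>\<^bsub>RG True\<^esub> cs True (Ef y)"
    using xy by (simp add: cs_simps infl_cs EB_cs Ef_diff Ef_carrier FG_mono)
  then show ?case using diff(3,4) xy(3,4) by (simp add: infl_cs EB_cs)
qed

end

text \<open>The induction step for commutativity: the recursion expresses x as a difference of
  products of elements that commute with a.\<close>

lemma comm_recursion: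
  fixes R (structure)
  assumes "ring R" "a \<in> carrier R" "x \<in> carrier R" "u \<in> carrier R" "v \<in> carrier R" "w \<in> carrier R" "y \<in> carrier R"
    and eq: "x \<oplus> w \<otimes> y = u \<otimes> v"
    and c: "a \<otimes> u = u \<otimes> a" "a \<otimes> v = v \<otimes> a" "a \<otimes> w = w \<otimes> a" "a \<otimes> y = y \<otimes> a"
  shows "a \<otimes> x = x \<otimes> a"
proof -
  interpret ring R by fact
  note cl = assms(2-7)
  have "a \<otimes> (s \<otimes> t) = s \<otimes> t \<otimes> a" if "s \<in> carrier R" "t \<in> carrier R" "a \<otimes> s = s \<otimes> a" "a \<otimes> t = t \<otimes> a" for s t
    using m_assoc[of a s t] m_assoc[of s a t] m_assoc[of s t a] cl that by simp
  then have m: "a \<otimes> (u \<otimes> v) = u \<otimes> v \<otimes> a" "a \<otimes> (w \<otimes> y) = w \<otimes> y \<otimes> a" using cl c by blast+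
  have "a \<otimes> x \<oplus> a \<otimes> (w \<otimes> y) = x \<otimes> a \<oplus> a \<otimes> (w \<otimes> y)"
    using arg_cong[OF eq, of "\<lambda>z. a \<otimes> z"] arg_cong[OF eq, of "\<lambda>z. z \<otimes> a"] m cl by (simp add: r_distr l_distr)
  then show ?thesis using cl by simp
qed

context datum
begin

subsection \<open>Decomposition of modules\<close>

lemma hiso_dim_eq: "is_module H M \<Longrightarrow> is_module H N \<Longrightarrow> hiso (am M) (am N) \<Longrightarrow> fst M = fst N"
  using hiso_dim hiso_sym by (metis le_antisym)

text \<open>One cyclic summand is split off at a time, by induction on the dimension of a matrix
  model; the case \<open>iso\<close> passes between the model and X.\<close>

lemma am_induct [consumes 2, case_names iso zero step]:
  assumes Vs: "complete_simples KG \<Omega> V" and X: "hm X"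
    and iso: "\<And>X Z. hm X \<Longrightarrow> hm Z \<Longrightarrow> hiso X Z \<Longrightarrow> Q X \<Longrightarrow> Q Z"
    and zero: "\<And>X. hm X \<Longrightarrow> fst X \<one> = 0 \<Longrightarrow> Q X"
    and step: "\<And>j k X'. j \<in> \<Omega> \<Longrightarrow> cyc_ok k (gr (V j)) \<Longrightarrow> hm X' \<Longrightarrow> Q X' \<Longrightarrow> Q (ds (cyc k (gr (V j))) X')"
  shows "Q X"
proof -
  have "Q (am M)" if "is_module H M" for M
    using that
  proof (induction "fst M" arbitrary: M rule: less_induct)
    case less
    note M = hm_am[OF less.prems]
    show ?case
    proof (cases "fst M = 0")
      case True then show ?thesis by (intro zero[OF M]) (simp add: fst_am_1[OF less.prems])
    next
      case False
      obtain j k M1 M2 where c: "j \<in> \<Omega>" "cyc_ok k (gr (V j))" and m: "is_module H M1" "is_module H M2"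
        and i: "hiso (am M1) (cyc k (gr (V j)))" "hiso (am M) (am (dsum M1 M2))" and nz: "fst M1 \<noteq> 0"
        using cyc_split[OF Vs less.prems False] .
      note C = hm_cyc[OF c(2)] and D = dsum_am[OF m] and h = hm_am[OF m(1)] hm_am[OF m(2)]
      have "fst M = fst M1 + fst M2" using hiso_dim_eq[OF less.prems D(1) i(2)] by (simp add: dsum_def)
      then have "Q (am M2)" using nz by (intro less.hyps m(2)) simp
      then have Q: "Q (ds (cyc k (gr (V j))) (am M2))" by (rule step[OF c h(2)])
      have "hiso (am M) (ds (cyc k (gr (V j))) (am M2))"
        by (rule hiso_trans[OF i(2) hiso_trans[OF D(2) hiso_ds[OF i(1) hiso_refl[OF h(2)] h C h(2)]]])
      then show ?thesis by (rule iso[OF hm_ds[OF C h(2)] M hiso_sym Q])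
    qed
  qed
  moreover obtain M where "is_module H M" "hiso (am M) X" using realize_module[OF X] .
  ultimately show ?thesis using iso[OF hm_am _ _] X by blast
qed

lemma mB_False [simp]: "mB False X = hm X" by (simp add: mB_def)

lemma gc_induct [consumes 2, case_names zero cyc add]:
  assumes Vs: "complete_simples KG \<Omega> V" and X: "hm X"
    and zero: "Q \<zero>\<^bsub>RG False\<^esub>"
    and cyc: "\<And>j k. j \<in> \<Omega> \<Longrightarrow> cyc_ok k (gr (V j)) \<Longrightarrow> Q (gc False (cyc k (gr (V j))))"
    and add: "\<And>a b. a \<in> carrier (RG False) \<Longrightarrow> b \<in> carrier (RG False) \<Longrightarrow> Q a \<Longrightarrow> Q b \<Longrightarrow> Q (a \<oplus>\<^bsub>RG False\<^esub> b)"
  shows "Q (gc False X)"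
  using Vs X
proof (induction X rule: am_induct)
  case (iso X Z) then show ?case using gc_iso[of X Z False] by simp
next
  case (zero X) then show ?case using gc_zero[of False X] assms(3) by simp
next
  case (step j k X')
  note C = hm_cyc[OF step(2)]
  show ?case using gc_ds[of False "cyc k (gr (V j))" X'] C step(3)
    add[OF _ _ cyc[OF step(1,2)] step(4)] by simp
qed

lemma RG_cyc_ind [consumes 2, case_names cyc add diff]:
  assumes Vs: "complete_simples KG \<Omega> V" and y: "y \<in> carrier (RG False)"
    and cyc: "\<And>j k. j \<in> \<Omega> \<Longrightarrow> cyc_ok k (gr (V j)) \<Longrightarrow> Q (gc False (cyc k (gr (V j))))"
    and add: "\<And>a b. a \<in> carrier (RG False) \<Longrightarrow> b \<in> carrier (RG False) \<Longrightarrow> Q a \<Longrightarrow> Q b \<Longrightarrow> Q (a \<oplus>\<^bsub>RG False\<^esub> b)"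
    and diff: "\<And>a b. a \<in> carrier (RG False) \<Longrightarrow> b \<in> carrier (RG False) \<Longrightarrow> Q a \<Longrightarrow> Q b \<Longrightarrow> Q (a \<ominus>\<^bsub>RG False\<^esub> b)"
    and zero: "Q \<zero>\<^bsub>RG False\<^esub>"
  shows "Q y"
  using y
proof (induction y rule: RG_ind)
  case (cls X)
  then have "hm X" by simp
  with Vs show ?case using zero cyc add by (rule gc_induct)
qed (rule diff)

subsection \<open>Commutativity\<close>

lemma hiso_cyc_gtriv:
  assumes ok: "cyc_ok k \<sigma>" "\<sigma> (g [^] n) = \<sigma> \<one>"
  shows "hiso (cyc k \<sigma>) (cyc k (gt \<sigma> gtriv))"
proof -
  have s: "gm \<sigma>" using ok by (simp add: cyc_ok_def)
  have k: "1 \<le> k" "k \<le> n" using ok by (auto simp: cyc_ok_def)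
  note t = tp_pr1'
  have ok': "cyc_ok k (gt \<sigma> gtriv)" by (rule cyc_ok_gt(1)[OF s ok(2) cyc_ok_gtriv(1)[OF k]])
  show ?thesis
  proof (rule hiso_cyc[OF ok(1) ok', where T = "flip * inc 0 * \<sigma> \<one>" and S = "\<sigma> \<one> * prj 0 * flip"])
    show "ghom \<sigma> (gt \<sigma> gtriv) (flip * inc 0 * \<sigma> \<one>)" unfolding ghom_def
    proof (intro conjI ballI)
      fix h assume h: "h \<in> carrier G"
      show "flip * inc 0 * \<sigma> \<one> * \<sigma> h = gt \<sigma> gtriv h * (flip * inc 0 * \<sigma> \<one>)"
        using mult_assoc_cong[OF t(1)[of "\<sigma> h"], of "\<sigma> \<one>"] by (simp add: gt_def gm_one[OF s h] mult.assoc)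
    qed (simp add: mult.assoc gm_one[OF s])
    show "ghom (gt \<sigma> gtriv) \<sigma> (\<sigma> \<one> * prj 0 * flip)" unfolding ghom_def
    proof (intro conjI ballI)
      have q: "prj 0 * (flip * tp A (pr (Suc 0))) = A * (prj 0 * flip)" for A :: "'k lop"
        unfolding t(2)[symmetric] by (simp add: mult.assoc mult_assoc_cong[OF flip_flip] prj_inc_left)
      show "\<sigma> \<one> * prj 0 * flip * gt \<sigma> gtriv \<one> = \<sigma> \<one> * prj 0 * flip"
        by (simp add: gt_def mult.assoc q mult_assoc_cong[OF gm_one(1)[OF s one_closed]])
      fix h assume h: "h \<in> carrier G"
      show "\<sigma> \<one> * prj 0 * flip * gt \<sigma> gtriv h = \<sigma> h * (\<sigma> \<one> * prj 0 * flip)"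
        by (simp add: gt_def mult.assoc q mult_assoc_cong[OF gm_one(1)[OF s h]] mult_assoc_cong[OF gm_one(2)[OF s h]])
    qed
    show "\<sigma> \<one> * prj 0 * flip * (flip * inc 0 * \<sigma> \<one>) = \<sigma> \<one>"
      by (simp add: mult.assoc mult_assoc_cong[OF flip_flip] prj_inc_left gm_one[OF s])
    show "flip * inc 0 * \<sigma> \<one> * (\<sigma> \<one> * prj 0 * flip) = gt \<sigma> gtriv \<one>"
      by (simp add: gt_def mult.assoc mult_assoc_cong[OF gm_one(1)[OF s one_closed]] t(2))
  qed
qed

lemma hiso_cyc_1_tv: "hiso (cyc 1 gtriv) tv"
proof -
  have C: "fst (cyc (Suc 0) gtriv) h = inc 0 * (pr 1 * prj 0)" "snd (cyc (Suc 0) gtriv) = 0" for h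
    by (simp_all add: cyc_def)
  show ?thesis
    by (rule hisoI[where T = "pr 1 * prj 0" and S = "inc 0 * pr 1"])
      (simp_all add: hhom_def ghom_def C tv_def ps mult_assoc_cong[OF pr1_pr1] prj_inc_left)
qed

declare gtriv_gchi [simp del]

abbreviation cy where "cy k \<equiv> gc False (cyc k gtriv)"

definition tr :: "('a \<Rightarrow> 'k lop) \<Rightarrow> bool" where "tr \<sigma> \<longleftrightarrow> gm \<sigma> \<and> \<sigma> (g [^] n) = \<sigma> \<one>"

lemma tr_gchi: "tr gchi" "tr gtriv" by (simp_all add: tr_def gm_gchi gm_gtriv gtriv_gchi)

lemma tr_ok: "tr \<sigma> \<Longrightarrow> 1 \<le> k \<Longrightarrow> k \<le> n \<Longrightarrow> cyc_ok k \<sigma>" by (simp add: tr_def cyc_ok_def)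

lemma tr_gt: "tr \<sigma> \<Longrightarrow> tr \<tau> \<Longrightarrow> tr (gt \<sigma> \<tau>)" by (simp add: tr_def gm_gt) (simp add: gt_def)

lemma tr_vz: "tr \<sigma> \<Longrightarrow> hm (vz \<sigma>)" by (simp add: tr_def hm_vz)

lemma hiso_gt_comm: "tr \<sigma> \<Longrightarrow> tr \<tau> \<Longrightarrow> 1 \<le> k \<Longrightarrow> k \<le> n \<Longrightarrow> hiso (cyc k (gt \<sigma> \<tau>)) (cyc k (gt \<tau> \<sigma>))"
  by (rule hiso_cyc[OF tr_ok tr_ok ghom_flip(1) ghom_flip(1)])
    (simp_all add: tr_gt, simp_all add: tr_def ghom_flip(2))

text \<open>\<sigma> is isomorphic to its products with the trivial module on either side, and a
  factor on which y is zero can be pulled out of a cyclic module to the left or to the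
  right.\<close>

lemma gc_cyc_vz:
  assumes s: "tr \<sigma>" and k: "1 \<le> k" "k \<le> n"
  shows "gc False (cyc k \<sigma>) = gc False (vz \<sigma>) \<otimes>\<^bsub>RG False\<^esub> cy k"
    "gc False (cyc k \<sigma>) = cy k \<otimes>\<^bsub>RG False\<^esub> gc False (vz \<sigma>)"
proof -
  have s': "gm \<sigma>" "\<sigma> (g [^] n) = \<sigma> \<one>" using s by (auto simp: tr_def)
  have g': "gm gtriv" "gtriv (g [^] n) = gtriv \<one>" using tr_gchi(2) by (auto simp: tr_def)
  note ok = tr_ok[OF s k] tr_ok[OF tr_gchi(2) k]
  note C = hm_cyc[OF ok(1)] hm_cyc[OF ok(2)] tr_vz[OF s]
  have 1: "hiso (cyc k \<sigma>) (cyc k (gt \<sigma> gtriv))" by (rule hiso_cyc_gtriv[OF ok(1) s'(2)])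
  have "hiso (cyc k \<sigma>) (ht (vz \<sigma>) (cyc k gtriv))"
    by (rule hiso_trans[OF 1 hiso_vz_cyc[OF s' ok(2)]])
  then have "gc False (cyc k \<sigma>) = gc False (ht (vz \<sigma>) (cyc k gtriv))"
    by (rule gc_iso) (simp_all add: C hm_ht)
  also have "\<dots> = gc False (vz \<sigma>) \<otimes>\<^bsub>RG False\<^esub> cy k" by (rule gc_ht) (simp_all add: C)
  finally show "gc False (cyc k \<sigma>) = gc False (vz \<sigma>) \<otimes>\<^bsub>RG False\<^esub> cy k" .
  have "hiso (cyc k \<sigma>) (ht (cyc k gtriv) (vz \<sigma>))"
    by (rule hiso_trans[OF hiso_trans[OF 1 hiso_gt_comm[OF s tr_gchi(2) k]] hiso_cyc_vz[OF s' ok(2) g'(2)]])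
  then have "gc False (cyc k \<sigma>) = gc False (ht (cyc k gtriv) (vz \<sigma>))"
    by (rule gc_iso) (simp_all add: C hm_ht)
  also have "\<dots> = cy k \<otimes>\<^bsub>RG False\<^esub> gc False (vz \<sigma>)" by (rule gc_ht) (simp_all add: C)
  finally show "gc False (cyc k \<sigma>) = cy k \<otimes>\<^bsub>RG False\<^esub> gc False (vz \<sigma>)" .
qed

lemma gc_vz_comm:
  assumes s: "tr \<sigma>" and t: "tr \<tau>"
  shows "gc False (vz \<sigma>) \<otimes>\<^bsub>RG False\<^esub> gc False (vz \<tau>) = gc False (vz \<tau>) \<otimes>\<^bsub>RG False\<^esub> gc False (vz \<sigma>)"
proof -
  note C = tr_vz[OF s] tr_vz[OF t]
  have st: "gm \<sigma>" "gm \<tau>" using s t by (auto simp: tr_def)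
  have f: "hhom (ht (vz \<sigma>) (vz \<tau>)) (ht (vz \<tau>) (vz \<sigma>)) (flip * gt \<sigma> \<tau> \<one>)" if "gm \<sigma>" "gm \<tau>" for \<sigma> \<tau>
    using ghom_flip(1)[OF that] by (simp add: hhom_def ht_def vz_def tp_linear)
  have "hiso (ht (vz \<sigma>) (vz \<tau>)) (ht (vz \<tau>) (vz \<sigma>))"
    by (rule hisoI[OF f[OF st] f[OF st(2,1)]]) (simp_all add: fst_ht ghom_flip(2) st)
  then have "gc False (ht (vz \<sigma>) (vz \<tau>)) = gc False (ht (vz \<tau>) (vz \<sigma>))" by (rule gc_iso) (simp_all add: C hm_ht)
  then show ?thesis by (simp add: gc_ht C)
qed

lemma cy_recursion:
  assumes m: "2 \<le> m" "m < n"
  shows "cy (Suc m) \<oplus>\<^bsub>RG False\<^esub> gc False (vz gchi) \<otimes>\<^bsub>RG False\<^esub> cy (m - 1) = cy 2 \<otimes>\<^bsub>RG False\<^esub> cy m"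
proof -
  have h: "hm (cyc 2 gtriv)" "hm (cyc m gtriv)" "hm (cyc (Suc m) gtriv)" "hm (cyc (m - 1) gchi)"
    by (rule hm_cyc[OF tr_ok[OF tr_gchi(2)]], use m in simp, use m in simp)+
      (rule hm_cyc[OF tr_ok[OF tr_gchi(1)]], use m in simp, use m in simp)
  have "gc False (ds (cyc (Suc m) gtriv) (cyc (m - 1) gchi)) = gc False (ht (cyc 2 gtriv) (cyc m gtriv))"
    by (rule gc_iso[OF hiso_clebsch_gordan[OF m]]) (simp_all only: mB_False h hm_ds hm_ht)
  moreover have "gc False (cyc (m - 1) gchi) = gc False (vz gchi) \<otimes>\<^bsub>RG False\<^esub> cy (m - 1)"
    by (rule gc_cyc_vz(1)[OF tr_gchi(1)]) (use m in auto)
  moreover have "gc False (ds (cyc (Suc m) gtriv) (cyc (m - 1) gchi)) = cy (Suc m) \<oplus>\<^bsub>RG False\<^esub> gc False (cyc (m - 1) gchi)"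
    by (rule gc_ds) (simp_all only: mB_False h)
  moreover have "gc False (ht (cyc 2 gtriv) (cyc m gtriv)) = cy 2 \<otimes>\<^bsub>RG False\<^esub> cy m"
    by (rule gc_ht) (simp_all only: mB_False h)
  ultimately show ?thesis by argo
qed

lemma cy_closed: "1 \<le> k \<Longrightarrow> k \<le> n \<Longrightarrow> cy k \<in> carrier (RG False)"
  using hm_cyc[OF tr_ok[OF tr_gchi(2)]] by (intro gc_closed) simp

text \<open>C(1, 1) is the unit, and the recursion produces all longer C(k, 1) from C(2, 1) and
  \<chi>^-1.\<close>

lemma cy_comm_gen:
  assumes a: "a \<in> carrier (RG False)" and c2: "a \<otimes>\<^bsub>RG False\<^esub> cy 2 = cy 2 \<otimes>\<^bsub>RG False\<^esub> a"
    and cw: "a \<otimes>\<^bsub>RG False\<^esub> gc False (vz gchi) = gc False (vz gchi) \<otimes>\<^bsub>RG False\<^esub> a"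
  shows "1 \<le> k \<Longrightarrow> k \<le> n \<Longrightarrow> a \<otimes>\<^bsub>RG False\<^esub> cy k = cy k \<otimes>\<^bsub>RG False\<^esub> a"
proof (induction k rule: less_induct)
  case (less k)
  interpret R: ring "RG False" by (rule RG_ring)
  consider "k = 1" | "k = 2" | "2 \<le> k - 1" "k = Suc (k - 1)" using less.prems by linarith
  then show ?case
  proof cases
    case 1
    have "cy 1 = \<one>\<^bsub>RG False\<^esub>"
      unfolding gc_one[symmetric] using hm_cyc[OF tr_ok[OF tr_gchi(2)], of 1] hm_tv n2 by (intro gc_iso hiso_cyc_1_tv) simp_all
    then have "cy k = \<one>\<^bsub>RG False\<^esub>" by (simp only: 1)
    then show ?thesis using a by simp
  next
    case 2 show ?thesis unfolding 2 by (rule c2)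
  next
    case 3
    have w: "gc False (vz gchi) \<in> carrier (RG False)" using tr_vz[OF tr_gchi(1)] by simp
    have "cy (Suc (k - 1)) \<oplus>\<^bsub>RG False\<^esub> gc False (vz gchi) \<otimes>\<^bsub>RG False\<^esub> cy (k - 1 - 1) = cy 2 \<otimes>\<^bsub>RG False\<^esub> cy (k - 1)"
      by (rule cy_recursion) (use 3 less.prems in auto)
    note eq = this[folded 3(2)]
    show ?thesis
      by (rule comm_recursion[OF RG_ring a cy_closed[OF less.prems] cy_closed cy_closed w cy_closed eq c2 less.IH cw less.IH])
        (use 3 less.prems in linarith)+
  qed
qed

lemma RG_comm:
  assumes Vs: "complete_simples KG \<Omega> V" and a: "a \<in> carrier (RG False)" and b: "b \<in> carrier (RG False)"
  shows "a \<otimes>\<^bsub>RG False\<^esub> b = b \<otimes>\<^bsub>RG False\<^esub> a"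
proof -
  interpret R: ring "RG False" by (rule RG_ring)
  let ?c = "\<lambda>a b. a \<otimes>\<^bsub>RG False\<^esub> b = b \<otimes>\<^bsub>RG False\<^esub> a"
  have n: "1 \<le> n" "2 \<le> n" using n2 by auto
  have ind: "?c (gc False (cyc n \<sigma>)) (gc False X)" if "gm \<sigma>" "hm X" for \<sigma> X
  proof -
    note C = hm_cyc[OF cyc_ok_n[OF that(1)]]
    have "gc False (ht (cyc n \<sigma>) X) = gc False (ht X (cyc n \<sigma>))"
      by (rule gc_iso[OF hiso_ind_comm]) (simp_all add: that C hm_ht)
    then show ?thesis by (simp add: gc_ht that C)
  qed
  have vc: "gc False (vz \<sigma>) \<in> carrier (RG False)" if "tr \<sigma>" for \<sigma> using tr_vz[OF that] by simp
  have vy: "?c (gc False (vz \<sigma>)) (cy k)" if "tr \<sigma>" "1 \<le> k" "k \<le> n" for \<sigma> k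
    using gc_cyc_vz[OF that] by simp
  \<comment> \<open>\<open>cy_comm_gen\<close> is used twice: [C(2, 1)] commutes with itself and so
    with [C(k, 1)]; then [C(k, 1)] commutes with [C(2, 1)] and so with [C(l, 1)].\<close>
  have yy: "?c (cy k) (cy l)" if k: "1 \<le> k" "k \<le> n" and l: "1 \<le> l" "l \<le> n" for k l
  proof (rule cy_comm_gen[OF cy_closed[OF k] _ vy[OF tr_gchi(1) k, symmetric] l])
    show "?c (cy k) (cy 2)"
      by (rule cy_comm_gen[OF cy_closed refl vy[OF tr_gchi(1), symmetric] k, symmetric]) (use n in auto)
  qed
  have com: "?c (x \<otimes>\<^bsub>RG False\<^esub> y) (z \<otimes>\<^bsub>RG False\<^esub> w)" if "x \<in> carrier (RG False)" "y \<in> carrier (RG False)" "z \<in> carrier (RG False)"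
    "w \<in> carrier (RG False)" "?c x z" "?c x w" "?c y z" "?c y w" for x y z w
  proof -
    have "x \<otimes>\<^bsub>RG False\<^esub> y \<otimes>\<^bsub>RG False\<^esub> (z \<otimes>\<^bsub>RG False\<^esub> w) = x \<otimes>\<^bsub>RG False\<^esub> (y \<otimes>\<^bsub>RG False\<^esub> z) \<otimes>\<^bsub>RG False\<^esub> w"
      using that(1-4) by (simp add: R.m_assoc)
    also have "\<dots> = x \<otimes>\<^bsub>RG False\<^esub> z \<otimes>\<^bsub>RG False\<^esub> (y \<otimes>\<^bsub>RG False\<^esub> w)" unfolding that(7) using that(1-4) by (simp add: R.m_assoc)
    also have "\<dots> = z \<otimes>\<^bsub>RG False\<^esub> (x \<otimes>\<^bsub>RG False\<^esub> w) \<otimes>\<^bsub>RG False\<^esub> y" unfolding that(5,8) using that(1-4) by (simp add: R.m_assoc)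
    also have "\<dots> = z \<otimes>\<^bsub>RG False\<^esub> w \<otimes>\<^bsub>RG False\<^esub> (x \<otimes>\<^bsub>RG False\<^esub> y)" unfolding that(6) using that(1-4) by (simp add: R.m_assoc)
    finally show ?thesis .
  qed
  have cc: "?c (gc False (cyc k (gr (V i)))) (gc False (cyc l (gr (V j))))"
    if ij: "cyc_ok k (gr (V i))" "cyc_ok l (gr (V j))" for i j k l
  proof -
    have g: "gm (gr (V i))" "gm (gr (V j))" using that by (auto simp: cyc_ok_def)
    \<comment> \<open>An induced module commutes with everything. Otherwise g^n acts trivially on
      both G-modules, and both classes factor by \<open>gc_cyc_vz\<close>.\<close>
    consider "k = n" | "l = n" | "tr (gr (V i))" "tr (gr (V j))" using ij unfolding cyc_ok_def tr_def by blast
    then show ?thesis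
    proof cases
      case 1 then show ?thesis using ind[OF g(1) hm_cyc[OF ij(2)]] by simp
    next
      case 2 then show ?thesis using ind[OF g(2) hm_cyc[OF ij(1)]] by simp
    next
      case 3
      have k: "1 \<le> k" "k \<le> n" and l: "1 \<le> l" "l \<le> n" using that by (auto simp: cyc_ok_def)
      show ?thesis unfolding gc_cyc_vz(1)[OF 3(1) k] gc_cyc_vz(1)[OF 3(2) l]
        by (rule com[OF vc[OF 3(1)] cy_closed[OF k] vc[OF 3(2)] cy_closed[OF l] gc_vz_comm[OF 3] vy[OF 3(1) l] vy[OF 3(2) k, symmetric] yy[OF k l]])
    qed
  qed
  have closed: "gc False (cyc k (gr (V i))) \<in> carrier (RG False)" if "cyc_ok k (gr (V i))" for k i
    using hm_cyc[OF that] by simp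
  have lem: "?c x b'" if x: "x \<in> carrier (RG False)" and b': "b' \<in> carrier (RG False)"
    and gen: "\<And>j k. j \<in> \<Omega> \<Longrightarrow> cyc_ok k (gr (V j)) \<Longrightarrow> ?c x (gc False (cyc k (gr (V j))))" for x b'
    using Vs b'
  proof (induction b' rule: RG_cyc_ind)
    case (cyc j k) then show ?case by (rule gen)
  next
    case (add a b) then show ?case using x by (simp add: R.r_distr R.l_distr)
  next
    case (diff a b) then show ?case using x by (simp add: R.minus_eq R.r_distr R.l_distr R.r_minus R.l_minus)
  qed (use x in simp)
  show ?thesis
  proof (rule lem[OF a b])
    fix j k assume j: "j \<in> \<Omega>" "cyc_ok k (gr (V j))"
    show "?c a (gc False (cyc k (gr (V j))))"
      by (rule lem[OF closed[OF j(2)] a, symmetric]) (rule cc[OF j(2)])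
  qed
qed

text \<open>For H/H(1 - e) commutativity descends along \<open>\<iota>\<close>, which is injective
  because \<open>EB\<close> is a left inverse.\<close>

lemma RG_cring:
  assumes Vs: "complete_simples KG \<Omega> V" shows "cring (RG B)"
proof (rule cring.intro[OF RG_ring], rule comm_monoid.intro[OF ring.is_monoid[OF RG_ring]], unfold_locales)
  fix a b assume ab: "a \<in> carrier (RG B)" "b \<in> carrier (RG B)"
  show "a \<otimes>\<^bsub>RG B\<^esub> b = b \<otimes>\<^bsub>RG B\<^esub> a"
  proof (cases B)
    case True
    interpret R: ring "RG True" by (rule RG_ring)
    note h = ring_hom_mult[OF infl_hom] ring_hom_closed[OF infl_hom]
    have "\<iota> (a \<otimes>\<^bsub>RG True\<^esub> b) = \<iota> (b \<otimes>\<^bsub>RG True\<^esub> a)" using ab True RG_comm[OF Vs] by (simp add: h)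
    then have "EB (\<iota> (a \<otimes>\<^bsub>RG True\<^esub> b)) = EB (\<iota> (b \<otimes>\<^bsub>RG True\<^esub> a))" by simp
    then show ?thesis using ab True by (simp add: EB_infl)
  next
    case False then show ?thesis using RG_comm[OF Vs] ab by simp
  qed
qed

subsection \<open>The ideal of projective modules\<close>

text \<open>f is extended to M along r, lifted there, and restricted along s.\<close>

lemma projective_retract:
  assumes M: "projective H M" and N: "is_module H N" and s: "hhom (am N) (am M) s" and r: "hhom (am M) (am N) r" "r * s = fst (am N) \<one>"
  shows "projective H N"
  unfolding projective_def
proof (intro conjI allI ballI impI N)
  fix A B p f
  assume p: "p \<in> mod_hom H A B" and f: "f \<in> mod_hom H N B"
    and sur: "is_module H A \<and> is_module H B \<and> (\<forall>w\<in>carrier_vec (fst B). \<exists>v\<in>carrier_vec (fst A). p *\<^sub>v v = w)"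
  have A: "is_module H A" and B: "is_module H B" using sur by auto
  have M': "is_module H M" using M by (simp add: projective_def)
  have pc: "p \<in> carrier_mat (fst B) (fst A)" and fc: "f \<in> carrier_mat (fst B) (fst N)" using p f by (auto simp: mod_hom_def)
  have fh: "hhom (am N) (am B) (opr f)" using f mod_hom_iff[OF N B fc] by simp
  note F = hhom_imp_mod_hom[OF M' B hhom_comp[OF r(1) fh]]
  obtain f' where f': "f' \<in> mod_hom H M A" "p * f' = tm (fst B) (fst M) (opr f * r)"
    using M p F(1) sur unfolding projective_def by blast
  have fc': "f' \<in> carrier_mat (fst A) (fst M)" using f' by (auto simp: mod_hom_def)
  have fh': "hhom (am M) (am A) (opr f')" using f'(1) mod_hom_iff[OF M' A fc'] by simp
  note t = hhom_imp_mod_hom[OF N A hhom_comp[OF s fh']]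
  let ?t = "tm (fst A) (fst N) (opr f' * s)"
  have 1: "opr p * opr f' = opr f * r"
    using arg_cong[OF f'(2), of opr] pc fc' F(2) by (subst (asm) opr_mult) auto
  have "opr (p * ?t) = opr p * opr ?t" using pc by (intro opr_mult) (simp add: carrier_matD[OF tm_carrier])
  then have "opr (p * ?t) = opr f"
    using mult_assoc_cong[OF 1, of s] hhom_1[OF fh] by (simp add: t(2) mult.assoc r(2))
  then have "p * ?t = f" using opr_inj[OF mult_carrier_mat[OF pc tm_carrier] fc] by simp
  then show "\<exists>f'\<in>mod_hom H N A. p * f' = f" using t(1) by blast
qed

lemma projective_summands:
  assumes M: "projective H M" and M1: "is_module H M1" and M2: "is_module H M2" and i: "hiso (am M) (am (dsum M1 M2))"
  shows "projective H M1" "projective H M2"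
proof -
  note h = hm_am[OF M1] hm_am[OF M2]
  obtain T S where *: "hhom (am M) (ds (am M1) (am M2)) T" "hhom (ds (am M1) (am M2)) (am M) S" "T * S = fst (ds (am M1) (am M2)) \<one>"
    using hiso_trans[OF i dsum_am(2)[OF M1 M2]] unfolding hiso_def by blast
  note p = hhom_inc_prj[OF h]
  have retract: "projective H N" if N: "is_module H N" and j: "hhom (am N) (ds (am M1) (am M2)) j"
    "hhom (ds (am M1) (am M2)) (am N) r" "r * j = fst (am N) \<one>" for N j r
  proof (rule projective_retract[OF M N hhom_comp[OF j(1) *(2)] hhom_comp[OF *(1) j(2)]])
    have "r * T * (S * j) = r * (T * S) * j" by (simp only: mult.assoc)
    then show "r * T * (S * j) = fst (am N) \<one>" by (simp only: *(3) hhom_1[OF j(2)] j(3))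
  qed
  show "projective H M1"
    by (rule retract[OF M1 p(1,3)]) (simp add: mult.assoc prj_inc_left gm_one[OF hm_gm[OF h(1)]])
  show "projective H M2"
    by (rule retract[OF M2 p(2,4)]) (simp add: mult.assoc prj_inc_left gm_one[OF hm_gm[OF h(2)]])
qed

abbreviation PP where "PP \<equiv> proj_ideal G \<chi> g n"

lemma H_cls: "is_module H M \<Longrightarrow> green_cls H zero_ideal M = gc False (am M)"
  using green_cls_gc[of M False] by (simp add: J_def modules_zero)

lemma PP_def: "PP = generate (add_monoid (RG False)) {gc False (am Q) | Q. indecomposable H Q \<and> projective H Q}"
proof -
  have "green_cls H zero_ideal Q = gc False (am Q)" if "projective H Q" for Q
    using that by (intro H_cls) (simp add: projective_def)
  then have "{green_cls H zero_ideal Q | Q. indecomposable H Q \<and> projective H Q} = {gc False (am Q) | Q. indecomposable H Q \<and> projective H Q}"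
    by blast
  then show ?thesis unfolding proj_ideal_def Let_def rH_def J_def by simp
qed

lemma PP_subgroup: "subgroup PP (add_monoid (RG False))"
proof -
  interpret R: ring "RG False" by (rule RG_ring)
  show ?thesis unfolding PP_def
  proof (rule R.add.generate_is_subgroup)
    have "gc False (am Q) \<in> carrier (RG False)" if "projective H Q" for Q
      using that hm_am[of Q] by (simp add: projective_def)
    then show "{gc False (am Q) | Q. indecomposable H Q \<and> projective H Q} \<subseteq> carrier (RG False)" by blast
  qed
qed

lemma PP_closed: "x \<in> PP \<Longrightarrow> x \<in> carrier (RG False)" "\<zero>\<^bsub>RG False\<^esub> \<in> PP"
  "x \<in> PP \<Longrightarrow> y \<in> PP \<Longrightarrow> x \<oplus>\<^bsub>RG False\<^esub> y \<in> PP" "x \<in> PP \<Longrightarrow> \<ominus>\<^bsub>RG False\<^esub> x \<in> PP"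
  using subgroup.mem_carrier[OF PP_subgroup] subgroup.one_closed[OF PP_subgroup] subgroup.m_closed[OF PP_subgroup]
    subgroup.m_inv_closed[OF PP_subgroup, of x] by (auto simp: a_inv_def)

text \<open>\<open>proj_ideal\<close> is generated by indecomposable projectives. Summands of
  projective modules are projective, so a decomposable one is handled by induction on the
  dimension.\<close>

lemma projective_PP: "projective H M \<Longrightarrow> gc False (am M) \<in> PP"
proof (induction "fst M" arbitrary: M rule: less_induct)
  case less
  have M: "is_module H M" using less.prems by (simp add: projective_def)
  consider "fst M = 0" | "indecomposable H M" | M1 M2 where "is_module H M1" "is_module H M2" "mod_iso H M (dsum M1 M2)" "fst M1 \<noteq> 0" "fst M2 \<noteq> 0"
    using M unfolding indecomposable_def by blast
  then show ?case
  proof cases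
    case 1
    then have "gc False (am M) = \<zero>\<^bsub>RG False\<^esub>" using hm_am[OF M] by (intro gc_zero) (simp_all add: fst_am_1[OF M])
    then show ?thesis using PP_closed(2) by simp
  next
    case 2
    then show ?thesis unfolding PP_def using less.prems by (intro generate.incl) blast
  next
    case 3
    note D = dsum_am[OF 3(1,2)]
    have i: "hiso (am M) (am (dsum M1 M2))" using 3(3) by (rule mod_iso_iff[OF M D(1), THEN iffD1])
    have d: "fst M = fst M1 + fst M2" using hiso_dim_eq[OF M D(1) i] by (simp add: dsum_def)
    note pp = projective_summands[OF less.prems 3(1,2) i]
    note h = hm_am[OF 3(1)] hm_am[OF 3(2)]
    have "gc False (am M) = gc False (ds (am M1) (am M2))"
      by (rule gc_iso[OF hiso_trans[OF i D(2)]]) (simp_all add: h hm_ds hm_am[OF M])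
    then have "gc False (am M) = gc False (am M1) \<oplus>\<^bsub>RG False\<^esub> gc False (am M2)" by (simp add: gc_ds h)
    moreover have "gc False (am M1) \<in> PP" "gc False (am M2) \<in> PP"
      using d 3(4,5) by (auto intro!: less.hyps pp)
    ultimately show ?thesis using PP_closed(3) by simp
  qed
qed

lemma cyc_n_PP: assumes "gm \<sigma>" shows "gc False (cyc n \<sigma>) \<in> PP"
proof -
  note C = hm_cyc[OF cyc_ok_n[OF assms]]
  obtain M where M: "is_module H M" "hiso (am M) (cyc n \<sigma>)" using realize_module[OF C] .
  have "gc False (am M) \<in> PP" by (rule projective_PP[OF projective_ind[OF M(1) assms M(2)]])
  moreover have "gc False (am M) = gc False (cyc n \<sigma>)" by (rule gc_iso[OF M(2)]) (simp_all add: C hm_am[OF M(1)])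
  ultimately show ?thesis by simp
qed

lemma PP_ind [consumes 2, case_names zero cyc add minus]:
  assumes Vs: "complete_simples KG \<Omega> V" and c: "c \<in> PP"
    and zero: "Q \<zero>\<^bsub>RG False\<^esub>"
    and cyc: "\<And>j. j \<in> \<Omega> \<Longrightarrow> Q (gc False (cyc n (gr (V j))))"
    and add: "\<And>a b. a \<in> PP \<Longrightarrow> b \<in> PP \<Longrightarrow> Q a \<Longrightarrow> Q b \<Longrightarrow> Q (a \<oplus>\<^bsub>RG False\<^esub> b)"
    and minus: "\<And>a. a \<in> PP \<Longrightarrow> Q a \<Longrightarrow> Q (\<ominus>\<^bsub>RG False\<^esub> a)"
  shows "Q c"
proof -
  have gen: "Q (gc False (am M)) \<and> gc False (am M) \<in> PP" if ip: "indecomposable H M" "projective H M" for M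
  proof -
    obtain j where j: "j \<in> \<Omega>" "hiso (am M) (cyc n (gr (V j)))" using projective_indecomposable[OF Vs ip] .
    have "simple_module KG (V j)" using Vs j(1) unfolding complete_simples_def by blast
    then have "gm (gr (V j))" using gm_gr simple_KG by simp
    then have C: "hm (cyc n (gr (V j)))" by (intro hm_cyc cyc_ok_n)
    have M: "is_module H M" using ip by (simp add: projective_def)
    have "gc False (am M) = gc False (cyc n (gr (V j)))" by (rule gc_iso[OF j(2)]) (simp_all add: C hm_am[OF M])
    then show ?thesis using cyc[OF j(1)] projective_PP[OF ip(2)] by simp
  qed
  have "c \<in> PP \<and> Q c" using c[unfolded PP_def]
  proof (induction c rule: generate.induct)
    case one then show ?case using zero PP_closed(2) by simp
  next
    case (incl h) then show ?case using gen by auto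
  next
    case (inv h)
    then have "h \<in> PP \<and> Q h" using gen by auto
    then show ?case using minus[of h] PP_closed(4)[of h] by (simp add: a_inv_def)
  next
    case (eng a b) then show ?case using add[of a b] PP_closed(3)[of a b] by simp
  qed
  then show ?thesis by simp
qed

text \<open>X \<otimes> C(n, V) is induced from the G-module X \<otimes> V, hence
  projective.\<close>

lemma PP_mult:
  assumes Vs: "complete_simples KG \<Omega> V" and x: "x \<in> carrier (RG False)" and c: "c \<in> PP"
  shows "x \<otimes>\<^bsub>RG False\<^esub> c \<in> PP"
  using x
proof (induction x rule: RG_ind)
  interpret R: ring "RG False" by (rule RG_ring)
  case (cls X)
  then have X: "hm X" "gc False X \<in> carrier (RG False)" by auto
  show ?case using Vs c
  proof (induction c rule: PP_ind)
    case zero then show ?case using X(2) PP_closed(2) by simp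
  next
    case (cyc j)
    have "simple_module KG (V j)" using Vs cyc unfolding complete_simples_def by blast
    then have s: "gm (gr (V j))" using gm_gr simple_KG by simp
    note g = gm_gt[OF hm_gm[OF X(1)] s]
    note C = hm_cyc[OF cyc_ok_n[OF s]] hm_cyc[OF cyc_ok_n[OF g]]
    have "gc False (cyc n (gt (fst X) (gr (V j)))) = gc False (ht X (cyc n (gr (V j))))"
      by (rule gc_iso[OF hiso_ht_ind[OF X(1) s]]) (simp_all add: C hm_ht X)
    then show ?case using cyc_n_PP[OF g] by (simp add: gc_ht C X)
  next
    case (add a b) then show ?case using X(2) PP_closed by (simp add: R.r_distr)
  next
    case (minus a) then show ?case using X(2) PP_closed by (simp add: R.r_minus)
  qed
next
  interpret R: ring "RG False" by (rule RG_ring)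
  case (diff a b) then show ?case using PP_closed c by (simp add: R.minus_eq R.l_distr R.l_minus)
qed

subsection \<open>The quotient of the sum ring\<close>

abbreviation SS where "SS \<equiv> sum_ring G \<chi> g n"

lemma rH_RG: "rH G \<chi> g n = RG False" "rHbar G \<chi> g n = RG True"
  by (simp_all add: rH_def rHbar_def J_def)

lemma SS_simps: "carrier SS = carrier (RG True) \<times> PP"
  "(b, c) \<otimes>\<^bsub>SS\<^esub> (b', c') = (b \<otimes>\<^bsub>RG True\<^esub> b', (\<iota> b \<otimes>\<^bsub>RG False\<^esub> c') \<oplus>\<^bsub>RG False\<^esub> (c \<otimes>\<^bsub>RG False\<^esub> \<iota> b') \<oplus>\<^bsub>RG False\<^esub> (c \<otimes>\<^bsub>RG False\<^esub> c'))"
  "(b, c) \<oplus>\<^bsub>SS\<^esub> (b', c') = (b \<oplus>\<^bsub>RG True\<^esub> b', c \<oplus>\<^bsub>RG False\<^esub> c')"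
  "\<one>\<^bsub>SS\<^esub> = (\<one>\<^bsub>RG True\<^esub>, \<zero>\<^bsub>RG False\<^esub>)" "\<zero>\<^bsub>SS\<^esub> = (\<zero>\<^bsub>RG True\<^esub>, \<zero>\<^bsub>RG False\<^esub>)"
  by (simp_all add: sum_ring_def Let_def rH_RG)

lemma infl_simps: 
  "b \<in> carrier (RG True) \<Longrightarrow> \<iota> b \<in> carrier (RG False)"
  "b \<in> carrier (RG True) \<Longrightarrow> b' \<in> carrier (RG True) \<Longrightarrow> \<iota> (b \<otimes>\<^bsub>RG True\<^esub> b') = \<iota> b \<otimes>\<^bsub>RG False\<^esub> \<iota> b'"
  "b \<in> carrier (RG True) \<Longrightarrow> b' \<in> carrier (RG True) \<Longrightarrow> \<iota> (b \<oplus>\<^bsub>RG True\<^esub> b') = \<iota> b \<oplus>\<^bsub>RG False\<^esub> \<iota> b'"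
  "\<iota> \<one>\<^bsub>RG True\<^esub> = \<one>\<^bsub>RG False\<^esub>" "\<iota> \<zero>\<^bsub>RG True\<^esub> = \<zero>\<^bsub>RG False\<^esub>"
  using ring_hom_closed[OF infl_hom] ring_hom_mult[OF infl_hom] ring_hom_add[OF infl_hom] ring_hom_one[OF infl_hom]
    ring_hom_zero[OF infl_hom RG_ring RG_ring] by auto

text \<open>Since (b, c) -> b + c may identify elements, the axioms are verified in each component;
  closure of the second component uses that \<open>PP\<close> absorbs products.\<close>

lemma SS_cring:
  assumes Vs: "complete_simples KG \<Omega> V" shows "cring SS"
proof -
  interpret B: cring "RG True" by (rule RG_cring[OF Vs])
  interpret R: cring "RG False" by (rule RG_cring[OF Vs])
  note i = infl_simps
  have m: "x \<otimes>\<^bsub>RG False\<^esub> c \<in> PP" "c \<otimes>\<^bsub>RG False\<^esub> x \<in> PP" if "x \<in> carrier (RG False)" "c \<in> PP" for x c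
    using PP_mult[OF Vs that] R.m_comm[of x c] that PP_closed(1) by auto
  show ?thesis
  proof (rule cringI)
    show "abelian_group SS"
    proof (rule abelian_groupI)
      fix x assume "x \<in> carrier SS"
      then obtain b c where bc: "x = (b, c)" "b \<in> carrier (RG True)" "c \<in> PP" by (auto simp: SS_simps(1))
      then show "\<exists>y\<in>carrier SS. y \<oplus>\<^bsub>SS\<^esub> x = \<zero>\<^bsub>SS\<^esub>"
        using PP_closed(1)[OF bc(3)] PP_closed(4)[OF bc(3)]
        by (intro bexI[of _ "(\<ominus>\<^bsub>RG True\<^esub> b, \<ominus>\<^bsub>RG False\<^esub> c)"]) (simp_all add: SS_simps B.l_neg R.l_neg)
    qed (auto simp: SS_simps PP_closed B.a_ac R.a_ac)
    show "comm_monoid SS"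
    proof (rule comm_monoidI)
      fix x y z assume "x \<in> carrier SS" "y \<in> carrier SS" "z \<in> carrier SS"
      then obtain a b c a' b' c' where e: "x = (a, a')" "y = (b, b')" "z = (c, c')"
        and c: "a \<in> carrier (RG True)" "b \<in> carrier (RG True)" "c \<in> carrier (RG True)" "a' \<in> PP" "b' \<in> PP" "c' \<in> PP"
        by (auto simp: SS_simps(1))
      note c' = PP_closed(1)[OF c(4)] PP_closed(1)[OF c(5)] PP_closed(1)[OF c(6)] i(1)[OF c(1)] i(1)[OF c(2)] i(1)[OF c(3)]
      show "x \<otimes>\<^bsub>SS\<^esub> y \<in> carrier SS" using c c' m by (simp add: e SS_simps PP_closed i)
      show "x \<otimes>\<^bsub>SS\<^esub> y \<otimes>\<^bsub>SS\<^esub> z = x \<otimes>\<^bsub>SS\<^esub> (y \<otimes>\<^bsub>SS\<^esub> z)"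
        using c(1-3) c' by (simp add: e SS_simps i B.m_assoc R.l_distr R.r_distr R.m_assoc R.a_ac)
      show "x \<otimes>\<^bsub>SS\<^esub> y = y \<otimes>\<^bsub>SS\<^esub> x"
        using c(1-3) c' by (simp add: e SS_simps i B.m_comm R.m_comm[of a' b'] R.m_comm[of a' "\<iota> b"] R.m_comm[of b' "\<iota> a"] R.a_ac)
      show "\<one>\<^bsub>SS\<^esub> \<otimes>\<^bsub>SS\<^esub> x = x" using c(1-3) c' by (simp add: e SS_simps i)
    qed (simp_all add: SS_simps PP_closed)
    fix x y z assume "x \<in> carrier SS" "y \<in> carrier SS" "z \<in> carrier SS"
    then obtain a b c a' b' c' where e: "x = (a, a')" "y = (b, b')" "z = (c, c')"
      and c: "a \<in> carrier (RG True)" "b \<in> carrier (RG True)" "c \<in> carrier (RG True)" "a' \<in> PP" "b' \<in> PP" "c' \<in> PP"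
      by (auto simp: SS_simps(1))
    note c' = PP_closed(1)[OF c(4)] PP_closed(1)[OF c(5)] PP_closed(1)[OF c(6)] i(1)[OF c(1)] i(1)[OF c(2)] i(1)[OF c(3)]
    show "(x \<oplus>\<^bsub>SS\<^esub> y) \<otimes>\<^bsub>SS\<^esub> z = x \<otimes>\<^bsub>SS\<^esub> z \<oplus>\<^bsub>SS\<^esub> y \<otimes>\<^bsub>SS\<^esub> z"
      using c(1-3) c' by (simp add: e SS_simps i B.l_distr R.l_distr R.r_distr R.a_ac)
  qed
qed

definition sum_map :: "((nat \<times> 'a, 'k) rep set \<Rightarrow>\<^sub>0 int) set \<times> ((nat \<times> 'a, 'k) rep set \<Rightarrow>\<^sub>0 int) set \<Rightarrow> ((nat \<times> 'a, 'k) rep set \<Rightarrow>\<^sub>0 int) set"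
  where "sum_map = (\<lambda>(b, c). \<iota> b \<oplus>\<^bsub>RG False\<^esub> c)"

lemma sum_map_hom:
  assumes Vs: "complete_simples KG \<Omega> V" shows "ring_hom_ring SS (RG False) sum_map"
proof (rule ring_hom_ringI2)
  show "ring SS" by (rule cring.axioms(1)[OF SS_cring[OF Vs]])
  show "ring (RG False)" by (rule RG_ring)
  interpret R: cring "RG False" by (rule RG_cring[OF Vs])
  show "sum_map \<in> Ring.ring_hom SS (RG False)"
  proof (rule ring_hom_memI)
    fix x y assume "x \<in> carrier SS" "y \<in> carrier SS"
    then obtain a b a' b' where e: "x = (a, a')" "y = (b, b')"
      and c: "a \<in> carrier (RG True)" "b \<in> carrier (RG True)" "a' \<in> PP" "b' \<in> PP"
      by (auto simp: SS_simps(1))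
    note c' = PP_closed(1)[OF c(3)] PP_closed(1)[OF c(4)] infl_simps(1)[OF c(1)] infl_simps(1)[OF c(2)]
    show "sum_map x \<in> carrier (RG False)" using c' by (simp add: sum_map_def e)
    show "sum_map (x \<otimes>\<^bsub>SS\<^esub> y) = sum_map x \<otimes>\<^bsub>RG False\<^esub> sum_map y"
      using c(1,2) c' by (simp add: sum_map_def e SS_simps infl_simps R.l_distr R.r_distr R.a_ac)
    show "sum_map (x \<oplus>\<^bsub>SS\<^esub> y) = sum_map x \<oplus>\<^bsub>RG False\<^esub> sum_map y"
      using c(1,2) c' by (simp add: sum_map_def e SS_simps infl_simps R.a_ac)
  next
    show "sum_map \<one>\<^bsub>SS\<^esub> = \<one>\<^bsub>RG False\<^esub>" by (simp add: sum_map_def SS_simps infl_simps)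
  qed
qed

lemma fst_cyc_gn: "\<sigma> (g [^] n) = scl c (\<sigma> \<one>) \<Longrightarrow> fst (cyc k \<sigma>) (g [^] n) = scl c (fst (cyc k \<sigma>) \<one>)"
  by (simp add: fst_cyc chi_gn chi_1 scl_sum)

lemma mB_cyc: assumes "cyc_ok k \<sigma>" "\<sigma> (g [^] n) = \<sigma> \<one>" shows "mB True (cyc k \<sigma>)"
  using hm_cyc[OF assms(1)] fst_cyc_gn[of \<sigma> 1 k] assms(2) by (simp add: mB_def)

text \<open>A cyclic generator C(k, V_j) comes from a single component: from \<open>PP\<close> if k
  = n, and from r(H/H(1 - e)) if g^n acts trivially on V_j.\<close>

lemma sum_map_surj:
  assumes Vs: "complete_simples KG \<Omega> V" shows "sum_map ` carrier SS = carrier (RG False)"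
proof
  interpret h: ring_hom_ring SS "RG False" sum_map by (rule sum_map_hom[OF Vs])
  show "sum_map ` carrier SS \<subseteq> carrier (RG False)" using h.hom_closed by blast
  show "carrier (RG False) \<subseteq> sum_map ` carrier SS"
  proof
    fix y assume "y \<in> carrier (RG False)"
    with Vs show "y \<in> sum_map ` carrier SS"
    proof (induction y rule: RG_cyc_ind)
      case (cyc j k)
      let ?C = "cyc k (gr (V j))"
      have C: "gc False ?C \<in> carrier (RG False)" using hm_cyc[OF cyc(2)] by simp
      consider "gc False ?C \<in> PP" | "gr (V j) (g [^] n) = gr (V j) \<one>" using cyc cyc_n_PP by (auto simp: cyc_ok_def)
      then show ?case
      proof cases
        case 1
        interpret B: ring "RG True" by (rule RG_ring)
        have "sum_map (\<zero>\<^bsub>RG True\<^esub>, gc False ?C) = gc False ?C" using C by (simp add: sum_map_def infl_simps)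
        moreover have "(\<zero>\<^bsub>RG True\<^esub>, gc False ?C) \<in> carrier SS" using 1 by (simp add: SS_simps)
        ultimately show ?thesis by (metis imageI)
      next
        case 2
        have "sum_map (gc True ?C, \<zero>\<^bsub>RG False\<^esub>) = gc False ?C" using C by (simp add: sum_map_def infl_gc)
        moreover have "(gc True ?C, \<zero>\<^bsub>RG False\<^esub>) \<in> carrier SS" using gc_closed[OF mB_cyc[OF cyc(2) 2]] PP_closed(2) by (simp add: SS_simps)
        ultimately show ?thesis by (metis imageI)
      qed
    next
      case (add a b)
      then obtain x y where "a = sum_map x" "b = sum_map y" "x \<in> carrier SS" "y \<in> carrier SS" by blast
      then show ?case by (intro image_eqI[of _ _ "x \<oplus>\<^bsub>SS\<^esub> y"]) simp_all
    next
      case (diff a b)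
      then obtain x y where "a = sum_map x" "b = sum_map y" "x \<in> carrier SS" "y \<in> carrier SS" by blast
      then show ?case by (intro image_eqI[of _ _ "x \<ominus>\<^bsub>SS\<^esub> y"]) (simp_all add: a_minus_def)
    next
      show "\<zero>\<^bsub>RG False\<^esub> \<in> sum_map ` carrier SS" by (rule image_eqI[of _ _ "\<zero>\<^bsub>SS\<^esub>"]) simp_all
    qed
  qed
qed

lemma lam_cases:
  assumes V: "simple_module KG V"
  obtains c where "lam G g n V = c" "gr V (g [^] n) = scl c (gr V \<one>)"
proof -
  have z: "g [^] n \<otimes> h = h \<otimes> g [^] n" if "h \<in> carrier G" for h
    by (rule gpow_central[OF that])
  obtain c where c: "snd V (g [^] n) = c \<cdot>\<^sub>m 1\<^sub>m (fst V)" "gr V (g [^] n) = scl c (pr (fst V))"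
    by (rule schur_central[OF V, of "g [^] n"]) (use z in auto)
  have "fst V \<noteq> 0" using V by (simp add: simple_module_def)
  have "lam G g n V = c" unfolding lam_def
  proof (rule the_equality)
    fix c' assume "snd V (g [^] n) = c' \<cdot>\<^sub>m 1\<^sub>m (fst V)"
    then have "(c' \<cdot>\<^sub>m 1\<^sub>m (fst V)) $$ (0, 0) = (c \<cdot>\<^sub>m 1\<^sub>m (fst V)) $$ (0, 0)" using c(1) by simp
    then show "c' = c" using \<open>fst V \<noteq> 0\<close> by simp
  qed (rule c)
  then show ?thesis using that c(2) gr_1[OF simple_KG[OF V]] by simp
qed

lemma EB_simps:
  shows "EB \<zero>\<^bsub>RG False\<^esub> = \<zero>\<^bsub>RG True\<^esub>"
    "x \<in> carrier (RG False) \<Longrightarrow> EB (\<ominus>\<^bsub>RG False\<^esub> x) = \<ominus>\<^bsub>RG True\<^esub> EB x"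
    "x \<in> carrier (RG False) \<Longrightarrow> y \<in> carrier (RG False) \<Longrightarrow> EB (x \<oplus>\<^bsub>RG False\<^esub> y) = EB x \<oplus>\<^bsub>RG True\<^esub> EB y"
proof -
  interpret B: ring "RG True" by (rule RG_ring)
  interpret R: ring "RG False" by (rule RG_ring)
  show z: "EB \<zero>\<^bsub>RG False\<^esub> = \<zero>\<^bsub>RG True\<^esub>" using EB_infl[of "\<zero>\<^bsub>RG True\<^esub>"] by (simp add: infl_simps)
  show m: "EB (\<ominus>\<^bsub>RG False\<^esub> x) = \<ominus>\<^bsub>RG True\<^esub> EB x" if "x \<in> carrier (RG False)" for x
    using EB_hom(2)[of "\<zero>\<^bsub>RG False\<^esub>" x] EB_hom(1)[of x x] that z by (simp add: a_minus_def)
  show "EB (x \<oplus>\<^bsub>RG False\<^esub> y) = EB x \<oplus>\<^bsub>RG True\<^esub> EB y" if "x \<in> carrier (RG False)" "y \<in> carrier (RG False)"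
    using EB_hom(2)[of x "\<ominus>\<^bsub>RG False\<^esub> y"] EB_hom(1)[of y y] that m by (simp add: a_minus_def)
qed

text \<open>Yields both claims about the submodule at once: a kernel is an ideal, and the quotient
  by it is the image.\<close>

lemma sum_ideal_kernel:
  assumes Vs: "complete_simples KG \<Omega> V" shows "sum_ideal G \<chi> g n \<Omega> V = a_kernel SS (RG False) sum_map"
proof -
  interpret h: ring_hom_ring SS "RG False" sum_map by (rule sum_map_hom[OF Vs])
  interpret B: ring "RG True" by (rule RG_ring)
  let ?gen = "\<lambda>i. (\<ominus>\<^bsub>RG True\<^esub> gc True (cyc n (gr (V i))), gc False (cyc n (gr (V i))))"
  have sim: "simple_module KG (V i)" if "i \<in> \<Omega>" for i using Vs that unfolding complete_simples_def by blast
  have ok: "cyc_ok n (gr (V i))" if "i \<in> \<Omega>" for i by (intro cyc_ok_n gm_gr simple_KG sim that)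
  define O0 where "O0 = Omega0 G g n \<Omega> V"
  have O0: "i \<in> \<Omega>" "gr (V i) (g [^] n) = gr (V i) \<one>" if "i \<in> O0" for i
  proof -
    show "i \<in> \<Omega>" using that by (simp add: O0_def Omega0_def)
    then obtain c where "lam G g n (V i) = c" "gr (V i) (g [^] n) = scl c (gr (V i) \<one>)" using lam_cases[OF sim] by metis
    then show "gr (V i) (g [^] n) = gr (V i) \<one>" using that by (simp add: O0_def Omega0_def)
  qed
  have cls: "green_cls H (J D) (Mmod \<chi> n (V i)) = gc D (cyc n (gr (V i)))" if "i \<in> O0" for i D
  proof -
    note M = Mmod_am[OF simple_KG[OF sim[OF O0(1)[OF that]]] ok[OF O0(1)[OF that]] O0(2)[OF that]]
    have C: "mB D (cyc n (gr (V i)))" by (rule mB_mono[OF mB_cyc[OF ok[OF O0(1)[OF that]] O0(2)[OF that]]])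
    have A: "mB D (am (Mmod \<chi> n (V i)))" by (rule mB_iso[OF hiso_sym[OF M(2)] C hm_am[OF M(1)]])
    have "green_cls H (J D) (Mmod \<chi> n (V i)) = gc D (am (Mmod \<chi> n (V i)))"
      by (rule green_cls_gc) (simp add: modules_J M(1) A)
    also have "\<dots> = gc D (cyc n (gr (V i)))" by (rule gc_iso[OF M(2) A C])
    finally show ?thesis .
  qed
  have "{(\<ominus>\<^bsub>rHbar G \<chi> g n\<^esub> green_cls H (I_bar G \<chi> g n) (Mmod \<chi> n (V i)), green_cls H zero_ideal (Mmod \<chi> n (V i))) | i. i \<in> O0} = ?gen ` O0"
    unfolding Setcompr_eq_image Collect_mem_eq rH_RG
    by (rule image_cong[OF refl]) (use cls[of _ True] cls[of _ False] in \<open>simp add: J_def\<close>)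
  then have I: "sum_ideal G \<chi> g n \<Omega> V = generate (add_monoid SS) (?gen ` O0)"
    by (simp add: sum_ideal_def Let_def O0_def)
  have gen: "?gen i \<in> a_kernel SS (RG False) sum_map" if "i \<in> O0" for i
  proof -
    note i = O0[OF that]
    have C: "mB True (cyc n (gr (V i)))" by (rule mB_cyc[OF ok[OF i(1)] i(2)])
    have "gc False (cyc n (gr (V i))) \<in> PP" by (intro cyc_n_PP gm_gr simple_KG sim i(1))
    moreover have "\<iota> (\<ominus>\<^bsub>RG True\<^esub> gc True (cyc n (gr (V i)))) \<oplus>\<^bsub>RG False\<^esub> gc False (cyc n (gr (V i))) = \<zero>\<^bsub>RG False\<^esub>"
      using infl_simps(3)[of "\<ominus>\<^bsub>RG True\<^esub> gc True (cyc n (gr (V i)))" "gc True (cyc n (gr (V i)))"] gc_closed[OF C]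
      by (simp add: infl_gc infl_simps(5) B.l_neg)
    ultimately show ?thesis using gc_closed[OF C] by (simp add: a_kernel_def' SS_simps sum_map_def)
  qed
  have kid: "ideal (a_kernel SS (RG False) sum_map) SS" by (rule h.kernel_is_ideal)
  have gsub: "?gen ` O0 \<subseteq> a_kernel SS (RG False) sum_map" using gen by (rule image_subsetI)
  have "a_kernel SS (RG False) sum_map \<subseteq> carrier SS" unfolding a_kernel_def' by (rule Collect_restrict)
  then have "?gen ` O0 \<subseteq> carrier (add_monoid SS)" using gsub by simp
  then have sub: "subgroup (generate (add_monoid SS) (?gen ` O0)) (add_monoid SS)"
    by (rule group.generate_is_subgroup[OF h.R.a_group])
  let ?I = "generate (add_monoid SS) (?gen ` O0)"
  have Icl: "\<zero>\<^bsub>SS\<^esub> \<in> ?I" "\<And>x y. x \<in> ?I \<Longrightarrow> y \<in> ?I \<Longrightarrow> x \<oplus>\<^bsub>SS\<^esub> y \<in> ?I" "\<And>x. x \<in> ?I \<Longrightarrow> \<ominus>\<^bsub>SS\<^esub> x \<in> ?I" "\<And>x. x \<in> ?I \<Longrightarrow> x \<in> carrier SS"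
    using subgroup.one_closed[OF sub] subgroup.m_closed[OF sub] subgroup.m_inv_closed[OF sub] subgroup.mem_carrier[OF sub] by (auto simp: a_inv_def)
  have neg: "\<ominus>\<^bsub>SS\<^esub> (b, c) = (\<ominus>\<^bsub>RG True\<^esub> b, \<ominus>\<^bsub>RG False\<^esub> c)" if "b \<in> carrier (RG True)" "c \<in> PP" for b c
    by (rule h.R.minus_equality) (use that in \<open>simp_all add: SS_simps B.l_neg h.S.l_neg PP_closed\<close>)
  \<comment> \<open>For c = [C(n, V_j)] the value \<open>EB c\<close> is M[n, j] if g^n acts
    trivially on V_j and zero otherwise, so the pair is a generator or zero. Both components are
    additive in c.\<close>
  have key: "(\<ominus>\<^bsub>RG True\<^esub> EB c, \<iota> (EB c)) \<in> ?I" if "c \<in> PP" for c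
    using Vs that
  proof (induction c rule: PP_ind)
    case zero show ?case using Icl(1) by (simp add: EB_simps infl_simps SS_simps)
  next
    case (cyc j)
    let ?C = "cyc n (gr (V j))"
    note C = hm_cyc[OF ok[OF cyc]]
    obtain c where c: "lam G g n (V j) = c" "gr (V j) (g [^] n) = scl c (gr (V j) \<one>)" using lam_cases[OF sim[OF cyc]] .
    show ?case
    proof (cases "c = 1")
      case True
      then have "j \<in> O0" using c(1) cyc by (simp add: O0_def Omega0_def)
      then have "?gen j \<in> ?I" by (intro generate.incl) simp
      moreover have T: "mB True ?C" using O0[OF \<open>j \<in> O0\<close>] ok by (intro mB_cyc) auto
      have "hiso (eX ?C) ?C" using T by (intro eX_trivial) (auto simp: mB_def)
      then have "EB (gc False ?C) = gc True ?C" unfolding EB_gc[OF C] by (rule gc_iso[OF _ mB_eX[OF C] T])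
      ultimately show ?thesis by (simp add: infl_gc)
    next
      case False
      have "ep (fst ?C) = 0" by (rule ep_scalar[OF hm_gm[OF C] fst_cyc_gn[OF c(2)] False])
      then have "EB (gc False ?C) = \<zero>\<^bsub>RG True\<^esub>" unfolding EB_gc[OF C] by (intro gc_zero mB_eX[OF C]) (simp add: fst_eX(1)[OF C])
      then show ?thesis using Icl(1) by (simp add: infl_simps SS_simps)
    qed
  next
    case (add a b)
    note ab = PP_closed(1)[OF add(1)] PP_closed(1)[OF add(2)]
    note e = EB_hom(1)[OF ab(1) ab(1)] EB_hom(1)[OF ab(2) ab(2)]
    show ?case using Icl(2)[OF add(3,4)] e by (simp add: EB_simps ab infl_simps SS_simps B.minus_add)
  next
    case (minus a)
    note a = PP_closed(1)[OF minus(1)]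
    note e = EB_hom(1)[OF a a]
    have "\<iota> (EB a) \<in> PP" using Icl(4)[OF minus(2)] by (simp add: SS_simps)
    moreover have "\<iota> (\<ominus>\<^bsub>RG True\<^esub> EB a) = \<ominus>\<^bsub>RG False\<^esub> \<iota> (EB a)"
      using infl_simps(3)[of "\<ominus>\<^bsub>RG True\<^esub> EB a" "EB a"] e
      by (intro h.S.minus_equality[symmetric]) (simp_all add: infl_simps B.l_neg)
    ultimately show ?case using Icl(3)[OF minus(2)] e by (simp add: EB_simps a neg)
  qed
  show ?thesis unfolding I
  proof
    show "?I \<subseteq> a_kernel SS (RG False) sum_map"
      by (rule group.generate_subgroup_incl[OF h.R.a_group gsub additive_subgroup.a_subgroup[OF ideal.axioms(1)[OF kid]]])
    show "a_kernel SS (RG False) sum_map \<subseteq> ?I"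
    proof
      fix x assume "x \<in> a_kernel SS (RG False) sum_map"
      then obtain b c where x: "x = (b, c)" "b \<in> carrier (RG True)" "c \<in> PP" "\<iota> b \<oplus>\<^bsub>RG False\<^esub> c = \<zero>\<^bsub>RG False\<^esub>"
        by (auto simp: a_kernel_def' SS_simps sum_map_def)
      note c = PP_closed(1)[OF x(3)]
      have "\<iota> (\<ominus>\<^bsub>RG True\<^esub> b) = \<ominus>\<^bsub>RG False\<^esub> \<iota> b"
        using infl_simps(3)[of "\<ominus>\<^bsub>RG True\<^esub> b" b] x(2)
        by (intro h.S.minus_equality[symmetric]) (simp_all add: infl_simps B.l_neg)
      moreover have "c = \<ominus>\<^bsub>RG False\<^esub> \<iota> b" using x c infl_simps(1) by (simp add: h.S.add.m_comm[of "\<iota> b" c] h.S.minus_equality)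
      \<comment> \<open>Once c is known to be inflated, the retraction recovers b as
        \<open>\<ominus> EB c\<close> and fixes c, so x is the element provided by
        \<open>key\<close>.\<close>
      ultimately have ci: "c = \<iota> (\<ominus>\<^bsub>RG True\<^esub> b)" by simp
      then have "EB c = \<ominus>\<^bsub>RG True\<^esub> b" using x(2) by (simp add: EB_infl)
      then show "x \<in> ?I" using key[OF x(3)] ci x(1,2) by simp
    qed
  qed
qed

lemma green_ring_quotient:
  assumes Vs: "complete_simples KG \<Omega> V"
  shows "cring SS \<and> ideal (sum_ideal G \<chi> g n \<Omega> V) SS \<and> SS Quot (sum_ideal G \<chi> g n \<Omega> V) \<simeq> rH G \<chi> g n"
proof -
  interpret h: ring_hom_ring SS "RG False" sum_map by (rule sum_map_hom[OF Vs])
  show ?thesis unfolding sum_ideal_kernel[OF Vs] rH_RG(1)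
    using SS_cring[OF Vs] h.kernel_is_ideal h.FactRing_iso[OF sum_map_surj[OF Vs]] by simp
qed

end

theorem theorem4p3:
  fixes G :: "('a, 'm) monoid_scheme"
    and \<chi> :: "'a \<Rightarrow> 'k::{alg_closed_field, field_char_0}"
    and g :: 'a
    and n :: nat
    and \<Omega> :: "'i set"
    and V :: "'i \<Rightarrow> ('a, 'k) rep"
  assumes "group G" and "finite (carrier G)"
    and "\<forall>h\<in>carrier G. \<chi> h \<noteq> 0"
    and "\<forall>h\<in>carrier G. \<forall>h'\<in>carrier G. \<chi> (h \<otimes>\<^bsub>G\<^esub> h') = \<chi> h * \<chi> h'"
    and "g \<in> carrier G" and "\<forall>h\<in>carrier G. g \<otimes>\<^bsub>G\<^esub> h = h \<otimes>\<^bsub>G\<^esub> g"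
    and "n \<ge> 2" and "\<chi> g ^ n = 1" and "\<forall>m. 0 < m \<and> m < n \<longrightarrow> \<chi> g ^ m \<noteq> 1"
    and "\<forall>h\<in>carrier G. \<chi> h ^ n = 1"
    and "g [^]\<^bsub>G\<^esub> n \<noteq> \<one>\<^bsub>G\<^esub>"
    and "complete_simples (group_alg G) \<Omega> V"
  shows "cring (sum_ring G \<chi> g n) \<and>
    ideal (sum_ideal G \<chi> g n \<Omega> V) (sum_ring G \<chi> g n) \<and>
    (sum_ring G \<chi> g n) Quot (sum_ideal G \<chi> g n \<Omega> V) \<simeq> rH G \<chi> g n"
proof -
  have "datum G \<chi> g n"
    by (rule datum.intro[OF assms(1)], rule datum_axioms.intro)
      (use assms(2-10) in blast)+
  then show ?thesis by (rule datum.green_ring_quotient[OF _ assms(12)])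
qed

end
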